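(* Let $c\in\mathbb N$, let $\mathbb E$ be a finite-dimensional Banach space, let $n\in\mathcal{CN}_1(\mathbb R^c,\mathbb E)$, let $1\le p\le\infty$, and let $N\in\mathcal B(L_p(\mathbb R^c,\mathbb E))$ be the operator $$(Nu)(x)=\int_{\mathbb R^c}n(x,x-y)\,u(y)\,dy .$$ If the operator $\mathbf 1+N$ is invertible in $L_p(\mathbb R^c,\mathbb E)$, then $(\mathbf 1+N)^{-1}=\mathbf 1+M$, where $$(Mu)(x)=\int_{\mathbb R^c}m(x,x-y)\,u(y)\,dy$$ with some $m\in\mathcal{CN}_1(\mathbb R^c,\mathbb E)$.
   Context: $\mathcal B(X)$ denotes the space of bounded linear operators on a Banach space $X$, and $\mathbf 1$ is the identity operator. $L_p=L_p(\mathbb R^c,\mathbb E)$ is taken with respect to Lebesgue measure. $\mathcal N_1(\mathbb R^c,\mathbb E)$ is the set of all measurable functions $n:\mathbb R^c\times\mathbb R^c\to\mathcal B(\mathbb E)$ for which there exists a function $\beta\in L_1(\mathbb R^c,\mathbb R)$, defined everywhere, such that $\|n(x,y)\|\le\beta(y)$ for almost all $(x,y)$. For $n\in\mathcal N_1(\mathbb R^c,\mathbb E)$ the integral operator $N$ above is a well-defined bounded operator on $L_p(\mathbb R^c,\mathbb E)$ for all $1\le p\le\infty$. For $n\in\mathcal N_1(\mathbb R^c,\mathbb E)$ let $\bar n$ be the function assigning to $x\in\mathbb R^c$ the function $\bar n(x):\mathbb R^c\to\mathcal B(\mathbb E)$, $\bar n(x)(y)=n(x,x-y)$. $\mathcal{CN}_1(\mathbb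 R^c,\mathbb E)$ is the class of kernels $n\in\mathcal N_1(\mathbb R^c,\mathbb E)$ that can be redefined on a set of measure zero in $\mathbb R^c\times\mathbb R^c$ so that $n$ becomes defined everywhere, the estimate $\|n(x,y)\|\le\beta(y)$ holds for all $x$ and $y$, and the corresponding function $x\mapsto\bar n(x)$ becomes continuous in the norm of $L_1(\mathbb R^c,\mathcal B(\mathbb E))$. *)

theory Defs
  imports "HOL-Analysis.Analysis" "HOL-Probability.Essential_Supremum"
begin

text \<open>
  The scalar field of the Banach space is any type of sort
  \<open>{real_normed_field, euclidean_space}\<close>; up to isomorphism these are \<open>real\<close> and
  \<open>complex\<close>. The topology, norm and Bochner integral of the Banach space come from its type
  class; \<open>scl\<close> is its scalar multiplication over the field, which restricts to
  \<open>scaleR\<close> on the reals. For \<open>scl = scaleR\<close> this is an ordinary real Banach space.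
\<close>

definition normed_space_over ::
    "('k::{real_normed_field,euclidean_space} \<Rightarrow> 'e::real_normed_vector \<Rightarrow> 'e) \<Rightarrow> bool" where
  "normed_space_over scl \<longleftrightarrow>
     vector_space scl \<and>
     (\<forall>a v. norm (scl a v) = norm a * norm v) \<and>
     (\<forall>r v. scl (of_real r) v = r *\<^sub>R v)"

definition bounded_ops ::
    "('k::{real_normed_field,euclidean_space} \<Rightarrow> 'e::real_normed_vector \<Rightarrow> 'e)
      \<Rightarrow> ('e \<Rightarrow>\<^sub>L 'e) set" where
  "bounded_ops scl = {A. Vector_Spaces.linear scl scl (blinfun_apply A)}"

text \<open>
  Elements of \<open>L\<^sub>p\<close> are represented by functions, operators on \<open>L\<^sub>p\<close> by maps of
  functions; equality in \<open>L\<^sub>p\<close> is equality almost everywhere. The exponent \<open>p\<close> ranges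
  over \<open>ennreal\<close>, which includes \<open>\<infinity>\<close>.
\<close>

definition Lp :: "ennreal \<Rightarrow> ('a::euclidean_space \<Rightarrow> 'e::real_normed_vector) set" where
  "Lp p = {u \<in> borel_measurable lebesgue.
     if p = \<infinity> then esssup lebesgue (\<lambda>x. ennreal (norm (u x))) < \<infinity>
     else integrable lebesgue (\<lambda>x. norm (u x) powr enn2real p)}"

definition Lp_norm :: "ennreal \<Rightarrow> ('a::euclidean_space \<Rightarrow> 'e::real_normed_vector) \<Rightarrow> real" where
  "Lp_norm p u =
     (if p = \<infinity> then enn2real (esssup lebesgue (\<lambda>x. ennreal (norm (u x))))
      else (LINT x|lebesgue. norm (u x) powr enn2real p) powr (1 / enn2real p))"

text \<open>
  Membership in \<open>\<B>(L\<^sub>p)\<close>. Compatibility with equality almost everywhere need not be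
  required: it follows from additivity, homogeneity and boundedness.
\<close>

definition Lp_bounded_op ::
    "('k::{real_normed_field,euclidean_space} \<Rightarrow> 'e::real_normed_vector \<Rightarrow> 'e) \<Rightarrow> ennreal
      \<Rightarrow> (('a::euclidean_space \<Rightarrow> 'e) \<Rightarrow> ('a \<Rightarrow> 'e)) \<Rightarrow> bool" where
  "Lp_bounded_op scl p T \<longleftrightarrow>
     (\<forall>u\<in>Lp p. T u \<in> Lp p) \<and>
     (\<forall>u\<in>Lp p. \<forall>v\<in>Lp p. AE x in lebesgue. T (\<lambda>y. u y + v y) x = T u x + T v x) \<and>
     (\<forall>a. \<forall>u\<in>Lp p. AE x in lebesgue. T (\<lambda>y. scl a (u y)) x = scl a (T u x)) \<and>
     (\<exists>C. \<forall>u\<in>Lp p. Lp_norm p (T u) \<le> C * Lp_norm p u)"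

definition Lp_inverse ::
    "('k::{real_normed_field,euclidean_space} \<Rightarrow> 'e::real_normed_vector \<Rightarrow> 'e) \<Rightarrow> ennreal
      \<Rightarrow> (('a::euclidean_space \<Rightarrow> 'e) \<Rightarrow> ('a \<Rightarrow> 'e))
      \<Rightarrow> (('a \<Rightarrow> 'e) \<Rightarrow> ('a \<Rightarrow> 'e)) \<Rightarrow> bool" where
  "Lp_inverse scl p T R \<longleftrightarrow>
     Lp_bounded_op scl p T \<and> Lp_bounded_op scl p R \<and>
     (\<forall>u\<in>Lp p. AE x in lebesgue. R (T u) x = u x) \<and>
     (\<forall>u\<in>Lp p. AE x in lebesgue. T (R u) x = u x)"

definition Lp_invertible ::
    "('k::{real_normed_field,euclidean_space} \<Rightarrow> 'e::real_normed_vector \<Rightarrow> 'e) \<Rightarrow> ennreal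
      \<Rightarrow> (('a::euclidean_space \<Rightarrow> 'e) \<Rightarrow> ('a \<Rightarrow> 'e)) \<Rightarrow> bool" where
  "Lp_invertible scl p T \<longleftrightarrow> (\<exists>R. Lp_inverse scl p T R)"

text \<open>
  The classes \<open>\<N>\<^sub>1\<close> and \<open>\<C>\<N>\<^sub>1\<close>; a kernel defined almost everywhere is represented by
  any total function extending it. Almost everywhere on pairs refers to
  Lebesgue measure on \<open>'a \<times> 'a\<close>.
\<close>

definition N1 ::
    "('k::{real_normed_field,euclidean_space} \<Rightarrow> 'e::real_normed_vector \<Rightarrow> 'e)
      \<Rightarrow> ('a::euclidean_space \<Rightarrow> 'a \<Rightarrow> 'e \<Rightarrow>\<^sub>L 'e) set" where
  "N1 scl = {n.
     (\<forall>x y. n x y \<in> bounded_ops scl) \<and>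
     (\<lambda>(x, y). n x y) \<in> borel_measurable lebesgue \<and>
     (\<exists>\<beta>::'a \<Rightarrow> real. integrable lebesgue \<beta> \<and>
        (AE (x, y) in lebesgue. norm (n x y) \<le> \<beta> y))}"

definition nbar ::
    "('a::euclidean_space \<Rightarrow> 'a \<Rightarrow> 'e \<Rightarrow>\<^sub>L 'e) \<Rightarrow> 'a \<Rightarrow> ('a \<Rightarrow> 'e::real_normed_vector \<Rightarrow>\<^sub>L 'e)" where
  "nbar n x = (\<lambda>y. n x (x - y))"

definition CN1 ::
    "('k::{real_normed_field,euclidean_space} \<Rightarrow> 'e::real_normed_vector \<Rightarrow> 'e)
      \<Rightarrow> ('a::euclidean_space \<Rightarrow> 'a \<Rightarrow> 'e \<Rightarrow>\<^sub>L 'e) set" where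
  "CN1 scl = {n \<in> N1 scl. \<exists>n'\<in>N1 scl.
     (AE (x, y) in lebesgue. n' x y = n x y) \<and>
     (\<exists>\<beta>::'a \<Rightarrow> real. integrable lebesgue \<beta> \<and> (\<forall>x y. norm (n' x y) \<le> \<beta> y)) \<and>
     (\<forall>x. nbar n' x \<in> Lp 1) \<and>
     (\<forall>x\<^sub>0. ((\<lambda>x. Lp_norm 1 (\<lambda>y. nbar n' x y - nbar n' x\<^sub>0 y)) \<longlongrightarrow> 0) (at x\<^sub>0))}"

definition integral_op ::
    "('a::euclidean_space \<Rightarrow> 'a \<Rightarrow> 'e \<Rightarrow>\<^sub>L 'e)
      \<Rightarrow> ('a \<Rightarrow> 'e::{banach,second_countable_topology}) \<Rightarrow> 'a \<Rightarrow> 'e" where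
  "integral_op n u = (\<lambda>x. LINT y|lebesgue. blinfun_apply (n x (x - y)) (u y))"

definition id_plus ::
    "(('a \<Rightarrow> 'e::plus) \<Rightarrow> ('a \<Rightarrow> 'e)) \<Rightarrow> ('a \<Rightarrow> 'e) \<Rightarrow> 'a \<Rightarrow> 'e" where
  "id_plus T u = (\<lambda>x. u x + T u x)"

end

theory Submission
  imports Defs
begin

text \<open>
  The theorem is a noncommutative Wiener lemma, and the proof follows the method of commutators with
  cut-off functions. Write \<open>K\<close> for the integral operator and \<open>R = 1 + M\<close> for the inverse of \<open>1 + K\<close>.

  In a real basis of the finite-dimensional space the functions become real functions on finitely
  many copies of Euclidean space, and the kernel a real kernel that is dominated by an integrable function
  \<open>h(x - y)\<close>. All \<open>L\<^sub>p\<close>-norms are treated together as Luxemburg norms, since only Jensen's inequality is used: it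
  gives the countable triangle inequality, the Schur test, and the comparison with integrals
  over sets of finite measure.

  First let the kernel be bounded by a summable function of \<open>j - l\<close> for \<open>x\<close>, \<open>y\<close> in the unit cubes with labels
  \<open>j\<close>, \<open>l\<close>. Invertibility says that \<open>\<parallel>u\<parallel> \<le> C \<parallel>(1 + K) u\<parallel>\<close>. Applied to \<open>u\<close>
  times a cut-off function of large width, the estimate acquires a commutator, which is small because the cut-off
  function varies slowly; summing over all positions of the cut-off, the commutator is absorbed (lemma \<open>localized_stability\<close>).
  The result is a pointwise inequality, in which \<open>|u|\<close> is at most \<open>|f|\<close> plus a convolution of \<open>|f|\<close> with a summable function of the cubes, for
  \<open>f = (1 + K) u\<close> (lemma \<open>stable_imp_pointwise_bound\<close>). The norm has disappeared from this inequality, which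
  has two consequences. The solutions of \<open>(1 + K) r(., y) = k(., y)\<close> decay as the kernel does; and \<open>1 + K\<close> is
  bounded below in the square norm, so that these solutions are limits of
  a gradient iteration, which produces a function measurable in both variables
  (proposition \<open>stable_cell_kernel_inverse\<close>).

  A kernel with a merely integrable majorant is the sum of a bounded kernel near the diagonal and a kernel of small
  norm. The latter is inverted by its Neumann series, and after dividing by this factor the former argument
  applies (theorem \<open>stable_kernel_inverse\<close>).

  This gives \<open>M\<close> a kernel with an integrable majorant. That its values are linear over the scalar field holds because
  \<open>R\<close> is linear and an integral operator determines its kernel almost everywhere. Finally, the
  identity \<open>M = - K - K M\<close> expresses the rows of the kernel of \<open>M\<close> by the rows of the kernel of \<open>K\<close>, so that continuity of the rows
  is inherited (lemma \<open>CN1_correction\<close>).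
\<close>

section \<open>Young functions and Luxemburg norms\<close>

text \<open>The last clause says that \<open>\<phi>\<close> is the supremum of its affine minorants. This is convexity
  together with lower semicontinuity, in the form that gives Jensen's inequality directly and allows
  the value infinity. The two clauses before it normalize \<open>\<phi>\<close> at 1, so that the norm built from
  \<open>\<phi>\<close> can be compared with integrals over sets of finite measure.\<close>

definition young :: "(ennreal \<Rightarrow> ennreal) \<Rightarrow> bool" where
  "young \<phi> \<longleftrightarrow> mono \<phi> \<and> \<phi> \<in> borel_measurable borel \<and>
     (\<forall>t\<le>1. \<phi> t \<le> t) \<and> (\<forall>t. \<phi> t \<le> 1 \<longrightarrow> t \<le> 1) \<and>
     (\<forall>t c. c < \<phi> t \<longrightarrow> (\<exists>a b. b < \<infinity> \<and> (\<forall>x. a * x \<le> \<phi> x + b) \<and> c + b \<le> a * t))"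

lemma youngD:
  assumes "young \<phi>"
  shows "s \<le> t \<Longrightarrow> \<phi> s \<le> \<phi> t" "\<phi> \<in> borel_measurable borel"
    "t \<le> 1 \<Longrightarrow> \<phi> t \<le> t" "\<phi> t \<le> 1 \<Longrightarrow> t \<le> 1" "\<phi> 0 = 0"
proof -
  show "s \<le> t \<Longrightarrow> \<phi> s \<le> \<phi> t" "\<phi> \<in> borel_measurable borel"
    "t \<le> 1 \<Longrightarrow> \<phi> t \<le> t" "\<phi> t \<le> 1 \<Longrightarrow> t \<le> 1"
    using assms by (auto simp: young_def mono_def)
  have "\<phi> 0 \<le> 0" using assms unfolding young_def by (metis zero_le)
  then show "\<phi> 0 = 0" by simp
qed

text \<open>If the inequality failed, some affine minorant would separate the two sides; integrating the minorant
  over a measure of mass at most one contradicts this.\<close>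

lemma young_jensen:
  assumes "young \<phi>" "emeasure M (space M) \<le> 1" "f \<in> borel_measurable M"
  shows "\<phi> (\<integral>\<^sup>+x. f x \<partial>M) \<le> (\<integral>\<^sup>+x. \<phi> (f x) \<partial>M)"
proof (rule ccontr)
  assume "\<not> ?thesis"
  then have lt: "(\<integral>\<^sup>+x. \<phi> (f x) \<partial>M) < \<phi> (\<integral>\<^sup>+x. f x \<partial>M)" by simp
  then obtain c where c: "(\<integral>\<^sup>+x. \<phi> (f x) \<partial>M) < c" "c < \<phi> (\<integral>\<^sup>+x. f x \<partial>M)"
    using dense by blast
  then obtain a b where b: "b < \<infinity>" and ab: "\<And>x. a * x \<le> \<phi> x + b"
      and cb: "c + b \<le> a * (\<integral>\<^sup>+x. f x \<partial>M)"
    using assms(1) unfolding young_def by meson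
  have [measurable]: "(\<lambda>x. \<phi> (f x)) \<in> borel_measurable M"
    using measurable_compose[OF assms(3) youngD(2)[OF assms(1)]] .
  have "a * (\<integral>\<^sup>+x. f x \<partial>M) = (\<integral>\<^sup>+x. a * f x \<partial>M)"
    using assms(3) by (simp add: nn_integral_cmult)
  also have "\<dots> \<le> (\<integral>\<^sup>+x. \<phi> (f x) + b \<partial>M)"
    by (intro nn_integral_mono ab)
  also have "\<dots> = (\<integral>\<^sup>+x. \<phi> (f x) \<partial>M) + b * emeasure M (space M)"
    by (subst nn_integral_add) auto
  also have "\<dots> \<le> (\<integral>\<^sup>+x. \<phi> (f x) \<partial>M) + b * 1"
    by (intro add_left_mono mult_left_mono assms(2)) simp
  finally have "c + b \<le> (\<integral>\<^sup>+x. \<phi> (f x) \<partial>M) + b" using cb by (simp add: order_trans)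
  then have "c \<le> (\<integral>\<^sup>+x. \<phi> (f x) \<partial>M)"
    using b by (simp add: ennreal_add_left_cancel_le add.commute[of _ b] less_top[symmetric])
  then show False using c by simp
qed

lemma young_mult_le:
  assumes "young \<phi>" "c \<le> 1"
  shows "\<phi> (c * t) \<le> c * \<phi> t"
proof -
  let ?M = "scale_measure c (count_space (UNIV :: unit set))"
  have "\<phi> (\<integral>\<^sup>+x. t \<partial>?M) \<le> (\<integral>\<^sup>+x. \<phi> t \<partial>?M)"
    by (rule young_jensen[OF assms(1)]) (use assms(2) in \<open>auto simp: space_scale_measure\<close>)
  then show ?thesis by (simp add: mult.commute space_scale_measure)
qed

text \<open>The power function for finite exponents. For the exponent infinity the function is 0 on the unit
  interval and infinite beyond it, which makes the Luxemburg norm the essential supremum.\<close>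

definition lp_phi :: "ennreal \<Rightarrow> ennreal \<Rightarrow> ennreal" where
  "lp_phi p t = (if p = \<infinity> then (if t \<le> 1 then 0 else \<infinity>)
     else if t = \<infinity> then \<infinity> else ennreal (enn2real t powr enn2real p))"

text \<open>The tangent of the power function at \<open>s\<close> lies below it; these tangents are the affine minorants
  used in the next lemma.\<close>

lemma powr_tangent:
  fixes x s p :: real
  assumes "x \<ge> 0" "s \<ge> 0" "p \<ge> 1"
  shows "p * s powr (p - 1) * x \<le> x powr p + (p - 1) * s powr p"
proof (cases "p = 1")
  case True
  then show ?thesis using assms by (auto simp: powr_def)
next
  case False
  then have p: "p > 1" using assms by simp
  have "x * s powr (p - 1) \<le> x powr p / p + (s powr (p-1)) powr (p/(p-1)) / (p/(p-1))"
    using Youngs_inequality[of p "p/(p-1)" x "s powr (p-1)"] p assms by (simp add: field_simps)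
  also have "(s powr (p-1)) powr (p/(p-1)) = s powr p" using p by (simp add: powr_powr)
  finally show ?thesis using p by (simp add: field_simps)
qed

lemma young_lp_phi:
  assumes "1 \<le> p"
  shows "young (lp_phi p)"
proof (cases "p = \<infinity>")
  case True
  have eq: "lp_phi p = (\<lambda>t. if t \<le> 1 then 0 else \<infinity>)" by (auto simp: lp_phi_def True)
  show ?thesis unfolding eq young_def
  proof (intro conjI allI impI)
    show "mono (\<lambda>t::ennreal. if t \<le> 1 then 0 else \<infinity>::ennreal)" by (auto simp: mono_def)
    show "(\<lambda>t::ennreal. if t \<le> 1 then 0 else \<infinity>::ennreal) \<in> borel_measurable borel" by measurable
    fix t c :: ennreal assume "c < (if t \<le> 1 then 0 else \<infinity>)"
    then have t: "t > 1" and c: "c < \<infinity>" by (auto split: if_splits)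
    obtain K :: real where K: "K \<ge> 0" "c + ennreal K \<le> ennreal K * t"
    proof (cases "t = \<infinity>")
      case True then show ?thesis by (intro that[of 1]) (auto simp: ennreal_mult_top)
    next
      case False
      define r where "r = enn2real t"
      define d where "d = enn2real c"
      have tr: "t = ennreal r" and cd: "c = ennreal d" and d: "d \<ge> 0"
        using False c by (auto simp: r_def d_def less_top)
      have r: "r > 1" using t tr by (metis ennreal_1 ennreal_less_iff zero_le_one)
      show ?thesis
      proof (rule that[of "d / (r - 1)"])
        show "0 \<le> d / (r-1)" using r d by simp
        have "d + d / (r-1) = d / (r-1) * r" using r by (simp add: field_simps)
        then show "c + ennreal (d / (r-1)) \<le> ennreal (d / (r-1)) * t"
          unfolding tr cd using r d by (simp flip: ennreal_plus ennreal_mult)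
      qed
    qed
    have "ennreal K * x \<le> (if x \<le> 1 then 0 else \<infinity>) + ennreal K" for x
      using mult_left_mono[of x 1 "ennreal K"] by auto
    then show "\<exists>a b. b < \<infinity> \<and> (\<forall>x. a * x \<le> (if x \<le> 1 then 0 else \<infinity>) + b) \<and> c + b \<le> a * t"
      using K by (intro exI[of _ "ennreal K"]) auto
  qed (auto split: if_splits simp: top_unique)
next
  case False
  define q where "q = enn2real p"
  have q: "q \<ge> 1" unfolding q_def using assms False
    by (metis enn2real_1 enn2real_mono less_top infinity_ennreal_def)
  have eq: "lp_phi p = (\<lambda>t. if t = \<infinity> then \<infinity> else ennreal (enn2real t powr q))"
    using False by (auto simp: lp_phi_def q_def)
  have tangent: "ennreal (q * s powr (q-1)) * x \<le> (if x = \<infinity> then \<infinity> else ennreal (enn2real x powr q)) + ennreal ((q-1) * s powr q)"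
    if "s \<ge> 0" for s x
  proof (cases "x = \<infinity>")
    case False
    then have x: "x = ennreal (enn2real x)" by (simp add: less_top)
    have "ennreal (q * s powr (q-1)) * x = ennreal (q * s powr (q-1) * enn2real x)"
      by (subst x, subst ennreal_mult) (use q in auto)
    also have "\<dots> \<le> ennreal (enn2real x powr q + (q-1) * s powr q)"
      using powr_tangent[of "enn2real x" s q] q that by (intro ennreal_leI) auto
    finally show ?thesis using False q by (simp add: ennreal_plus)
  qed simp
  show ?thesis unfolding eq young_def
  proof (intro conjI allI impI)
    show "mono (\<lambda>t. if t = \<infinity> then \<infinity> else ennreal (enn2real t powr q))"
      by (rule monoI) (use q in \<open>auto intro!: ennreal_leI powr_mono2 enn2real_mono simp: less_top top_unique\<close>)
    show "(\<lambda>t. if t = \<infinity> then \<infinity> else ennreal (enn2real t powr q)) \<in> borel_measurable borel"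
      by measurable
  next
    fix t :: ennreal assume t: "t \<le> 1"
    then have ti: "t \<noteq> \<infinity>" using ennreal_one_less_top by (auto simp: top_unique dest: leD)
    have "enn2real t \<le> 1" using t by (metis enn2real_1 enn2real_mono ennreal_one_less_top)
    then have "enn2real t powr q \<le> enn2real t powr 1"
      using q by (intro powr_mono') auto
    then have "ennreal (enn2real t powr q) \<le> ennreal (enn2real t)" by (intro ennreal_leI) simp
    then show "(if t = \<infinity> then \<infinity> else ennreal (enn2real t powr q)) \<le> t"
      using ti by (metis ennreal_enn2real infinity_ennreal_def less_top)
  next
    fix t :: ennreal assume t: "(if t = \<infinity> then \<infinity> else ennreal (enn2real t powr q)) \<le> 1"
    then have ti: "t \<noteq> \<infinity>" by (metis ennreal_one_less_top infinity_ennreal_def leD)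
    with t have "enn2real t powr q \<le> 1" by simp
    then have "enn2real t \<le> 1" using q
      by (metis enn2real_nonneg le_less_trans less_eq_real_def not_le powr_less_mono2 powr_one_eq_one zero_less_one)
    then show "t \<le> 1" using ti by (metis ennreal_1 ennreal_enn2real ennreal_leI infinity_ennreal_def less_top)
  next
    fix t c :: ennreal assume c: "c < (if t = \<infinity> then \<infinity> else ennreal (enn2real t powr q))"
    show "\<exists>a b. b < \<infinity> \<and> (\<forall>x. a * x \<le> (if x = \<infinity> then \<infinity> else ennreal (enn2real x powr q)) + b) \<and> c + b \<le> a * t"
    proof (cases "t = \<infinity>")
      case True
      show ?thesis
        using tangent[of 1] q True
        by (intro exI[of _ "ennreal (q * 1 powr (q-1))"] exI[of _ "ennreal ((q-1) * 1 powr q)"])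
           (auto simp: ennreal_mult_top)
    next
      case False
      define s where "s = enn2real t"
      have s: "s \<ge> 0" "t = ennreal s" using False by (auto simp: s_def less_top)
      have "c + ennreal ((q-1) * s powr q) \<le> ennreal (s powr q) + ennreal ((q-1) * s powr q)"
        using c False by (intro add_right_mono) (auto simp: s_def)
      also have "\<dots> = ennreal (q * s powr (q-1) * s)"
      proof -
        have e: "q * s powr (q-1) * s = s powr q + (q - 1) * s powr q"
          using powr_mult_base[OF s(1), of "q-1"] by (simp add: algebra_simps)
        show ?thesis unfolding e using q by (subst ennreal_plus) auto
      qed
      also have "\<dots> = ennreal (q * s powr (q-1)) * t"
        using s q by (simp add: ennreal_mult)
      finally show ?thesis
        using tangent[of s] s by (intro exI[of _ "ennreal (q * s powr (q-1))"] exI[of _ "ennreal ((q-1) * s powr q)"]) auto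
    qed
  qed
qed

lemma young_jensen_weighted:
  assumes "young \<phi>" and [measurable]: "w \<in> borel_measurable M" "f \<in> borel_measurable M"
    and "(\<integral>\<^sup>+x. w x \<partial>M) \<le> 1"
  shows "\<phi> (\<integral>\<^sup>+x. w x * f x \<partial>M) \<le> (\<integral>\<^sup>+x. w x * \<phi> (f x) \<partial>M)"
proof -
  note [measurable] = youngD(2)[OF assms(1)]
  have "\<phi> (\<integral>\<^sup>+x. f x \<partial>density M w) \<le> (\<integral>\<^sup>+x. \<phi> (f x) \<partial>density M w)"
    by (rule young_jensen[OF assms(1)]) (auto simp: emeasure_density assms(4) cong: nn_integral_cong)
  then show ?thesis by (simp add: nn_integral_density)
qed

text \<open>The Luxemburg norm of a nonnegative function. With \<open>lp_phi p\<close> it is the \<open>L\<^sub>p\<close>-norm, so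
  working with it treats all exponents, infinity included, by one argument.\<close>

definition luxemburg :: "'m measure \<Rightarrow> (ennreal \<Rightarrow> ennreal) \<Rightarrow> ('m \<Rightarrow> ennreal) \<Rightarrow> ennreal" where
  "luxemburg M \<phi> f = Inf {ennreal r | r. r > 0 \<and> (\<integral>\<^sup>+x. \<phi> (ennreal (1 / r) * f x) \<partial>M) \<le> 1}"

lemma luxemburg_le: "r > 0 \<Longrightarrow> (\<integral>\<^sup>+x. \<phi> (ennreal (1 / r) * f x) \<partial>M) \<le> 1 \<Longrightarrow> luxemburg M \<phi> f \<le> ennreal r"
  unfolding luxemburg_def by (rule Inf_lower) auto

lemma luxemburg_less_imp:
  assumes "young \<phi>" "luxemburg M \<phi> f < ennreal r"
  shows "r > 0" "(\<integral>\<^sup>+x. \<phi> (ennreal (1 / r) * f x) \<partial>M) \<le> 1"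
proof -
  obtain r0 where r0: "r0 > 0" "(\<integral>\<^sup>+x. \<phi> (ennreal (1 / r0) * f x) \<partial>M) \<le> 1" "ennreal r0 < ennreal r"
    using assms(2) unfolding luxemburg_def Inf_less_iff by auto
  then have lt: "r0 < r" by (metis ennreal_less_iff less_imp_le)
  then show "r > 0" using r0 by simp
  have "(\<integral>\<^sup>+x. \<phi> (ennreal (1 / r) * f x) \<partial>M) \<le> (\<integral>\<^sup>+x. \<phi> (ennreal (1 / r0) * f x) \<partial>M)"
    using lt r0(1)
    by (intro nn_integral_mono youngD(1)[OF assms(1)] mult_right_mono ennreal_leI divide_left_mono) auto
  with r0 show "(\<integral>\<^sup>+x. \<phi> (ennreal (1 / r) * f x) \<partial>M) \<le> 1" by simp
qed

lemma le_mult_luxemburgI: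
  assumes "\<And>r. luxemburg M \<phi> f < ennreal r \<Longrightarrow> r > 0 \<Longrightarrow> X \<le> ennreal c * ennreal r" "c > 0"
  shows "X \<le> ennreal c * luxemburg M \<phi> f"
proof (cases "luxemburg M \<phi> f = \<infinity>")
  case True
  then show ?thesis using assms(2) by (simp add: ennreal_mult_top)
next
  case False
  then obtain g where g: "luxemburg M \<phi> f = ennreal g" "g \<ge> 0" by (cases "luxemburg M \<phi> f") auto
  show ?thesis
  proof (rule ennreal_le_epsilon)
    fix e :: real assume "0 < e"
    have "X \<le> ennreal c * ennreal (g + e / c)"
      by (rule assms(1)) (use g \<open>0 < e\<close> assms(2) in \<open>auto simp: ennreal_less_iff add_nonneg_pos\<close>)
    also have "\<dots> = ennreal c * luxemburg M \<phi> f + ennreal e"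
      using g \<open>0 < e\<close> assms(2) by (simp add: ennreal_mult[symmetric] distrib_left flip: ennreal_plus)
    finally show "X \<le> ennreal c * luxemburg M \<phi> f + ennreal e" .
  qed
qed

lemma luxemburg_mono_AE:
  assumes "young \<phi>" "AE x in M. f x \<le> g x"
  shows "luxemburg M \<phi> f \<le> luxemburg M \<phi> g"
proof -
  have "luxemburg M \<phi> f \<le> ennreal 1 * luxemburg M \<phi> g"
  proof (rule le_mult_luxemburgI)
    fix r assume r: "luxemburg M \<phi> g < ennreal r" "r > 0"
    have "(\<integral>\<^sup>+x. \<phi> (ennreal (1 / r) * f x) \<partial>M) \<le> (\<integral>\<^sup>+x. \<phi> (ennreal (1 / r) * g x) \<partial>M)"
      using assms(2) by (intro nn_integral_mono_AE) (auto elim!: eventually_mono intro!: youngD(1)[OF assms(1)] mult_left_mono)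
    then have "luxemburg M \<phi> f \<le> ennreal r"
      using luxemburg_less_imp[OF assms(1) r(1)] by (intro luxemburg_le) auto
    then show "luxemburg M \<phi> f \<le> ennreal 1 * ennreal r" by simp
  qed simp
  then show ?thesis by simp
qed

lemma luxemburg_zero: assumes "young \<phi>" shows "luxemburg M \<phi> (\<lambda>x. 0) = 0"
proof -
  have "luxemburg M \<phi> (\<lambda>x. 0) \<le> ennreal e" if "e > 0" for e
    by (rule luxemburg_le) (use that youngD(5)[OF assms] in auto)
  then show ?thesis by (metis ennreal_le_epsilon add_0 le_zero_eq)
qed

lemma luxemburg_cmult:
  assumes "young \<phi>" "c \<ge> 0" "c = 0 \<Longrightarrow> luxemburg M \<phi> f < \<infinity>"
  shows "luxemburg M \<phi> (\<lambda>x. ennreal c * f x) \<le> ennreal c * luxemburg M \<phi> f"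
proof (cases "c = 0")
  case True then show ?thesis by (simp add: luxemburg_zero[OF assms(1)])
next
  case False
  show ?thesis
  proof (rule le_mult_luxemburgI)
    fix r assume r: "luxemburg M \<phi> f < ennreal r" "r > 0"
    have eq: "ennreal (1 / (c * r)) * (ennreal c * f x) = ennreal (1/r) * f x" for x
      using False assms(2) r(2) by (subst mult.assoc[symmetric], subst ennreal_mult[symmetric]) auto
    have "luxemburg M \<phi> (\<lambda>x. ennreal c * f x) \<le> ennreal (c * r)"
      using False assms(2) r(2) by (intro luxemburg_le) (auto simp: eq luxemburg_less_imp[OF assms(1) r(1)])
    then show "luxemburg M \<phi> (\<lambda>x. ennreal c * f x) \<le> ennreal c * ennreal r"
      using assms(2) r(2) by (simp add: ennreal_mult)
  qed (use False assms(2) in auto)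
qed

text \<open>The triangle inequality for countably many terms. Divided by the sum of numbers slightly above
  their norms, the sum of the functions is a convex combination of functions whose modular is at most
  one, and Jensen's inequality applies.\<close>

lemma luxemburg_sum:
  fixes f :: "'g::countable \<Rightarrow> 'm \<Rightarrow> ennreal"
  assumes "young \<phi>" and [measurable]: "\<And>g. f g \<in> borel_measurable M"
  shows "luxemburg M \<phi> (\<lambda>x. \<integral>\<^sup>+g. f g x \<partial>count_space UNIV) \<le> (\<integral>\<^sup>+g. luxemburg M \<phi> (f g) \<partial>count_space UNIV)"
    (is "?L \<le> ?R")
proof (cases "?R = \<infinity>")
  case False
  note [measurable] = youngD(2)[OF assms(1)]
  define v where "v g = enn2real (luxemburg M \<phi> (f g))" for g
  have fin: "luxemburg M \<phi> (f g) < \<infinity>" for g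
    using False nn_integral_PInf_AE[of "\<lambda>g. luxemburg M \<phi> (f g)" "count_space UNIV"]
    by (auto simp: AE_count_space less_top)
  then have v: "luxemburg M \<phi> (f g) = ennreal (v g)" "v g \<ge> 0" for g
    by (auto simp: v_def)
  show ?thesis
  proof (rule ennreal_le_epsilon)
    fix e :: real assume e: "0 < e"
    \<comment> \<open>positive weights of total mass at most \<open>e\<close> on the countable index type\<close>
    define \<delta> where "\<delta> g = e * (1/2) ^ Suc (to_nat g)" for g :: 'g
    have \<delta>: "\<delta> g > 0" for g using e by (simp add: \<delta>_def)
    have "(\<integral>\<^sup>+g. ennreal (\<delta> g) \<partial>count_space UNIV) = (\<integral>\<^sup>+n. ennreal (e * (1/2) ^ Suc n) \<partial>count_space (range (to_nat :: 'g \<Rightarrow> nat)))"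
      unfolding \<delta>_def by (rule nn_integral_bij_count_space) (auto simp: bij_betw_def)
    also have "\<dots> \<le> (\<integral>\<^sup>+n. ennreal (e * (1/2) ^ Suc n) \<partial>count_space UNIV)"
      by (subst nn_integral_count_space_indicator) (auto intro!: nn_integral_mono simp: indicator_def)
    also have "\<dots> = (\<Sum>n. ennreal (e * (1/2) ^ Suc n))"
      by (rule nn_integral_count_space_nat)
    also have "\<dots> = ennreal e"
      using e sums_mult[OF power_half_series, of e] by (intro suminf_ennreal_eq) auto
    finally have sum\<delta>: "(\<integral>\<^sup>+g. ennreal (\<delta> g) \<partial>count_space UNIV) \<le> ennreal e" .
    define r where "r g = v g + \<delta> g" for g
    have r: "r g > 0" for g using v \<delta> by (simp add: r_def add_nonneg_pos)
    have R_le: "(\<integral>\<^sup>+g. ennreal (r g) \<partial>count_space UNIV) \<le> ?R + ennreal e"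
      unfolding r_def using v \<delta> sum\<delta> less_imp_le[OF \<delta>]
      by (simp add: nn_integral_add add_left_mono)
    then have "(\<integral>\<^sup>+g. ennreal (r g) \<partial>count_space UNIV) < \<infinity>"
      using False by (simp add: less_top[symmetric] top_unique) (metis ennreal_add_eq_top ennreal_neq_top top_unique)
    then obtain R where R: "(\<integral>\<^sup>+g. ennreal (r g) \<partial>count_space UNIV) = ennreal R" "R \<ge> 0"
      by (cases "\<integral>\<^sup>+g. ennreal (r g) \<partial>count_space UNIV") auto
    have "ennreal (r undefined) \<le> (\<integral>\<^sup>+g. ennreal (r g) * indicator {undefined} g \<partial>count_space UNIV)"
      by simp
    also have "\<dots> \<le> ennreal R" unfolding R(1)[symmetric]
      by (intro nn_integral_mono) (auto simp: indicator_def)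
    finally have Rpos: "R > 0" using r[of undefined] R(2) by (auto simp: ennreal_le_iff)
    have w: "(\<integral>\<^sup>+g. ennreal (r g / R) \<partial>count_space UNIV) = 1"
    proof -
      have "(\<integral>\<^sup>+g. ennreal (r g / R) \<partial>count_space UNIV) = (\<integral>\<^sup>+g. ennreal (1 / R) * ennreal (r g) \<partial>count_space UNIV)"
        using Rpos r by (intro nn_integral_cong) (simp add: ennreal_mult[symmetric] less_imp_le)
      also have "\<dots> = ennreal (1 / R) * ennreal R" by (simp add: nn_integral_cmult R(1))
      finally show ?thesis using Rpos by (simp flip: ennreal_mult)
    qed
    have scaled: "ennreal (1 / R) * f g x = ennreal (r g / R) * (ennreal (1 / r g) * f g x)" for g x
      using Rpos r[of g] by (subst mult.assoc[symmetric], subst ennreal_mult[symmetric]) auto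
    have "(\<integral>\<^sup>+x. \<phi> (ennreal (1 / R) * (\<integral>\<^sup>+g. f g x \<partial>count_space UNIV)) \<partial>M)
        = (\<integral>\<^sup>+x. \<phi> (\<integral>\<^sup>+g. ennreal (r g / R) * (ennreal (1 / r g) * f g x) \<partial>count_space UNIV) \<partial>M)"
      by (simp add: nn_integral_cmult[symmetric] scaled)
    also have "\<dots> \<le> (\<integral>\<^sup>+x. \<integral>\<^sup>+g. ennreal (r g / R) * \<phi> (ennreal (1 / r g) * f g x) \<partial>count_space UNIV \<partial>M)"
      by (intro nn_integral_mono young_jensen_weighted[OF assms(1)]) (auto simp: w)
    also have "\<dots> = (\<integral>\<^sup>+g. ennreal (r g / R) * (\<integral>\<^sup>+x. \<phi> (ennreal (1 / r g) * f g x) \<partial>M) \<partial>count_space UNIV)"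
      by (subst nn_integral_count_space_nn_integral) (auto simp: nn_integral_cmult)
    also have "\<dots> \<le> (\<integral>\<^sup>+g. ennreal (r g / R) * 1 \<partial>count_space UNIV)"
    proof (intro nn_integral_mono mult_left_mono)
      fix g
      have "luxemburg M \<phi> (f g) < ennreal (r g)"
        using v[of g] \<delta>[of g] by (simp add: r_def ennreal_less_iff)
      then show "(\<integral>\<^sup>+x. \<phi> (ennreal (1 / r g) * f g x) \<partial>M) \<le> 1"
        using luxemburg_less_imp[OF assms(1)] by blast
    qed simp
    finally have "(\<integral>\<^sup>+x. \<phi> (ennreal (1 / R) * (\<integral>\<^sup>+g. f g x \<partial>count_space UNIV)) \<partial>M) \<le> 1"
      by (simp add: w)
    then have "?L \<le> ennreal R" using Rpos by (rule luxemburg_le[rotated])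
    then show "?L \<le> ?R + ennreal e" using R_le unfolding R(1) by simp
  qed
qed simp

lemma luxemburg_add:
  assumes "young \<phi>" and [measurable]: "f \<in> borel_measurable M" "g \<in> borel_measurable M"
  shows "luxemburg M \<phi> (\<lambda>x. f x + g x) \<le> luxemburg M \<phi> f + luxemburg M \<phi> g"
  using luxemburg_sum[OF assms(1), of "\<lambda>b. if b then f else g" M]
  by (simp add: nn_integral_count_space_finite UNIV_bool add.commute)

text \<open>Local integrability: Jensen's inequality for normalized measure on \<open>A\<close>, followed by the
  normalization of \<open>\<phi>\<close> at 1. Together with the indicator estimate below it is the only
  link between the norm and plain integrals, and it is the same for all exponents.\<close>

lemma nn_integral_set_le_luxemburg:
  assumes "young \<phi>" and [measurable]: "f \<in> borel_measurable M" "A \<in> sets M"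
    and "emeasure M A \<le> ennreal K" "K \<ge> 1"
  shows "(\<integral>\<^sup>+x. f x * indicator A x \<partial>M) \<le> ennreal K * luxemburg M \<phi> f"
proof (rule le_mult_luxemburgI)
  note [measurable] = youngD(2)[OF assms(1)]
  fix r assume r: "luxemburg M \<phi> f < ennreal r" "r > 0"
  have "\<phi> (\<integral>\<^sup>+x. (ennreal (1/K) * indicator A x) * (ennreal (1/r) * f x) \<partial>M)
      \<le> (\<integral>\<^sup>+x. (ennreal (1/K) * indicator A x) * \<phi> (ennreal (1/r) * f x) \<partial>M)"
  proof (rule young_jensen_weighted[OF assms(1)])
    have "(\<integral>\<^sup>+x. ennreal (1/K) * indicator A x \<partial>M) = ennreal (1/K) * emeasure M A"
      by (simp add: nn_integral_cmult)
    also have "\<dots> \<le> ennreal (1/K) * ennreal K" by (intro mult_left_mono assms) simp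
    also have "\<dots> = 1" using assms(5) by (simp flip: ennreal_mult)
    finally show "(\<integral>\<^sup>+x. ennreal (1/K) * indicator A x \<partial>M) \<le> 1" .
  qed auto
  also have "\<dots> \<le> (\<integral>\<^sup>+x. \<phi> (ennreal (1/r) * f x) \<partial>M)"
  proof (intro nn_integral_mono)
    fix x
    have "ennreal (1/K) * indicator A x \<le> 1 * 1" 
      using assms(5) by (intro mult_mono) (auto simp: indicator_def)
    then show "ennreal (1/K) * indicator A x * \<phi> (ennreal (1/r) * f x) \<le> \<phi> (ennreal (1/r) * f x)"
      using mult_right_mono[of _ 1] by fastforce
  qed
  also have "\<dots> \<le> 1" by (rule luxemburg_less_imp[OF assms(1) r(1)])
  finally have "(\<integral>\<^sup>+x. (ennreal (1/K) * indicator A x) * (ennreal (1/r) * f x) \<partial>M) \<le> 1"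
    by (rule youngD(4)[OF assms(1)])
  also have "(\<integral>\<^sup>+x. (ennreal (1/K) * indicator A x) * (ennreal (1/r) * f x) \<partial>M) = ennreal (1/(K*r)) * (\<integral>\<^sup>+x. f x * indicator A x \<partial>M)"
    using assms(5) r(2) by (subst nn_integral_cmult[symmetric]) (auto intro!: nn_integral_cong simp: ennreal_mult[of "1/K" "1/r", simplified] mult_ac)
  finally have "ennreal (K*r) * (ennreal (1/(K*r)) * (\<integral>\<^sup>+x. f x * indicator A x \<partial>M)) \<le> ennreal (K * r) * 1"
    by (rule mult_left_mono) simp
  then show "(\<integral>\<^sup>+x. f x * indicator A x \<partial>M) \<le> ennreal K * ennreal r"
    using assms(5) r(2) by (simp add: mult.assoc[symmetric] ennreal_mult[symmetric])
qed (use assms in simp)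

lemma luxemburg_indicator:
  assumes "young \<phi>" and [measurable]: "A \<in> sets M" and "emeasure M A \<le> ennreal K" "K \<ge> 1"
  shows "luxemburg M \<phi> (indicator A) \<le> ennreal K"
proof (rule luxemburg_le)
  have "(\<integral>\<^sup>+x. \<phi> (ennreal (1 / K) * indicator A x) \<partial>M) \<le> (\<integral>\<^sup>+x. ennreal (1 / K) * indicator A x \<partial>M)"
    using assms(4) by (intro nn_integral_mono youngD(3)[OF assms(1)]) (auto simp: indicator_def)
  also have "\<dots> = ennreal (1/K) * emeasure M A" by (simp add: nn_integral_cmult)
  also have "\<dots> \<le> ennreal (1/K) * ennreal K" by (intro mult_left_mono assms) simp
  also have "\<dots> = 1" using assms(4) by (simp flip: ennreal_mult)
  finally show "(\<integral>\<^sup>+x. \<phi> (ennreal (1 / K) * indicator A x) \<partial>M) \<le> 1" .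
qed (use assms in simp)

text \<open>Jensen's inequality in each row uses the bound on the rows; integrating over the rows then uses the
  bound on the columns.\<close>

lemma young_schur_test:
  fixes q :: "'m \<Rightarrow> 'm \<Rightarrow> ennreal"
  assumes "sigma_finite_measure M" "young \<phi>"
    and [measurable]: "case_prod q \<in> borel_measurable (M \<Otimes>\<^sub>M M)" "f \<in> borel_measurable M"
    and 1: "\<And>x. x \<in> space M \<Longrightarrow> (\<integral>\<^sup>+y. q x y \<partial>M) \<le> 1" and 2: "\<And>y. y \<in> space M \<Longrightarrow> (\<integral>\<^sup>+x. q x y \<partial>M) \<le> 1"
  shows "(\<integral>\<^sup>+x. \<phi> (\<integral>\<^sup>+y. q x y * f y \<partial>M) \<partial>M) \<le> (\<integral>\<^sup>+x. \<phi> (f x) \<partial>M)"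
proof -
  interpret sigma_finite_measure M by fact
  interpret pair_sigma_finite M M by standard
  note [measurable] = youngD(2)[OF assms(2)]
  have "(\<integral>\<^sup>+x. \<phi> (\<integral>\<^sup>+y. q x y * f y \<partial>M) \<partial>M) \<le> (\<integral>\<^sup>+x. \<integral>\<^sup>+y. q x y * \<phi> (f y) \<partial>M \<partial>M)"
    by (intro nn_integral_mono young_jensen_weighted[OF assms(2)] 1) auto
  also have "\<dots> = (\<integral>\<^sup>+y. (\<integral>\<^sup>+x. q x y \<partial>M) * \<phi> (f y) \<partial>M)"
    by (subst Fubini'[symmetric]) (auto intro!: nn_integral_cong nn_integral_multc)
  also have "\<dots> \<le> (\<integral>\<^sup>+y. 1 * \<phi> (f y) \<partial>M)"
    by (intro nn_integral_mono mult_right_mono 2) auto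
  finally show ?thesis by simp
qed

lemma luxemburg_schur_test:
  fixes q :: "'m \<Rightarrow> 'm \<Rightarrow> ennreal"
  assumes "sigma_finite_measure M" "young \<phi>"
    and [measurable]: "case_prod q \<in> borel_measurable (M \<Otimes>\<^sub>M M)" "f \<in> borel_measurable M"
    and 1: "\<And>x. x \<in> space M \<Longrightarrow> (\<integral>\<^sup>+y. q x y \<partial>M) \<le> ennreal K" and 2: "\<And>y. y \<in> space M \<Longrightarrow> (\<integral>\<^sup>+x. q x y \<partial>M) \<le> ennreal K"
    and K: "K > 0"
  shows "luxemburg M \<phi> (\<lambda>x. \<integral>\<^sup>+y. q x y * f y \<partial>M) \<le> ennreal K * luxemburg M \<phi> f"
proof (rule le_mult_luxemburgI)
  fix r assume r: "luxemburg M \<phi> f < ennreal r" "r > 0"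
  have scale: "(\<integral>\<^sup>+y. ennreal (1/K) * h y \<partial>M) \<le> 1"
    if [measurable]: "h \<in> borel_measurable M" and le: "(\<integral>\<^sup>+y. h y \<partial>M) \<le> ennreal K" for h
  proof -
    have "(\<integral>\<^sup>+y. ennreal (1/K) * h y \<partial>M) = ennreal (1/K) * (\<integral>\<^sup>+y. h y \<partial>M)" by (simp add: nn_integral_cmult)
    also have "\<dots> \<le> ennreal (1/K) * ennreal K" by (intro mult_left_mono le) simp
    also have "\<dots> = 1" using K by (simp flip: ennreal_mult)
    finally show ?thesis .
  qed
  have "(\<integral>\<^sup>+x. \<phi> (\<integral>\<^sup>+y. (ennreal (1/K) * q x y) * (ennreal (1/r) * f y) \<partial>M) \<partial>M) \<le> (\<integral>\<^sup>+x. \<phi> (ennreal (1/r) * f x) \<partial>M)"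
    by (rule young_schur_test[OF assms(1,2)]) (auto intro!: scale 1 2)
  also have "\<dots> \<le> 1" by (rule luxemburg_less_imp[OF assms(2) r(1)])
  finally have "(\<integral>\<^sup>+x. \<phi> (\<integral>\<^sup>+y. (ennreal (1/K) * q x y) * (ennreal (1/r) * f y) \<partial>M) \<partial>M) \<le> 1" .
  moreover have "(\<integral>\<^sup>+y. (ennreal (1/K) * q x y) * (ennreal (1/r) * f y) \<partial>M) = ennreal (1/(K*r)) * (\<integral>\<^sup>+y. q x y * f y \<partial>M)"
    if "x \<in> space M" for x
    using K r(2) that by (subst nn_integral_cmult[symmetric]) (auto intro!: nn_integral_cong simp: ennreal_mult[of "1/K" "1/r", simplified] mult_ac)
  ultimately have "(\<integral>\<^sup>+x. \<phi> (ennreal (1/(K*r)) * (\<integral>\<^sup>+y. q x y * f y \<partial>M)) \<partial>M) \<le> 1"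
    by (simp cong: nn_integral_cong)
  then have "luxemburg M \<phi> (\<lambda>x. \<integral>\<^sup>+y. q x y * f y \<partial>M) \<le> ennreal (K * r)"
    using K r(2) by (intro luxemburg_le) auto
  then show "luxemburg M \<phi> (\<lambda>x. \<integral>\<^sup>+y. q x y * f y \<partial>M) \<le> ennreal K * ennreal r"
    using K r(2) by (simp add: ennreal_mult)
qed fact

section \<open>Integral operators and the Schur test\<close>

lemma abs_integral_le_nn_integral:
  fixes f :: "'m \<Rightarrow> real"
  shows "ennreal \<bar>\<integral>x. f x \<partial>M\<bar> \<le> (\<integral>\<^sup>+x. ennreal \<bar>f x\<bar> \<partial>M)"
proof (cases "integrable M f")
  case True
  then show ?thesis using integral_norm_bound_ennreal[of M f] by simp
qed (simp add: not_integrable_integral_eq)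

definition kop :: "'m measure \<Rightarrow> ('m \<Rightarrow> 'm \<Rightarrow> real) \<Rightarrow> ('m \<Rightarrow> real) \<Rightarrow> 'm \<Rightarrow> real" where
  "kop M k u x = (\<integral>y. k x y * u y \<partial>M)"

definition kcomp :: "'m measure \<Rightarrow> ('m \<Rightarrow> 'm \<Rightarrow> real) \<Rightarrow> ('m \<Rightarrow> 'm \<Rightarrow> real) \<Rightarrow> 'm \<Rightarrow> 'm \<Rightarrow> real" where
  "kcomp M k l x y = (\<integral>z. k x z * l z y \<partial>M)"

text \<open>The hypotheses of the Schur test, by which \<open>k\<close> defines an operator of norm at most \<open>K\<close>
  for every Young function.\<close>

definition schur :: "'m measure \<Rightarrow> real \<Rightarrow> ('m \<Rightarrow> 'm \<Rightarrow> real) \<Rightarrow> bool" where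
  "schur M K k \<longleftrightarrow> case_prod k \<in> borel_measurable (M \<Otimes>\<^sub>M M) \<and> 0 < K \<and>
     (\<forall>x. (\<integral>\<^sup>+y. ennreal \<bar>k x y\<bar> \<partial>M) \<le> ennreal K) \<and> (\<forall>y. (\<integral>\<^sup>+x. ennreal \<bar>k x y\<bar> \<partial>M) \<le> ennreal K)"

text \<open>Majorants of the iterated kernels. The index is shifted by one: \<open>kmaj M k n\<close> and
  \<open>kpow M k n\<close> belong to the power \<open>n + 1\<close> of the operator, because the identity has no kernel.\<close>

primrec kmaj :: "'m measure \<Rightarrow> ('m \<Rightarrow> 'm \<Rightarrow> real) \<Rightarrow> nat \<Rightarrow> 'm \<Rightarrow> 'm \<Rightarrow> ennreal" where
  "kmaj M k 0 = (\<lambda>x y. ennreal \<bar>k x y\<bar>)"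
| "kmaj M k (Suc n) = (\<lambda>x y. \<integral>\<^sup>+z. ennreal \<bar>k x z\<bar> * kmaj M k n z y \<partial>M)"

primrec kpow :: "'m measure \<Rightarrow> ('m \<Rightarrow> 'm \<Rightarrow> real) \<Rightarrow> nat \<Rightarrow> 'm \<Rightarrow> 'm \<Rightarrow> real" where
  "kpow M k 0 = k"
| "kpow M k (Suc n) = kcomp M k (kpow M k n)"

lemma schurD:
  assumes "schur M K k"
  shows "case_prod k \<in> borel_measurable (M \<Otimes>\<^sub>M M)" "0 < K"
    "(\<integral>\<^sup>+y. ennreal \<bar>k x y\<bar> \<partial>M) \<le> ennreal K" "(\<integral>\<^sup>+x. ennreal \<bar>k x y\<bar> \<partial>M) \<le> ennreal K"
  using assms by (auto simp: schur_def)

context sigma_finite_measure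
begin

lemma kop_measurable[measurable]:
  assumes [measurable]: "case_prod k \<in> borel_measurable (M \<Otimes>\<^sub>M M)" "u \<in> borel_measurable M"
  shows "kop M k u \<in> borel_measurable M"
  unfolding kop_def[abs_def] by measurable

lemma kcomp_measurable[measurable]:
  assumes [measurable]: "case_prod k \<in> borel_measurable (M \<Otimes>\<^sub>M M)" "case_prod l \<in> borel_measurable (M \<Otimes>\<^sub>M M)"
  shows "case_prod (kcomp M k l) \<in> borel_measurable (M \<Otimes>\<^sub>M M)"
  unfolding kcomp_def[abs_def] by measurable

lemma kop_cong_AE:
  assumes [measurable]: "case_prod k \<in> borel_measurable (M \<Otimes>\<^sub>M M)" "u \<in> borel_measurable M" "v \<in> borel_measurable M"
    and "AE x in M. u x = v x" "x \<in> space M"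
  shows "kop M k u x = kop M k v x"
  unfolding kop_def using assms(4,5) by (intro integral_cong_AE) auto

lemma kcomp_eq_kop: "kcomp M k l x y = kop M k (\<lambda>z. l z y) x"
  by (simp add: kop_def kcomp_def)

lemma kop_kcomp_at:
  assumes [measurable]: "case_prod k \<in> borel_measurable (M \<Otimes>\<^sub>M M)" "case_prod l \<in> borel_measurable (M \<Otimes>\<^sub>M M)"
      "u \<in> borel_measurable M" and x: "x \<in> space M"
    and fin: "(\<integral>\<^sup>+z. ennreal \<bar>k x z\<bar> * (\<integral>\<^sup>+y. ennreal \<bar>l z y\<bar> * ennreal \<bar>u y\<bar> \<partial>M) \<partial>M) < \<infinity>"
  shows "kop M (kcomp M k l) u x = kop M k (kop M l u) x"
proof -
  interpret MM: pair_sigma_finite M M by standard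
  note [measurable] = measurable_Pair2[OF assms(1) x, simplified]
  have "(\<integral>\<^sup>+(z,y). ennreal \<bar>k x z * l z y * u y\<bar> \<partial>(M \<Otimes>\<^sub>M M)) = (\<integral>\<^sup>+z. \<integral>\<^sup>+y. ennreal \<bar>k x z * l z y * u y\<bar> \<partial>M \<partial>M)"
    using nn_integral_fst[of "\<lambda>(z,y). ennreal \<bar>k x z * l z y * u y\<bar>" M] by simp
  also have "\<dots> = (\<integral>\<^sup>+z. ennreal \<bar>k x z\<bar> * (\<integral>\<^sup>+y. ennreal \<bar>l z y\<bar> * ennreal \<bar>u y\<bar> \<partial>M) \<partial>M)"
    by (auto intro!: nn_integral_cong simp: nn_integral_cmult[symmetric] abs_mult ennreal_mult mult_ac)
  finally have int: "integrable (M \<Otimes>\<^sub>M M) (\<lambda>(z,y). k x z * l z y * u y)"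
    using fin by (intro integrableI_bounded) (auto simp: split_beta')
  have "kop M (kcomp M k l) u x = (\<integral>y. (\<integral>z. k x z * l z y * u y \<partial>M) \<partial>M)"
    by (simp add: kop_def kcomp_def)
  also have "\<dots> = (\<integral>z. (\<integral>y. k x z * l z y * u y \<partial>M) \<partial>M)"
    by (rule MM.Fubini_integral[OF int])
  also have "\<dots> = kop M k (kop M l u) x"
    by (simp add: kop_def mult.assoc)
  finally show ?thesis .
qed

lemma schur_AE_integrable_iff: "integrable M (\<lambda>y. k x y * u y)"
  if [measurable]: "case_prod k \<in> borel_measurable (M \<Otimes>\<^sub>M M)" "u \<in> borel_measurable M" and x: "x \<in> space M"
    and "(\<integral>\<^sup>+y. ennreal \<bar>k x y\<bar> * ennreal \<bar>u y\<bar> \<partial>M) < \<infinity>"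
  using that(4) measurable_Pair2[OF that(1) x] by (intro integrableI_bounded) (auto simp: abs_mult ennreal_mult)

end

text \<open>The space \<open>Lg\<close> of the functions with finite norm \<open>nrm\<close>, and the operators
  \<open>S k\<close>, the identity plus the integral operator with kernel \<open>k\<close>.\<close>

locale luxemburg_space = sigma_finite_measure M for M :: "'m measure" +
  fixes \<phi> :: "ennreal \<Rightarrow> ennreal"
  assumes young: "young \<phi>" and space_UNIV[simp]: "space M = UNIV"
begin

sublocale MM: pair_sigma_finite M M by standard

definition nrm :: "('m \<Rightarrow> real) \<Rightarrow> ennreal" where
  "nrm u = luxemburg M \<phi> (\<lambda>x. ennreal \<bar>u x\<bar>)"

definition Lg :: "('m \<Rightarrow> real) set" where
  "Lg = {u \<in> borel_measurable M. nrm u < \<infinity>}"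

definition S :: "('m \<Rightarrow> 'm \<Rightarrow> real) \<Rightarrow> ('m \<Rightarrow> real) \<Rightarrow> 'm \<Rightarrow> real" where
  "S k u x = u x + kop M k u x"

lemma LgD: "u \<in> Lg \<Longrightarrow> u \<in> borel_measurable M" "u \<in> Lg \<Longrightarrow> nrm u < \<infinity>"
  by (auto simp: Lg_def)

lemma nrm_mono: "AE x in M. \<bar>u x\<bar> \<le> \<bar>v x\<bar> \<Longrightarrow> nrm u \<le> nrm v"
  unfolding nrm_def by (rule luxemburg_mono_AE[OF young]) (auto intro: ennreal_leI)

lemma Lg_mono: "v \<in> Lg \<Longrightarrow> u \<in> borel_measurable M \<Longrightarrow> AE x in M. \<bar>u x\<bar> \<le> \<bar>v x\<bar> \<Longrightarrow> u \<in> Lg"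
  unfolding Lg_def using nrm_mono[of u v] by (auto intro: le_less_trans)

lemma nrm_add:
  assumes [measurable]: "u \<in> borel_measurable M" "v \<in> borel_measurable M"
  shows "nrm (\<lambda>x. u x + v x) \<le> nrm u + nrm v"
proof -
  have "nrm (\<lambda>x. u x + v x) \<le> luxemburg M \<phi> (\<lambda>x. ennreal \<bar>u x\<bar> + ennreal \<bar>v x\<bar>)"
    unfolding nrm_def by (intro luxemburg_mono_AE[OF young]) (auto intro!: ennreal_leI simp flip: ennreal_plus)
  also have "\<dots> \<le> nrm u + nrm v" unfolding nrm_def by (rule luxemburg_add[OF young]) auto
  finally show ?thesis .
qed

lemma nrm_minus: "nrm (\<lambda>x. - u x) = nrm u" by (simp add: nrm_def)

lemma Lg_add: "u \<in> Lg \<Longrightarrow> v \<in> Lg \<Longrightarrow> (\<lambda>x. u x + v x) \<in> Lg"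
  using nrm_add[of u v] by (auto simp: Lg_def intro: le_less_trans)

lemma Lg_minus: "u \<in> Lg \<Longrightarrow> (\<lambda>x. - u x) \<in> Lg"
  by (auto simp: Lg_def nrm_minus)

lemma Lg_diff: "u \<in> Lg \<Longrightarrow> v \<in> Lg \<Longrightarrow> (\<lambda>x. u x - v x) \<in> Lg"
  using Lg_add[OF _ Lg_minus] by fastforce

lemma nn_integral_set_le_fin:
  assumes [measurable]: "f \<in> borel_measurable M" "A \<in> sets M" and A: "emeasure M A < \<infinity>"
  obtains K where "K > 0" "(\<integral>\<^sup>+x. f x * indicator A x \<partial>M) \<le> ennreal K * luxemburg M \<phi> f"
proof
  show "(\<integral>\<^sup>+x. f x * indicator A x \<partial>M) \<le> ennreal (max 1 (enn2real (emeasure M A))) * luxemburg M \<phi> f"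
    by (rule nn_integral_set_le_luxemburg[OF young]) (use A in \<open>auto simp: max_def ennreal_enn2real_if not_le\<close>)
qed simp

lemma AE_finite_luxemburg:
  assumes [measurable]: "f \<in> borel_measurable M" and fin: "luxemburg M \<phi> f < \<infinity>"
  shows "AE x in M. f x < \<infinity>"
proof -
  obtain A :: "nat \<Rightarrow> 'm set" where A: "range A \<subseteq> sets M" "(\<Union>i. A i) = space M" "\<And>i. emeasure M (A i) \<noteq> \<infinity>"
    using sigma_finite by blast
  have "AE x in M. f x * indicator (A i) x \<noteq> \<infinity>" for i
  proof (rule nn_integral_PInf_AE)
    have [measurable]: "A i \<in> sets M" using A by auto
    show "(\<lambda>x. f x * indicator (A i) x) \<in> borel_measurable M" by measurable
    obtain K where "(\<integral>\<^sup>+x. f x * indicator (A i) x \<partial>M) \<le> ennreal K * luxemburg M \<phi> f"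
      using nn_integral_set_le_fin[of f "A i"] A(3)[of i] by (auto simp: less_top)
    also have "\<dots> < \<infinity>" using fin by (simp add: ennreal_mult_less_top)
    finally show "(\<integral>\<^sup>+x. f x * indicator (A i) x \<partial>M) \<noteq> \<infinity>" by simp
  qed
  then have "AE x in M. \<forall>i. f x * indicator (A i) x \<noteq> \<infinity>" by (simp add: AE_all_countable)
  then show ?thesis
  proof eventually_elim
    case (elim x)
    obtain i where "x \<in> A i" using A(2) by auto
    then show ?case using elim[rule_format, of i] by (simp add: less_top)
  qed
qed

lemma AE_zero_nrm:
  assumes [measurable]: "u \<in> borel_measurable M" and "nrm u = 0"
  shows "AE x in M. u x = 0"
proof -
  obtain A :: "nat \<Rightarrow> 'm set" where A: "range A \<subseteq> sets M" "(\<Union>i. A i) = space M" "\<And>i. emeasure M (A i) \<noteq> \<infinity>"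
    using sigma_finite by blast
  have "AE x in M. ennreal \<bar>u x\<bar> * indicator (A i) x = 0" for i
  proof -
    have [measurable]: "A i \<in> sets M" using A by auto
    obtain K where "(\<integral>\<^sup>+x. ennreal \<bar>u x\<bar> * indicator (A i) x \<partial>M) \<le> ennreal K * nrm u"
      using nn_integral_set_le_fin[of "\<lambda>x. ennreal \<bar>u x\<bar>" "A i"] A(3)[of i] by (auto simp: less_top nrm_def)
    then have "(\<integral>\<^sup>+x. ennreal \<bar>u x\<bar> * indicator (A i) x \<partial>M) = 0" using assms by simp
    then show ?thesis by (subst (asm) nn_integral_0_iff_AE) auto
  qed
  then have "AE x in M. \<forall>i. ennreal \<bar>u x\<bar> * indicator (A i) x = 0" unfolding AE_all_countable by blast
  then show ?thesis
  proof eventually_elim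
    case (elim x)
    obtain i where "x \<in> A i" using A(2) by auto
    then show ?case using elim[rule_format, of i] by simp
  qed
qed

lemma luxemburg_kernel_le:
  assumes "schur M K k" and [measurable]: "f \<in> borel_measurable M"
  shows "luxemburg M \<phi> (\<lambda>x. \<integral>\<^sup>+y. ennreal \<bar>k x y\<bar> * f y \<partial>M) \<le> ennreal K * luxemburg M \<phi> f"
proof -
  note [measurable] = schurD(1)[OF assms(1)]
  show ?thesis
    by (rule luxemburg_schur_test[OF sigma_finite_measure_axioms young]) (auto intro: schurD[OF assms(1)])
qed

lemma schur_AE_finite:
  assumes "schur M K k" "u \<in> Lg"
  shows "AE x in M. (\<integral>\<^sup>+y. ennreal \<bar>k x y\<bar> * ennreal \<bar>u y\<bar> \<partial>M) < \<infinity>"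
proof (rule AE_finite_luxemburg)
  note [measurable] = schurD(1)[OF assms(1)] LgD(1)[OF assms(2)]
  show "(\<lambda>x. \<integral>\<^sup>+y. ennreal \<bar>k x y\<bar> * ennreal \<bar>u y\<bar> \<partial>M) \<in> borel_measurable M" by measurable
  show "luxemburg M \<phi> (\<lambda>x. \<integral>\<^sup>+y. ennreal \<bar>k x y\<bar> * ennreal \<bar>u y\<bar> \<partial>M) < \<infinity>"
    using LgD[OF assms(2)] by (intro le_less_trans[OF luxemburg_kernel_le[OF assms(1)]]) (auto simp: nrm_def ennreal_mult_less_top)
qed

lemma schur_AE_integrable:
  assumes "schur M K k" "u \<in> Lg"
  shows "AE x in M. integrable M (\<lambda>y. k x y * u y)"
  using schur_AE_finite[OF assms]
  by eventually_elim (use schurD(1)[OF assms(1)] LgD(1)[OF assms(2)] in \<open>auto intro: schur_AE_integrable_iff\<close>)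

lemma nrm_kop_le:
  assumes "schur M K k" "u \<in> borel_measurable M"
  shows "nrm (kop M k u) \<le> ennreal K * nrm u"
proof -
  have "nrm (kop M k u) \<le> luxemburg M \<phi> (\<lambda>x. \<integral>\<^sup>+y. ennreal \<bar>k x y\<bar> * ennreal \<bar>u y\<bar> \<partial>M)"
    unfolding nrm_def kop_def using abs_integral_le_nn_integral
    by (intro luxemburg_mono_AE[OF young] always_eventually allI) (auto simp: abs_mult ennreal_mult simp flip: abs_mult ennreal_mult)
  also have "\<dots> \<le> ennreal K * nrm u"
    unfolding nrm_def using assms by (intro luxemburg_kernel_le) auto
  finally show ?thesis .
qed

lemma kop_Lg:
  assumes "schur M K k" "u \<in> Lg"
  shows "kop M k u \<in> Lg"
proof -
  note [measurable] = schurD(1)[OF assms(1)] LgD(1)[OF assms(2)]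
  show ?thesis using nrm_kop_le[OF assms(1), of u] LgD[OF assms(2)]
    by (auto simp: Lg_def ennreal_mult_less_top intro: le_less_trans)
qed

lemma S_Lg: "schur M K k \<Longrightarrow> u \<in> Lg \<Longrightarrow> S k u \<in> Lg"
  unfolding S_def[abs_def] by (intro Lg_add kop_Lg)

lemma nrm_S_le:
  assumes "schur M K k" "u \<in> Lg"
  shows "nrm (S k u) \<le> ennreal (1 + K) * nrm u"
proof -
  note [measurable] = schurD(1)[OF assms(1)] LgD(1)[OF assms(2)]
  have "nrm (S k u) \<le> nrm u + nrm (kop M k u)"
    unfolding S_def[abs_def] by (intro nrm_add) measurable
  also have "\<dots> \<le> nrm u + ennreal K * nrm u"
    by (intro add_left_mono nrm_kop_le[OF assms(1)]) measurable
  also have "\<dots> = ennreal (1 + K) * nrm u"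
    using schurD(2)[OF assms(1)] by (simp add: distrib_right)
  finally show ?thesis .
qed

lemma S_cong_AE:
  assumes "schur M K k" "u \<in> borel_measurable M" "v \<in> borel_measurable M" "AE x in M. u x = v x"
  shows "AE x in M. S k u x = S k v x"
  using assms(4) by eventually_elim (simp add: S_def kop_cong_AE[OF schurD(1)[OF assms(1)] assms(2-4)])

lemma kop_add_AE:
  assumes "schur M K k" "u \<in> Lg" "v \<in> Lg"
  shows "AE x in M. kop M k (\<lambda>y. u y + v y) x = kop M k u x + kop M k v x"
  using schur_AE_integrable[OF assms(1,2)] schur_AE_integrable[OF assms(1,3)]
  by eventually_elim (simp add: kop_def distrib_left)

lemma kop_diff_AE:
  assumes "schur M K k" "u \<in> Lg" "v \<in> Lg"
  shows "AE x in M. kop M k (\<lambda>y. u y - v y) x = kop M k u x - kop M k v x"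
  using schur_AE_integrable[OF assms(1,2)] schur_AE_integrable[OF assms(1,3)]
  by eventually_elim (simp add: kop_def right_diff_distrib)

lemma kop_kernel_add_AE:
  assumes "schur M K k" "schur M K' l" "u \<in> Lg"
  shows "AE x in M. kop M (\<lambda>x y. k x y + l x y) u x = kop M k u x + kop M l u x"
  using schur_AE_integrable[OF assms(1,3)] schur_AE_integrable[OF assms(2,3)]
  by eventually_elim (simp add: kop_def distrib_right)

text \<open>Fubini's theorem at the points where the iterated integral of the absolute values is finite; by the
  Schur test these are almost all points.\<close>

lemma kop_kcomp_AE:
  assumes "schur M K k" "schur M K' l" "u \<in> Lg"
  shows "AE x in M. kop M (kcomp M k l) u x = kop M k (kop M l u) x"
proof -
  note [measurable] = schurD(1)[OF assms(1)] schurD(1)[OF assms(2)] LgD(1)[OF assms(3)]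
  let ?f = "\<lambda>z. \<integral>\<^sup>+y. ennreal \<bar>l z y\<bar> * ennreal \<bar>u y\<bar> \<partial>M"
  have "luxemburg M \<phi> ?f \<le> ennreal K' * nrm u"
    unfolding nrm_def by (rule luxemburg_kernel_le[OF assms(2)]) auto
  then have "luxemburg M \<phi> ?f < \<infinity>"
    using LgD[OF assms(3)] by (auto simp: ennreal_mult_less_top intro: le_less_trans)
  then have "luxemburg M \<phi> (\<lambda>x. \<integral>\<^sup>+z. ennreal \<bar>k x z\<bar> * ?f z \<partial>M) < \<infinity>"
    by (intro le_less_trans[OF luxemburg_kernel_le[OF assms(1)]]) (auto simp: ennreal_mult_less_top)
  then have "AE x in M. (\<integral>\<^sup>+z. ennreal \<bar>k x z\<bar> * ?f z \<partial>M) < \<infinity>"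
    by (rule AE_finite_luxemburg[rotated]) auto
  then show ?thesis
    by eventually_elim (auto intro: kop_kcomp_at)
qed

end

section \<open>Neumann series of kernels\<close>

context sigma_finite_measure
begin

lemma nn_integral_kernel_comp:
  assumes [measurable]: "case_prod f \<in> borel_measurable (M \<Otimes>\<^sub>M M)" "case_prod g \<in> borel_measurable (M \<Otimes>\<^sub>M M)"
    and f: "\<And>x. x \<in> space M \<Longrightarrow> (\<integral>\<^sup>+y. f x y \<partial>M) \<le> ennreal a" "\<And>y. y \<in> space M \<Longrightarrow> (\<integral>\<^sup>+x. f x y \<partial>M) \<le> ennreal a"
    and g: "\<And>x. x \<in> space M \<Longrightarrow> (\<integral>\<^sup>+y. g x y \<partial>M) \<le> ennreal b" "\<And>y. y \<in> space M \<Longrightarrow> (\<integral>\<^sup>+x. g x y \<partial>M) \<le> ennreal b"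
    and "0 \<le> a" "0 \<le> b"
  shows "x \<in> space M \<Longrightarrow> (\<integral>\<^sup>+y. \<integral>\<^sup>+z. f x z * g z y \<partial>M \<partial>M) \<le> ennreal (a * b)"
    and "y \<in> space M \<Longrightarrow> (\<integral>\<^sup>+x. \<integral>\<^sup>+z. f x z * g z y \<partial>M \<partial>M) \<le> ennreal (a * b)"
proof -
  interpret pair_sigma_finite M M by standard
  assume x: "x \<in> space M"
  note [measurable] = measurable_Pair2[OF assms(1) x, simplified]
  have "(\<integral>\<^sup>+y. \<integral>\<^sup>+z. f x z * g z y \<partial>M \<partial>M) = (\<integral>\<^sup>+z. f x z * (\<integral>\<^sup>+y. g z y \<partial>M) \<partial>M)"
    by (subst Fubini') (auto intro!: nn_integral_cong nn_integral_cmult)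
  also have "\<dots> \<le> (\<integral>\<^sup>+z. f x z * ennreal b \<partial>M)"
    by (intro nn_integral_mono mult_left_mono g) auto
  also have "\<dots> = (\<integral>\<^sup>+z. f x z \<partial>M) * ennreal b"
    by (rule nn_integral_multc) auto
  also have "\<dots> \<le> ennreal a * ennreal b" by (intro mult_right_mono f x) simp
  finally show "(\<integral>\<^sup>+y. \<integral>\<^sup>+z. f x z * g z y \<partial>M \<partial>M) \<le> ennreal (a * b)"
    using assms(7,8) by (simp add: ennreal_mult)
next
  interpret pair_sigma_finite M M by standard
  assume y: "y \<in> space M"
  note [measurable] = measurable_Pair1[OF assms(2) y, simplified]
  have "(\<integral>\<^sup>+x. \<integral>\<^sup>+z. f x z * g z y \<partial>M \<partial>M) = (\<integral>\<^sup>+z. (\<integral>\<^sup>+x. f x z \<partial>M) * g z y \<partial>M)"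
    by (subst Fubini'[symmetric]) (auto intro!: nn_integral_cong nn_integral_multc)
  also have "\<dots> \<le> (\<integral>\<^sup>+z. ennreal a * g z y \<partial>M)"
    by (intro nn_integral_mono mult_right_mono f) auto
  also have "\<dots> = ennreal a * (\<integral>\<^sup>+z. g z y \<partial>M)"
    by (rule nn_integral_cmult) auto
  also have "\<dots> \<le> ennreal a * ennreal b" by (intro mult_left_mono g y) simp
  finally show "(\<integral>\<^sup>+x. \<integral>\<^sup>+z. f x z * g z y \<partial>M \<partial>M) \<le> ennreal (a * b)"
    using assms(7,8) by (simp add: ennreal_mult)
qed

lemma abs_kcomp_le: "ennreal \<bar>kcomp M k l x y\<bar> \<le> (\<integral>\<^sup>+z. ennreal \<bar>k x z\<bar> * ennreal \<bar>l z y\<bar> \<partial>M)"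
  unfolding kcomp_def using abs_integral_le_nn_integral[of M "\<lambda>z. k x z * l z y"]
  by (simp add: abs_mult ennreal_mult)

lemma schur_kcomp:
  assumes k: "schur M K k" and l: "schur M K' l" and [simp]: "space M = UNIV"
  shows "schur M (K * K') (kcomp M k l)"
proof -
  note [measurable] = schurD(1)[OF k] schurD(1)[OF l]
  note * = nn_integral_kernel_comp[of "\<lambda>x y. ennreal \<bar>k x y\<bar>" "\<lambda>x y. ennreal \<bar>l x y\<bar>" K K', OF _ _ schurD(3)[OF k] schurD(4)[OF k] schurD(3)[OF l] schurD(4)[OF l] less_imp_le[OF schurD(2)[OF k]] less_imp_le[OF schurD(2)[OF l]]]
  show ?thesis unfolding schur_def
  proof (intro conjI allI)
    show "0 < K * K'" using schurD(2)[OF k] schurD(2)[OF l] by simp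
    fix x
    show "(\<integral>\<^sup>+y. ennreal \<bar>kcomp M k l x y\<bar> \<partial>M) \<le> ennreal (K * K')"
      by (intro order_trans[OF nn_integral_mono *(1)[of x]] abs_kcomp_le) auto
    show "(\<integral>\<^sup>+y. ennreal \<bar>kcomp M k l y x\<bar> \<partial>M) \<le> ennreal (K * K')"
      by (intro order_trans[OF nn_integral_mono *(2)[of x]] abs_kcomp_le) auto
  qed measurable
qed

lemma schur_add:
  assumes k: "schur M K k" and l: "schur M K' l" and [simp]: "space M = UNIV"
  shows "schur M (K + K') (\<lambda>x y. k x y + l x y)"
proof -
  note [measurable] = schurD(1)[OF k] schurD(1)[OF l]
  have tri: "ennreal \<bar>a + b\<bar> \<le> ennreal \<bar>a\<bar> + ennreal \<bar>b\<bar>" for a b :: real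
    by (simp flip: ennreal_plus)
  show ?thesis unfolding schur_def
  proof (intro conjI allI)
    show "0 < K + K'" using schurD(2)[OF k] schurD(2)[OF l] by simp
    fix x
    have "(\<integral>\<^sup>+y. ennreal \<bar>k x y + l x y\<bar> \<partial>M) \<le> (\<integral>\<^sup>+y. ennreal \<bar>k x y\<bar> \<partial>M) + (\<integral>\<^sup>+y. ennreal \<bar>l x y\<bar> \<partial>M)"
      by (subst nn_integral_add[symmetric]) (auto intro!: nn_integral_mono tri)
    also have "\<dots> \<le> ennreal K + ennreal K'" by (intro add_mono schurD[OF k] schurD[OF l])
    finally show "(\<integral>\<^sup>+y. ennreal \<bar>k x y + l x y\<bar> \<partial>M) \<le> ennreal (K + K')"
      using schurD(2)[OF k] schurD(2)[OF l] by simp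
    have "(\<integral>\<^sup>+y. ennreal \<bar>k y x + l y x\<bar> \<partial>M) \<le> (\<integral>\<^sup>+y. ennreal \<bar>k y x\<bar> \<partial>M) + (\<integral>\<^sup>+y. ennreal \<bar>l y x\<bar> \<partial>M)"
      by (subst nn_integral_add[symmetric]) (auto intro!: nn_integral_mono tri)
    also have "\<dots> \<le> ennreal K + ennreal K'" by (intro add_mono schurD[OF k] schurD[OF l])
    finally show "(\<integral>\<^sup>+y. ennreal \<bar>k y x + l y x\<bar> \<partial>M) \<le> ennreal (K + K')"
      using schurD(2)[OF k] schurD(2)[OF l] by simp
  qed measurable
qed

lemma kmaj_measurable[measurable]:
  assumes [measurable]: "case_prod k \<in> borel_measurable (M \<Otimes>\<^sub>M M)"
  shows "case_prod (kmaj M k n) \<in> borel_measurable (M \<Otimes>\<^sub>M M)"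
proof (induction n)
  case (Suc n)
  note [measurable] = this
  show ?case by simp
qed simp

lemma kpow_measurable[measurable]:
  assumes [measurable]: "case_prod k \<in> borel_measurable (M \<Otimes>\<^sub>M M)"
  shows "case_prod (kpow M k n) \<in> borel_measurable (M \<Otimes>\<^sub>M M)"
  by (induction n) (simp_all add: kcomp_measurable)

lemma abs_kpow_le_kmaj: "ennreal \<bar>kpow M k n x y\<bar> \<le> kmaj M k n x y"
proof (induction n arbitrary: x)
  case (Suc n)
  have "ennreal \<bar>kpow M k (Suc n) x y\<bar> \<le> (\<integral>\<^sup>+z. ennreal \<bar>k x z\<bar> * ennreal \<bar>kpow M k n z y\<bar> \<partial>M)"
    using abs_kcomp_le by simp
  also have "\<dots> \<le> kmaj M k (Suc n) x y"
    by (auto intro!: nn_integral_mono mult_left_mono Suc)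
  finally show ?case .
qed simp

lemma nn_integral_kmaj_le:
  assumes k: "schur M K k" and [simp]: "space M = UNIV"
  shows "(\<integral>\<^sup>+y. kmaj M k n x y \<partial>M) \<le> ennreal (K ^ Suc n) \<and> (\<integral>\<^sup>+x. kmaj M k n x y \<partial>M) \<le> ennreal (K ^ Suc n)"
proof (induction n arbitrary: x y)
  case 0
  then show ?case using schurD[OF k] by simp
next
  case (Suc n)
  note [measurable] = schurD(1)[OF k]
  show ?case
    using nn_integral_kernel_comp[of "\<lambda>x y. ennreal \<bar>k x y\<bar>" "kmaj M k n" K "K ^ Suc n", OF _ _ schurD(3)[OF k] schurD(4)[OF k]] Suc schurD(2)[OF k]
    by (auto simp: mult.commute)
qed

text \<open>The kernel is the alternating sum of the iterated kernels, set to 0 where the sum of the majorants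
  diverges. The pointwise bound by this sum is kept in the conclusion, since it transfers every
  domination of \<open>k\<close> that is stable under composition.\<close>

lemma neumann_kernel:
  assumes k: "schur M (1/2) k" and sp[simp]: "space M = UNIV"
  obtains p where "schur M 1 p" "\<And>x y. ennreal \<bar>p x y\<bar> \<le> (\<Sum>n. kmaj M k n x y)"
    "\<And>x. AE y in M. k x y + p x y + kcomp M k p x y = 0"
proof -
  interpret MM: pair_sigma_finite M M by standard
  note km[measurable] = schurD(1)[OF k]
  define Q where "Q x y = (\<Sum>n. kmaj M k n x y)" for x y
  define p where "p x y = (if Q x y < \<infinity> then \<Sum>n. (-1) ^ Suc n * kpow M k n x y else 0)" for x y
  have [measurable]: "case_prod Q \<in> borel_measurable (M \<Otimes>\<^sub>M M)" unfolding Q_def by measurable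
  have [measurable]: "case_prod p \<in> borel_measurable (M \<Otimes>\<^sub>M M)" unfolding p_def by measurable
  have sec[measurable]: "\<And>x. k x \<in> borel_measurable M" "\<And>x. p x \<in> borel_measurable M" "\<And>x. Q x \<in> borel_measurable M"
      "\<And>x n. kmaj M k n x \<in> borel_measurable M"
      "\<And>y. (\<lambda>x. Q x y) \<in> borel_measurable M" "\<And>y n. (\<lambda>x. kpow M k n x y) \<in> borel_measurable M" 
      "\<And>y n. (\<lambda>x. kmaj M k n x y) \<in> borel_measurable M" "\<And>y. (\<lambda>x. p x y) \<in> borel_measurable M"
    by measurable
  have summ: "summable (\<lambda>n. \<bar>kpow M k n x y\<bar>)" "ennreal (\<Sum>n. \<bar>kpow M k n x y\<bar>) \<le> Q x y" if "Q x y < \<infinity>" for x y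
  proof -
    have le: "(\<Sum>n. ennreal \<bar>kpow M k n x y\<bar>) \<le> Q x y"
      unfolding Q_def using abs_kpow_le_kmaj[of k _ x y] by (intro suminf_le) auto
    then show *: "summable (\<lambda>n. \<bar>kpow M k n x y\<bar>)"
      using that by (intro summable_suminf_not_top) auto
    show "ennreal (\<Sum>n. \<bar>kpow M k n x y\<bar>) \<le> Q x y"
      using le * by (simp add: suminf_ennreal2)
  qed
  have pQ: "ennreal \<bar>p x y\<bar> \<le> Q x y" for x y
  proof (cases "Q x y < \<infinity>")
    case True
    have "\<bar>\<Sum>n. (-1) ^ Suc n * kpow M k n x y\<bar> \<le> (\<Sum>n. \<bar>(-1) ^ Suc n * kpow M k n x y\<bar>)"
      using summ(1)[OF True] by (intro summable_rabs) (simp add: abs_mult power_abs)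
    also have "(\<Sum>n. (-1) ^ Suc n * kpow M k n x y) = p x y" unfolding p_def using True by (rule if_P[symmetric])
    also have "(\<Sum>n. \<bar>(-1) ^ Suc n * kpow M k n x y\<bar>) = (\<Sum>n. \<bar>kpow M k n x y\<bar>)" by (simp add: abs_mult power_abs)
    finally have "\<bar>p x y\<bar> \<le> (\<Sum>n. \<bar>kpow M k n x y\<bar>)" .
    from order_trans[OF ennreal_leI[OF this] summ(2)[OF True]] show ?thesis .
  next
    case False
    then have "p x y = 0" unfolding p_def by (rule if_not_P)
    then show ?thesis by simp
  qed
  have geom: "(\<Sum>n. ennreal ((1/2) ^ Suc n)) = 1"
    unfolding ennreal_1[symmetric] by (rule suminf_ennreal_eq) (simp_all add: power_half_series del: power_Suc)
  have Qint: "(\<integral>\<^sup>+y. Q x y \<partial>M) \<le> 1" "(\<integral>\<^sup>+x. Q x y \<partial>M) \<le> 1" for x y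
  proof -
    have "(\<integral>\<^sup>+y. Q x y \<partial>M) = (\<Sum>n. \<integral>\<^sup>+y. kmaj M k n x y \<partial>M)"
      unfolding Q_def by (subst nn_integral_suminf) auto
    also have "\<dots> \<le> (\<Sum>n. ennreal ((1/2) ^ Suc n))"
      by (intro suminf_le conjunct1[OF nn_integral_kmaj_le[OF k sp]]) auto
    finally show "(\<integral>\<^sup>+y. Q x y \<partial>M) \<le> 1" using geom by simp
    have "(\<integral>\<^sup>+x. Q x y \<partial>M) = (\<Sum>n. \<integral>\<^sup>+x. kmaj M k n x y \<partial>M)"
      unfolding Q_def by (subst nn_integral_suminf) auto
    also have "\<dots> \<le> (\<Sum>n. ennreal ((1/2) ^ Suc n))"
      by (intro suminf_le conjunct2[OF nn_integral_kmaj_le[OF k sp]]) auto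
    finally show "(\<integral>\<^sup>+x. Q x y \<partial>M) \<le> 1" using geom by simp
  qed
  have "schur M 1 p" unfolding schur_def
  proof (intro conjI allI)
    fix x
    show "(\<integral>\<^sup>+y. ennreal \<bar>p x y\<bar> \<partial>M) \<le> ennreal 1"
      using order_trans[OF nn_integral_mono[OF pQ] Qint(1)[of x]] by simp
    show "(\<integral>\<^sup>+y. ennreal \<bar>p y x\<bar> \<partial>M) \<le> ennreal 1"
      using order_trans[OF nn_integral_mono Qint(2)[of x]] pQ by simp
  qed auto
  moreover have "AE y in M. k x y + p x y + kcomp M k p x y = 0" for x
  proof -
    have "AE y in M. Q x y \<noteq> \<infinity>"
      using Qint(1)[of x] by (intro nn_integral_PInf_AE) (auto simp: top_unique)
    then show ?thesis
    proof eventually_elim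
      case (elim y)
      then have fin: "Q x y < \<infinity>" by (simp add: less_top)
      have split: "Q x y = kmaj M k 0 x y + (\<Sum>n. kmaj M k (Suc n) x y)"
        unfolding Q_def using suminf_offset[of "\<lambda>n. kmaj M k n x y" 1] by (simp add: add.commute del: kmaj.simps)
      have "(\<Sum>n. kmaj M k (Suc n) x y) = (\<integral>\<^sup>+z. ennreal \<bar>k x z\<bar> * Q z y \<partial>M)"
        unfolding Q_def by (simp add: nn_integral_suminf[symmetric])
      then have int: "(\<integral>\<^sup>+z. ennreal \<bar>k x z\<bar> * Q z y \<partial>M) < \<infinity>"
        using fin unfolding split by simp
      define g where "g n z = k x z * ((-1) ^ Suc n * kpow M k n z y)" for n z
      have gm[measurable]: "g n \<in> borel_measurable M" for n unfolding g_def by measurable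
      have gle: "(\<integral>\<^sup>+z. ennreal \<bar>g n z\<bar> \<partial>M) \<le> kmaj M k (Suc n) x y" for n
        unfolding g_def kmaj.simps
        by (intro nn_integral_mono) (auto simp: abs_mult power_abs ennreal_mult intro!: mult_left_mono abs_kpow_le_kmaj)
      have sumfin: "(\<Sum>n. kmaj M k (Suc n) x y) < \<infinity>" using fin unfolding split by simp
      then have kfin: "kmaj M k (Suc n) x y < \<infinity>" for n
        by (metis ennreal_suminf_lessD infinity_ennreal_def)
      have gint: "integrable M (g n)" for n
        using gle[of n] kfin[of n] by (intro integrableI_bounded) auto
      have gsum: "summable (\<lambda>n. \<integral>z. norm (g n z) \<partial>M)"
      proof (rule summable_suminf_not_top)
        have "(\<Sum>n. ennreal (\<integral>z. norm (g n z) \<partial>M)) = (\<Sum>n. \<integral>\<^sup>+z. ennreal \<bar>g n z\<bar> \<partial>M)"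
          using gint by (subst nn_integral_eq_integral) auto
        also have "\<dots> \<le> (\<Sum>n. kmaj M k (Suc n) x y)" by (intro suminf_le gle) auto
        finally show "(\<Sum>n. ennreal (\<integral>z. norm (g n z) \<partial>M)) \<noteq> top" using sumfin by (auto simp: top_unique)
      qed simp
      have AEz: "AE z in M. ennreal \<bar>k x z\<bar> * Q z y \<noteq> \<infinity>"
        using int by (intro nn_integral_PInf_AE) auto
      have pt: "k x z * p z y = (\<Sum>n. g n z)" "summable (\<lambda>n. norm (g n z))"
        if "ennreal \<bar>k x z\<bar> * Q z y \<noteq> \<infinity>" for z
      proof -
        have "k x z = 0 \<or> Q z y < \<infinity>" using that by (auto simp: ennreal_mult_eq_top_iff less_top)
        show "k x z * p z y = (\<Sum>n. g n z)"
        proof (cases "k x z = 0")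
          case True
          then show ?thesis by (simp add: g_def)
        next
          case False
          then have Qf: "Q z y < \<infinity>" using \<open>k x z = 0 \<or> Q z y < \<infinity>\<close> by simp
          have "summable (\<lambda>n. (- 1) ^ Suc n * kpow M k n z y)"
            by (rule summable_rabs_cancel) (use summ(1)[OF Qf] in \<open>simp add: abs_mult power_abs\<close>)
          from suminf_mult[OF this, of "k x z"] show ?thesis
            unfolding g_def p_def if_P[OF Qf] by simp
        qed
        show "summable (\<lambda>n. norm (g n z))"
          using \<open>k x z = 0 \<or> Q z y < \<infinity>\<close> summ(1)[of z y]
          by (auto simp: g_def abs_mult power_abs intro!: summable_mult)
      qed
      have "kcomp M k p x y = (\<integral>z. (\<Sum>n. g n z) \<partial>M)"
        unfolding kcomp_def using AEz by (intro integral_cong_AE) (auto elim!: eventually_mono simp: pt)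
      also have "\<dots> = (\<Sum>n. \<integral>z. g n z \<partial>M)"
        using AEz by (intro integral_suminf gint gsum) (erule eventually_mono, rule pt(2))
      also have "\<dots> = (\<Sum>n. (-1) ^ Suc n * kpow M k (Suc n) x y)"
      proof (intro arg_cong[where f=suminf] ext)
        fix n
        have "(\<integral>z. g n z \<partial>M) = (\<integral>z. (-1) ^ Suc n * (k x z * kpow M k n z y) \<partial>M)"
          by (intro Bochner_Integration.integral_cong) (auto simp: g_def)
        then show "(\<integral>z. g n z \<partial>M) = (-1) ^ Suc n * kpow M k (Suc n) x y"
          by (simp only: integral_mult_right_zero kpow.simps kcomp_def)
      qed
      finally have kp: "kcomp M k p x y = (\<Sum>n. (-1) ^ Suc n * kpow M k (Suc n) x y)" .
      have s: "summable (\<lambda>n. (-1) ^ Suc n * kpow M k n x y)"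
        by (rule summable_rabs_cancel) (use summ(1)[OF fin] in \<open>simp add: abs_mult power_abs\<close>)
      define f where "f n = (-1) ^ Suc n * kpow M k n x y" for n
      have fs: "summable f" using s unfolding f_def .
      have "p x y = suminf f" unfolding p_def if_P[OF fin] f_def ..
      also have "\<dots> = (\<Sum>n. f (Suc n)) + f 0" using suminf_split_head[OF fs] by simp
      also have "(\<Sum>n. f (Suc n)) = - (\<Sum>n. - f (Suc n))"
        using suminf_minus[of "\<lambda>n. f (Suc n)"] fs by (simp add: summable_Suc_iff)
      also have "(\<lambda>n. - f (Suc n)) = (\<lambda>n. (-1) ^ Suc n * kpow M k (Suc n) x y)"
        by (simp add: f_def fun_eq_iff)
      also have "(\<Sum>n. (-1) ^ Suc n * kpow M k (Suc n) x y) = kcomp M k p x y" by (rule kp[symmetric])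
      also have "f 0 = - k x y" by (simp add: f_def)
      finally show ?case by simp
    qed
  qed
  ultimately show ?thesis using pQ that[of p] unfolding Q_def by blast
qed

end

section \<open>From kernel identities to inverse operators\<close>

context luxemburg_space
begin

lemma kop_right_inverse:
  assumes k: "schur M K k" and p: "schur M K' p"
    and id: "AE x in M. AE y in M. k x y + p x y + kcomp M k p x y = 0" and u: "u \<in> Lg"
  shows "AE x in M. S k (S p u) x = u x"
proof -
  note [measurable] = schurD(1)[OF k] schurD(1)[OF p] LgD(1)[OF u]
  note kp = schur_kcomp[OF k p space_UNIV]
  have pu: "kop M p u \<in> Lg" by (rule kop_Lg[OF p u])
  show ?thesis
    using id kop_kcomp_AE[OF k p u] schur_AE_integrable[OF k u] schur_AE_integrable[OF p u]
      schur_AE_integrable[OF kp u] schur_AE_integrable[OF k pu]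
  proof eventually_elim
    case (elim x)
    have "kop M k u x + kop M p u x + kop M (kcomp M k p) u x
      = (\<integral>y. k x y * u y + p x y * u y + kcomp M k p x y * u y \<partial>M)"
      using elim by (simp add: kop_def)
    also have "\<dots> = (\<integral>y. 0 \<partial>M)"
    proof (rule integral_cong_AE)
      show "AE y in M. k x y * u y + p x y * u y + kcomp M k p x y * u y = 0"
        using elim(1) by eventually_elim (metis distrib_right mult_zero_left)
    qed measurable
    finally have "kop M k u x + kop M p u x + kop M k (kop M p u) x = 0" using elim by simp
    moreover have "kop M k (S p u) x = kop M k u x + kop M k (kop M p u) x"
      using elim by (simp add: kop_def[of _ k] S_def[abs_def] distrib_left)
    ultimately show ?case by (simp add: S_def)
  qed
qed

lemma S_diff_AE:
  assumes "schur M K k" "u \<in> Lg" "v \<in> Lg"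
  shows "AE x in M. S k (\<lambda>y. u y - v y) x = S k u x - S k v x"
  using kop_diff_AE[OF assms] by eventually_elim (simp add: S_def)

lemma S_eq_imp_eq:
  assumes k: "schur M K k" and u: "u \<in> Lg" and v: "v \<in> Lg"
    and inj: "\<And>w. w \<in> Lg \<Longrightarrow> AE x in M. S k w x = 0 \<Longrightarrow> AE x in M. w x = 0"
    and eq: "AE x in M. S k u x = S k v x"
  shows "AE x in M. u x = v x"
proof -
  have "AE x in M. S k (\<lambda>y. u y - v y) x = 0"
    using S_diff_AE[OF k u v] eq by eventually_elim simp
  from inj[OF Lg_diff[OF u v] this] show ?thesis by eventually_elim simp
qed

text \<open>The function \<open>S p (S k u) - u\<close> is annihilated by the injective operator \<open>S k\<close>.\<close>

lemma left_inverse_of_right_inverse: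
  assumes k: "schur M K k" and p: "schur M K' p" and u: "u \<in> Lg"
    and inj: "\<And>w. w \<in> Lg \<Longrightarrow> AE x in M. S k w x = 0 \<Longrightarrow> AE x in M. w x = 0"
    and right: "\<And>w. w \<in> Lg \<Longrightarrow> AE x in M. S k (S p w) x = w x"
  shows "AE x in M. S p (S k u) x = u x"
  using S_eq_imp_eq[OF k S_Lg[OF p S_Lg[OF k u]] u inj right[OF S_Lg[OF k u]]] .

lemma S_inj_of_stable:
  assumes st: "\<And>u. u \<in> Lg \<Longrightarrow> nrm u \<le> ennreal C * nrm (S k u)"
    and w: "w \<in> Lg" and "AE x in M. S k w x = 0"
  shows "AE x in M. w x = 0"
proof -
  have "nrm (S k w) \<le> nrm (\<lambda>x. 0)"
    using assms(3) by (intro nrm_mono) auto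
  also have "\<dots> = 0" by (simp add: nrm_def luxemburg_zero[OF young])
  finally have "nrm w = 0" using st[OF w] by simp
  then show ?thesis using LgD(1)[OF w] by (intro AE_zero_nrm)
qed

lemma S_inj_contraction:
  assumes k: "schur M K k" "K < 1" and w: "w \<in> Lg" and 0: "AE x in M. S k w x = 0"
  shows "AE x in M. w x = 0"
proof -
  have "nrm w \<le> nrm (kop M k w)"
    using 0 by (intro nrm_mono) (auto simp: S_def elim!: eventually_mono)
  also have "\<dots> \<le> ennreal K * nrm w" using LgD(1)[OF w] by (rule nrm_kop_le[OF k(1)])
  finally have le: "nrm w \<le> ennreal K * nrm w" .
  obtain t where t: "nrm w = ennreal t" "t \<ge> 0" using LgD(2)[OF w] by (cases "nrm w") auto
  have "t \<le> K * t" using le t schurD(2)[OF k(1)] by (simp flip: ennreal_mult)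
  then have "t = 0" using k(2) t(2) by (metis less_eq_real_def mult_le_cancel_right1 not_le)
  then show ?thesis using LgD(1)[OF w] t by (intro AE_zero_nrm) auto
qed

end

section \<open>Convolution on a countable group\<close>

abbreviation gsum :: "('g \<Rightarrow> ennreal) \<Rightarrow> ennreal" where
  "gsum f \<equiv> \<integral>\<^sup>+g. f g \<partial>count_space UNIV"

definition conv :: "('g::ab_group_add \<Rightarrow> ennreal) \<Rightarrow> ('g \<Rightarrow> ennreal) \<Rightarrow> 'g \<Rightarrow> ennreal" where
  "conv a b t = gsum (\<lambda>s. a (t - s) * b s)"

lemma gsum_swap:
  fixes f :: "'g::countable \<Rightarrow> 'h::countable \<Rightarrow> ennreal"
  shows "gsum (\<lambda>s. gsum (\<lambda>t. f s t)) = gsum (\<lambda>t. gsum (\<lambda>s. f s t))"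
  by (rule nn_integral_count_space_nn_integral) auto

lemma gsum_diff_right: "gsum (\<lambda>s. f (s - a)) = gsum f" for f :: "'g::ab_group_add \<Rightarrow> ennreal"
  by (rule nn_integral_bij_count_space) (auto intro!: bij_betwI[of _ _ _ "\<lambda>s. s + a"])

lemma gsum_diff_left: "gsum (\<lambda>s. f (a - s)) = gsum f" for f :: "'g::ab_group_add \<Rightarrow> ennreal"
  by (rule nn_integral_bij_count_space) (auto intro!: bij_betwI[of _ _ _ "\<lambda>s. a - s"])

lemma gsum_uminus: "gsum (\<lambda>s. f (- s)) = gsum f" for f :: "'g::ab_group_add \<Rightarrow> ennreal"
  using gsum_diff_left[of f 0] by simp

lemma le_gsum: "f g \<le> gsum f"
proof -
  have "f g = gsum (\<lambda>h. f g * indicator {g} h)" by simp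
  also have "\<dots> \<le> gsum f" by (intro nn_integral_mono) (auto simp: indicator_def)
  finally show ?thesis .
qed

lemma gsum_conv:
  fixes a b :: "'g::{countable,ab_group_add} \<Rightarrow> ennreal"
  shows "gsum (conv a b) = gsum a * gsum b"
proof -
  have "gsum (conv a b) = gsum (\<lambda>s. gsum (\<lambda>t. a (t - s) * b s))"
    unfolding conv_def by (rule gsum_swap)
  also have "\<dots> = gsum (\<lambda>s. gsum a * b s)"
    by (simp add: nn_integral_multc gsum_diff_right)
  finally show ?thesis by (simp add: nn_integral_cmult)
qed

lemma conv_assoc:
  fixes a b d :: "'g::{countable,ab_group_add} \<Rightarrow> ennreal"
  shows "conv a (conv b d) t = conv (conv a b) d t"
proof -
  have "conv a (conv b d) t = gsum (\<lambda>s. gsum (\<lambda>r. a (t - s) * (b (s - r) * d r)))"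
    by (simp add: conv_def nn_integral_cmult)
  also have "\<dots> = gsum (\<lambda>r. gsum (\<lambda>s. a (t - s) * (b (s - r) * d r)))" by (rule gsum_swap)
  also have "\<dots> = gsum (\<lambda>r. conv a b (t - r) * d r)"
  proof (rule nn_integral_cong)
    fix r
    have "gsum (\<lambda>s. a (t - s) * b (s - r)) = gsum (\<lambda>s. a (t - r - s) * b s)"
      using gsum_diff_right[of "\<lambda>s. a (t - r - s) * b s" r] by (simp add: algebra_simps)
    then show "gsum (\<lambda>s. a (t - s) * (b (s - r) * d r)) = conv a b (t - r) * d r"
      by (simp add: conv_def mult.assoc[symmetric] nn_integral_multc)
  qed
  finally show ?thesis by (simp add: conv_def)
qed

lemma conv_mono: "(\<And>t. b t \<le> b' t) \<Longrightarrow> conv a b t \<le> conv a b' t"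
  unfolding conv_def by (intro nn_integral_mono mult_left_mono) auto

lemma conv_add_right: "conv a (\<lambda>t. b t + b' t) t = conv a b t + conv a b' t"
  by (simp add: conv_def distrib_left nn_integral_add)

lemma conv_add_left: "conv (\<lambda>t. a t + a' t) b t = conv a b t + conv a' b t"
  by (simp add: conv_def distrib_right nn_integral_add)

lemma conv_cmult_right: "conv a (\<lambda>t. z * b t) t = z * conv a b t"
  by (simp add: conv_def nn_integral_cmult[symmetric] mult_ac)

lemma conv_cmult_left: "conv (\<lambda>t. z * a t) b t = z * conv a b t"
  by (simp add: conv_def nn_integral_cmult[symmetric] mult_ac)

primrec convpow :: "('g::ab_group_add \<Rightarrow> ennreal) \<Rightarrow> nat \<Rightarrow> 'g \<Rightarrow> ennreal" where
  "convpow e 0 = indicator {0}"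
| "convpow e (Suc n) = conv (convpow e n) e"

lemma conv_indicator_0: "conv (indicator {0}) b t = b t" for t :: "'g::ab_group_add"
proof -
  have "conv (indicator {0}) b t = gsum (\<lambda>s. b t * indicator {t} s)"
    unfolding conv_def by (intro nn_integral_cong) (auto simp: indicator_def)
  then show ?thesis by simp
qed

text \<open>A discrete Gronwall inequality: the inequality is substituted into itself, and the remainder vanishes
  because \<open>A\<close> is bounded and \<open>e\<close> has total mass at most one half.\<close>

lemma conv_inequality_iterate:
  fixes A :: "'g::{countable,ab_group_add} \<Rightarrow> ennreal"
  assumes le: "\<And>t. A t \<le> h t + conv e A t" and bdd: "\<And>t. A t \<le> ennreal K"
    and e: "gsum e \<le> ennreal (1/2)"
  shows "A t \<le> conv (\<lambda>g. \<Sum>n. convpow e n g) h t"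
    and "gsum (\<lambda>g. \<Sum>n. convpow e n g) \<le> 2"
proof -
  have pow: "gsum (convpow e n) \<le> ennreal ((1/2) ^ n)" for n
  proof (induction n)
    case (Suc n)
    have "gsum (convpow e (Suc n)) = gsum (convpow e n) * gsum e" by (simp add: gsum_conv)
    also have "\<dots> \<le> ennreal ((1/2) ^ n) * ennreal (1/2)" by (intro mult_mono Suc e) auto
    also have "\<dots> = ennreal ((1/2) ^ Suc n)" by (subst ennreal_mult[symmetric]) (auto simp: mult.commute)
    finally show ?case .
  qed simp
  have iter: "A t \<le> (\<Sum>i<n. conv (convpow e i) h t) + conv (convpow e n) A t" for n
  proof (induction n)
    case 0
    show ?case by (simp add: conv_indicator_0)
  next
    case (Suc n)
    have "conv (convpow e n) A t \<le> conv (convpow e n) (\<lambda>t. h t + conv e A t) t"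
      by (rule conv_mono) (rule le)
    also have "\<dots> = conv (convpow e n) h t + conv (convpow e (Suc n)) A t"
      by (simp add: conv_add_right conv_assoc)
    finally have "(\<Sum>i<n. conv (convpow e i) h t) + conv (convpow e n) A t
        \<le> (\<Sum>i<n. conv (convpow e i) h t) + (conv (convpow e n) h t + conv (convpow e (Suc n)) A t)"
      by (rule add_left_mono)
    from order_trans[OF Suc this] show ?case by (simp add: add.assoc)
  qed
  have rest: "conv (convpow e n) A t \<le> ennreal ((1/2) ^ n * max 0 K)" for n
  proof -
    have "conv (convpow e n) A t \<le> gsum (\<lambda>s. convpow e n (t - s) * ennreal (max 0 K))"
      unfolding conv_def using bdd by (intro nn_integral_mono mult_left_mono) (auto intro: order_trans[OF _ ennreal_leI[OF max.cobounded2]])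
    also have "\<dots> = gsum (convpow e n) * ennreal (max 0 K)"
      by (simp add: nn_integral_multc gsum_diff_left)
    also have "\<dots> \<le> ennreal ((1/2) ^ n) * ennreal (max 0 K)" by (intro mult_right_mono pow) simp
    finally show ?thesis by (subst ennreal_mult) auto
  qed
  have swap: "conv (\<lambda>g. \<Sum>n. convpow e n g) h t = (\<Sum>n. conv (convpow e n) h t)"
    unfolding conv_def by (simp add: nn_integral_suminf[symmetric])
  show "A t \<le> conv (\<lambda>g. \<Sum>n. convpow e n g) h t"
  proof (rule ennreal_le_epsilon)
    fix \<epsilon> :: real assume "0 < \<epsilon>"
    have "(\<lambda>n. (1/2) ^ n * max 0 K) \<longlonglongrightarrow> 0 * max 0 K"
      by (intro tendsto_mult LIMSEQ_power_zero tendsto_const) simp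
    then have "\<forall>\<^sub>F n in sequentially. (1/2) ^ n * max 0 K < \<epsilon>"
      using \<open>0 < \<epsilon>\<close> by (intro order_tendstoD) auto
    then obtain n where n: "(1/2) ^ n * max 0 K < \<epsilon>" by (auto simp: eventually_sequentially)
    have "A t \<le> (\<Sum>i<n. conv (convpow e i) h t) + conv (convpow e n) A t" by (rule iter)
    also have "\<dots> \<le> conv (\<lambda>g. \<Sum>n. convpow e n g) h t + ennreal \<epsilon>"
      unfolding swap using n
      by (intro add_mono sum_le_suminf order_trans[OF rest ennreal_leI]) auto
    finally show "A t \<le> conv (\<lambda>g. \<Sum>n. convpow e n g) h t + ennreal \<epsilon>" .
  qed
  have "gsum (\<lambda>g. \<Sum>n. convpow e n g) = (\<Sum>n. gsum (convpow e n))"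
    by (simp add: nn_integral_suminf)
  also have "\<dots> \<le> (\<Sum>n. ennreal ((1/2) ^ n))" by (intro suminf_le pow) auto
  also have "\<dots> = ennreal (1 / (1 - 1/2))" by (rule suminf_ennreal_eq) (use geometric_sums[of "1/2::real"] in auto)
  finally show "gsum (\<lambda>g. \<Sum>n. convpow e n g) \<le> 2" by simp
qed

section \<open>Spaces divided into cells\<close>

text \<open>The bound in the Schur test may now be 0, as happens for cells that a commutator does not reach.\<close>

lemma luxemburg_schur_test_ennreal:
  fixes q :: "'m \<Rightarrow> 'm \<Rightarrow> ennreal"
  assumes "sigma_finite_measure M" "young \<phi>"
    and [measurable]: "case_prod q \<in> borel_measurable (M \<Otimes>\<^sub>M M)" "f \<in> borel_measurable M"
    and 1: "\<And>x. x \<in> space M \<Longrightarrow> (\<integral>\<^sup>+y. q x y \<partial>M) \<le> X" and 2: "\<And>y. y \<in> space M \<Longrightarrow> (\<integral>\<^sup>+x. q x y \<partial>M) \<le> X"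
    and fin: "X < \<infinity>" "luxemburg M \<phi> f < \<infinity>"
  shows "luxemburg M \<phi> (\<lambda>x. \<integral>\<^sup>+y. q x y * f y \<partial>M) \<le> X * luxemburg M \<phi> f"
proof (rule ennreal_le_epsilon)
  fix e :: real assume e: "0 < e"
  obtain x g where x: "X = ennreal x" "x \<ge> 0" and g: "luxemburg M \<phi> f = ennreal g" "g \<ge> 0"
    using fin by (cases X; cases "luxemburg M \<phi> f") auto
  have pos: "x + e / (g + 1) > 0" using x g e by (simp add: add_nonneg_pos)
  have "luxemburg M \<phi> (\<lambda>x. \<integral>\<^sup>+y. q x y * f y \<partial>M) \<le> ennreal (x + e / (g + 1)) * luxemburg M \<phi> f"
    using x g e pos by (intro luxemburg_schur_test[OF assms(1,2)]) (auto intro!: order_trans[OF 1] order_trans[OF 2] ennreal_leI)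
  also have "\<dots> = ennreal (x * g + e * (g / (g+1)))"
    using x g e by (simp add: ennreal_mult[symmetric] algebra_simps)
  also have "\<dots> \<le> ennreal (x * g + e)"
    proof (intro ennreal_leI add_left_mono)
      have "e * (g / (g + 1)) \<le> e * 1" using g e by (intro mult_left_mono) (auto simp: divide_le_eq_1)
      then show "e * (g / (g + 1)) \<le> e" by simp
    qed
  also have "\<dots> = X * luxemburg M \<phi> f + ennreal e"
    using x g e by (simp add: ennreal_mult)
  finally show "luxemburg M \<phi> (\<lambda>x. \<integral>\<^sup>+y. q x y * f y \<partial>M) \<le> X * luxemburg M \<phi> f + ennreal e" .
qed

text \<open>A space divided by \<open>c\<close> into cells of measure at most \<open>\<kappa>\<close>, which are labelled by a countable
  group with a length function whose balls have the doubling property. The model is Euclidean space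
  divided into unit cubes, with the integer vectors as labels.\<close>

locale cell_space = luxemburg_space M \<phi> for M :: "'m measure" and \<phi> +
  fixes c :: "'m \<Rightarrow> 'g::{countable,ab_group_add}" and len :: "'g \<Rightarrow> nat" and \<kappa> :: real and D :: nat
  assumes c_measurable[measurable]: "c \<in> measurable M (count_space UNIV)"
    and emeasure_cell: "\<And>j. emeasure M (c -` {j}) \<le> ennreal \<kappa>" and \<kappa>: "1 \<le> \<kappa>"
    and len_0[simp]: "len 0 = 0" and len_add: "\<And>a b. len (a + b) \<le> len a + len b"
    and len_minus[simp]: "\<And>a. len (- a) = len a"
    and finite_ball: "\<And>n. finite {g. len g \<le> n}"
    and doubling: "\<And>n. card {g. len g \<le> 3 * n} \<le> D * card {g. len g \<le> n}"
begin

lemma cell_sets[measurable]: "c -` {j} \<in> sets M"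
  using measurable_sets[OF c_measurable, of "{j}"] by simp

lemma len_diff: "len (a - b) \<le> len a + len b"
  using len_add[of a "- b"] by simp

lemma len_swap: "len (a - b) = len (b - a)"
  using len_minus[of "a - b"] by simp

lemma measurable_cell_fun[measurable]: "(\<lambda>x. h (c x)) \<in> borel_measurable M"
  by (rule measurable_compose[OF c_measurable]) simp

lemma measurable_cell_fun2[measurable]: "(\<lambda>(x, y). h (c x) (c y)) \<in> borel_measurable (M \<Otimes>\<^sub>M M)"
proof -
  have "(\<lambda>z. (c (fst z), c (snd z))) \<in> measurable (M \<Otimes>\<^sub>M M) (count_space UNIV \<Otimes>\<^sub>M count_space UNIV)"
    by measurable
  also have "(count_space UNIV \<Otimes>\<^sub>M count_space UNIV :: ('g \<times> 'g) measure) = count_space UNIV"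
    by (subst pair_measure_countable) auto
  finally have "(\<lambda>z. case_prod h (c (fst z), c (snd z))) \<in> borel_measurable (M \<Otimes>\<^sub>M M)"
    by (rule measurable_compose) simp
  then show ?thesis by (simp add: split_beta')
qed

lemma nn_integral_cells:
  assumes [measurable]: "f \<in> borel_measurable M"
  shows "(\<integral>\<^sup>+x. h (c x) * f x \<partial>M) = gsum (\<lambda>j. h j * (\<integral>\<^sup>+x. f x * indicator (c -` {j}) x \<partial>M))"
proof -
  have "(\<integral>\<^sup>+x. h (c x) * f x \<partial>M) = (\<integral>\<^sup>+x. gsum (\<lambda>j. h j * (f x * indicator (c -` {j}) x)) \<partial>M)"
  proof (intro nn_integral_cong)
    fix x
    have "gsum (\<lambda>j. h j * (f x * indicator (c -` {j}) x)) = gsum (\<lambda>j. (h (c x) * f x) * indicator {c x} j)"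
      by (intro nn_integral_cong) (auto simp: indicator_def)
    then show "h (c x) * f x = gsum (\<lambda>j. h j * (f x * indicator (c -` {j}) x))" by simp
  qed
  also have "\<dots> = gsum (\<lambda>j. \<integral>\<^sup>+x. h j * (f x * indicator (c -` {j}) x) \<partial>M)"
    by (rule nn_integral_count_space_nn_integral) auto
  finally show ?thesis by (simp add: nn_integral_cmult)
qed

lemma nn_integral_cell_fun_le: "(\<integral>\<^sup>+x. h (c x) \<partial>M) \<le> ennreal \<kappa> * gsum h"
proof -
  have "(\<integral>\<^sup>+x. h (c x) \<partial>M) = gsum (\<lambda>j. h j * emeasure M (c -` {j}))"
    using nn_integral_cells[of "\<lambda>x. 1" h] by simp
  also have "\<dots> \<le> gsum (\<lambda>j. h j * ennreal \<kappa>)"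
    by (intro nn_integral_mono mult_left_mono emeasure_cell) simp
  also have "\<dots> = gsum h * ennreal \<kappa>" by (rule nn_integral_multc) simp
  finally show ?thesis by (simp only: mult.commute)
qed

lemma nn_integral_cell_conv_le:
  "(\<integral>\<^sup>+y. h (c x - c y) \<partial>M) \<le> ennreal \<kappa> * gsum h" "(\<integral>\<^sup>+x. h (c x - c y) \<partial>M) \<le> ennreal \<kappa> * gsum h"
  using nn_integral_cell_fun_le[of "\<lambda>j. h (c x - j)"] nn_integral_cell_fun_le[of "\<lambda>j. h (j - c y)"]
  by (simp_all add: gsum_diff_left gsum_diff_right)

text \<open>Applying a kernel that depends only on the cells is a convolution of the cell integrals.\<close>

lemma nn_integral_conv_cells:
  assumes [measurable]: "f \<in> borel_measurable M"
  shows "(\<integral>\<^sup>+y. B (g - c y) * f y \<partial>M) = conv B (\<lambda>j. \<integral>\<^sup>+x. f x * indicator (c -` {j}) x \<partial>M) g"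
  unfolding conv_def by (rule nn_integral_cells) measurable

lemma cell_schur:
  assumes [measurable]: "case_prod k \<in> borel_measurable (M \<Otimes>\<^sub>M M)"
    and k: "\<And>x y. ennreal \<bar>k x y\<bar> \<le> B (c x - c y)" and B: "gsum B \<le> ennreal b" "b > 0"
  shows "schur M (\<kappa> * b) k"
  unfolding schur_def
proof (intro conjI allI)
  have le: "ennreal \<kappa> * gsum B \<le> ennreal (\<kappa> * b)"
    using B(2) \<kappa> by (subst ennreal_mult) (auto intro!: mult_left_mono B(1))
  fix x
  show "(\<integral>\<^sup>+y. ennreal \<bar>k x y\<bar> \<partial>M) \<le> ennreal (\<kappa> * b)"
    by (intro order_trans[OF nn_integral_mono order_trans[OF nn_integral_cell_conv_le(1)[of B x] le]] k)
  show "(\<integral>\<^sup>+y. ennreal \<bar>k y x\<bar> \<partial>M) \<le> ennreal (\<kappa> * b)"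
    by (intro order_trans[OF nn_integral_mono order_trans[OF nn_integral_cell_conv_le(2)[of B x] le]] k)
qed (use B \<kappa> in auto)

lemma luxemburg_const_cell: "luxemburg M \<phi> (\<lambda>x. X * indicator (c -` {j}) x) \<le> X * ennreal \<kappa>"
proof (cases "X = \<infinity>")
  case True
  then show ?thesis using \<kappa> by (simp add: ennreal_top_mult)
next
  case False
  then obtain r where r: "X = ennreal r" "r \<ge> 0" by (cases X) auto
  have "luxemburg M \<phi> (indicator (c -` {j})) \<le> ennreal \<kappa>"
    by (rule luxemburg_indicator[OF young _ emeasure_cell \<kappa>]) measurable
  then have "ennreal r * luxemburg M \<phi> (indicator (c -` {j})) \<le> ennreal r * ennreal \<kappa>"
    by (rule mult_left_mono) simp
  moreover have "luxemburg M \<phi> (\<lambda>x. ennreal r * indicator (c -` {j}) x) \<le> ennreal r * luxemburg M \<phi> (indicator (c -` {j}))"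
    by (rule luxemburg_cmult[OF young r(2)]) (use \<open>luxemburg M \<phi> (indicator (c -` {j})) \<le> ennreal \<kappa>\<close> in \<open>auto intro: le_less_trans\<close>)
  ultimately show ?thesis unfolding r by (rule order_trans[rotated])
qed

lemma luxemburg_cell_fun_le: "luxemburg M \<phi> (\<lambda>x. h (c x)) \<le> ennreal \<kappa> * gsum h"
proof -
  have "luxemburg M \<phi> (\<lambda>x. h (c x)) = luxemburg M \<phi> (\<lambda>x. gsum (\<lambda>j. h j * indicator (c -` {j}) x))"
  proof (rule arg_cong[where f="luxemburg M \<phi>"], rule ext)
    fix x
    have "gsum (\<lambda>j. h j * indicator (c -` {j}) x) = gsum (\<lambda>j. h (c x) * indicator {c x} j)"
      by (intro nn_integral_cong) (auto simp: indicator_def)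
    then show "h (c x) = gsum (\<lambda>j. h j * indicator (c -` {j}) x)" by simp
  qed
  also have "\<dots> \<le> gsum (\<lambda>j. luxemburg M \<phi> (\<lambda>x. h j * indicator (c -` {j}) x))"
    by (rule luxemburg_sum[OF young]) measurable
  also have "\<dots> \<le> gsum (\<lambda>j. h j * ennreal \<kappa>)"
    by (intro nn_integral_mono luxemburg_const_cell)
  also have "\<dots> = gsum h * ennreal \<kappa>" by (rule nn_integral_multc) simp
  finally show ?thesis by (simp only: mult.commute)
qed

end

section \<open>Localization by cut-off functions\<close>

context cell_space
begin

text \<open>Equal to 1 on the ball of radius \<open>L\<close>, equal to 0 outside the ball of radius \<open>2 * L\<close>, and linear
  in the length in between. Its Lipschitz constant \<open>1 / L\<close> makes commutators small for
  large \<open>L\<close>.\<close>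

definition cutoff :: "nat \<Rightarrow> 'g \<Rightarrow> real" where
  "cutoff L g = max 0 (min 1 (2 - real (len g) / real L))"

lemma cutoff_bounds: "0 \<le> cutoff L g" "cutoff L g \<le> 1" "\<bar>cutoff L g\<bar> \<le> 1"
  by (auto simp: cutoff_def)

lemma cutoff_eq_1: "L > 0 \<Longrightarrow> len g \<le> L \<Longrightarrow> cutoff L g = 1"
  by (simp add: cutoff_def)

lemma cutoff_eq_0: "L > 0 \<Longrightarrow> 2 * L \<le> len g \<Longrightarrow> cutoff L g = 0"
  by (simp add: cutoff_def field_simps)

lemma cutoff_lipschitz:
  assumes "L > 0"
  shows "\<bar>cutoff L g - cutoff L h\<bar> \<le> min 1 (real (len (g - h)) / real L)"
proof -
  have "len g \<le> len h + len (g - h)" using len_add[of h "g - h"] by simp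
  moreover have "len h \<le> len g + len (g - h)" using len_diff[of g "g - h"] by simp
  ultimately have "\<bar>real (len g) - real (len h)\<bar> \<le> real (len (g - h))" by linarith
  then have "\<bar>real (len g) - real (len h)\<bar> / real L \<le> real (len (g - h)) / real L"
    by (rule divide_right_mono) simp
  then have "\<bar>real (len g) / real L - real (len h) / real L\<bar> \<le> real (len (g - h)) / real L"
    using assms by (simp add: diff_divide_distrib[symmetric])
  then show ?thesis by (auto simp: cutoff_def max_def min_def)
qed

text \<open>Dominated convergence: each factor tends to 0 as the width grows.\<close>

lemma commutator_sum_small:
  assumes B: "gsum B < \<infinity>" and e: "0 < e"
  obtains L where "L > 0" "gsum (\<lambda>d. B d * ennreal (min 1 (real (len d) / real L))) \<le> ennreal e"
proof -
  have fin: "B d < \<infinity>" for d using le_gsum[of B d] B by (rule le_less_trans)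
  have "(\<lambda>L. gsum (\<lambda>d. B d * ennreal (min 1 (real (len d) / real (Suc L))))) \<longlonglongrightarrow> gsum (\<lambda>d::'g. 0)"
  proof (rule nn_integral_dominated_convergence[where w=B])
    show "gsum B < \<infinity>" by fact
    show "AE d in count_space UNIV. B d * ennreal (min 1 (real (len d) / real (Suc L))) \<le> B d" for L
    proof (intro AE_I2)
      fix d
      have "B d * ennreal (min 1 (real (len d) / real (Suc L))) \<le> B d * 1"
        by (intro mult_left_mono) auto
      then show "B d * ennreal (min 1 (real (len d) / real (Suc L))) \<le> B d" by simp
    qed
    have lim0: "(\<lambda>L. min 1 (real (len d) / real (Suc L))) \<longlonglongrightarrow> min 1 0" for d
      using LIMSEQ_Suc[OF lim_const_over_n[of "real (len d)"]] by (intro tendsto_min tendsto_const) simp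
    have "(\<lambda>L. B d * ennreal (min 1 (real (len d) / real (Suc L)))) \<longlonglongrightarrow> B d * ennreal (min 1 0)" for d
      using fin[of d] by (intro ennreal_tendsto_cmult tendsto_ennrealI lim0) auto
    then show "AE d in count_space UNIV. (\<lambda>L. B d * ennreal (min 1 (real (len d) / real (Suc L)))) \<longlonglongrightarrow> 0"
      by simp
  qed auto
  then have "\<forall>\<^sub>F L in sequentially. gsum (\<lambda>d. B d * ennreal (min 1 (real (len d) / real (Suc L)))) < ennreal e"
    using e by (intro order_tendstoD(2)) auto
  then obtain L where "gsum (\<lambda>d. B d * ennreal (min 1 (real (len d) / real (Suc L)))) < ennreal e"
    by (auto simp: eventually_sequentially)
  then show ?thesis by (intro that[of "Suc L"]) auto
qed

definition near :: "nat \<Rightarrow> 'g \<Rightarrow> ennreal" where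
  "near n g = indicator {g. len g \<le> n} g"

definition ball_card :: "nat \<Rightarrow> real" where
  "ball_card n = real (card {g. len g \<le> n})"

lemma ball_card_pos: "ball_card n > 0"
proof -
  have "0 \<in> {g. len g \<le> n}" by simp
  then show ?thesis unfolding ball_card_def using finite_ball[of n] by (metis card_gt_0_iff empty_iff of_nat_0_less_iff)
qed

lemma gsum_near: "gsum (near n) = ennreal (ball_card n)"
proof -
  have "gsum (near n) = emeasure (count_space UNIV) {g. len g \<le> n}"
    unfolding near_def by (subst nn_integral_indicator[symmetric]) auto
  then show ?thesis using finite_ball[of n] by (simp add: ball_card_def ennreal_of_nat_eq_real_of_nat)
qed

lemma near_swap: "near n (a - b) = near n (b - a)"
  by (simp add: near_def len_swap[of a b] indicator_def)

text \<open>A bound for the effect of the commutator with the cut-off at \<open>t\<close> on functions living near \<open>s\<close>,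
  where \<open>g\<close> is the offset \<open>t - s\<close> and \<open>d\<close> the difference of the cells of the two
  arguments of the kernel.\<close>

definition commutator_weight :: "('g \<Rightarrow> ennreal) \<Rightarrow> nat \<Rightarrow> 'g \<Rightarrow> 'g \<Rightarrow> ennreal" where
  "commutator_weight B L g d = B d * ennreal (min 1 (real (len d) / real L)) * (near (3 * L) g + near (3 * L) (d - g))"

lemma gsum_commutator_weight:
  "gsum (\<lambda>g. gsum (commutator_weight B L g))
     = 2 * ennreal (ball_card (3 * L)) * gsum (\<lambda>d. B d * ennreal (min 1 (real (len d) / real L)))"
proof -
  have "gsum (\<lambda>g. gsum (commutator_weight B L g)) = gsum (\<lambda>d. gsum (\<lambda>g. commutator_weight B L g d))"
    by (rule gsum_swap)
  also have "\<dots> = gsum (\<lambda>d. B d * ennreal (min 1 (real (len d) / real L)) * (2 * ennreal (ball_card (3 * L))))"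
    unfolding commutator_weight_def
    by (simp add: nn_integral_cmult nn_integral_add gsum_diff_left gsum_near mult_2)
  also have "\<dots> = gsum (\<lambda>d. B d * ennreal (min 1 (real (len d) / real L))) * (2 * ennreal (ball_card (3 * L)))"
    by (rule nn_integral_multc) simp
  finally show ?thesis by (simp only: mult.commute)
qed

text \<open>The commutator vanishes unless one of the two cells lies within \<open>2 * L\<close> of \<open>t\<close>, and
  the cell \<open>h\<close> lies within \<open>L\<close> of \<open>s\<close>. Hence \<open>t - s\<close>, or its difference
  from \<open>g - h\<close>, has length at most \<open>3 * L\<close>, which explains the radius in the weight.\<close>

lemma cutoff_commutator_pointwise:
  assumes L: "L > 0"
  shows "ennreal \<bar>cutoff L (h - t) - cutoff L (g - t)\<bar> * near L (h - s) * B (g - h)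
    \<le> commutator_weight B L (t - s) (g - h)"
proof (cases "near L (h - s) = 0 \<or> cutoff L (h - t) = cutoff L (g - t)")
  case False
  then have n1: "len (h - s) \<le> L" and ne: "cutoff L (h - t) \<noteq> cutoff L (g - t)"
    by (auto simp: near_def indicator_def split: if_splits)
  have "len (h - t) \<le> 2 * L \<or> len (g - t) \<le> 2 * L"
    using ne cutoff_eq_0[OF L] by (metis linear)
  then have "1 \<le> near (3 * L) (t - s) + near (3 * L) (g - h - (t - s))"
  proof
    assume "len (h - t) \<le> 2 * L"
    then have "len (t - s) \<le> 3 * L" using len_diff[of "h - s" "h - t"] n1 by simp
    then show ?thesis by (simp add: near_def)
  next
    assume "len (g - t) \<le> 2 * L"
    moreover have eq: "g - h - (t - s) = (g - t) - (h - s)" by simp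
    ultimately have "len (g - h - (t - s)) \<le> 3 * L"
      unfolding eq using len_diff[of "g - t" "h - s"] n1 by linarith
    then show ?thesis by (simp add: near_def)
  qed
  have lip: "ennreal \<bar>cutoff L (h - t) - cutoff L (g - t)\<bar> \<le> ennreal (min 1 (real (len (g - h)) / real L))"
    using cutoff_lipschitz[OF L, of "h - t" "g - t"] len_swap[of g h] by (intro ennreal_leI) simp
  have "ennreal \<bar>cutoff L (h - t) - cutoff L (g - t)\<bar> * near L (h - s) * B (g - h)
    = B (g - h) * ennreal \<bar>cutoff L (h - t) - cutoff L (g - t)\<bar> * 1"
    using n1 by (simp add: near_def mult_ac)
  also have "\<dots> \<le> commutator_weight B L (t - s) (g - h)"
    unfolding commutator_weight_def by (intro mult_mono lip order_refl) (use \<open>1 \<le> _\<close> in auto)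
  finally show ?thesis .
qed auto

text \<open>The norm of the commutator is bounded by the norms of the localized functions again. To introduce
  them, the integrand is averaged over all centres \<open>s\<close> within \<open>L\<close> of the cell of \<open>y\<close>; for
  these the cut-off at \<open>s\<close> equals 1 there, so inserting it changes nothing. The average accounts for
  the division by the cardinality of a ball.\<close>

lemma cutoff_commutator_norm:
  assumes [measurable]: "case_prod k \<in> borel_measurable (M \<Otimes>\<^sub>M M)" "u \<in> borel_measurable M"
    and k: "\<And>x y. ennreal \<bar>k x y\<bar> \<le> B (c x - c y)" and B: "gsum B < \<infinity>"
    and u: "nrm u < \<infinity>" and L: "L > 0"
  shows "luxemburg M \<phi> (\<lambda>x. \<integral>\<^sup>+y. ennreal \<bar>k x y\<bar> * (ennreal \<bar>cutoff L (c y - t) - cutoff L (c x - t)\<bar> * ennreal \<bar>u y\<bar>) \<partial>M)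
    \<le> conv (\<lambda>g. ennreal (\<kappa> / ball_card L) * gsum (commutator_weight B L g))
         (\<lambda>s. nrm (\<lambda>x. cutoff L (c x - s) * u x)) t"
proof -
  let ?R = "\<lambda>x. \<integral>\<^sup>+y. ennreal \<bar>k x y\<bar> * (ennreal \<bar>cutoff L (c y - t) - cutoff L (c x - t)\<bar> * ennreal \<bar>u y\<bar>) \<partial>M"
  let ?us = "\<lambda>s y. ennreal \<bar>cutoff L (c y - s) * u y\<bar>"
  let ?q = "\<lambda>s x y. commutator_weight B L (t - s) (c x - c y)"
  let ?b = "ball_card L"
  note b = ball_card_pos[of L]
  have Wfin: "gsum (commutator_weight B L g) < \<infinity>" for g
  proof -
    have "gsum (\<lambda>d. B d * ennreal (min 1 (real (len d) / real L))) \<le> gsum (\<lambda>d. B d * 1)"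
      by (intro nn_integral_mono mult_left_mono) auto
    then have "gsum (\<lambda>g. gsum (commutator_weight B L g)) < \<infinity>"
      using B unfolding gsum_commutator_weight by (auto simp: ennreal_mult_less_top intro: le_less_trans)
    then show ?thesis by (rule le_less_trans[OF le_gsum, rotated])
  qed
  have us_le: "nrm (\<lambda>x. cutoff L (c x - s) * u x) \<le> nrm u" for s
    by (intro nrm_mono AE_I2) (auto simp: abs_mult cutoff_bounds intro: mult_left_le_one_le)
  have R_le: "?R x \<le> ennreal (1 / ?b) * gsum (\<lambda>s. \<integral>\<^sup>+y. ?q s x y * ?us s y \<partial>M)" for x
  proof -
    have "ennreal ?b * ?R x = (\<integral>\<^sup>+y. gsum (\<lambda>s. near L (c y - s)) * (ennreal \<bar>k x y\<bar> * (ennreal \<bar>cutoff L (c y - t) - cutoff L (c x - t)\<bar> * ennreal \<bar>u y\<bar>)) \<partial>M)"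
      by (simp add: gsum_diff_left gsum_near nn_integral_cmult)
    also have "\<dots> = (\<integral>\<^sup>+y. gsum (\<lambda>s. near L (c y - s) * (ennreal \<bar>k x y\<bar> * (ennreal \<bar>cutoff L (c y - t) - cutoff L (c x - t)\<bar> * ennreal \<bar>u y\<bar>))) \<partial>M)"
      by (simp add: nn_integral_multc)
    also have "\<dots> \<le> (\<integral>\<^sup>+y. gsum (\<lambda>s. ?q s x y * ?us s y) \<partial>M)"
    proof (intro nn_integral_mono)
      fix y s
      have "near L (c y - s) * (ennreal \<bar>k x y\<bar> * (ennreal \<bar>cutoff L (c y - t) - cutoff L (c x - t)\<bar> * ennreal \<bar>u y\<bar>))
        = ennreal \<bar>k x y\<bar> * (ennreal \<bar>cutoff L (c y - t) - cutoff L (c x - t)\<bar> * near L (c y - s)) * ?us s y"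
        using cutoff_eq_1[OF L, of "c y - s"] by (auto simp: near_def indicator_def mult_ac)
      also have "\<dots> \<le> B (c x - c y) * (ennreal \<bar>cutoff L (c y - t) - cutoff L (c x - t)\<bar> * near L (c y - s)) * ?us s y"
        by (intro mult_right_mono k) auto
      also have "\<dots> \<le> ?q s x y * ?us s y"
        using cutoff_commutator_pointwise[OF L, of "c y" t "c x" s B] by (intro mult_right_mono) (auto simp: mult_ac)
      finally show "near L (c y - s) * (ennreal \<bar>k x y\<bar> * (ennreal \<bar>cutoff L (c y - t) - cutoff L (c x - t)\<bar> * ennreal \<bar>u y\<bar>))
        \<le> ?q s x y * ?us s y" .
    qed
    also have "\<dots> = gsum (\<lambda>s. \<integral>\<^sup>+y. ?q s x y * ?us s y \<partial>M)"
      by (rule nn_integral_count_space_nn_integral) auto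
    finally have "ennreal (1 / ?b) * (ennreal ?b * ?R x) \<le> ennreal (1 / ?b) * gsum (\<lambda>s. \<integral>\<^sup>+y. ?q s x y * ?us s y \<partial>M)"
      by (rule mult_left_mono) simp
    then show ?thesis using b by (simp add: mult.assoc[symmetric] flip: ennreal_mult)
  qed
  have "luxemburg M \<phi> ?R \<le> luxemburg M \<phi> (\<lambda>x. ennreal (1 / ?b) * gsum (\<lambda>s. \<integral>\<^sup>+y. ?q s x y * ?us s y \<partial>M))"
    by (intro luxemburg_mono_AE[OF young] AE_I2 R_le)
  also have "\<dots> \<le> ennreal (1 / ?b) * luxemburg M \<phi> (\<lambda>x. gsum (\<lambda>s. \<integral>\<^sup>+y. ?q s x y * ?us s y \<partial>M))"
    using b by (intro luxemburg_cmult[OF young]) auto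
  also have "\<dots> \<le> ennreal (1 / ?b) * gsum (\<lambda>s. luxemburg M \<phi> (\<lambda>x. \<integral>\<^sup>+y. ?q s x y * ?us s y \<partial>M))"
    by (intro mult_left_mono luxemburg_sum[OF young]) auto
  also have "\<dots> \<le> ennreal (1 / ?b) * gsum (\<lambda>s. ennreal \<kappa> * gsum (commutator_weight B L (t - s)) * nrm (\<lambda>x. cutoff L (c x - s) * u x))"
    unfolding nrm_def
  proof (intro mult_left_mono nn_integral_mono luxemburg_schur_test_ennreal[OF sigma_finite_measure_axioms young])
    fix s
    show "ennreal \<kappa> * gsum (commutator_weight B L (t - s)) < \<infinity>"
      using Wfin[of "t - s"] by (simp add: ennreal_mult_less_top)
    show "luxemburg M \<phi> (\<lambda>x. ennreal \<bar>cutoff L (c x - s) * u x\<bar>) < \<infinity>"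
      using us_le[of s] u unfolding nrm_def by (rule le_less_trans)
    show "(\<integral>\<^sup>+y. ?q s x y \<partial>M) \<le> ennreal \<kappa> * gsum (commutator_weight B L (t - s))" for x
      by (rule nn_integral_cell_conv_le)
    show "(\<integral>\<^sup>+x. ?q s x y \<partial>M) \<le> ennreal \<kappa> * gsum (commutator_weight B L (t - s))" for y
      by (rule nn_integral_cell_conv_le)
  qed auto
  also have "\<dots> = conv (\<lambda>g. ennreal (\<kappa> / ball_card L) * gsum (commutator_weight B L g))
         (\<lambda>s. nrm (\<lambda>x. cutoff L (c x - s) * u x)) t"
    unfolding conv_def using b \<kappa>
    by (subst nn_integral_cmult[symmetric]) (auto intro!: nn_integral_cong simp: mult.assoc[symmetric] ennreal_mult[symmetric])
  finally show ?thesis .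
qed

text \<open>The stability estimate applied to the function cut off at \<open>t\<close> bounds the localized norms
  \<open>a t\<close> of \<open>u\<close> by those of \<open>S k u\<close> plus a commutator, which is a convolution of the
  numbers \<open>a t\<close> with a sequence of total mass at most one half. Iterating removes
  the commutator, and stability holds locally up to a summable convolution.\<close>

lemma localized_stability:
  assumes km[measurable]: "case_prod k \<in> borel_measurable (M \<Otimes>\<^sub>M M)"
    and k: "\<And>x y. ennreal \<bar>k x y\<bar> \<le> B (c x - c y)" and B: "gsum B < \<infinity>"
    and C: "C > 0" and st: "\<And>u. u \<in> Lg \<Longrightarrow> nrm u \<le> ennreal C * nrm (S k u)"
  obtains L w where "L > 0" "gsum w < \<infinity>"
    "\<And>u t. u \<in> Lg \<Longrightarrow> nrm (\<lambda>x. cutoff L (c x - t) * u x)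
        \<le> conv w (\<lambda>s. nrm (\<lambda>x. cutoff L (c x - s) * S k u x)) t"
proof -
  \<comment> \<open>small enough that the commutator weights, whose sum carries the factors \<open>2\<close>, \<open>D\<close>, \<open>\<kappa>\<close> and \<open>C\<close>, have total mass at most one half; \<open>D + 1\<close> replaces \<open>D\<close> to avoid a division by 0\<close>
  define \<delta> where "\<delta> = 1 / (4 * C * \<kappa> * (D + 1))"
  have \<delta>: "\<delta> > 0" using C \<kappa> by (simp add: \<delta>_def add_nonneg_pos)
  obtain L where L: "L > 0" and small: "gsum (\<lambda>d. B d * ennreal (min 1 (real (len d) / real L))) \<le> ennreal \<delta>"
    using commutator_sum_small[OF B \<delta>] by blast
  let ?b = "ball_card L"
  note b = ball_card_pos[of L]
  define e where "e g = ennreal C * (ennreal (\<kappa> / ?b) * gsum (commutator_weight B L g))" for g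
  have e_sum: "gsum e \<le> ennreal (1/2)"
  proof -
    have b3: "ball_card (3 * L) \<le> D * ?b"
      using doubling[of L] unfolding ball_card_def by (metis of_nat_le_iff of_nat_mult)
    have "gsum e = ennreal C * (ennreal (\<kappa> / ?b) * gsum (\<lambda>g. gsum (commutator_weight B L g)))"
      unfolding e_def by (simp add: nn_integral_cmult)
    also have "\<dots> \<le> ennreal C * (ennreal (\<kappa> / ?b) * (2 * ennreal (D * ?b) * ennreal \<delta>))"
      unfolding gsum_commutator_weight by (intro mult_left_mono mult_mono small ennreal_leI b3) auto
    also have "\<dots> = ennreal (C * (\<kappa> / ?b * (2 * (D * ?b) * \<delta>)))"
    proof -
      have 2: "(2::ennreal) = ennreal 2" by simp
      have nn: "0 \<le> D * ?b" "0 \<le> 2 * (D * ?b)" "0 \<le> 2 * (D * ?b) * \<delta>" "0 \<le> \<kappa> / ?b" "0 \<le> C" "0 \<le> \<delta>"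
          "0 \<le> \<kappa> / ?b * (2 * (D * ?b) * \<delta>)"
        using C \<kappa> b \<delta> by auto
      show ?thesis unfolding 2 using nn by (simp only: ennreal_mult[symmetric] zero_le_numeral)
    qed
    also have "C * (\<kappa> / ?b * (2 * (D * ?b) * \<delta>)) = (D / (D + 1)) / 2"
    proof -
      have "C * (\<kappa> / ?b * (2 * (D * ?b) * \<delta>)) = 2 * D * (C * \<kappa> * \<delta>)" using b by simp
      also have "C * \<kappa> * \<delta> = 1 / (4 * (D + 1))" using C \<kappa> by (simp add: \<delta>_def)
      also have "2 * D * (1 / (4 * (D + 1))) = (D / (D + 1)) / 2" by (simp add: field_simps)
      finally show ?thesis .
    qed
    also have "ennreal ((D / (D + 1)) / 2) \<le> ennreal (1/2)"
      by (intro ennreal_leI) (simp add: field_simps)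
    finally show ?thesis .
  qed
  define w where "w g = ennreal C * (\<Sum>n. convpow e n g)" for g
  obtain b0 where b0: "gsum B \<le> ennreal b0" "b0 > 0"
    using B by (metis add.commute add_pos_nonneg ennreal_enn2real enn2real_nonneg ennreal_leI infinity_ennreal_def le_add_same_cancel1 less_eq_real_def zero_less_one)
  have sk: "schur M (\<kappa> * b0) k" by (rule cell_schur[OF km k b0])
  show ?thesis
  proof (rule that[OF L])
    have "gsum w \<le> ennreal C * 2"
      unfolding w_def using conv_inequality_iterate(2)[of "\<lambda>_. 0" "\<lambda>_. 0" e 0, OF _ _ e_sum]
      by (simp add: nn_integral_cmult mult_left_mono)
    also have "\<dots> < \<infinity>" by (simp add: ennreal_mult_less_top)
    finally show "gsum w < \<infinity>" .
    fix u t assume u: "u \<in> Lg"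
    note [measurable] = LgD(1)[OF u] schurD(1)[OF sk]
    have Sm[measurable]: "S k u \<in> borel_measurable M" using LgD(1)[OF S_Lg[OF sk u]] .
    let ?a = "\<lambda>t. nrm (\<lambda>x. cutoff L (c x - t) * u x)"
    let ?f = "\<lambda>t. nrm (\<lambda>x. cutoff L (c x - t) * S k u x)"
    have a_le: "?a s \<le> nrm u" for s
      by (intro nrm_mono AE_I2) (auto simp: abs_mult cutoff_bounds intro: mult_left_le_one_le)
    have uL: "(\<lambda>x. cutoff L (c x - s) * u x) \<in> Lg" for s
      by (rule Lg_mono[OF u]) (auto simp: abs_mult cutoff_bounds intro!: AE_I2 mult_left_le_one_le)
    have step: "?a s \<le> ennreal C * ?f s + conv e ?a s" for s
    proof -
      let ?R = "\<lambda>x. \<integral>\<^sup>+y. ennreal \<bar>k x y\<bar> * (ennreal \<bar>cutoff L (c y - s) - cutoff L (c x - s)\<bar> * ennreal \<bar>u y\<bar>) \<partial>M"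
      have "AE x in M. ennreal \<bar>S k (\<lambda>x. cutoff L (c x - s) * u x) x\<bar> \<le> ennreal \<bar>cutoff L (c x - s) * S k u x\<bar> + ?R x"
        using schur_AE_integrable[OF sk u] schur_AE_integrable[OF sk uL[of s]]
      proof eventually_elim
        case (elim x)
        have "S k (\<lambda>x. cutoff L (c x - s) * u x) x - cutoff L (c x - s) * S k u x
          = kop M k (\<lambda>y. cutoff L (c y - s) * u y) x - cutoff L (c x - s) * kop M k u x"
          by (simp add: S_def algebra_simps)
        also have "\<dots> = (\<integral>y. k x y * (cutoff L (c y - s) * u y) - cutoff L (c x - s) * (k x y * u y) \<partial>M)"
          using elim by (simp add: kop_def)
        also have "\<dots> = (\<integral>y. k x y * ((cutoff L (c y - s) - cutoff L (c x - s)) * u y) \<partial>M)"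
          by (simp add: algebra_simps)
        finally have "ennreal \<bar>S k (\<lambda>x. cutoff L (c x - s) * u x) x - cutoff L (c x - s) * S k u x\<bar> \<le> ?R x"
          using abs_integral_le_nn_integral[of M "\<lambda>y. k x y * ((cutoff L (c y - s) - cutoff L (c x - s)) * u y)"]
          by (simp add: abs_mult ennreal_mult)
        then have "ennreal \<bar>cutoff L (c x - s) * S k u x\<bar> + ennreal \<bar>S k (\<lambda>x. cutoff L (c x - s) * u x) x - cutoff L (c x - s) * S k u x\<bar>
            \<le> ennreal \<bar>cutoff L (c x - s) * S k u x\<bar> + ?R x" by (rule add_left_mono)
        then show ?case
          by (rule order_trans[rotated]) (simp flip: ennreal_plus)
      qed
      then have "nrm (S k (\<lambda>x. cutoff L (c x - s) * u x)) \<le> luxemburg M \<phi> (\<lambda>x. ennreal \<bar>cutoff L (c x - s) * S k u x\<bar> + ?R x)"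
        unfolding nrm_def by (rule luxemburg_mono_AE[OF young])
      also have "\<dots> \<le> ?f s + luxemburg M \<phi> ?R"
        unfolding nrm_def by (rule luxemburg_add[OF young]) measurable
      also have "\<dots> \<le> ?f s + conv (\<lambda>g. ennreal (\<kappa> / ball_card L) * gsum (commutator_weight B L g)) ?a s"
        by (intro add_left_mono cutoff_commutator_norm[OF km _ k B LgD(2)[OF u] L]) measurable
      finally have "ennreal C * nrm (S k (\<lambda>x. cutoff L (c x - s) * u x))
          \<le> ennreal C * (?f s + conv (\<lambda>g. ennreal (\<kappa> / ball_card L) * gsum (commutator_weight B L g)) ?a s)"
        by (rule mult_left_mono) simp
      from order_trans[OF st[OF uL] this] show ?thesis
        unfolding e_def conv_cmult_left by (simp add: distrib_left)
    qed
    obtain K where K: "nrm u = ennreal K" using LgD(2)[OF u] by (cases "nrm u") auto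
    have "?a t \<le> conv (\<lambda>g. \<Sum>n. convpow e n g) (\<lambda>t. ennreal C * ?f t) t"
      by (rule conv_inequality_iterate(1)[OF step _ e_sum]) (use a_le K in auto)
    then show "?a t \<le> conv w ?f t"
      unfolding w_def conv_cmult_left conv_cmult_right .
  qed
qed

text \<open>The norm disappears from the estimate. With \<open>f = S k u\<close> and \<open>g\<close> the image of \<open>u\<close> under the integral operator, \<open>u = f - g\<close> and
  \<open>S k g\<close> is the image of \<open>f\<close> under the integral operator. Localized stability is applied
  to \<open>g\<close> instead of \<open>u\<close>, because the image of \<open>f\<close> is bounded on each cell by integrals of \<open>f\<close> over
  cells, while the local norms of \<open>f\<close> itself are not controlled by such integrals. One more application of the
  operator turns cell integrals of \<open>g\<close> into pointwise values.\<close>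

lemma stable_imp_pointwise_bound:
  assumes km[measurable]: "case_prod k \<in> borel_measurable (M \<Otimes>\<^sub>M M)"
    and k: "\<And>x y. ennreal \<bar>k x y\<bar> \<le> B (c x - c y)" and B: "gsum B < \<infinity>"
    and C: "C > 0" and st: "\<And>u. u \<in> Lg \<Longrightarrow> nrm u \<le> ennreal C * nrm (S k u)"
  obtains V where "gsum V < \<infinity>"
    "\<And>u. u \<in> Lg \<Longrightarrow> AE x in M. ennreal \<bar>u x\<bar> \<le> ennreal \<bar>S k u x\<bar> + (\<integral>\<^sup>+y. V (c x - c y) * ennreal \<bar>S k u y\<bar> \<partial>M)"
proof -
  obtain L w where L: "L > 0" and w: "gsum w < \<infinity>" and loc: "\<And>u t. u \<in> Lg \<Longrightarrow> nrm (\<lambda>x. cutoff L (c x - t) * u x)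
        \<le> conv w (\<lambda>s. nrm (\<lambda>x. cutoff L (c x - s) * S k u x)) t"
    using localized_stability[OF km k B C st] by blast
  obtain b0 where b0: "gsum B \<le> ennreal b0" "b0 > 0"
    using B by (metis add.commute add_pos_nonneg ennreal_enn2real enn2real_nonneg ennreal_leI infinity_ennreal_def le_add_same_cancel1 less_eq_real_def zero_less_one)
  have sk: "schur M (\<kappa> * b0) k" by (rule cell_schur[OF km k b0])
  \<comment> \<open>the two factors \<open>\<kappa>\<close> come from passing between norms and integrals on cells\<close>
  define V where "V g = B g + ennreal (\<kappa> * \<kappa>) * conv B (conv w (conv (near (2 * L)) B)) g" for g
  show ?thesis
  proof (rule that)
    show "gsum V < \<infinity>"
      unfolding V_def using B w by (simp add: nn_integral_add nn_integral_cmult gsum_conv gsum_near ennreal_mult_less_top)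
    fix u assume u: "u \<in> Lg"
    define f where "f = S k u"
    define g where "g = kop M k u"
    have f: "f \<in> Lg" unfolding f_def by (rule S_Lg[OF sk u])
    have g: "g \<in> Lg" unfolding g_def by (rule kop_Lg[OF sk u])
    note [measurable] = LgD(1)[OF u] LgD(1)[OF f] LgD(1)[OF g]
    define F where "F j = (\<integral>\<^sup>+x. ennreal \<bar>f x\<bar> * indicator (c -` {j}) x \<partial>M)" for j
    define G where "G j = (\<integral>\<^sup>+x. ennreal \<bar>g x\<bar> * indicator (c -` {j}) x \<partial>M)" for j
    have kop_le: "ennreal \<bar>kop M k v x\<bar> \<le> conv B (\<lambda>j. \<integral>\<^sup>+x. ennreal \<bar>v x\<bar> * indicator (c -` {j}) x \<partial>M) (c x)"
      if [measurable]: "v \<in> borel_measurable M" for v x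
    proof -
      have "ennreal \<bar>kop M k v x\<bar> \<le> (\<integral>\<^sup>+y. ennreal \<bar>k x y * v y\<bar> \<partial>M)"
        unfolding kop_def by (rule abs_integral_le_nn_integral)
      also have "\<dots> \<le> (\<integral>\<^sup>+y. B (c x - c y) * ennreal \<bar>v y\<bar> \<partial>M)"
        using k by (intro nn_integral_mono) (auto simp: abs_mult ennreal_mult intro!: mult_right_mono)
      also have "\<dots> = conv B (\<lambda>j. \<integral>\<^sup>+x. ennreal \<bar>v x\<bar> * indicator (c -` {j}) x \<partial>M) (c x)"
        by (rule nn_integral_conv_cells) measurable
      finally show ?thesis .
    qed
    have Sg: "AE x in M. S k g x = kop M k f x"
    proof -
      have "AE x in M. kop M k (\<lambda>y. u y + g y) x = kop M k u x + kop M k g x"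
        by (rule kop_add_AE[OF sk u g])
      moreover have "(\<lambda>y. u y + g y) = f" by (simp add: f_def g_def S_def fun_eq_iff)
      ultimately show ?thesis by (auto simp: S_def g_def elim!: eventually_mono)
    qed
    have G_le: "G t \<le> ennreal \<kappa> * conv w (\<lambda>s. ennreal \<kappa> * conv (near (2 * L)) (conv B F) s) t" for t
    proof -
      have "G t = (\<integral>\<^sup>+x. ennreal \<bar>cutoff L (c x - t) * g x\<bar> * indicator (c -` {t}) x \<partial>M)"
        unfolding G_def using cutoff_eq_1[OF L, of 0] by (intro nn_integral_cong) (auto simp: indicator_def)
      also have "\<dots> \<le> ennreal \<kappa> * nrm (\<lambda>x. cutoff L (c x - t) * g x)"
        unfolding nrm_def by (rule nn_integral_set_le_luxemburg[OF young _ _ emeasure_cell \<kappa>]) auto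
      also have "\<dots> \<le> ennreal \<kappa> * conv w (\<lambda>s. nrm (\<lambda>x. cutoff L (c x - s) * S k g x)) t"
        by (intro mult_left_mono loc g) simp
      also have "\<dots> \<le> ennreal \<kappa> * conv w (\<lambda>s. ennreal \<kappa> * conv (near (2 * L)) (conv B F) s) t"
      proof (intro mult_left_mono conv_mono)
        fix s
        have "nrm (\<lambda>x. cutoff L (c x - s) * S k g x) \<le> luxemburg M \<phi> (\<lambda>x. near (2 * L) (c x - s) * conv B F (c x))"
          unfolding nrm_def
        proof (rule luxemburg_mono_AE[OF young])
          show "AE x in M. ennreal \<bar>cutoff L (c x - s) * S k g x\<bar> \<le> near (2 * L) (c x - s) * conv B F (c x)"
            using Sg
          proof eventually_elim
            case (elim x)
            have "ennreal \<bar>cutoff L (c x - s)\<bar> \<le> near (2 * L) (c x - s)"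
              using cutoff_eq_0[OF L, of "c x - s"] cutoff_bounds(3)[of L "c x - s"]
              by (auto simp: near_def indicator_def)
            then have "ennreal \<bar>cutoff L (c x - s)\<bar> * ennreal \<bar>kop M k f x\<bar> \<le> near (2 * L) (c x - s) * conv B F (c x)"
              unfolding F_def by (intro mult_mono kop_le) auto
            then show ?case using elim by (simp add: abs_mult ennreal_mult)
          qed
        qed
        also have "\<dots> \<le> ennreal \<kappa> * gsum (\<lambda>j. near (2 * L) (j - s) * conv B F j)"
          by (rule luxemburg_cell_fun_le)
        also have "\<dots> = ennreal \<kappa> * conv (near (2 * L)) (conv B F) s"
          unfolding conv_def[of "near (2 * L)"] by (simp add: near_swap[of _ s])
        finally show "nrm (\<lambda>x. cutoff L (c x - s) * S k g x) \<le> ennreal \<kappa> * conv (near (2 * L)) (conv B F) s" .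
      qed simp
      finally show ?thesis .
    qed
    have conv_V: "conv V F t = conv B F t + conv B (\<lambda>t. ennreal \<kappa> * conv w (\<lambda>s. ennreal \<kappa> * conv (near (2 * L)) (conv B F) s) t) t" for t
    proof -
      have assoc: "conv a (conv b d) = conv (conv a b) d" for a b d :: "'g \<Rightarrow> ennreal"
        by (rule ext) (rule conv_assoc)
      have "conv V F t = conv B F t + ennreal (\<kappa> * \<kappa>) * conv (conv B (conv w (conv (near (2 * L)) B))) F t"
        unfolding V_def conv_add_left conv_cmult_left ..
      also have "conv (conv B (conv w (conv (near (2 * L)) B))) F = conv B (conv w (conv (near (2 * L)) (conv B F)))"
        by (simp only: assoc)
      also have "ennreal (\<kappa> * \<kappa>) * conv B (conv w (conv (near (2 * L)) (conv B F))) t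
          = conv B (\<lambda>t. ennreal \<kappa> * conv w (\<lambda>s. ennreal \<kappa> * conv (near (2 * L)) (conv B F) s) t) t"
        unfolding conv_cmult_right using \<kappa> by (simp add: ennreal_mult mult.assoc)
      finally show ?thesis .
    qed
    have "AE x in M. ennreal \<bar>u x\<bar> \<le> ennreal \<bar>f x\<bar> + conv V F (c x)"
      using Sg
    proof eventually_elim
      case (elim x)
      have "u x = f x - g x" by (simp add: f_def g_def S_def)
      moreover have "g x = kop M k f x - kop M k g x" using elim by (simp add: S_def)
      ultimately have "\<bar>u x\<bar> \<le> \<bar>f x\<bar> + (\<bar>kop M k f x\<bar> + \<bar>kop M k g x\<bar>)" by simp
      then have "ennreal \<bar>u x\<bar> \<le> ennreal \<bar>f x\<bar> + (ennreal \<bar>kop M k f x\<bar> + ennreal \<bar>kop M k g x\<bar>)"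
        by (simp flip: ennreal_plus)
      also have "\<dots> \<le> ennreal \<bar>f x\<bar> + (conv B F (c x) + conv B G (c x))"
        unfolding F_def G_def by (intro add_mono kop_le order_refl) auto
      also have "\<dots> \<le> ennreal \<bar>f x\<bar> + conv V F (c x)"
        unfolding conv_V by (intro add_mono order_refl conv_mono G_le)
      finally show ?case .
    qed
    then show "AE x in M. ennreal \<bar>S k u x\<bar> + (\<integral>\<^sup>+y. V (c x - c y) * ennreal \<bar>S k u y\<bar> \<partial>M) \<ge> ennreal \<bar>u x\<bar>"
      unfolding f_def[symmetric] F_def using nn_integral_conv_cells[of "\<lambda>y. ennreal \<bar>f y\<bar>" V] by simp
  qed
qed

end

section \<open>Square-integral estimates\<close>

lemma young_square: "young (\<lambda>t::ennreal. t\<^sup>2)"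
proof -
  have "lp_phi 2 = (\<lambda>t. t\<^sup>2)"
  proof
    fix t :: ennreal
    show "lp_phi 2 t = t\<^sup>2"
    proof (cases t)
      case (real r)
      have "r powr 2 = r\<^sup>2" using real by (cases "r = 0") (auto simp: powr_numeral)
      then show ?thesis using real by (simp add: lp_phi_def ennreal_power)
    qed (simp add: lp_phi_def power2_eq_square)
  qed
  moreover have "young (lp_phi 2)" by (rule young_lp_phi) simp
  ultimately show ?thesis by simp
qed

lemma schur_test_square:
  fixes q :: "'m \<Rightarrow> 'm \<Rightarrow> ennreal"
  assumes "sigma_finite_measure M"
    and [measurable]: "case_prod q \<in> borel_measurable (M \<Otimes>\<^sub>M M)" "f \<in> borel_measurable M"
    and 1: "\<And>x. x \<in> space M \<Longrightarrow> (\<integral>\<^sup>+y. q x y \<partial>M) \<le> ennreal K" and 2: "\<And>y. y \<in> space M \<Longrightarrow> (\<integral>\<^sup>+x. q x y \<partial>M) \<le> ennreal K"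
    and K: "K > 0"
  shows "(\<integral>\<^sup>+x. (\<integral>\<^sup>+y. q x y * f y \<partial>M)\<^sup>2 \<partial>M) \<le> ennreal (K\<^sup>2) * (\<integral>\<^sup>+x. (f x)\<^sup>2 \<partial>M)"
proof -
  interpret sigma_finite_measure M by fact
  have scale: "(\<integral>\<^sup>+y. ennreal (1/K) * h y \<partial>M) \<le> 1"
    if [measurable]: "h \<in> borel_measurable M" and le: "(\<integral>\<^sup>+y. h y \<partial>M) \<le> ennreal K" for h
  proof -
    have "(\<integral>\<^sup>+y. ennreal (1/K) * h y \<partial>M) = ennreal (1/K) * (\<integral>\<^sup>+y. h y \<partial>M)" by (simp add: nn_integral_cmult)
    also have "\<dots> \<le> ennreal (1/K) * ennreal K" by (intro mult_left_mono le) simp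
    also have "\<dots> = 1" using K by (simp flip: ennreal_mult)
    finally show ?thesis .
  qed
  have "(\<integral>\<^sup>+x. (\<integral>\<^sup>+y. q x y * f y \<partial>M)\<^sup>2 \<partial>M)
      = (\<integral>\<^sup>+x. ennreal (K\<^sup>2) * (\<integral>\<^sup>+y. ennreal (1/K) * q x y * f y \<partial>M)\<^sup>2 \<partial>M)"
  proof (intro nn_integral_cong)
    fix x assume "x \<in> space M"
    then have "(\<integral>\<^sup>+y. ennreal (1/K) * q x y * f y \<partial>M) = ennreal (1/K) * (\<integral>\<^sup>+y. q x y * f y \<partial>M)"
      by (subst nn_integral_cmult[symmetric]) (auto simp: mult.assoc)
    then show "(\<integral>\<^sup>+y. q x y * f y \<partial>M)\<^sup>2 = ennreal (K\<^sup>2) * (\<integral>\<^sup>+y. ennreal (1/K) * q x y * f y \<partial>M)\<^sup>2"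
      using K by (simp add: power_mult_distrib ennreal_power mult.assoc[symmetric] ennreal_mult[symmetric] power_divide)
  qed
  also have "\<dots> = ennreal (K\<^sup>2) * (\<integral>\<^sup>+x. (\<integral>\<^sup>+y. ennreal (1/K) * q x y * f y \<partial>M)\<^sup>2 \<partial>M)"
    by (rule nn_integral_cmult) measurable
  also have "\<dots> \<le> ennreal (K\<^sup>2) * (\<integral>\<^sup>+x. (f x)\<^sup>2 \<partial>M)"
    by (intro mult_left_mono young_schur_test[OF assms(1) young_square]) (auto intro!: scale 1 2)
  finally show ?thesis .
qed

lemma ennreal_add_square_le: "(a + b)\<^sup>2 \<le> 2 * a\<^sup>2 + 2 * (b::ennreal)\<^sup>2"
proof (cases a; cases b)
  fix x y :: real assume "a = ennreal x" "0 \<le> x" "b = ennreal y" "0 \<le> y"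
  moreover have "(x + y)\<^sup>2 \<le> 2 * x\<^sup>2 + 2 * y\<^sup>2" using sum_squares_bound[of x y] by (simp add: power2_sum)
  ultimately have "ennreal ((x + y)\<^sup>2) \<le> ennreal (2 * x\<^sup>2) + ennreal (2 * y\<^sup>2)"
    by (simp flip: ennreal_plus)
  then show ?thesis
    using \<open>a = _\<close> \<open>b = _\<close> \<open>0 \<le> x\<close> \<open>0 \<le> y\<close> by (simp add: ennreal_mult ennreal_power[symmetric])
qed (auto simp: power2_eq_square ennreal_mult_top ennreal_top_mult)

context cell_space
begin

text \<open>Functions bounded by a summable function of the cell. They are bounded and integrable, so they belong to every space
  \<open>Lg\<close> and are square integrable; adjoints can be computed on them.\<close>

definition cdom :: "('m \<Rightarrow> real) \<Rightarrow> bool" where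
  "cdom v \<longleftrightarrow> v \<in> borel_measurable M \<and> (\<exists>H. (\<forall>x. ennreal \<bar>v x\<bar> \<le> H (c x)) \<and> gsum H < \<infinity>)"

definition kdom :: "('g \<Rightarrow> ennreal) \<Rightarrow> ('m \<Rightarrow> 'm \<Rightarrow> real) \<Rightarrow> bool" where
  "kdom B k \<longleftrightarrow> case_prod k \<in> borel_measurable (M \<Otimes>\<^sub>M M) \<and> (\<forall>x y. ennreal \<bar>k x y\<bar> \<le> B (c x - c y)) \<and> gsum B < \<infinity>"

lemma cdomI: "v \<in> borel_measurable M \<Longrightarrow> (\<And>x. ennreal \<bar>v x\<bar> \<le> H (c x)) \<Longrightarrow> gsum H < \<infinity> \<Longrightarrow> cdom v"
  unfolding cdom_def by blast

lemma kdomD: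
  assumes "kdom B k"
  shows "case_prod k \<in> borel_measurable (M \<Otimes>\<^sub>M M)" "ennreal \<bar>k x y\<bar> \<le> B (c x - c y)" "gsum B < \<infinity>"
  using assms by (auto simp: kdom_def)

lemma cdomD: "cdom v \<Longrightarrow> v \<in> borel_measurable M" by (simp add: cdom_def)

lemma kdom_schur:
  assumes "kdom B k"
  obtains K where "schur M K k"
proof -
  obtain b where "gsum B = ennreal b" "b \<ge> 0" using kdomD(3)[OF assms] by (cases "gsum B") auto
  then have "schur M (\<kappa> * (b + 1)) k"
    by (intro cell_schur[OF kdomD(1,2)[OF assms]]) auto
  then show ?thesis by (rule that)
qed

lemma kdom_transpose:
  assumes "kdom B k"
  shows "kdom (\<lambda>g. B (- g)) (\<lambda>x y. k y x)"
  using kdomD[OF assms] measurable_pair_swap[OF kdomD(1)[OF assms]] by (auto simp: kdom_def gsum_uminus split_beta')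

lemma kdom_column: "kdom B k \<Longrightarrow> cdom (\<lambda>x. k x y)"
  by (rule cdomI[of _ "\<lambda>g. B (g - c y)"]) (auto dest: kdomD simp: gsum_diff_right)

lemma cdom_Lg: assumes "cdom v" shows "v \<in> Lg"
proof -
  obtain H where H: "\<And>x. ennreal \<bar>v x\<bar> \<le> H (c x)" "gsum H < \<infinity>" using assms by (auto simp: cdom_def)
  have "nrm v \<le> luxemburg M \<phi> (\<lambda>x. H (c x))"
    unfolding nrm_def by (intro luxemburg_mono_AE[OF young] AE_I2 H)
  also have "\<dots> \<le> ennreal \<kappa> * gsum H" by (rule luxemburg_cell_fun_le)
  also have "\<dots> < \<infinity>" using H(2) by (simp add: ennreal_mult_less_top)
  finally show ?thesis using cdomD[OF assms] by (simp add: Lg_def)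
qed

lemma cdom_add:
  assumes "cdom v" "cdom w"
  shows "cdom (\<lambda>x. v x + w x)"
proof -
  obtain H H' where H: "\<And>x. ennreal \<bar>v x\<bar> \<le> H (c x)" "gsum H < \<infinity>" and H': "\<And>x. ennreal \<bar>w x\<bar> \<le> H' (c x)" "gsum H' < \<infinity>"
    using assms by (auto simp: cdom_def)
  have "ennreal \<bar>v x + w x\<bar> \<le> H (c x) + H' (c x)" for x
  proof -
    have "ennreal \<bar>v x + w x\<bar> \<le> ennreal \<bar>v x\<bar> + ennreal \<bar>w x\<bar>" by (simp flip: ennreal_plus)
    also have "\<dots> \<le> H (c x) + H' (c x)" by (intro add_mono H H')
    finally show ?thesis .
  qed
  then show ?thesis using cdomD[OF assms(1)] cdomD[OF assms(2)] H(2) H'(2)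
    by (intro cdomI[of _ "\<lambda>g. H g + H' g"]) (auto simp: nn_integral_add)
qed

lemma cdom_cmult:
  assumes "cdom v"
  shows "cdom (\<lambda>x. a * v x)"
proof -
  obtain H where H: "\<And>x. ennreal \<bar>v x\<bar> \<le> H (c x)" "gsum H < \<infinity>" using assms by (auto simp: cdom_def)
  show ?thesis
  proof (rule cdomI[of _ "\<lambda>g. ennreal \<bar>a\<bar> * H g"])
    show "(\<lambda>x. a * v x) \<in> borel_measurable M" using cdomD[OF assms] by simp
    show "ennreal \<bar>a * v x\<bar> \<le> ennreal \<bar>a\<bar> * H (c x)" for x
      using mult_left_mono[OF H(1), of "ennreal \<bar>a\<bar>" x] by (simp add: abs_mult ennreal_mult)
    show "gsum (\<lambda>g. ennreal \<bar>a\<bar> * H g) < \<infinity>"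
      using H(2) by (simp add: nn_integral_cmult ennreal_mult_less_top)
  qed
qed

lemma cdom_diff: "cdom v \<Longrightarrow> cdom w \<Longrightarrow> cdom (\<lambda>x. v x - w x)"
  using cdom_add[OF _ cdom_cmult[of w "-1"]] by simp

lemma cdom_nn_integral: assumes "cdom v" shows "(\<integral>\<^sup>+x. ennreal \<bar>v x\<bar> \<partial>M) < \<infinity>"
proof -
  obtain H where H: "\<And>x. ennreal \<bar>v x\<bar> \<le> H (c x)" "gsum H < \<infinity>" using assms by (auto simp: cdom_def)
  have "(\<integral>\<^sup>+x. ennreal \<bar>v x\<bar> \<partial>M) \<le> (\<integral>\<^sup>+x. H (c x) \<partial>M)" by (intro nn_integral_mono H)
  also have "\<dots> \<le> ennreal \<kappa> * gsum H" by (rule nn_integral_cell_fun_le)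
  also have "\<dots> < \<infinity>" using H(2) by (simp add: ennreal_mult_less_top)
  finally show ?thesis .
qed

lemma cdom_integrable: "cdom v \<Longrightarrow> integrable M v"
  using cdom_nn_integral[of v] by (intro integrableI_bounded) (auto dest: cdomD)

lemma cdom_bounded: assumes "cdom v" obtains b where "b \<ge> 0" "\<And>x. \<bar>v x\<bar> \<le> b"
proof -
  obtain H where H: "\<And>x. ennreal \<bar>v x\<bar> \<le> H (c x)" "gsum H < \<infinity>" using assms by (auto simp: cdom_def)
  obtain b where b: "gsum H = ennreal b" "b \<ge> 0" using H(2) by (cases "gsum H") auto
  have "ennreal \<bar>v x\<bar> \<le> ennreal b" for x using order_trans[OF H(1) le_gsum[of H]] b by simp
  then show ?thesis using b(2) by (intro that[of b]) (auto simp: ennreal_le_iff)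
qed

lemma cdom_mult: assumes "cdom v" "cdom w" shows "cdom (\<lambda>x. v x * w x)"
proof -
  obtain b where b: "b \<ge> 0" "\<And>x. \<bar>v x\<bar> \<le> b" using cdom_bounded[OF assms(1)] by blast
  obtain H where H: "\<And>x. ennreal \<bar>w x\<bar> \<le> H (c x)" "gsum H < \<infinity>" using assms(2) by (auto simp: cdom_def)
  have "ennreal \<bar>v x * w x\<bar> \<le> ennreal b * H (c x)" for x
    using b H(1)[of x] by (auto simp: abs_mult ennreal_mult intro!: mult_mono ennreal_leI)
  then show ?thesis using cdomD[OF assms(1)] cdomD[OF assms(2)] H(2)
    by (intro cdomI[of _ "\<lambda>g. ennreal b * H g"]) (auto simp: nn_integral_cmult ennreal_mult_less_top)
qed

lemma nn_integral_kernel_cdom: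
  assumes k: "kdom B k" and H: "\<And>x. ennreal \<bar>v x\<bar> \<le> H (c x)" "gsum H < \<infinity>"
  shows "(\<integral>\<^sup>+y. ennreal \<bar>k x y\<bar> * ennreal \<bar>v y\<bar> \<partial>M) \<le> ennreal \<kappa> * conv B H (c x)"
    "ennreal \<kappa> * conv B H (c x) < \<infinity>" "gsum (\<lambda>g. ennreal \<kappa> * conv B H g) < \<infinity>"
proof -
  have "(\<integral>\<^sup>+y. ennreal \<bar>k x y\<bar> * ennreal \<bar>v y\<bar> \<partial>M) \<le> (\<integral>\<^sup>+y. B (c x - c y) * H (c y) \<partial>M)"
    by (intro nn_integral_mono mult_mono kdomD(2)[OF k] H) auto
  also have "\<dots> \<le> ennreal \<kappa> * conv B H (c x)"
    unfolding conv_def by (rule nn_integral_cell_fun_le)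
  finally show "(\<integral>\<^sup>+y. ennreal \<bar>k x y\<bar> * ennreal \<bar>v y\<bar> \<partial>M) \<le> ennreal \<kappa> * conv B H (c x)" .
  show *: "gsum (\<lambda>g. ennreal \<kappa> * conv B H g) < \<infinity>"
    using H(2) kdomD(3)[OF k] by (simp add: nn_integral_cmult gsum_conv ennreal_mult_less_top)
  show "ennreal \<kappa> * conv B H (c x) < \<infinity>" by (rule le_less_trans[OF le_gsum *])
qed

lemma cdom_kernel_integrable:
  assumes k: "kdom B k" and v: "cdom v"
  shows "integrable M (\<lambda>y. k x y * v y)"
proof -
  obtain H where H: "\<And>x. ennreal \<bar>v x\<bar> \<le> H (c x)" "gsum H < \<infinity>" using v by (auto simp: cdom_def)
  show ?thesis
    by (rule schur_AE_integrable_iff[OF kdomD(1)[OF k] cdomD[OF v]])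
       (use nn_integral_kernel_cdom(1,2)[OF k H, of x] in \<open>auto intro: le_less_trans\<close>)
qed

lemma cdom_kop:
  assumes k: "kdom B k" and v: "cdom v"
  shows "cdom (kop M k v)"
proof -
  obtain H where H: "\<And>x. ennreal \<bar>v x\<bar> \<le> H (c x)" "gsum H < \<infinity>" using v by (auto simp: cdom_def)
  have "ennreal \<bar>kop M k v x\<bar> \<le> ennreal \<kappa> * conv B H (c x)" for x
    using abs_integral_le_nn_integral[of M "\<lambda>y. k x y * v y"] nn_integral_kernel_cdom(1)[OF k H, of x]
    by (simp add: kop_def abs_mult ennreal_mult)
  moreover have "kop M k v \<in> borel_measurable M"
    using kdomD(1)[OF k] cdomD[OF v] by measurable
  ultimately show ?thesis by (intro cdomI[OF _ _ nn_integral_kernel_cdom(3)[OF k H]])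
qed

lemma cdom_S: "kdom B k \<Longrightarrow> cdom v \<Longrightarrow> cdom (S k v)"
  unfolding S_def[abs_def] by (intro cdom_add cdom_kop)

lemma cdom_S_diff:
  assumes k: "kdom B k" and v: "cdom v" and w: "cdom w"
  shows "S k (\<lambda>y. v y - w y) x = S k v x - S k w x"
  using cdom_kernel_integrable[OF k v, of x] cdom_kernel_integrable[OF k w, of x]
  by (simp add: S_def kop_def right_diff_distrib)

lemma S_adjoint:
  assumes k: "kdom B k" and v: "cdom v" and w: "cdom w"
  shows "(\<integral>x. v x * S (\<lambda>x y. k y x) w x \<partial>M) = (\<integral>x. w x * S k v x \<partial>M)"
proof -
  let ?t = "\<lambda>x y. k y x"
  note kt = kdom_transpose[OF k]
  note [measurable] = kdomD(1)[OF k] kdomD(1)[OF kt] cdomD[OF v] cdomD[OF w]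
  obtain H where H: "\<And>x. ennreal \<bar>w x\<bar> \<le> H (c x)" "gsum H < \<infinity>" using w by (auto simp: cdom_def)
  let ?W = "\<lambda>g. ennreal \<kappa> * conv (\<lambda>g. B (- g)) H g"
  note W = nn_integral_kernel_cdom[OF kt H]
  obtain b where b: "b \<ge> 0" "\<And>x. \<bar>v x\<bar> \<le> b" using cdom_bounded[OF v] by blast
  have "(\<integral>\<^sup>+(x,y). ennreal \<bar>v x * (k y x * w y)\<bar> \<partial>(M \<Otimes>\<^sub>M M)) = (\<integral>\<^sup>+x. \<integral>\<^sup>+y. ennreal \<bar>v x * (k y x * w y)\<bar> \<partial>M \<partial>M)"
    using nn_integral_fst[of "\<lambda>(x,y). ennreal \<bar>v x * (k y x * w y)\<bar>" M] by simp
  also have "\<dots> = (\<integral>\<^sup>+x. ennreal \<bar>v x\<bar> * (\<integral>\<^sup>+y. ennreal \<bar>k y x\<bar> * ennreal \<bar>w y\<bar> \<partial>M) \<partial>M)"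
    by (intro nn_integral_cong) (simp add: nn_integral_cmult[symmetric] abs_mult ennreal_mult)
  also have "\<dots> \<le> (\<integral>\<^sup>+x. ennreal b * ?W (c x) \<partial>M)"
    by (intro nn_integral_mono mult_mono ennreal_leI b W) auto
  also have "\<dots> \<le> ennreal \<kappa> * gsum (\<lambda>g. ennreal b * ?W g)"
    by (rule nn_integral_cell_fun_le)
  also have "gsum (\<lambda>g. ennreal b * ?W g) = ennreal b * gsum ?W" by (rule nn_integral_cmult) simp
  finally have int: "integrable (M \<Otimes>\<^sub>M M) (\<lambda>(x,y). v x * (k y x * w y))"
    using W(3) by (intro integrableI_bounded) (auto simp: split_beta' ennreal_mult_less_top intro: le_less_trans)
  have vw: "integrable M (\<lambda>x. v x * w x)" by (intro cdom_integrable cdom_mult v w)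
  have i1: "integrable M (\<lambda>x. v x * kop M ?t w x)" by (intro cdom_integrable cdom_mult v cdom_kop[OF kt] w)
  have i2: "integrable M (\<lambda>x. w x * kop M k v x)" by (intro cdom_integrable cdom_mult v cdom_kop[OF k] w)
  have "(\<integral>x. v x * kop M ?t w x \<partial>M) = (\<integral>x. \<integral>y. v x * (k y x * w y) \<partial>M \<partial>M)"
    by (simp add: kop_def)
  also have "\<dots> = (\<integral>y. \<integral>x. v x * (k y x * w y) \<partial>M \<partial>M)"
    by (rule MM.Fubini_integral[OF int, symmetric])
  also have "\<dots> = (\<integral>y. w y * kop M k v y \<partial>M)"
    unfolding kop_def by (intro Bochner_Integration.integral_cong) (auto simp: mult_ac simp flip: integral_mult_right_zero)
  finally show ?thesis using vw i1 i2
    by (simp add: S_def distrib_left mult.commute)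
qed

lemma cdom_square_integral:
  assumes "cdom v"
  shows "ennreal (\<integral>x. (v x)\<^sup>2 \<partial>M) = (\<integral>\<^sup>+x. (ennreal \<bar>v x\<bar>)\<^sup>2 \<partial>M)" "integrable M (\<lambda>x. (v x)\<^sup>2)"
proof -
  show *: "integrable M (\<lambda>x. (v x)\<^sup>2)" using cdom_integrable[OF cdom_mult[OF assms assms]] by (simp add: power2_eq_square)
  have "(\<integral>\<^sup>+x. (ennreal \<bar>v x\<bar>)\<^sup>2 \<partial>M) = (\<integral>\<^sup>+x. ennreal ((v x)\<^sup>2) \<partial>M)"
    by (intro nn_integral_cong) (simp add: ennreal_power)
  then show "ennreal (\<integral>x. (v x)\<^sup>2 \<partial>M) = (\<integral>\<^sup>+x. (ennreal \<bar>v x\<bar>)\<^sup>2 \<partial>M)"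
    using * by (simp add: nn_integral_eq_integral)
qed

text \<open>A pointwise domination carries over to square integrals by the Schur test, whatever the norm
  from which the domination was derived.\<close>

lemma L2_bound_of_pointwise_bound:
  assumes q[measurable]: "case_prod q \<in> borel_measurable (M \<Otimes>\<^sub>M M)"
    and qK: "\<And>x. (\<integral>\<^sup>+y. q x y \<partial>M) \<le> ennreal K" "\<And>y. (\<integral>\<^sup>+x. q x y \<partial>M) \<le> ennreal K" "K > 0"
    and v: "cdom v" and w: "cdom w"
    and le: "AE x in M. ennreal \<bar>v x\<bar> \<le> ennreal \<bar>w x\<bar> + (\<integral>\<^sup>+y. q x y * ennreal \<bar>w y\<bar> \<partial>M)"
  shows "(\<integral>x. (v x)\<^sup>2 \<partial>M) \<le> 2 * (1 + K\<^sup>2) * (\<integral>x. (w x)\<^sup>2 \<partial>M)"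
proof -
  note [measurable] = cdomD[OF w] cdomD[OF v]
  have "ennreal (\<integral>x. (v x)\<^sup>2 \<partial>M) = (\<integral>\<^sup>+x. (ennreal \<bar>v x\<bar>)\<^sup>2 \<partial>M)" by (rule cdom_square_integral[OF v])
  also have "\<dots> \<le> (\<integral>\<^sup>+x. 2 * (ennreal \<bar>w x\<bar>)\<^sup>2 + 2 * (\<integral>\<^sup>+y. q x y * ennreal \<bar>w y\<bar> \<partial>M)\<^sup>2 \<partial>M)"
    using le by (intro nn_integral_mono_AE) (auto elim!: eventually_mono intro!: order_trans[OF power_mono ennreal_add_square_le])
  also have "\<dots> = 2 * (\<integral>\<^sup>+x. (ennreal \<bar>w x\<bar>)\<^sup>2 \<partial>M) + 2 * (\<integral>\<^sup>+x. (\<integral>\<^sup>+y. q x y * ennreal \<bar>w y\<bar> \<partial>M)\<^sup>2 \<partial>M)"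
    by (simp add: nn_integral_add nn_integral_cmult)
  also have "\<dots> \<le> 2 * (\<integral>\<^sup>+x. (ennreal \<bar>w x\<bar>)\<^sup>2 \<partial>M) + 2 * (ennreal (K\<^sup>2) * (\<integral>\<^sup>+x. (ennreal \<bar>w x\<bar>)\<^sup>2 \<partial>M))"
    using qK by (intro add_left_mono mult_left_mono schur_test_square[OF sigma_finite_measure_axioms]) auto
  also have "\<dots> = ennreal (2 * (1 + K\<^sup>2) * (\<integral>x. (w x)\<^sup>2 \<partial>M))"
  proof -
    have 2: "(2::ennreal) = ennreal 2" by simp
    have nn: "0 \<le> (\<integral>x. (w x)\<^sup>2 \<partial>M)" by simp
    show ?thesis unfolding cdom_square_integral(1)[OF w, symmetric] 2
      using nn by (simp add: ennreal_mult[symmetric] algebra_simps del: ennreal_numeral flip: ennreal_plus)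
  qed
  finally show ?thesis by (subst (asm) ennreal_le_iff) auto
qed

lemma S_L2_bound:
  assumes k: "kdom B k"
  obtains \<Lambda> where "\<Lambda> > 0" "\<And>w. cdom w \<Longrightarrow> (\<integral>x. (S k w x)\<^sup>2 \<partial>M) \<le> \<Lambda> * (\<integral>x. (w x)\<^sup>2 \<partial>M)"
proof -
  obtain K where K: "schur M K k" by (rule kdom_schur[OF k])
  note [measurable] = kdomD(1)[OF k]
  show ?thesis
  proof (rule that)
    show "2 * (1 + K\<^sup>2) > 0" by (simp add: add_pos_nonneg)
    fix w assume w: "cdom w"
    have "ennreal \<bar>S k w x\<bar> \<le> ennreal \<bar>w x\<bar> + (\<integral>\<^sup>+y. ennreal \<bar>k x y\<bar> * ennreal \<bar>w y\<bar> \<partial>M)" for x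
    proof -
      have "ennreal \<bar>S k w x\<bar> \<le> ennreal \<bar>w x\<bar> + ennreal \<bar>kop M k w x\<bar>" by (simp add: S_def flip: ennreal_plus)
      also have "ennreal \<bar>kop M k w x\<bar> \<le> (\<integral>\<^sup>+y. ennreal \<bar>k x y\<bar> * ennreal \<bar>w y\<bar> \<partial>M)"
        using abs_integral_le_nn_integral[of M "\<lambda>y. k x y * w y"] by (simp add: kop_def abs_mult ennreal_mult)
      finally show ?thesis by (simp add: add_left_mono)
    qed
    then show "(\<integral>x. (S k w x)\<^sup>2 \<partial>M) \<le> 2 * (1 + K\<^sup>2) * (\<integral>x. (w x)\<^sup>2 \<partial>M)"
      by (intro L2_bound_of_pointwise_bound[of "\<lambda>x y. ennreal \<bar>k x y\<bar>" K])
         (auto intro: schurD[OF K] cdom_S[OF k w] w)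
  qed
qed

text \<open>The pointwise bound gives a lower bound for \<open>S k\<close> in the square norm. Writing \<open>T\<close> for the adjoint of
  \<open>S k\<close>, the operator \<open>1 - \<alpha> T (S k)\<close> is then a contraction for \<open>\<alpha>\<close> the reciprocal of a bound for the square of the norm
  of \<open>T\<close>.\<close>

lemma richardson_contraction:
  assumes k: "kdom B k" and V: "gsum V < \<infinity>"
    and pw: "\<And>u. u \<in> Lg \<Longrightarrow> AE x in M. ennreal \<bar>u x\<bar> \<le> ennreal \<bar>S k u x\<bar> + (\<integral>\<^sup>+y. V (c x - c y) * ennreal \<bar>S k u y\<bar> \<partial>M)"
  obtains \<alpha> \<rho> :: real where "0 \<le> \<rho>" "\<rho> < 1"
    "\<And>e. cdom e \<Longrightarrow> (\<integral>x. (e x - \<alpha> * S (\<lambda>x y. k y x) (S k e) x)\<^sup>2 \<partial>M) \<le> \<rho> * (\<integral>x. (e x)\<^sup>2 \<partial>M)"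
proof -
  note kt = kdom_transpose[OF k]
  obtain \<Lambda> where \<Lambda>: "\<Lambda> > 0" "\<And>w. cdom w \<Longrightarrow> (\<integral>x. (S (\<lambda>x y. k y x) w x)\<^sup>2 \<partial>M) \<le> \<Lambda> * (\<integral>x. (w x)\<^sup>2 \<partial>M)"
    using S_L2_bound[OF kt] by blast
  obtain v where v: "gsum V = ennreal v" "v \<ge> 0" using V by (cases "gsum V") auto
  define K where "K = \<kappa> * (v + 1)"
  have K: "K > 0" using v \<kappa> by (simp add: K_def)
  have VK: "ennreal \<kappa> * gsum V \<le> ennreal K"
    using v \<kappa> by (simp add: K_def ennreal_mult[symmetric] mult_left_mono)
  define \<Theta> where "\<Theta> = 2 * (1 + K\<^sup>2)"
  have \<Theta>: "\<Theta> > 0" by (simp add: \<Theta>_def add_pos_nonneg)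
  have lower: "(\<integral>x. (e x)\<^sup>2 \<partial>M) \<le> \<Theta> * (\<integral>x. (S k e x)\<^sup>2 \<partial>M)" if e: "cdom e" for e
    unfolding \<Theta>_def
    by (rule L2_bound_of_pointwise_bound[of "\<lambda>x y. V (c x - c y)", OF _ _ _ K e cdom_S[OF k e] pw[OF cdom_Lg[OF e]]])
       (auto intro: order_trans[OF nn_integral_cell_conv_le(1) VK] order_trans[OF nn_integral_cell_conv_le(2) VK])
  define \<alpha> where "\<alpha> = 1 / \<Lambda>"
  \<comment> \<open>the maximum only serves to make \<open>\<rho>\<close> nonnegative when all functions vanish\<close>
  define \<rho> where "\<rho> = max 0 (1 - 1 / (\<Lambda> * \<Theta>))"
  show ?thesis
  proof (rule that[of \<rho> \<alpha>])
    show "0 \<le> \<rho>" "\<rho> < 1" using \<Lambda>(1) \<Theta> by (auto simp: \<rho>_def)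
    fix e assume e: "cdom e"
    let ?s = "S k e" and ?t = "S (\<lambda>x y. k y x) (S k e)"
    have s: "cdom ?s" by (rule cdom_S[OF k e])
    have t: "cdom ?t" by (rule cdom_S[OF kt s])
    have "(\<integral>x. (e x - \<alpha> * ?t x)\<^sup>2 \<partial>M) = (\<integral>x. (e x)\<^sup>2 - 2 * \<alpha> * (e x * ?t x) + \<alpha>\<^sup>2 * (?t x)\<^sup>2 \<partial>M)"
      by (intro Bochner_Integration.integral_cong) (auto simp: power2_eq_square algebra_simps)
    also have "\<dots> = (\<integral>x. (e x)\<^sup>2 \<partial>M) - 2 * \<alpha> * (\<integral>x. e x * ?t x \<partial>M) + \<alpha>\<^sup>2 * (\<integral>x. (?t x)\<^sup>2 \<partial>M)"
      using cdom_square_integral(2)[OF e] cdom_square_integral(2)[OF t] cdom_integrable[OF cdom_mult[OF e t]] by simp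
    also have "(\<integral>x. e x * ?t x \<partial>M) = (\<integral>x. (?s x)\<^sup>2 \<partial>M)"
      unfolding S_adjoint[OF k e s] by (simp add: power2_eq_square)
    also have "(\<integral>x. (e x)\<^sup>2 \<partial>M) - 2 * \<alpha> * (\<integral>x. (?s x)\<^sup>2 \<partial>M) + \<alpha>\<^sup>2 * (\<integral>x. (?t x)\<^sup>2 \<partial>M)
      \<le> (\<integral>x. (e x)\<^sup>2 \<partial>M) - 2 * \<alpha> * (\<integral>x. (?s x)\<^sup>2 \<partial>M) + \<alpha>\<^sup>2 * (\<Lambda> * (\<integral>x. (?s x)\<^sup>2 \<partial>M))"
      by (intro add_left_mono mult_left_mono \<Lambda>(2)[OF s]) simp
    also have "\<dots> = (\<integral>x. (e x)\<^sup>2 \<partial>M) - (1 / \<Lambda>) * (\<integral>x. (?s x)\<^sup>2 \<partial>M)"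
      using \<Lambda>(1) by (simp add: \<alpha>_def power2_eq_square field_simps)
    also have "\<dots> \<le> (\<integral>x. (e x)\<^sup>2 \<partial>M) - (1 / \<Lambda>) * ((1 / \<Theta>) * (\<integral>x. (e x)\<^sup>2 \<partial>M))"
      using lower[OF e] \<Theta> \<Lambda>(1) by (intro diff_left_mono mult_left_mono) (auto simp: field_simps)
    also have "\<dots> = (1 - 1 / (\<Lambda> * \<Theta>)) * (\<integral>x. (e x)\<^sup>2 \<partial>M)" by (simp add: algebra_simps)
    also have "\<dots> \<le> \<rho> * (\<integral>x. (e x)\<^sup>2 \<partial>M)" by (intro mult_right_mono) (auto simp: \<rho>_def)
    finally show "(\<integral>x. (e x - \<alpha> * ?t x)\<^sup>2 \<partial>M) \<le> \<rho> * (\<integral>x. (e x)\<^sup>2 \<partial>M)" .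
  qed
qed

end

section \<open>A jointly measurable kernel for the inverse\<close>

context cell_space
begin

text \<open>Richardson iteration for the columns of the inverse, that is for the equations
  \<open>S k (r(., y)) = k(., y)\<close>. Solutions chosen separately for each \<open>y\<close> need not be measurable in
  both arguments; the iterates are, since they are built from \<open>k\<close> by integration.\<close>

primrec richardson :: "real \<Rightarrow> ('m \<Rightarrow> 'm \<Rightarrow> real) \<Rightarrow> nat \<Rightarrow> 'm \<Rightarrow> 'm \<Rightarrow> real" where
  "richardson \<alpha> k 0 = (\<lambda>x y. 0)"
| "richardson \<alpha> k (Suc n) = (\<lambda>x y. richardson \<alpha> k n x y
      + \<alpha> * S (\<lambda>x y. k y x) (\<lambda>z. k z y - S k (\<lambda>w. richardson \<alpha> k n w y) z) x)"

lemma S_column_measurable: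
  assumes [measurable]: "case_prod k \<in> borel_measurable (M \<Otimes>\<^sub>M M)" "case_prod l \<in> borel_measurable (M \<Otimes>\<^sub>M M)"
  shows "(\<lambda>(x, y). S k (\<lambda>z. l z y) x) \<in> borel_measurable (M \<Otimes>\<^sub>M M)"
proof -
  have "(\<lambda>(x, y). S k (\<lambda>z. l z y) x) = (\<lambda>(x, y). l x y + kcomp M k l x y)"
    by (simp add: S_def kcomp_eq_kop fun_eq_iff)
  then show ?thesis by simp
qed

lemma richardson_measurable[measurable]:
  assumes km[measurable]: "case_prod k \<in> borel_measurable (M \<Otimes>\<^sub>M M)"
  shows "case_prod (richardson \<alpha> k n) \<in> borel_measurable (M \<Otimes>\<^sub>M M)"
proof (induction n)
  case (Suc n)
  note [measurable] = Suc
  have kt[measurable]: "case_prod (\<lambda>x y. k y x) \<in> borel_measurable (M \<Otimes>\<^sub>M M)"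
    using measurable_pair_swap[OF km] by (simp add: split_beta')
  note [measurable] = S_column_measurable[OF km Suc]
  have "(\<lambda>(x, y). k x y - S k (\<lambda>w. richardson \<alpha> k n w y) x) \<in> borel_measurable (M \<Otimes>\<^sub>M M)" by measurable
  note [measurable] = S_column_measurable[OF kt this]
  show ?case unfolding richardson.simps by measurable
qed simp

lemma richardson_cdom:
  assumes k: "kdom B k"
  shows "cdom (\<lambda>x. richardson \<alpha> k n x y)"
proof (induction n)
  case 0
  show ?case by (simp, rule cdomI[of _ "\<lambda>_. 0"]) auto
next
  case (Suc n)
  show ?case unfolding richardson.simps
    by (intro cdom_add cdom_cmult cdom_S[OF kdom_transpose[OF k]] cdom_diff cdom_S[OF k] kdom_column[OF k] Suc)
qed

text \<open>The square integrals are summable, so the series of squares converges almost everywhere.\<close>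

lemma AE_tendsto_zero_of_geometric:
  fixes e :: "nat \<Rightarrow> 'm \<Rightarrow> real"
  assumes e: "\<And>n. cdom (e n)" and \<rho>: "0 \<le> \<rho>" "\<rho> < 1"
    and le: "\<And>n. (\<integral>x. (e n x)\<^sup>2 \<partial>M) \<le> \<rho> ^ n * Z"
  shows "AE x in M. (\<lambda>n. e n x) \<longlonglongrightarrow> 0"
proof -
  note [measurable] = cdomD[OF e]
  have "(\<integral>\<^sup>+x. (\<Sum>n. (ennreal \<bar>e n x\<bar>)\<^sup>2) \<partial>M) = (\<Sum>n. \<integral>\<^sup>+x. (ennreal \<bar>e n x\<bar>)\<^sup>2 \<partial>M)"
    by (rule nn_integral_suminf) measurable
  also have "\<dots> = (\<Sum>n. ennreal (\<integral>x. (e n x)\<^sup>2 \<partial>M))" by (simp add: cdom_square_integral(1)[OF e])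
  also have "\<dots> \<le> (\<Sum>n. ennreal (\<rho> ^ n * max 0 Z))"
    using \<rho> by (intro suminf_le ennreal_leI order_trans[OF le] mult_left_mono) auto
  also have "\<dots> = ennreal (1 / (1 - \<rho>) * max 0 Z)"
    using \<rho> by (intro suminf_ennreal_eq sums_mult2 geometric_sums) auto
  finally have "(\<integral>\<^sup>+x. (\<Sum>n. (ennreal \<bar>e n x\<bar>)\<^sup>2) \<partial>M) \<noteq> \<infinity>" by (auto simp: top_unique)
  then have "AE x in M. (\<Sum>n. (ennreal \<bar>e n x\<bar>)\<^sup>2) \<noteq> \<infinity>" by (intro nn_integral_PInf_AE) measurable
  then show ?thesis
  proof eventually_elim
    case (elim x)
    then have "summable (\<lambda>n. (e n x)\<^sup>2)"
      by (intro summable_suminf_not_top) (auto simp: ennreal_power)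
    then have "(\<lambda>n. (e n x)\<^sup>2) \<longlonglongrightarrow> 0" by (rule summable_LIMSEQ_zero)
    then have "(\<lambda>n. sqrt ((e n x)\<^sup>2)) \<longlonglongrightarrow> sqrt 0" by (rule tendsto_real_sqrt)
    then show ?case by (simp add: tendsto_rabs_zero_iff)
  qed
qed

text \<open>For each \<open>y\<close> the column \<open>k(., y)\<close> has a preimage under \<open>S k\<close>, which by the
  pointwise bound decays like a summable function of the cells. Hence it is square
  integrable, and Richardson iteration converges to it.\<close>

proposition stable_cell_kernel_inverse:
  assumes k: "kdom B k" and C: "C > 0"
    and st: "\<And>u. u \<in> Lg \<Longrightarrow> nrm u \<le> ennreal C * nrm (S k u)"
    and solv: "\<And>f. f \<in> Lg \<Longrightarrow> \<exists>u\<in>Lg. AE x in M. S k u x = f x"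
  obtains B' m where "kdom B' m" "AE x in M. AE y in M. k x y + m x y + kcomp M k m x y = 0"
proof -
  note km[measurable] = kdomD(1)[OF k]
  note kt = kdom_transpose[OF k]
  obtain K where sk: "schur M K k" by (rule kdom_schur[OF k])
  obtain K' where skt: "schur M K' (\<lambda>x y. k y x)" by (rule kdom_schur[OF kt])
  obtain V where V: "gsum V < \<infinity>" and pw: "\<And>u. u \<in> Lg \<Longrightarrow> AE x in M. ennreal \<bar>u x\<bar> \<le> ennreal \<bar>S k u x\<bar> + (\<integral>\<^sup>+y. V (c x - c y) * ennreal \<bar>S k u y\<bar> \<partial>M)"
    by (rule stable_imp_pointwise_bound[OF kdomD[OF k] C st]) (simp, rule that)
  obtain \<alpha> \<rho> :: real where \<rho>: "0 \<le> \<rho>" "\<rho> < 1" and contr: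
    "\<And>e. cdom e \<Longrightarrow> (\<integral>x. (e x - \<alpha> * S (\<lambda>x y. k y x) (S k e) x)\<^sup>2 \<partial>M) \<le> \<rho> * (\<integral>x. (e x)\<^sup>2 \<partial>M)"
    by (rule richardson_contraction[OF k V pw]) (simp, rule that)
  define B' where "B' g = B g + ennreal \<kappa> * conv V B g" for g
  have B': "gsum B' < \<infinity>"
    unfolding B'_def using V kdomD(3)[OF k] by (simp add: nn_integral_add nn_integral_cmult gsum_conv ennreal_mult_less_top)
  let ?r = "richardson \<alpha> k"
  \<comment> \<open>where the iteration does not converge, \<open>lim\<close> is an unspecified value, which the bound makes harmless\<close>
  define r where "r x y = (if ennreal \<bar>lim (\<lambda>n. ?r n x y)\<bar> \<le> B' (c x - c y) then lim (\<lambda>n. ?r n x y) else 0)" for x y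
  have [measurable]: "(\<lambda>(x, y). lim (\<lambda>n. ?r n x y)) \<in> borel_measurable (M \<Otimes>\<^sub>M M)"
    unfolding split_beta' by (rule borel_measurable_lim_metric) (use richardson_measurable[OF km] in \<open>simp add: split_beta'\<close>)
  have rm[measurable]: "case_prod r \<in> borel_measurable (M \<Otimes>\<^sub>M M)"
    unfolding r_def by measurable
  have rk: "kdom B' r" using B' rm unfolding kdom_def by (auto simp: r_def)
  have col: "AE x in M. r x y + kop M k (\<lambda>z. r z y) x = k x y" for y
  proof -
    note ky = kdom_column[OF k, of y]
    obtain u0 where u0: "u0 \<in> Lg" "AE x in M. S k u0 x = k x y" using solv[OF cdom_Lg[OF ky]] by blast
    have bound: "AE x in M. ennreal \<bar>u0 x\<bar> \<le> B' (c x - c y)"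
      using pw[OF u0(1)] u0(2)
    proof eventually_elim
      case (elim x)
      have "(\<integral>\<^sup>+z. V (c x - c z) * ennreal \<bar>S k u0 z\<bar> \<partial>M) = (\<integral>\<^sup>+z. V (c x - c z) * ennreal \<bar>k z y\<bar> \<partial>M)"
        using u0(2) by (intro nn_integral_cong_AE) (auto elim!: eventually_mono)
      also have "\<dots> \<le> (\<integral>\<^sup>+z. V (c x - c z) * B (c z - c y) \<partial>M)"
        by (intro nn_integral_mono mult_left_mono kdomD(2)[OF k]) simp
      also have "\<dots> \<le> ennreal \<kappa> * gsum (\<lambda>j. V (c x - j) * B (j - c y))"
        by (rule nn_integral_cell_fun_le)
      also have "gsum (\<lambda>j. V (c x - j) * B (j - c y)) = conv V B (c x - c y)"
        unfolding conv_def using gsum_diff_right[of "\<lambda>s. V (c x - c y - s) * B s" "c y"] by (simp add: algebra_simps)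
      finally have "ennreal \<bar>u0 x\<bar> \<le> ennreal \<bar>S k u0 x\<bar> + ennreal \<kappa> * conv V B (c x - c y)"
        using elim(1) by (meson add_left_mono order_trans)
      also have "\<dots> \<le> B' (c x - c y)"
        unfolding B'_def elim(2) by (intro add_right_mono kdomD(2)[OF k])
      finally show ?case .
    qed
    \<comment> \<open>the bound holds only almost everywhere for \<open>u0\<close>, while \<open>cdom\<close> asks for it everywhere\<close>
    define u where "u x = (if ennreal \<bar>u0 x\<bar> \<le> B' (c x - c y) then u0 x else 0)" for x
    have [measurable]: "u0 \<in> borel_measurable M" by (rule LgD[OF u0(1)])
    define F where "F x = B' (c x - c y)" for x
    have F[measurable]: "F \<in> borel_measurable M"
      unfolding F_def[abs_def] by (rule measurable_cell_fun[of "\<lambda>g. B' (g - c y)"])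
    have "u = (\<lambda>x. if ennreal \<bar>u0 x\<bar> \<le> F x then u0 x else 0)" by (simp add: u_def F_def fun_eq_iff)
    also have "\<dots> \<in> borel_measurable M" by measurable
    finally have [measurable]: "u \<in> borel_measurable M" .
    have u: "cdom u"
      by (rule cdomI[of _ "\<lambda>g. B' (g - c y)"]) (use B' in \<open>auto simp: u_def gsum_diff_right\<close>)
    note [measurable] = cdomD[OF u]
    have uu0: "AE x in M. u x = u0 x" using bound by eventually_elim (simp add: u_def)
    have Su: "AE x in M. S k u x = k x y"
    proof -
      have "AE x in M. S k u x = S k u0 x" by (rule S_cong_AE[OF sk _ _ uu0]) measurable
      then show ?thesis using u0(2) by eventually_elim simp
    qed
    define e where "e n x = u x - ?r n x y" for n x
    have e: "cdom (e n)" for n unfolding e_def[abs_def] by (intro cdom_diff u richardson_cdom[OF k])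
    have step: "AE x in M. e (Suc n) x = e n x - \<alpha> * S (\<lambda>x y. k y x) (S k (e n)) x" for n
    proof -
      note rn = richardson_cdom[OF k, of \<alpha> n y]
      have "AE z in M. k z y - S k (\<lambda>w. ?r n w y) z = S k (e n) z"
        using Su by eventually_elim (simp add: e_def[abs_def] cdom_S_diff[OF k u rn])
      then have "AE x in M. S (\<lambda>x y. k y x) (\<lambda>z. k z y - S k (\<lambda>w. ?r n w y) z) x = S (\<lambda>x y. k y x) (S k (e n)) x"
        by (rule S_cong_AE[OF skt cdomD[OF cdom_diff[OF ky cdom_S[OF k rn]]] cdomD[OF cdom_S[OF k e]]])
      then show ?thesis by eventually_elim (simp add: e_def)
    qed
    have "(\<integral>x. (e n x)\<^sup>2 \<partial>M) \<le> \<rho> ^ n * (\<integral>x. (e 0 x)\<^sup>2 \<partial>M)" for n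
    proof (induction n)
      case (Suc n)
      note [measurable] = cdomD[OF e] cdomD[OF cdom_S[OF kt cdom_S[OF k e]]]
      have "(\<integral>x. (e (Suc n) x)\<^sup>2 \<partial>M) = (\<integral>x. (e n x - \<alpha> * S (\<lambda>x y. k y x) (S k (e n)) x)\<^sup>2 \<partial>M)"
        using step[of n] by (intro integral_cong_AE) (auto elim!: eventually_mono)
      also have "\<dots> \<le> \<rho> * (\<integral>x. (e n x)\<^sup>2 \<partial>M)" by (rule contr[OF e])
      also have "\<dots> \<le> \<rho> * (\<rho> ^ n * (\<integral>x. (e 0 x)\<^sup>2 \<partial>M))" by (intro mult_left_mono Suc \<rho>)
      finally show ?case by (simp add: mult.assoc)
    qed simp
    from AE_tendsto_zero_of_geometric[OF e \<rho> this]
    have lim: "AE x in M. r x y = u x" using bound uu0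
    proof eventually_elim
      case (elim x)
      have "(\<lambda>n. u x - e n x) \<longlonglongrightarrow> u x - 0" by (intro tendsto_diff tendsto_const elim(1))
      then have "lim (\<lambda>n. ?r n x y) = u x" by (simp add: e_def limI)
      then show ?case using elim(2,3) by (simp add: r_def)
    qed
    have "AE x in M. S k (\<lambda>z. r z y) x = S k u x"
      by (rule S_cong_AE[OF sk _ _ lim]) (auto intro: cdomD kdom_column[OF rk])
    then show ?thesis using Su by eventually_elim (simp add: S_def)
  qed
  define m where "m x y = - r x y" for x y
  show ?thesis
  proof (rule that)
    show mk: "kdom B' m" using rk rm unfolding kdom_def m_def by (auto simp: split_beta')
    have [measurable]: "case_prod m \<in> borel_measurable (M \<Otimes>\<^sub>M M)" by (rule kdomD[OF mk])
    have "AE x in M. k x y + m x y + kcomp M k m x y = 0" for y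
      using col[of y] by eventually_elim (simp add: m_def kcomp_def kop_def)
    then have "AE y in M. AE x in M. k x y + m x y + kcomp M k m x y = 0" by simp
    then show "AE x in M. AE y in M. k x y + m x y + kcomp M k m x y = 0"
      by (subst MM.AE_commute) (auto simp: split_beta' pred_def)
  qed
qed

end

section \<open>Splitting off a small kernel\<close>

context luxemburg_space
begin

lemma S_add_AE:
  assumes "schur M K k" "u \<in> Lg" "v \<in> Lg"
  shows "AE x in M. S k (\<lambda>y. u y + v y) x = S k u x + S k v x"
  using kop_add_AE[OF assms] by eventually_elim (simp add: S_def)

lemma S_kernel_product:
  assumes k: "schur M K k" and l: "schur M K' l" and u: "u \<in> Lg"
  shows "AE x in M. S (\<lambda>x y. k x y + l x y + kcomp M k l x y) u x = S k (S l u) x"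
proof -
  note kl = schur_kcomp[OF k l space_UNIV] and a = schur_add[OF k l space_UNIV]
  have eq: "(\<lambda>y. u y + kop M l u y) = S l u" by (simp add: S_def fun_eq_iff)
  show ?thesis
    using kop_kernel_add_AE[OF a kl u] kop_kernel_add_AE[OF k l u] kop_kcomp_AE[OF k l u]
      kop_add_AE[OF k u kop_Lg[OF l u]]
    by eventually_elim (simp add: S_def eq)
qed

text \<open>With \<open>1 + P\<close> the inverse of \<open>1 + K\<^sub>e\<close>, the operator \<open>1 + K\<^sub>0 + K\<^sub>e\<close> factors as
  \<open>(1 + K\<^sub>e) (1 + K\<^sub>1)\<close> where \<open>K\<^sub>1 = (1 + P) K\<^sub>0\<close>.\<close>

lemma perturbed_kernel:
  assumes k0: "schur M K0 k0" and ke: "schur M (1/2) ke" and p: "schur M 1 p"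
    and p_inv: "\<And>x. AE y in M. ke x y + p x y + kcomp M ke p x y = 0"
    and k_def: "k = (\<lambda>x y. k0 x y + ke x y)" and k1_def: "k1 = (\<lambda>x y. k0 x y + kcomp M p k0 x y)"
  shows "schur M (K0 + K0) k1" "schur M (K0 + 1/2) k"
    "\<And>u. u \<in> Lg \<Longrightarrow> AE x in M. S ke (S p u) x = u x"
    "\<And>u. u \<in> Lg \<Longrightarrow> AE x in M. S ke (S k1 u) x = S k u x"
    "\<And>w. w \<in> Lg \<Longrightarrow> AE x in M. S ke w x = 0 \<Longrightarrow> AE x in M. w x = 0"
proof -
  note pk0 = schur_kcomp[OF p k0 space_UNIV]
  show k1: "schur M (K0 + K0) k1" unfolding k1_def using schur_add[OF k0 pk0 space_UNIV] by simp
  show k: "schur M (K0 + 1/2) k" unfolding k_def by (rule schur_add[OF k0 ke space_UNIV])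
  show right: "AE x in M. S ke (S p u) x = u x" if u: "u \<in> Lg" for u
    by (rule kop_right_inverse[OF ke p _ u]) (simp add: p_inv)
  show inj: "AE x in M. w x = 0" if "w \<in> Lg" "AE x in M. S ke w x = 0" for w
    by (rule S_inj_contraction[OF ke _ that]) simp
  fix u assume u: "u \<in> Lg"
  have left: "AE x in M. S p (S ke u) x = u x"
    by (rule left_inverse_of_right_inverse[OF ke p u inj right])
  have k0u: "kop M k0 u \<in> Lg" by (rule kop_Lg[OF k0 u])
  have Sk: "AE x in M. S k u x = S ke u x + kop M k0 u x"
    using kop_kernel_add_AE[OF k0 ke u] by eventually_elim (simp add: S_def k_def)
  have "AE x in M. S p (S k u) x = S p (\<lambda>y. S ke u y + kop M k0 u y) x"
    using LgD(1)[OF S_Lg[OF k u]] LgD(1)[OF Lg_add[OF S_Lg[OF ke u] k0u]] Sk by (rule S_cong_AE[OF p])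
  then have Spk: "AE x in M. S p (S k u) x = S k1 u x"
    using S_add_AE[OF p S_Lg[OF ke u] k0u] left kop_kernel_add_AE[OF k0 pk0 u] kop_kcomp_AE[OF p k0 u]
    by eventually_elim (simp add: S_def[of "\<lambda>x y. k0 x y + kcomp M p k0 x y"] S_def[of p "kop M k0 u"] k1_def)
  have "AE x in M. S ke (S k1 u) x = S ke (S p (S k u)) x"
    using LgD(1)[OF S_Lg[OF k1 u]] LgD(1)[OF S_Lg[OF p S_Lg[OF k u]]]
    by (rule S_cong_AE[OF ke]) (use Spk in \<open>auto elim!: eventually_mono\<close>)
  then show "AE x in M. S ke (S k1 u) x = S k u x"
    using right[OF S_Lg[OF k u]] by eventually_elim simp
qed

lemma perturbed_kernel_stable:
  assumes k0: "schur M K0 k0" and ke: "schur M (1/2) ke" and p: "schur M 1 p"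
    and p_inv: "\<And>x. AE y in M. ke x y + p x y + kcomp M ke p x y = 0"
    and k_def: "k = (\<lambda>x y. k0 x y + ke x y)" and k1_def: "k1 = (\<lambda>x y. k0 x y + kcomp M p k0 x y)"
    and C: "C > 0" and st: "\<And>u. u \<in> Lg \<Longrightarrow> nrm u \<le> ennreal C * nrm (S k u)"
    and u: "u \<in> Lg"
  shows "nrm u \<le> ennreal (C * (3/2)) * nrm (S k1 u)"
proof -
  note P = perturbed_kernel[OF k0 ke p p_inv k_def k1_def]
  have "nrm u \<le> ennreal C * nrm (S k u)" by (rule st[OF u])
  also have "nrm (S k u) \<le> nrm (S ke (S k1 u))"
    using P(4)[OF u] by (intro nrm_mono) (auto elim!: eventually_mono)
  also have "\<dots> \<le> ennreal (1 + 1/2) * nrm (S k1 u)"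
    by (rule nrm_S_le[OF ke S_Lg[OF P(1) u]])
  finally have "nrm u \<le> ennreal C * (ennreal (1 + 1/2) * nrm (S k1 u))" by (simp add: mult_left_mono)
  moreover have "ennreal (C * (3/2)) = ennreal C * ennreal (1 + 1/2)" using C by (subst ennreal_mult) auto
  ultimately show ?thesis by (simp only: mult.assoc)
qed

lemma perturbed_kernel_solvable:
  assumes k0: "schur M K0 k0" and ke: "schur M (1/2) ke" and p: "schur M 1 p"
    and p_inv: "\<And>x. AE y in M. ke x y + p x y + kcomp M ke p x y = 0"
    and k_def: "k = (\<lambda>x y. k0 x y + ke x y)" and k1_def: "k1 = (\<lambda>x y. k0 x y + kcomp M p k0 x y)"
    and solv: "\<And>f. f \<in> Lg \<Longrightarrow> \<exists>u\<in>Lg. AE x in M. S k u x = f x"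
    and f: "f \<in> Lg"
  shows "\<exists>u\<in>Lg. AE x in M. S k1 u x = f x"
proof -
  note P = perturbed_kernel[OF k0 ke p p_inv k_def k1_def]
  obtain u where u: "u \<in> Lg" "AE x in M. S k u x = S ke f x" using solv[OF S_Lg[OF ke f]] by blast
  have "AE x in M. S ke (S k1 u) x = S ke f x" using P(4)[OF u(1)] u(2) by eventually_elim simp
  from S_eq_imp_eq[OF ke S_Lg[OF P(1) u(1)] f P(5) this] u(1) show ?thesis by blast
qed

lemma perturbed_kernel_inverse:
  assumes k0: "schur M K0 k0" and ke: "schur M (1/2) ke" and p: "schur M 1 p"
    and p_inv: "\<And>x. AE y in M. ke x y + p x y + kcomp M ke p x y = 0"
    and k_def: "k = (\<lambda>x y. k0 x y + ke x y)" and k1_def: "k1 = (\<lambda>x y. k0 x y + kcomp M p k0 x y)"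
    and m1: "schur M K1 m1" and m1_inv: "AE x in M. AE y in M. k1 x y + m1 x y + kcomp M k1 m1 x y = 0"
    and f: "f \<in> Lg"
  shows "AE x in M. S k (S (\<lambda>x y. m1 x y + p x y + kcomp M m1 p x y) f) x = f x"
proof -
  note P = perturbed_kernel[OF k0 ke p p_inv k_def k1_def]
  let ?m = "\<lambda>x y. m1 x y + p x y + kcomp M m1 p x y"
  have m: "schur M (K1 + 1 + K1 * 1) ?m" by (intro schur_add schur_kcomp m1 p space_UNIV)
  have pf: "S p f \<in> Lg" by (rule S_Lg[OF p f])
  have mf: "S ?m f \<in> Lg" by (rule S_Lg[OF m f])
  have w: "S m1 (S p f) \<in> Lg" by (rule S_Lg[OF m1 pf])
  have "AE x in M. S k (S ?m f) x = S k (S m1 (S p f)) x"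
    by (rule S_cong_AE[OF P(2) LgD(1)[OF mf] LgD(1)[OF w] S_kernel_product[OF m1 p f]])
  moreover have "AE x in M. S ke (S k1 (S m1 (S p f))) x = S ke (S p f) x"
    by (rule S_cong_AE[OF ke LgD(1)[OF S_Lg[OF P(1) w]] LgD(1)[OF pf] kop_right_inverse[OF P(1) m1 m1_inv pf]])
  ultimately show ?thesis
    using P(4)[OF w] P(3)[OF f] by eventually_elim simp
qed

end

section \<open>Copies of Euclidean space\<close>

text \<open>Counting measure on the numbers below \<open>d\<close>. All natural numbers are allowed as indices, so that \<open>d\<close> can be a
  term and not a type.\<close>

definition idx :: "nat \<Rightarrow> nat measure" where
  "idx d = density (count_space UNIV) (indicator {..<d})"

text \<open>Functions on this space are \<open>d\<close>-tuples of functions on Euclidean space.\<close>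

definition LM :: "nat \<Rightarrow> ('a::euclidean_space \<times> nat) measure" where
  "LM d = lborel \<Otimes>\<^sub>M idx d"

lemma space_idx[simp]: "space (idx d) = UNIV" and sets_idx[simp, measurable_cong]: "sets (idx d) = sets (count_space UNIV)"
  by (auto simp: idx_def)

lemma nn_integral_idx: "(\<integral>\<^sup>+i. f i \<partial>idx d) = (\<Sum>i<d. f i)"
proof -
  have "(\<integral>\<^sup>+i. f i \<partial>idx d) = (\<integral>\<^sup>+i. f i * indicator {..<d} i \<partial>count_space UNIV)"
    unfolding idx_def by (subst nn_integral_density) (auto simp: mult.commute)
  also have "\<dots> = (\<Sum>i<d. f i)" by (subst nn_integral_indicator_finite) auto
  finally show ?thesis .
qed

lemma AE_idx: "(AE i in idx d. P i) \<longleftrightarrow> (\<forall>i<d. P i)"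
  unfolding idx_def by (subst AE_density) (auto simp: AE_count_space indicator_def)

interpretation idx: finite_measure "idx d" for d
proof
  have "emeasure (idx d) (space (idx d)) = (\<integral>\<^sup>+i. 1 \<partial>idx d)" by simp
  then show "emeasure (idx d) (space (idx d)) \<noteq> \<infinity>" unfolding nn_integral_idx by (simp add: ennreal_of_nat_eq_real_of_nat)
qed

interpretation LMp: pair_sigma_finite "lborel :: 'a::euclidean_space measure" "idx d" for d
  by standard

lemma sigma_finite_LM: "sigma_finite_measure (LM d :: ('a::euclidean_space \<times> nat) measure)"
  unfolding LM_def by (rule LMp.P.sigma_finite_measure_axioms) 

lemma space_LM[simp]: "space (LM d) = UNIV"
  by (simp add: LM_def space_pair_measure)

lemma sets_LM[measurable_cong]: "sets (LM d) = sets (borel \<Otimes>\<^sub>M count_space UNIV)"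
  unfolding LM_def by (intro sets_pair_measure_cong) auto

lemma LM_measurable_iff: "f \<in> borel_measurable (LM d) \<longleftrightarrow> (\<forall>i. (\<lambda>x. f (x, i)) \<in> borel_measurable borel)"
proof
  assume [measurable]: "f \<in> borel_measurable (LM d)"
  show "\<forall>i. (\<lambda>x. f (x, i)) \<in> borel_measurable borel" by measurable
next
  assume "\<forall>i. (\<lambda>x. f (x, i)) \<in> borel_measurable borel"
  then have [measurable]: "\<And>i. (\<lambda>x. f (x, i)) \<in> borel_measurable borel" by simp
  have "(\<lambda>z. f (fst z, snd z)) \<in> borel_measurable (borel \<Otimes>\<^sub>M count_space UNIV)"
    by (rule measurable_compose_countable[where f="\<lambda>i z. f (fst z, i)" and g=snd]) auto
  then show "f \<in> borel_measurable (LM d)" by (simp cong: measurable_cong_sets add: measurable_cong_sets[OF sets_LM])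
qed

lemma nn_integral_LM:
  assumes [measurable]: "f \<in> borel_measurable (LM d)"
  shows "(\<integral>\<^sup>+z. f z \<partial>LM d) = (\<integral>\<^sup>+x. (\<Sum>i<d. f (x, i)) \<partial>lborel)"
proof -
  have "f \<in> borel_measurable (lborel \<Otimes>\<^sub>M idx d)" using assms by (simp add: LM_def)
  from idx.nn_integral_fst[OF this] show ?thesis by (simp add: LM_def nn_integral_idx)
qed

lemma AE_LM:
  "(AE z in LM d. P z) \<longleftrightarrow> (AE x in lborel. \<forall>i<d. P (x, i))"
proof
  assume "AE z in LM d. P z"
  then have "AE x in lborel. AE i in idx d. P (x, i)" unfolding LM_def by (rule LMp.AE_pair)
  then show "AE x in lborel. \<forall>i<d. P (x, i)" by (simp add: AE_idx)
next
  assume "AE x in lborel. \<forall>i<d. P (x, i)"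
  then obtain N where N: "{x \<in> space lborel. \<not> (\<forall>i<d. P (x, i))} \<subseteq> N" "emeasure lborel N = 0" "N \<in> sets lborel"
    by (rule AE_E)
  then have "AE x in lborel. AE i in idx d. fst (x, i) \<notin> N \<and> snd (x, i) < d"
    by (simp add: AE_idx AE_not_in null_setsI)
  then have "AE z in LM d. fst z \<notin> N \<and> snd z < d"
    unfolding LM_def by (subst (asm) LMp.AE_pair_iff) (use N(3) in \<open>auto simp: measurable_cong_sets\<close>)
  then show "AE z in LM d. P z"
    by eventually_elim (use N(1) in \<open>auto, fastforce\<close>)
qed

section \<open>Kernels dominated by integrable functions of the difference\<close>

lemma nn_integral_lborel_diff_left:
  fixes h :: "'a::euclidean_space \<Rightarrow> ennreal"
  assumes [measurable]: "h \<in> borel_measurable borel"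
  shows "(\<integral>\<^sup>+y. h (a - y) \<partial>lborel) = (\<integral>\<^sup>+y. h y \<partial>lborel)"
proof -
  have "(\<integral>\<^sup>+y. h y \<partial>lborel) = (\<integral>\<^sup>+y. h y \<partial>(density (distr lborel borel (\<lambda>x. a + (- 1) *\<^sub>R x)) (\<lambda>_. ennreal (\<bar>- 1\<bar> ^ DIM('a)))))"
    by (subst lborel_affine[of "-1" a]) auto
  also have "\<dots> = (\<integral>\<^sup>+y. h (a - y) \<partial>lborel)"
    by (simp add: nn_integral_density nn_integral_distr)
  finally show ?thesis by simp
qed

lemma nn_integral_lborel_diff_right:
  fixes h :: "'a::euclidean_space \<Rightarrow> ennreal"
  assumes [measurable]: "h \<in> borel_measurable borel"
  shows "(\<integral>\<^sup>+x. h (x - b) \<partial>lborel) = (\<integral>\<^sup>+x. h x \<partial>lborel)"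
proof -
  have "(\<integral>\<^sup>+x. h x \<partial>lborel) = (\<integral>\<^sup>+x. h x \<partial>distr lborel borel ((+) (- b)))"
    by (simp only: lborel_distr_plus)
  also have "\<dots> = (\<integral>\<^sup>+x. h (x - b) \<partial>lborel)"
    by (simp add: nn_integral_distr)
  finally show ?thesis by simp
qed

definition hconv :: "('a::euclidean_space \<Rightarrow> ennreal) \<Rightarrow> ('a \<Rightarrow> ennreal) \<Rightarrow> 'a \<Rightarrow> ennreal" where
  "hconv f g t = (\<integral>\<^sup>+s. f (t - s) * g s \<partial>lborel)"

lemma hconv_measurable[measurable]:
  assumes [measurable]: "f \<in> borel_measurable borel" "g \<in> borel_measurable borel"
  shows "hconv f g \<in> borel_measurable borel"
  unfolding hconv_def[abs_def] by measurable

lemma nn_integral_hconv: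
  assumes [measurable]: "f \<in> borel_measurable borel" "g \<in> borel_measurable borel"
  shows "(\<integral>\<^sup>+t. hconv f g t \<partial>lborel) = (\<integral>\<^sup>+t. f t \<partial>lborel) * (\<integral>\<^sup>+t. g t \<partial>lborel)"
proof -
  have "(\<integral>\<^sup>+t. hconv f g t \<partial>lborel) = (\<integral>\<^sup>+s. \<integral>\<^sup>+t. f (t - s) * g s \<partial>lborel \<partial>lborel)"
    unfolding hconv_def by (rule lborel_pair.Fubini') measurable
  also have "\<dots> = (\<integral>\<^sup>+s. (\<integral>\<^sup>+t. f t \<partial>lborel) * g s \<partial>lborel)"
    by (simp add: nn_integral_multc nn_integral_lborel_diff_right)
  finally show ?thesis by (simp add: nn_integral_cmult)
qed

lemma fst_LM_measurable[measurable]: "fst \<in> measurable (LM d) borel"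
  by (simp cong: measurable_cong_sets add: measurable_cong_sets[OF sets_LM])

lemma nn_integral_LM_fst:
  fixes g :: "'a::euclidean_space \<Rightarrow> ennreal"
  assumes [measurable]: "g \<in> borel_measurable borel"
  shows "(\<integral>\<^sup>+z. g (fst z) \<partial>LM d) = of_nat d * (\<integral>\<^sup>+x. g x \<partial>lborel)"
  by (subst nn_integral_LM) (auto simp: nn_integral_cmult)

text \<open>The matrix form of the domination that the class \<open>N1\<close> asks of an operator kernel.\<close>

definition tdom :: "nat \<Rightarrow> ('a::euclidean_space \<Rightarrow> ennreal) \<Rightarrow> ('a \<times> nat \<Rightarrow> 'a \<times> nat \<Rightarrow> real) \<Rightarrow> bool" where
  "tdom d h k \<longleftrightarrow> case_prod k \<in> borel_measurable (LM d \<Otimes>\<^sub>M LM d) \<and> h \<in> borel_measurable borel \<and>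
     (\<integral>\<^sup>+t. h t \<partial>lborel) < \<infinity> \<and> (\<forall>x y. ennreal \<bar>k x y\<bar> \<le> h (fst x - fst y))"

lemma tdomD:
  assumes "tdom d h k"
  shows "case_prod k \<in> borel_measurable (LM d \<Otimes>\<^sub>M LM d)" "h \<in> borel_measurable borel"
    "(\<integral>\<^sup>+t. h t \<partial>lborel) < \<infinity>" "ennreal \<bar>k x y\<bar> \<le> h (fst x - fst y)"
  using assms unfolding tdom_def by blast+

lemma nn_integral_LM_diff:
  fixes h :: "'a::euclidean_space \<Rightarrow> ennreal"
  assumes [measurable]: "h \<in> borel_measurable borel"
  shows "(\<integral>\<^sup>+y. h (a - fst y) \<partial>LM d) = of_nat d * (\<integral>\<^sup>+t. h t \<partial>lborel)"
    "(\<integral>\<^sup>+x. h (fst x - a) \<partial>LM d) = of_nat d * (\<integral>\<^sup>+t. h t \<partial>lborel)"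
  using nn_integral_LM_fst[of "\<lambda>y. h (a - y)" d] nn_integral_LM_fst[of "\<lambda>x. h (x - a)" d]
  by (simp_all add: nn_integral_lborel_diff_left nn_integral_lborel_diff_right)

lemma tdom_schur_le:
  assumes k: "tdom d h k" and K: "of_nat d * (\<integral>\<^sup>+t. h t \<partial>lborel) \<le> ennreal K" "K > 0"
  shows "schur (LM d) K k"
proof -
  note [measurable] = tdomD(2)[OF k]
  show ?thesis unfolding schur_def
  proof (intro conjI allI)
    fix x
    have "(\<integral>\<^sup>+y. ennreal \<bar>k x y\<bar> \<partial>LM d) \<le> (\<integral>\<^sup>+y. h (fst x - fst y) \<partial>LM d)"
      by (intro nn_integral_mono tdomD[OF k])
    then show "(\<integral>\<^sup>+y. ennreal \<bar>k x y\<bar> \<partial>LM d) \<le> ennreal K"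
      using K(1) by (simp add: nn_integral_LM_diff)
    have "(\<integral>\<^sup>+y. ennreal \<bar>k y x\<bar> \<partial>LM d) \<le> (\<integral>\<^sup>+y. h (fst y - fst x) \<partial>LM d)"
      by (intro nn_integral_mono tdomD[OF k])
    then show "(\<integral>\<^sup>+y. ennreal \<bar>k y x\<bar> \<partial>LM d) \<le> ennreal K"
      using K(1) by (simp add: nn_integral_LM_diff)
  qed (use k K in \<open>auto simp: tdom_def\<close>)
qed

lemma tdom_schur:
  assumes "tdom d h k"
  obtains K where "schur (LM d) K k"
proof -
  obtain r where r: "(\<integral>\<^sup>+t. h t \<partial>lborel) = ennreal r" "r \<ge> 0"
    using tdomD(3)[OF assms] by (cases "\<integral>\<^sup>+t. h t \<partial>lborel") auto
  have "schur (LM d) (d * r + 1) k"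
    using r by (intro tdom_schur_le[OF assms]) (auto simp: add_nonneg_pos ennreal_of_nat_eq_real_of_nat ennreal_mult[symmetric])
  then show ?thesis by (rule that)
qed

lemma nn_integral_LM_hconv:
  fixes f g :: "'a::euclidean_space \<Rightarrow> ennreal"
  assumes [measurable]: "f \<in> borel_measurable borel" "g \<in> borel_measurable borel"
  shows "(\<integral>\<^sup>+z. f (a - fst z) * g (fst z - b) \<partial>LM d) = of_nat d * hconv f g (a - b)"
proof -
  have "(\<integral>\<^sup>+z. f (a - fst z) * g (fst z - b) \<partial>LM d) = of_nat d * (\<integral>\<^sup>+z. f (a - z) * g (z - b) \<partial>lborel)"
    by (rule nn_integral_LM_fst[where g="\<lambda>z. f (a - z) * g (z - b)"]) measurable
  also have "(\<integral>\<^sup>+z. f (a - z) * g (z - b) \<partial>lborel) = hconv f g (a - b)"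
    using nn_integral_lborel_diff_right[of "\<lambda>z. f (a - b - z) * g z" b] by (simp add: hconv_def)
  finally show ?thesis .
qed

lemma tdom_kcomp:
  assumes k: "tdom d h k" and l: "tdom d h' l"
  shows "tdom d (\<lambda>t. of_nat d * hconv h h' t) (kcomp (LM d) k l)"
proof -
  interpret sigma_finite_measure "LM d :: ('a \<times> nat) measure" by (rule sigma_finite_LM)
  note [measurable] = tdomD(1,2)[OF k] tdomD(1,2)[OF l]
  have "ennreal \<bar>kcomp (LM d) k l x y\<bar> \<le> of_nat d * hconv h h' (fst x - fst y)" for x y
  proof -
    have "ennreal \<bar>kcomp (LM d) k l x y\<bar> \<le> (\<integral>\<^sup>+z. ennreal \<bar>k x z\<bar> * ennreal \<bar>l z y\<bar> \<partial>LM d)"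
      by (rule abs_kcomp_le)
    also have "\<dots> \<le> (\<integral>\<^sup>+z. h (fst x - fst z) * h' (fst z - fst y) \<partial>LM d)"
      by (intro nn_integral_mono mult_mono tdomD(4)[OF k] tdomD(4)[OF l]) auto
    finally show ?thesis by (simp add: nn_integral_LM_hconv)
  qed
  moreover have "(\<integral>\<^sup>+t. of_nat d * hconv h h' t \<partial>lborel) < \<infinity>"
    using tdomD(3)[OF k] tdomD(3)[OF l]
    by (simp add: nn_integral_cmult nn_integral_hconv ennreal_mult_less_top of_nat_less_top)
  ultimately show ?thesis unfolding tdom_def by simp
qed

lemma tdom_add:
  assumes k: "tdom d h k" and l: "tdom d h' l"
  shows "tdom d (\<lambda>t. h t + h' t) (\<lambda>x y. k x y + l x y)"
proof -
  note [measurable] = tdomD(1,2)[OF k] tdomD(1,2)[OF l]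
  have "ennreal \<bar>k x y + l x y\<bar> \<le> h (fst x - fst y) + h' (fst x - fst y)" for x y
  proof -
    have "ennreal \<bar>k x y + l x y\<bar> \<le> ennreal \<bar>k x y\<bar> + ennreal \<bar>l x y\<bar>" by (simp flip: ennreal_plus)
    also have "\<dots> \<le> h (fst x - fst y) + h' (fst x - fst y)" by (intro add_mono tdomD(4)[OF k] tdomD(4)[OF l])
    finally show ?thesis .
  qed
  then show ?thesis using tdomD(3)[OF k] tdomD(3)[OF l]
    unfolding tdom_def by (simp add: nn_integral_add)
qed

lemma tdom_uminus: "tdom d h k \<Longrightarrow> tdom d h (\<lambda>x y. - k x y)"
  unfolding tdom_def by (auto simp: split_beta')

section \<open>Unit cubes as cells\<close>

definition cell :: "real ^ 'c \<Rightarrow> int ^ 'c" where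
  "cell x = (\<chi> i. \<lfloor>x $ i\<rfloor>)"

definition len :: "int ^ 'c \<Rightarrow> nat" where
  "len g = Max (range (\<lambda>i. nat \<bar>g $ i\<bar>))"

lemma len_le_iff: "len g \<le> n \<longleftrightarrow> (\<forall>i. \<bar>g $ i\<bar> \<le> int n)"
  unfolding len_def by (subst Max_le_iff) (auto simp: nat_le_iff)

lemma abs_le_len: "\<bar>g $ i\<bar> \<le> int (len g)"
  using len_le_iff[of g "len g"] by simp

lemma len_ball_eq: "{g :: int ^ 'c. len g \<le> n} = vec_lambda ` (UNIV \<rightarrow>\<^sub>E {- int n..int n})"
proof (intro set_eqI iffI)
  fix g :: "int ^ 'c" assume "g \<in> {g. len g \<le> n}"
  then have "vec_nth g \<in> UNIV \<rightarrow>\<^sub>E {- int n..int n}" by (auto simp: len_le_iff abs_le_iff minus_le_iff)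
  then show "g \<in> vec_lambda ` (UNIV \<rightarrow>\<^sub>E {- int n..int n})" by (metis image_eqI vec_nth_inverse)
qed (auto simp: len_le_iff PiE_iff abs_le_iff minus_le_iff)

lemma card_len_ball: "finite {g :: int ^ 'c. len g \<le> n}" "card {g :: int ^ 'c. len g \<le> n} = (2 * n + 1) ^ CARD('c)"
proof -
  show "finite {g :: int ^ 'c. len g \<le> n}" unfolding len_ball_eq by (intro finite_imageI finite_PiE) auto
  have inj: "inj_on (vec_lambda :: ('c \<Rightarrow> int) \<Rightarrow> _) A" for A
    by (rule inj_onI) (metis UNIV_I vec_lambda_inverse)
  show "card {g :: int ^ 'c. len g \<le> n} = (2 * n + 1) ^ CARD('c)"
    unfolding len_ball_eq card_image[OF inj] by (simp add: card_PiE prod_constant nat_add_distrib nat_mult_distrib)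
qed

lemma cell_measurable[measurable]: "cell \<in> measurable borel (count_space UNIV)"
proof -
  have "cell -` {g} \<inter> space borel \<in> sets borel" for g :: "int ^ 'c"
  proof -
    have "cell -` {g} \<inter> space borel = {x. \<forall>i. of_int (g $ i) \<le> x $ i \<and> x $ i < of_int (g $ i) + 1}"
      by (auto simp: cell_def vec_eq_iff floor_eq_iff)
    also have "\<dots> \<in> sets borel" by measurable
    finally show ?thesis .
  qed
  then show ?thesis by (subst measurable_count_space_eq_countable) (auto simp: countableI_type)
qed

lemma emeasure_cell_le: "emeasure lborel (cell -` {g :: int ^ 'c}) \<le> 1"
proof -
  let ?a = "(\<chi> i. of_int (g $ i)) :: real ^ 'c"
  have "cell -` {g} \<subseteq> cbox ?a (?a + 1)"
    by (auto simp: cell_def vec_eq_iff floor_eq_iff mem_box_cart less_imp_le)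
  then have "emeasure lborel (cell -` {g}) \<le> emeasure lborel (cbox ?a (?a + 1))"
    by (rule emeasure_mono) simp
  also have "\<dots> = 1"
    by (subst emeasure_lborel_cbox) (auto simp: inner_add_left Basis_vec_def inner_axis intro!: prod.neutral)
  finally show ?thesis .
qed

lemma len_cell_diff: "len (cell (x - y) - (cell x - cell y)) \<le> 1"
proof -
  have "\<bar>\<lfloor>x $ i - y $ i\<rfloor> - (\<lfloor>x $ i\<rfloor> - \<lfloor>y $ i\<rfloor>)\<bar> \<le> 1" for i by linarith
  then show ?thesis by (simp add: len_le_iff cell_def)
qed

lemma cell_space_LM:
  assumes "young \<phi>"
  shows "cell_space (LM d :: ((real ^ 'c) \<times> nat) measure) \<phi> (\<lambda>z. cell (fst z)) len (max 1 (real d)) (3 ^ CARD('c))"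
proof -
  interpret sigma_finite_measure "LM d :: ((real ^ 'c) \<times> nat) measure" by (rule sigma_finite_LM)
  show ?thesis
  proof
    show "(\<lambda>z. cell (fst z)) \<in> measurable (LM d :: ((real ^ 'c) \<times> nat) measure) (count_space UNIV)" by measurable
    fix a b :: "int ^ 'c" and n :: nat
    show "len (0 :: int ^ 'c) = 0" by (simp add: len_def)
    show "len (a + b) \<le> len a + len b"
      unfolding len_le_iff using abs_le_len[of a] abs_le_len[of b] by (auto intro: order_trans[OF abs_triangle_ineq] add_mono)
    show "len (- a) = len a" by (simp add: len_def)
    show "finite {g :: int ^ 'c. len g \<le> n}" by (rule card_len_ball)
    show "card {g :: int ^ 'c. len g \<le> 3 * n} \<le> 3 ^ CARD('c) * card {g :: int ^ 'c. len g \<le> n}"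
      unfolding card_len_ball power_mult_distrib[symmetric] by (intro power_mono) auto
    have "emeasure (LM d) ((\<lambda>z. cell (fst z)) -` {a}) = (\<integral>\<^sup>+z. indicator (cell -` {a}) (fst z) \<partial>LM d)"
    proof (subst nn_integral_indicator[symmetric])
      have "(\<lambda>z. cell (fst z)) -` {a} \<inter> space (LM d :: ((real ^ 'c) \<times> nat) measure) \<in> sets (LM d)"
        by (rule measurable_sets[OF measurable_compose[OF fst_LM_measurable cell_measurable]]) simp
      then show "(\<lambda>z. cell (fst z)) -` {a} \<in> sets (LM d :: ((real ^ 'c) \<times> nat) measure)" by simp
    qed (auto intro!: nn_integral_cong simp: indicator_def)
    also have "\<dots> = of_nat d * emeasure lborel (cell -` {a})"
      using measurable_sets[OF cell_measurable, of "{a}"]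
      by (subst nn_integral_LM_fst) auto
    also have "\<dots> \<le> of_nat d * 1" by (intro mult_left_mono emeasure_cell_le) simp
    also have "\<dots> \<le> ennreal (max 1 (real d))" by (simp add: ennreal_of_nat_eq_real_of_nat ennreal_leI)
    finally show "emeasure (LM d) ((\<lambda>z. cell (fst z)) -` {a}) \<le> ennreal (max 1 (real d))" .
  qed (use assms in auto)
qed

section \<open>The inverse theorem for scalar kernels\<close>

lemma cell_fun_measurable[measurable]: "(\<lambda>t. F (cell t)) \<in> borel_measurable borel"
  by (rule measurable_compose[OF cell_measurable]) simp

lemma gsum_close: "gsum (\<lambda>g. indicator {g. len (a - g) \<le> 1} g) = ennreal (3 ^ CARD('c))" for a :: "int ^ 'c"
proof -
  have "gsum (\<lambda>g. indicator {g. len (a - g) \<le> 1} g :: ennreal) = gsum (\<lambda>g. indicator {g. len g \<le> 1} (a - g))"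
    by (intro nn_integral_cong) (auto simp: indicator_def)
  also have "\<dots> = gsum (indicator {g :: int ^ 'c. len g \<le> 1})" by (rule gsum_diff_left)
  also have "\<dots> = emeasure (count_space UNIV) {g :: int ^ 'c. len g \<le> 1}" by simp
  also have "\<dots> = ennreal (3 ^ CARD('c))"
    using card_len_ball(1)[where 'c='c, of 1] card_len_ball(2)[where 'c='c, of 1]
    by (simp add: ennreal_of_nat_eq_real_of_nat ennreal_power)
  finally show ?thesis .
qed

text \<open>What remains of \<open>h\<close> after removing its bounded part near the origin is small in the mean.\<close>

lemma dominating_tail_small:
  fixes h :: "real ^ 'c \<Rightarrow> ennreal"
  assumes [measurable]: "h \<in> borel_measurable borel" and fin: "(\<integral>\<^sup>+t. h t \<partial>lborel) < \<infinity>" and e: "0 < e"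
  obtains L :: nat where "(\<integral>\<^sup>+t. h t * indicator {t. \<not> (h t \<le> ennreal L \<and> len (cell t) \<le> L)} t \<partial>lborel) \<le> ennreal e"
proof -
  let ?h = "\<lambda>L t. h t * indicator {t. \<not> (h t \<le> ennreal (real L) \<and> len (cell t) \<le> L)} t"
  have [measurable]: "?h L \<in> borel_measurable borel" for L
  proof -
    have [measurable]: "Measurable.pred borel (\<lambda>t :: real ^ 'c. len (cell t) \<le> L)"
      by (rule measurable_compose[OF cell_measurable]) simp
    show ?thesis by measurable
  qed
  have "(\<lambda>L. \<integral>\<^sup>+t. ?h L t \<partial>lborel) \<longlonglongrightarrow> (\<integral>\<^sup>+t. 0 \<partial>(lborel :: (real ^ 'c) measure))"
  proof (rule nn_integral_dominated_convergence[where w=h])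
    have "AE t in lborel. h t \<noteq> \<infinity>" using fin by (intro nn_integral_PInf_AE) auto
    then show "AE t in lborel. (\<lambda>L. ?h L t) \<longlonglongrightarrow> 0"
    proof eventually_elim
      case (elim t)
      then obtain r where r: "h t = ennreal r" by (cases "h t") auto
      obtain n :: nat where n: "r \<le> real n" using real_arch_simple by blast
      have "\<forall>\<^sub>F L in sequentially. ?h L t = 0"
        using eventually_ge_at_top[of "max n (len (cell t))"]
        by eventually_elim (use r n in \<open>auto simp: indicator_def intro: ennreal_leI\<close>)
      then show ?case by (rule tendsto_eventually)
    qed
  qed (use fin in \<open>auto simp: indicator_def\<close>)
  then have "\<forall>\<^sub>F L in sequentially. (\<integral>\<^sup>+t. ?h L t \<partial>lborel) < ennreal e"
    using e by (intro order_tendstoD(2)) auto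
  then obtain L where "(\<integral>\<^sup>+t. ?h L t \<partial>lborel) < ennreal e" by (auto simp: eventually_sequentially)
  then show ?thesis by (intro that[of L]) auto
qed

text \<open>Each majorant of an iterated kernel is dominated by an iterated convolution of \<open>h\<close>, and the integrals of
  these form a geometric series.\<close>

lemma tdom_neumann:
  fixes k :: "(real ^ 'c) \<times> nat \<Rightarrow> (real ^ 'c) \<times> nat \<Rightarrow> real"
  assumes k: "tdom d h k" and small: "of_nat d * (\<integral>\<^sup>+t. h t \<partial>lborel) \<le> ennreal (1/2)"
    and pm: "case_prod p \<in> borel_measurable (LM d \<Otimes>\<^sub>M LM d)"
    and p: "\<And>x y. ennreal \<bar>p x y\<bar> \<le> (\<Sum>n. kmaj (LM d) k n x y)"
  obtains \<Gamma> where "tdom d \<Gamma> p"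
proof -
  note [measurable] = tdomD(2)[OF k]
  \<comment> \<open>each composition sums over the \<open>d\<close> indices, which explains the factor \<open>of_nat d\<close>\<close>
  define \<gamma> where "\<gamma> n = rec_nat h (\<lambda>_ g t. of_nat d * hconv h g t) n" for n
  have \<gamma>0: "\<gamma> 0 = h" and \<gamma>S: "\<gamma> (Suc n) = (\<lambda>t. of_nat d * hconv h (\<gamma> n) t)" for n
    by (simp_all add: \<gamma>_def)
  have [measurable]: "\<gamma> n \<in> borel_measurable borel" for n
    by (induction n) (simp_all add: \<gamma>0 \<gamma>S)
  have le: "kmaj (LM d) k n x y \<le> \<gamma> n (fst x - fst y)" for n x y
  proof (induction n arbitrary: x)
    case 0
    then show ?case using tdomD(4)[OF k] by (simp add: \<gamma>0)
  next
    case (Suc n)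
    have "kmaj (LM d) k (Suc n) x y \<le> (\<integral>\<^sup>+z. h (fst x - fst z) * \<gamma> n (fst z - fst y) \<partial>LM d)"
      unfolding kmaj.simps by (intro nn_integral_mono mult_mono tdomD(4)[OF k] Suc) auto
    also have "\<dots> = \<gamma> (Suc n) (fst x - fst y)"
      unfolding \<gamma>S by (rule nn_integral_LM_hconv) measurable
    finally show ?case .
  qed
  have int: "(\<integral>\<^sup>+t. \<gamma> n t \<partial>lborel) \<le> (\<integral>\<^sup>+t. h t \<partial>lborel) * ennreal ((1/2) ^ n)" for n
  proof (induction n)
    case (Suc n)
    have "(\<integral>\<^sup>+t. \<gamma> (Suc n) t \<partial>lborel) = (of_nat d * (\<integral>\<^sup>+t. h t \<partial>lborel)) * (\<integral>\<^sup>+t. \<gamma> n t \<partial>lborel)"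
      by (simp add: \<gamma>S nn_integral_cmult nn_integral_hconv mult.assoc)
    also have "\<dots> \<le> ennreal (1/2) * ((\<integral>\<^sup>+t. h t \<partial>lborel) * ennreal ((1/2) ^ n))"
      by (intro mult_mono small Suc) auto
    also have "\<dots> = (\<integral>\<^sup>+t. h t \<partial>lborel) * (ennreal (1/2) * ennreal ((1/2) ^ n))"
      by (simp only: mult.left_commute)
    also have "ennreal (1/2) * ennreal ((1/2) ^ n) = ennreal ((1/2) ^ Suc n)"
      by (subst ennreal_mult[symmetric]) auto
    finally show ?case .
  qed (simp add: \<gamma>0)
  define \<Gamma> where "\<Gamma> t = (\<Sum>n. \<gamma> n t)" for t
  have [measurable]: "\<Gamma> \<in> borel_measurable borel" unfolding \<Gamma>_def[abs_def] by measurable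
  have "(\<integral>\<^sup>+t. \<Gamma> t \<partial>lborel) = (\<Sum>n. \<integral>\<^sup>+t. \<gamma> n t \<partial>lborel)"
    unfolding \<Gamma>_def by (rule nn_integral_suminf) measurable
  also have "\<dots> \<le> (\<Sum>n. (\<integral>\<^sup>+t. h t \<partial>lborel) * ennreal ((1/2) ^ n))"
    by (intro suminf_le int) auto
  also have "\<dots> = (\<integral>\<^sup>+t. h t \<partial>lborel) * (\<Sum>n. ennreal ((1/2) ^ n))"
    by (rule ennreal_suminf_cmult)
  also have "(\<Sum>n. ennreal ((1/2) ^ n)) = ennreal (1 / (1 - 1/2))"
    by (rule suminf_ennreal_eq) (use geometric_sums[of "1/2::real"] in auto)
  also have "(\<integral>\<^sup>+t. h t \<partial>lborel) * \<dots> < \<infinity>"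
    using tdomD(3)[OF k] by (simp add: ennreal_mult_less_top)
  finally have "(\<integral>\<^sup>+t. \<Gamma> t \<partial>lborel) < \<infinity>" .
  moreover have "ennreal \<bar>p x y\<bar> \<le> \<Gamma> (fst x - fst y)" for x y
    unfolding \<Gamma>_def by (rule order_trans[OF p]) (intro suminf_le le; simp)
  ultimately have "tdom d \<Gamma> p" using pm unfolding tdom_def by simp
  then show ?thesis by (rule that)
qed

context
  fixes \<phi> :: "ennreal \<Rightarrow> ennreal" and d :: nat
  assumes y: "young \<phi>"
begin

interpretation cell_space "LM d :: ((real ^ 'c) \<times> nat) measure" \<phi> "\<lambda>z. cell (fst z)" len "max 1 (real d)" "3 ^ CARD('c)"
  by (rule cell_space_LM[OF y])

text \<open>The cell of a difference and the difference of the cells have distance at most 1, so a summable function of the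
  cells spreads over at most \<open>3\<close> to the power \<open>CARD('c)\<close> neighbouring cubes.\<close>

lemma kdom_tdom:
  fixes B :: "int ^ 'c \<Rightarrow> ennreal"
  assumes "kdom B m"
  obtains h where "tdom d h m"
proof -
  define h where "h t = gsum (\<lambda>g. indicator {g. len (cell t - g) \<le> 1} g * B g)" for t :: "real ^ 'c"
  have [measurable]: "h \<in> borel_measurable borel" unfolding h_def[abs_def] by measurable
  have cm[measurable]: "cell -` {j} \<in> sets borel" for j :: "int ^ 'c"
    using measurable_sets[OF cell_measurable, of "{j}"] by simp
  have meas: "(\<lambda>t. indicator {g. len (cell t - g) \<le> 1} g :: ennreal) \<in> borel_measurable borel" for g :: "int ^ 'c"
    by (rule cell_fun_measurable)
  have close: "(\<integral>\<^sup>+t. indicator {g. len (cell t - g) \<le> 1} g \<partial>lborel) \<le> ennreal (3 ^ CARD('c))" for g :: "int ^ 'c"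
  proof -
    have "(\<integral>\<^sup>+t. indicator {g. len (cell t - g) \<le> 1} g \<partial>lborel)
      = (\<integral>\<^sup>+t. gsum (\<lambda>j. indicator {j. len (g - j) \<le> 1} j * indicator (cell -` {j}) t) \<partial>lborel)"
    proof (intro nn_integral_cong)
      fix t :: "real ^ 'c"
      have "gsum (\<lambda>j. indicator {j. len (g - j) \<le> 1} j * indicator (cell -` {j}) t :: ennreal)
        = gsum (\<lambda>j. indicator {g. len (cell t - g) \<le> 1} g * indicator {cell t} j)"
        using len_swap[of g "cell t"] by (intro nn_integral_cong) (auto simp: indicator_def)
      then show "indicator {g. len (cell t - g) \<le> 1} g = gsum (\<lambda>j. indicator {j. len (g - j) \<le> 1} j * indicator (cell -` {j}) t :: ennreal)"
        by simp
    qed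
    also have "\<dots> = gsum (\<lambda>j. \<integral>\<^sup>+t. indicator {j. len (g - j) \<le> 1} j * indicator (cell -` {j}) t \<partial>lborel)"
      by (intro nn_integral_count_space_nn_integral) auto
    also have "\<dots> \<le> gsum (\<lambda>j. indicator {j. len (g - j) \<le> 1} j * 1)"
    proof (intro nn_integral_mono)
      fix j :: "int ^ 'c"
      have "(\<integral>\<^sup>+t. indicator {j. len (g - j) \<le> 1} j * indicator (cell -` {j}) t \<partial>lborel)
          = indicator {j. len (g - j) \<le> 1} j * emeasure lborel (cell -` {j})"
        by (simp add: nn_integral_cmult)
      also have "\<dots> \<le> indicator {j. len (g - j) \<le> 1} j * 1"
        by (intro mult_left_mono emeasure_cell_le) simp
      finally show "(\<integral>\<^sup>+t. indicator {j. len (g - j) \<le> 1} j * indicator (cell -` {j}) t \<partial>lborel)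
          \<le> indicator {j. len (g - j) \<le> 1} j * 1" .
    qed
    finally show ?thesis using gsum_close[of g] by simp
  qed
  have "(\<integral>\<^sup>+t. h t \<partial>lborel) = gsum (\<lambda>g. \<integral>\<^sup>+t. indicator {g. len (cell t - g) \<le> 1} g * B g \<partial>lborel)"
    unfolding h_def using meas by (intro nn_integral_count_space_nn_integral) auto
  also have "\<dots> \<le> gsum (\<lambda>g. ennreal (3 ^ CARD('c)) * B g)"
  proof (intro nn_integral_mono)
    fix g
    have "(\<integral>\<^sup>+t. indicator {g. len (cell t - g) \<le> 1} g * B g \<partial>lborel)
        = (\<integral>\<^sup>+t. indicator {g. len (cell t - g) \<le> 1} g \<partial>lborel) * B g"
      using meas[of g] by (intro nn_integral_multc) simp
    also have "\<dots> \<le> ennreal (3 ^ CARD('c)) * B g" by (rule mult_right_mono[OF close]) simp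
    finally show "(\<integral>\<^sup>+t. indicator {g. len (cell t - g) \<le> 1} g * B g \<partial>lborel) \<le> ennreal (3 ^ CARD('c)) * B g" .
  qed
  also have "\<dots> < \<infinity>" using kdomD(3)[OF assms] by (simp add: nn_integral_cmult ennreal_mult_less_top)
  finally have "(\<integral>\<^sup>+t. h t \<partial>lborel) < \<infinity>" .
  moreover have "ennreal \<bar>m x z\<bar> \<le> h (fst x - fst z)" for x z
  proof -
    let ?g = "cell (fst x) - cell (fst z)"
    have "ennreal \<bar>m x z\<bar> \<le> indicator {g. len (cell (fst x - fst z) - g) \<le> 1} ?g * B ?g"
      using kdomD(2)[OF assms, of x z] len_cell_diff[of "fst x" "fst z"] by simp
    also have "\<dots> \<le> h (fst x - fst z)" unfolding h_def by (rule le_gsum)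
    finally show ?thesis .
  qed
  ultimately have "tdom d h m" using kdomD(1)[OF assms] unfolding tdom_def by simp
  then show ?thesis by (rule that)
qed

text \<open>Domination by cells asks for local boundedness, which an integrable function of the difference does not provide.
  In a composition it is enough that one factor has it, because the other factor is integrated over.\<close>

lemma kdom_kcomp_tdom:
  fixes B :: "int ^ 'c \<Rightarrow> ennreal"
  assumes p: "tdom d \<Gamma> p" and k: "kdom B k"
  obtains B' where "kdom B' (kcomp (LM d) p k)"
proof -
  note [measurable] = tdomD(1,2)[OF p] kdomD(1)[OF k]
  let ?I = "\<lambda>w g. indicator {g. len (cell w - g) \<le> 1} g :: ennreal"
  have I[measurable]: "(\<lambda>w. ?I w g) \<in> borel_measurable borel" for g :: "int ^ 'c" by (rule cell_fun_measurable)
  define G where "G g = (\<integral>\<^sup>+w. \<Gamma> w * ?I w g \<partial>lborel)" for g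
  have close: "gsum (?I w) = ennreal (3 ^ CARD('c))" for w :: "real ^ 'c" by (rule gsum_close)
  have "gsum G = (\<integral>\<^sup>+w. gsum (\<lambda>g. \<Gamma> w * ?I w g) \<partial>lborel)"
    unfolding G_def by (rule nn_integral_count_space_nn_integral[symmetric]) auto
  also have "\<dots> = (\<integral>\<^sup>+w. \<Gamma> w * ennreal (3 ^ CARD('c)) \<partial>lborel)"
  proof (intro nn_integral_cong)
    fix w :: "real ^ 'c"
    show "gsum (\<lambda>g. \<Gamma> w * ?I w g) = \<Gamma> w * ennreal (3 ^ CARD('c))"
      unfolding close[of w, symmetric] by (rule nn_integral_cmult) simp
  qed
  also have "\<dots> < \<infinity>" using tdomD(3)[OF p] by (simp add: nn_integral_multc ennreal_mult_less_top)
  finally have G: "gsum G < \<infinity>" .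
  have "ennreal \<bar>kcomp (LM d) p k x z\<bar> \<le> of_nat d * conv B G (cell (fst x) - cell (fst z))" for x z
  proof -
    let ?a = "fst x" and ?j = "cell (fst z)"
    have Bm: "(\<lambda>w. B (cell w - ?j)) \<in> borel_measurable borel" "(\<lambda>w. B (cell (?a - w) - ?j)) \<in> borel_measurable borel"
      by (rule cell_fun_measurable, rule measurable_compose[OF _ cell_fun_measurable[of "\<lambda>g. B (g - ?j)"]], measurable)
    note [measurable] = Bm
    have "ennreal \<bar>kcomp (LM d) p k x z\<bar> \<le> (\<integral>\<^sup>+w. ennreal \<bar>p x w\<bar> * ennreal \<bar>k w z\<bar> \<partial>LM d)"
      by (rule abs_kcomp_le)
    also have "\<dots> \<le> (\<integral>\<^sup>+w. \<Gamma> (?a - fst w) * B (cell (fst w) - ?j) \<partial>LM d)"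
      by (intro nn_integral_mono mult_mono tdomD(4)[OF p] kdomD(2)[OF k]) auto
    also have "\<dots> = of_nat d * (\<integral>\<^sup>+w. \<Gamma> (?a - w) * B (cell w - ?j) \<partial>lborel)"
      by (rule nn_integral_LM_fst[where g="\<lambda>w. \<Gamma> (?a - w) * B (cell w - ?j)"]) measurable
    also have "(\<integral>\<^sup>+w. \<Gamma> (?a - w) * B (cell w - ?j) \<partial>lborel) = (\<integral>\<^sup>+w. \<Gamma> w * B (cell (?a - w) - ?j) \<partial>lborel)"
      using nn_integral_lborel_diff_left[of "\<lambda>w. \<Gamma> w * B (cell (?a - w) - ?j)" ?a] by simp
    also have "\<dots> \<le> (\<integral>\<^sup>+w. gsum (\<lambda>g. \<Gamma> w * ?I w g * B (cell ?a - ?j - g)) \<partial>lborel)"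
    proof (intro nn_integral_mono)
      fix w
      let ?g = "cell ?a - cell (?a - w)"
      have "\<Gamma> w * B (cell (?a - w) - ?j) = \<Gamma> w * ?I w ?g * B (cell ?a - ?j - ?g)"
        using len_cell_diff[of ?a "?a - w"] by (simp add: algebra_simps)
      also have "\<dots> \<le> gsum (\<lambda>g. \<Gamma> w * ?I w g * B (cell ?a - ?j - g))"
        by (rule le_gsum[where f="\<lambda>g. \<Gamma> w * ?I w g * B (cell ?a - ?j - g)"])
      finally show "\<Gamma> w * B (cell (?a - w) - ?j) \<le> gsum (\<lambda>g. \<Gamma> w * ?I w g * B (cell ?a - ?j - g))" .
    qed
    also have "\<dots> = gsum (\<lambda>g. \<integral>\<^sup>+w. \<Gamma> w * ?I w g * B (cell ?a - ?j - g) \<partial>lborel)"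
      by (rule nn_integral_count_space_nn_integral) auto
    also have "\<dots> = conv B G (cell ?a - ?j)"
      unfolding conv_def G_def by (intro nn_integral_cong) (subst nn_integral_multc, simp_all only: mult.commute, measurable)
    finally show ?thesis by (simp add: mult_left_mono)
  qed
  moreover have "gsum (\<lambda>g. of_nat d * conv B G g) < \<infinity>"
    using G kdomD(3)[OF k] by (simp add: nn_integral_cmult gsum_conv ennreal_mult_less_top of_nat_less_top)
  ultimately have "kdom (\<lambda>g. of_nat d * conv B G g) (kcomp (LM d) p k)"
    unfolding kdom_def by simp
  then show ?thesis by (rule that)
qed

lemma kdom_add:
  assumes k: "kdom B k" and l: "kdom B' l"
  shows "kdom (\<lambda>g. B g + B' g) (\<lambda>x z. k x z + l x z)"
proof -
  note [measurable] = kdomD(1)[OF k] kdomD(1)[OF l]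
  have "ennreal \<bar>k x z + l x z\<bar> \<le> B (cell (fst x) - cell (fst z)) + B' (cell (fst x) - cell (fst z))" for x z
  proof -
    have "ennreal \<bar>k x z + l x z\<bar> \<le> ennreal \<bar>k x z\<bar> + ennreal \<bar>l x z\<bar>" by (simp flip: ennreal_plus)
    also have "\<dots> \<le> B (cell (fst x) - cell (fst z)) + B' (cell (fst x) - cell (fst z))"
      by (intro add_mono kdomD(2)[OF k] kdomD(2)[OF l])
    finally show ?thesis .
  qed
  then show ?thesis using kdomD(3)[OF k] kdomD(3)[OF l] unfolding kdom_def by (simp add: nn_integral_add)
qed

text \<open>The kernel is split into a bounded part \<open>k0\<close> near the diagonal, which is dominated by cells, and a
  small part \<open>ke\<close>, whose Neumann series is again dominated by an integrable function of the difference.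
  Dividing out the small part leaves a kernel dominated by cells, to which Richardson iteration applies.\<close>

theorem stable_kernel_inverse:
  fixes k :: "(real ^ 'c) \<times> nat \<Rightarrow> (real ^ 'c) \<times> nat \<Rightarrow> real"
  assumes k: "tdom d h k" and C: "C > 0"
    and st: "\<And>u. u \<in> Lg \<Longrightarrow> nrm u \<le> ennreal C * nrm (S k u)"
    and solv: "\<And>f. f \<in> Lg \<Longrightarrow> \<exists>u\<in>Lg. AE x in LM d. S k u x = f x"
  obtains H m where "tdom d H m" "\<And>f. f \<in> Lg \<Longrightarrow> AE x in LM d. S k (S m f) x = f x"
proof -
  note [measurable] = tdomD(1,2)[OF k]
  obtain L :: nat where L: "(\<integral>\<^sup>+t. h t * indicator {t. \<not> (h t \<le> ennreal L \<and> len (cell t) \<le> L)} t \<partial>lborel) \<le> ennreal (1 / (2 * (real d + 1)))"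
    by (rule dominating_tail_small[OF tdomD(2,3)[OF k], of "1 / (2 * (real d + 1))"]) auto
  define A where "A = {t :: real ^ 'c. h t \<le> ennreal L \<and> len (cell t) \<le> L}"
  have Am[measurable]: "A \<in> sets borel"
  proof -
    have [measurable]: "Measurable.pred borel (\<lambda>t :: real ^ 'c. len (cell t) \<le> L)"
      by (rule measurable_compose[OF cell_measurable]) simp
    show ?thesis unfolding A_def by measurable
  qed
  define k0 where "k0 x z = k x z * indicator A (fst x - fst z)" for x z
  define ke where "ke x z = k x z * indicator (- A) (fst x - fst z)" for x z
  define he where "he t = h t * indicator (- A) t" for t
  have [measurable]: "case_prod k0 \<in> borel_measurable (LM d \<Otimes>\<^sub>M LM d)" "case_prod ke \<in> borel_measurable (LM d \<Otimes>\<^sub>M LM d)"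
    unfolding k0_def ke_def by measurable
  have ke: "tdom d he ke"
  proof -
    have "(\<integral>\<^sup>+t. he t \<partial>lborel) \<le> (\<integral>\<^sup>+t. h t \<partial>lborel)"
      unfolding he_def by (intro nn_integral_mono) (auto simp: indicator_def)
    then have "(\<integral>\<^sup>+t. he t \<partial>lborel) < \<infinity>" using tdomD(3)[OF k] by (rule le_less_trans)
    moreover have "he \<in> borel_measurable borel" unfolding he_def[abs_def] by measurable
    moreover have "ennreal \<bar>ke x z\<bar> \<le> he (fst x - fst z)" for x z
      using tdomD(4)[OF k, of x z] by (auto simp: ke_def he_def indicator_def)
    ultimately show ?thesis unfolding tdom_def by simp
  qed
  have he: "of_nat d * (\<integral>\<^sup>+t. he t \<partial>lborel) \<le> ennreal (1/2)"
  proof -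
    have "(\<integral>\<^sup>+t. he t \<partial>lborel) \<le> ennreal (1 / (2 * (real d + 1)))"
      using L by (simp add: he_def A_def Compl_eq)
    then have "of_nat d * (\<integral>\<^sup>+t. he t \<partial>lborel) \<le> ennreal (real d) * ennreal (1 / (2 * (real d + 1)))"
      unfolding ennreal_of_nat_eq_real_of_nat by (rule mult_left_mono) simp
    also have "\<dots> = ennreal (real d * (1 / (2 * (real d + 1))))" by (rule ennreal_mult[symmetric]) auto
    also have "\<dots> \<le> ennreal (1/2)" by (intro ennreal_leI) (simp add: field_simps)
    finally show ?thesis .
  qed
  have ske: "schur (LM d) (1/2) ke" by (rule tdom_schur_le[OF ke he]) simp
  have "\<exists>p. schur (LM d) 1 p \<and> (\<forall>x z. ennreal \<bar>p x z\<bar> \<le> (\<Sum>n. kmaj (LM d) ke n x z)) \<and>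
      (\<forall>x. AE z in LM d. ke x z + p x z + kcomp (LM d) ke p x z = 0)"
    by (rule neumann_kernel[OF ske space_LM]) blast
  then obtain p where p: "schur (LM d) 1 p" "\<And>x z. ennreal \<bar>p x z\<bar> \<le> (\<Sum>n. kmaj (LM d) ke n x z)"
    "\<And>x. AE z in LM d. ke x z + p x z + kcomp (LM d) ke p x z = 0"
    by blast
  obtain \<Gamma> where \<Gamma>: "tdom d \<Gamma> p"
    by (rule tdom_neumann[OF ke he schurD(1)[OF p(1)] p(2)])
  \<comment> \<open>the radius grows by 1 because cells of differences differ from differences of cells\<close>
  define B0 where "B0 g = ennreal L * indicator {g. len g \<le> L + 1} g" for g :: "int ^ 'c"
  have k0: "kdom B0 k0"
  proof -
    have "gsum B0 = ennreal L * emeasure (count_space UNIV) {g :: int ^ 'c. len g \<le> L + 1}"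
      unfolding B0_def by (simp add: nn_integral_cmult)
    also have "\<dots> < \<infinity>" using card_len_ball(1)[where 'c='c, of "L + 1"] by (simp add: ennreal_mult_less_top of_nat_less_top)
    finally have "gsum B0 < \<infinity>" .
    moreover have "ennreal \<bar>k0 x z\<bar> \<le> B0 (cell (fst x) - cell (fst z))" for x z
    proof (cases "fst x - fst z \<in> A")
      case True
      let ?g = "cell (fst x) - cell (fst z)" and ?c = "cell (fst x - fst z)"
      have "len ?g \<le> len ?c + len (?c - ?g)" using len_diff[of ?c "?c - ?g"] by simp
      then have "len ?g \<le> L + 1" using True len_cell_diff[of "fst x" "fst z"] by (simp add: A_def)
      moreover have "ennreal \<bar>k x z\<bar> \<le> ennreal (real L)"
        by (rule order_trans[OF tdomD(4)[OF k, of x z]]) (use True in \<open>simp add: A_def\<close>)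
      ultimately show ?thesis using True by (simp add: k0_def B0_def)
    qed (simp add: k0_def)
    ultimately show ?thesis unfolding kdom_def by simp
  qed
  obtain K0 where sk0: "schur (LM d) K0 k0" by (rule kdom_schur[OF k0])
  obtain B1 where pk0: "kdom B1 (kcomp (LM d) p k0)" by (rule kdom_kcomp_tdom[OF \<Gamma> k0])
  define k1 where "k1 = (\<lambda>x z. k0 x z + kcomp (LM d) p k0 x z)"
  have k1: "kdom (\<lambda>g. B0 g + B1 g) k1" unfolding k1_def by (rule kdom_add[OF k0 pk0])
  have k_eq: "k = (\<lambda>x z. k0 x z + ke x z)"
    by (auto simp: fun_eq_iff k0_def ke_def indicator_def)
  note pert = sk0 ske p(1) p(3) k_eq k1_def
  have st1: "nrm u \<le> ennreal (C * (3/2)) * nrm (S k1 u)" if "u \<in> Lg" for u :: "(real ^ 'c) \<times> nat \<Rightarrow> real"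
    by (rule perturbed_kernel_stable[OF pert C st that])
  have solv1: "\<exists>u\<in>Lg. AE x in LM d. S k1 u x = f x" if "f \<in> Lg" for f :: "(real ^ 'c) \<times> nat \<Rightarrow> real"
    by (rule perturbed_kernel_solvable[OF pert solv that])
  have C1: "C * (3/2) > 0" using C by simp
  obtain Bm m1 where m1: "kdom Bm m1" "AE x in LM d. AE z in LM d. k1 x z + m1 x z + kcomp (LM d) k1 m1 x z = 0"
    by (rule stable_cell_kernel_inverse[OF k1 C1 st1 solv1])
  obtain h1 where h1: "tdom d h1 m1" by (rule kdom_tdom[OF m1(1)])
  obtain K1 where sm1: "schur (LM d) K1 m1" by (rule kdom_schur[OF m1(1)])
  show ?thesis
  proof (rule that)
    show "tdom d (\<lambda>t. h1 t + \<Gamma> t + of_nat d * hconv h1 \<Gamma> t) (\<lambda>x z. m1 x z + p x z + kcomp (LM d) m1 p x z)"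
      by (intro tdom_add tdom_kcomp h1 \<Gamma>)
    fix f :: "(real ^ 'c) \<times> nat \<Rightarrow> real" assume "f \<in> Lg"
    then show "AE x in LM d. S k (S (\<lambda>x z. m1 x z + p x z + kcomp (LM d) m1 p x z) f) x = f x"
      by (rule perturbed_kernel_inverse[OF pert sm1 m1(2)])
  qed
qed

end

section \<open>Coordinates of a finite-dimensional space\<close>

text \<open>By induction: a vector outside the span of the previous ones has positive distance from it, for otherwise the
  coefficients of approximating combinations would form Cauchy sequences, whose limits put the vector
  into the span.\<close>

lemma independent_coefficients_bounded:
  fixes B :: "'e::real_normed_vector set"
  assumes "finite B" "independent B"
  shows "\<exists>C>0. \<forall>a. \<forall>b\<in>B. \<bar>a b\<bar> \<le> C * norm (\<Sum>b\<in>B. a b *\<^sub>R b)"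
  using assms
proof (induction B rule: finite_induct)
  case empty
  show ?case by (intro exI[of _ 1]) auto
next
  case (insert v B)
  have indB: "independent B" and vB: "v \<notin> span B" using insert by (auto simp: independent_insert)
  obtain C where C: "C > 0" "\<And>a b. b \<in> B \<Longrightarrow> \<bar>a b\<bar> \<le> C * norm (\<Sum>b\<in>B. a b *\<^sub>R b)"
    using insert.IH[OF indB] by blast
  have "\<exists>\<delta>>0. \<forall>a. \<delta> \<le> norm (v + (\<Sum>b\<in>B. a b *\<^sub>R b))"
  proof (rule ccontr)
    assume neg: "\<not> ?thesis"
    have small: "\<exists>a. norm (v + (\<Sum>b\<in>B. a b *\<^sub>R b)) < inverse (real (Suc n))" for n
    proof -
      have "inverse (real (Suc n)) > 0" by simp
      with neg have "\<not> (\<forall>a. inverse (real (Suc n)) \<le> norm (v + (\<Sum>b\<in>B. a b *\<^sub>R b)))" by blast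
      then show ?thesis by (simp add: not_le)
    qed
    have "\<exists>a. \<forall>n. norm (v + (\<Sum>b\<in>B. a n b *\<^sub>R b)) < inverse (real (Suc n))"
      by (rule choice) (use small in blast)
    then obtain a where a: "\<And>n. norm (v + (\<Sum>b\<in>B. a n b *\<^sub>R b)) < inverse (real (Suc n))" by blast
    define x where "x n = (\<Sum>b\<in>B. a n b *\<^sub>R b)" for n
    have "(\<lambda>n. v + x n) \<longlonglongrightarrow> 0"
      by (rule Lim_null_comparison[OF _ LIMSEQ_inverse_real_of_nat]) (use a in \<open>auto simp: x_def intro!: always_eventually less_imp_le\<close>)
    from tendsto_diff[OF this tendsto_const[of v]] have x: "x \<longlonglongrightarrow> - v" by simp
    then have xC: "Cauchy x" by (rule LIMSEQ_imp_Cauchy)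
    have conv: "convergent (\<lambda>n. a n b)" if b: "b \<in> B" for b
    proof (rule Cauchy_convergent, rule metric_CauchyI)
      fix e :: real assume "0 < e"
      then obtain N where N: "\<And>m n. m \<ge> N \<Longrightarrow> n \<ge> N \<Longrightarrow> norm (x m - x n) < e / C"
        using CauchyD[OF xC, of "e / C"] C(1) by auto
      have "dist (a m b) (a n b) < e" if "m \<ge> N" "n \<ge> N" for m n
      proof -
        have "\<bar>a m b - a n b\<bar> \<le> C * norm (\<Sum>b\<in>B. (a m b - a n b) *\<^sub>R b)"
          using C(2)[OF b, of "\<lambda>b. a m b - a n b"] .
        also have "(\<Sum>b\<in>B. (a m b - a n b) *\<^sub>R b) = x m - x n"
          by (simp add: x_def sum_subtractf scaleR_left_diff_distrib)
        also have "C * norm (x m - x n) < C * (e / C)" using N[OF that] C(1) by (intro mult_strict_left_mono) auto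
        finally show ?thesis using C(1) by (simp add: dist_real_def)
      qed
      then show "\<exists>N. \<forall>m\<ge>N. \<forall>n\<ge>N. dist (a m b) (a n b) < e" by blast
    qed
    define \<alpha> where "\<alpha> b = lim (\<lambda>n. a n b)" for b
    have \<alpha>: "(\<lambda>n. a n b) \<longlonglongrightarrow> \<alpha> b" if "b \<in> B" for b
      unfolding \<alpha>_def using conv[OF that] by (simp only: convergent_LIMSEQ_iff)
    have "x \<longlonglongrightarrow> (\<Sum>b\<in>B. \<alpha> b *\<^sub>R b)"
      unfolding x_def by (intro tendsto_sum tendsto_scaleR \<alpha> tendsto_const)
    then have "- v = (\<Sum>b\<in>B. \<alpha> b *\<^sub>R b)" using x LIMSEQ_unique by blast
    moreover have "(\<Sum>b\<in>B. \<alpha> b *\<^sub>R b) \<in> span B" by (intro span_sum span_scale span_base)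
    ultimately have "- v \<in> span B" by simp
    then show False using vB span_neg[of "- v" B] by simp
  qed
  then obtain \<delta> where \<delta>: "\<delta> > 0" "\<And>a. \<delta> \<le> norm (v + (\<Sum>b\<in>B. a b *\<^sub>R b))" by blast
  define C' where "C' = 1 / \<delta> + C * (1 + norm v / \<delta>)"
  have C': "C' > 0" "1 / \<delta> \<le> C'" "C * (1 + norm v / \<delta>) \<le> C'"
    using \<delta>(1) C(1) by (auto simp: C'_def intro!: add_pos_nonneg mult_nonneg_nonneg)
  show ?case
  proof (intro exI[of _ C'] conjI allI ballI)
    fix a b assume b: "b \<in> insert v B"
    let ?s = "\<Sum>b\<in>B. a b *\<^sub>R b"
    let ?x = "\<Sum>b\<in>insert v B. a b *\<^sub>R b"
    have x: "?x = a v *\<^sub>R v + ?s" using insert by simp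
    have av: "\<bar>a v\<bar> \<le> (1 / \<delta>) * norm ?x"
    proof (cases "a v = 0")
      case False
      have "?x = a v *\<^sub>R (v + (\<Sum>b\<in>B. (a b / a v) *\<^sub>R b))"
        using False by (simp add: x scaleR_sum_right scaleR_add_right)
      then have "norm ?x = \<bar>a v\<bar> * norm (v + (\<Sum>b\<in>B. (a b / a v) *\<^sub>R b))" by simp
      also have "\<dots> \<ge> \<bar>a v\<bar> * \<delta>" by (intro mult_left_mono \<delta>) simp
      finally show ?thesis using \<delta>(1) by (simp add: field_simps)
    qed (use \<delta>(1) in simp)
    have "norm ?s = norm (?x - a v *\<^sub>R v)" by (simp add: x)
    also have "\<dots> \<le> norm ?x + \<bar>a v\<bar> * norm v" using norm_triangle_ineq4[of ?x "a v *\<^sub>R v"] by simp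
    also have "\<dots> \<le> norm ?x + (1 / \<delta>) * norm ?x * norm v" by (intro add_left_mono mult_right_mono av) simp
    finally have s: "norm ?s \<le> (1 + norm v / \<delta>) * norm ?x" by (simp add: algebra_simps)
    show "\<bar>a b\<bar> \<le> C' * norm ?x"
    proof (cases "b = v")
      case True
      then show ?thesis using order_trans[OF av mult_right_mono[OF C'(2)]] by simp
    next
      case False
      then have "\<bar>a b\<bar> \<le> C * norm ?s" using b C(2) by blast
      also have "\<dots> \<le> C * ((1 + norm v / \<delta>) * norm ?x)" using C(1) s by (intro mult_left_mono) auto
      also have "\<dots> \<le> C' * norm ?x" using mult_right_mono[OF C'(3), of "norm ?x"] by (simp add: mult.assoc)
      finally show ?thesis .
    qed
  qed (rule C')
qed

text \<open>A basis over the real numbers with its dual functionals, also when the scalar field is larger; linearity over the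
  scalar field is treated separately.\<close>

locale real_coordinates =
  fixes d :: nat and b :: "nat \<Rightarrow> 'e::{banach,second_countable_topology}" and co :: "nat \<Rightarrow> 'e \<Rightarrow> real"
  assumes co_linear: "\<And>i. bounded_linear (co i)"
    and expand: "\<And>e. (\<Sum>i<d. co i e *\<^sub>R b i) = e"
    and dual: "\<And>i j. i < d \<Longrightarrow> j < d \<Longrightarrow> co i (b j) = (if i = j then 1 else 0)"

lemma real_coordinates_exist:
  fixes scl :: "'k::{real_normed_field,euclidean_space} \<Rightarrow> 'e::{banach,second_countable_topology} \<Rightarrow> 'e"
  assumes ns: "normed_space_over scl" and fd: "finite_dimensional_vector_space scl BE"
  obtains d and b :: "nat \<Rightarrow> 'e" and co where "real_coordinates d b co"
proof -
  interpret F: finite_dimensional_vector_space scl BE by fact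
  have sr: "scl (of_real r) v = r *\<^sub>R v" for r v using ns by (simp add: normed_space_over_def)
  define G where "G = (\<lambda>(\<beta>, e). scl \<beta> e) ` (Basis \<times> BE)"
  have finG: "finite G" unfolding G_def using F.finite_Basis by (intro finite_imageI finite_cartesian_product) auto
  have scl_span: "scl a e \<in> span G" if "e \<in> BE" for a e
  proof -
    have "scl a e = scl (\<Sum>\<beta>\<in>Basis. (a \<bullet> \<beta>) *\<^sub>R \<beta>) e" by (simp add: euclidean_representation)
    also have "\<dots> = (\<Sum>\<beta>\<in>Basis. (a \<bullet> \<beta>) *\<^sub>R scl \<beta> e)"
      by (simp add: F.scale_sum_left scaleR_conv_of_real sr[symmetric])
    also have "\<dots> \<in> span G" using that by (intro span_sum span_scale span_base) (auto simp: G_def)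
    finally show ?thesis .
  qed
  have "e \<in> span G" for e
  proof -
    have "e \<in> F.span BE" using F.span_Basis by simp
    then show ?thesis
    proof (induction rule: F.span_induct_alt)
      case base show ?case by (rule span_zero)
    next
      case (step a x y) then show ?case by (intro span_add scl_span)
    qed
  qed
  then have spanG: "span G = UNIV" by auto
  obtain B where B: "B \<subseteq> G" "independent B" "G \<subseteq> span B" by (rule maximal_independent_subset)
  have finB: "finite B" using B(1) finG by (rule finite_subset)
  have spanB: "span B = UNIV" using spanG span_minimal[OF B(3) subspace_span] by auto
  define d where "d = card B"
  obtain f where f: "bij_betw f {..<d} B"
    using ex_bij_betw_nat_finite[OF finB] unfolding d_def atLeast0LessThan by blast
  define co where "co i e = (if i < d then representation B e (f i) else 0)" for i e
  have rep_sum: "(\<Sum>v\<in>B. representation B e v *\<^sub>R v) = e" for e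
    by (rule sum_representation_eq[OF B(2) _ finB]) (auto simp: spanB)
  obtain C where C: "C > 0" "\<And>a v. v \<in> B \<Longrightarrow> \<bar>a v\<bar> \<le> C * norm (\<Sum>v\<in>B. a v *\<^sub>R v)"
    using independent_coefficients_bounded[OF finB B(2)] by blast
  have "real_coordinates d f co"
  proof (rule real_coordinates.intro)
    fix i
    show "bounded_linear (co i)"
    proof (cases "i < d")
      case True
      then have fi: "f i \<in> B" using f by (auto simp: bij_betw_def)
      show ?thesis
      proof (rule bounded_linear_intro[where K=C])
        show "co i (x + y) = co i x + co i y" for x y
          using representation_add[OF B(2), of y x] spanB by (simp add: co_def)
        show "co i (r *\<^sub>R x) = r *\<^sub>R co i x" for r x
          using representation_scale[OF B(2), of x r] spanB by (simp add: co_def)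
        show "norm (co i x) \<le> norm x * C" for x
          using C(2)[OF fi, of "representation B x"] True by (simp add: co_def rep_sum mult.commute)
      qed
    next
      case False
      then have "co i = (\<lambda>_. 0)" by (simp add: co_def fun_eq_iff)
      then show ?thesis by simp
    qed
    fix e
    show "(\<Sum>i<d. co i e *\<^sub>R f i) = e"
      using sum.reindex_bij_betw[OF f, of "\<lambda>v. representation B e v *\<^sub>R v"] rep_sum by (simp add: co_def)
    fix j assume ij: "i < d" "j < d"
    then have "f j \<in> B" using f by (auto simp: bij_betw_def)
    then have "representation B (f j) = (\<lambda>v. if v = f j then 1 else 0)" by (rule representation_basis[OF B(2)])
    moreover have "f i = f j \<longleftrightarrow> i = j"
      using inj_on_eq_iff[OF bij_betw_imp_inj_on[OF f]] ij by simp
    ultimately show "co i (f j) = (if i = j then 1 else 0)"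
      using ij by (simp add: co_def)
  qed
  then show ?thesis by (rule that)
qed

context real_coordinates
begin

lemma co_measurable[measurable]: "co i \<in> borel_measurable borel"
  by (intro borel_measurable_continuous_onI linear_continuous_on co_linear)

lemma co_add: "co i (x + y) = co i x + co i y" and co_scaleR: "co i (r *\<^sub>R x) = r * co i x"
  and co_diff: "co i (x - y) = co i x - co i y" and co_minus: "co i (- x) = - co i x" and co_0[simp]: "co i 0 = 0"
  and co_sum: "co i (sum f A) = (\<Sum>a\<in>A. co i (f a))"
  using linear_add[OF bounded_linear.linear[OF co_linear]] linear_scale[OF bounded_linear.linear[OF co_linear]]
    linear_diff[OF bounded_linear.linear[OF co_linear]] linear_neg[OF bounded_linear.linear[OF co_linear]]
    linear_0[OF bounded_linear.linear[OF co_linear]] linear_sum[OF bounded_linear.linear[OF co_linear]]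
  by simp_all

lemma eq_iff_co: "x = y \<longleftrightarrow> (\<forall>i<d. co i x = co i y)"
  using expand[of x] expand[of y] by (metis (no_types, lifting) lessThan_iff sum.cong)

lemma co_sum_basis: "i < d \<Longrightarrow> co i (\<Sum>j<d. a j *\<^sub>R b j) = a i"
  by (simp add: co_sum co_scaleR dual if_distrib[where f="\<lambda>x. _ * x"] sum.delta' cong: if_cong)

definition coC :: real where
  "coC = (SOME C. C > 0 \<and> (\<forall>i<d. \<forall>e. \<bar>co i e\<bar> \<le> C * norm e))"

lemma coC: "coC > 0" "i < d \<Longrightarrow> \<bar>co i e\<bar> \<le> coC * norm e"
proof -
  have "\<exists>K. \<forall>e::'e. norm (co i e) \<le> norm e * K" for i using bounded_linear.bounded[OF co_linear] .
  then obtain K where K: "\<And>i e. norm (co i e) \<le> norm e * K i" by metis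
  have "\<exists>C. C > 0 \<and> (\<forall>i<d. \<forall>e::'e. \<bar>co i e\<bar> \<le> C * norm e)"
  proof (intro exI conjI allI impI)
    show "1 + (\<Sum>i<d. \<bar>K i\<bar>) > 0" by (intro add_pos_nonneg sum_nonneg) auto
    fix i and e :: 'e assume "i < d"
    then have "\<bar>K i\<bar> \<le> (\<Sum>i<d. \<bar>K i\<bar>)" by (intro member_le_sum) auto
    then have "norm e * K i \<le> norm e * (1 + (\<Sum>i<d. \<bar>K i\<bar>))" by (intro mult_left_mono) auto
    then show "\<bar>co i e\<bar> \<le> (1 + (\<Sum>i<d. \<bar>K i\<bar>)) * norm e" using K[of i e] by (simp add: mult.commute)
  qed
  from someI_ex[OF this] show "coC > 0" "i < d \<Longrightarrow> \<bar>co i e\<bar> \<le> coC * norm e"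
    unfolding coC_def by auto
qed

definition bC :: real where "bC = 1 + (\<Sum>i<d. norm (b i))"

lemma bC: "bC > 0" "i < d \<Longrightarrow> norm (b i) \<le> bC"
proof -
  show "bC > 0" unfolding bC_def by (intro add_pos_nonneg sum_nonneg) auto
  assume "i < d"
  then have "norm (b i) \<le> (\<Sum>i<d. norm (b i))" by (intro member_le_sum) auto
  then show "norm (b i) \<le> bC" by (simp add: bC_def)
qed

lemma norm_le_co: "norm e \<le> bC * (\<Sum>i<d. \<bar>co i e\<bar>)"
proof -
  have "norm e = norm (\<Sum>i<d. co i e *\<^sub>R b i)" by (simp add: expand)
  also have "\<dots> \<le> (\<Sum>i<d. \<bar>co i e\<bar> * bC)"
    using bC(2) by (intro sum_norm_le) (auto intro: mult_left_mono)
  finally show ?thesis by (simp add: sum_distrib_left mult.commute)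
qed

lemma measurable_of_co:
  assumes "\<And>i. i < d \<Longrightarrow> (\<lambda>x. co i (f x)) \<in> borel_measurable M"
  shows "f \<in> borel_measurable M"
proof -
  have "(\<lambda>x. \<Sum>i<d. co i (f x) *\<^sub>R b i) \<in> borel_measurable M"
    by (intro borel_measurable_sum borel_measurable_scaleR borel_measurable_const assms) auto
  then show ?thesis by (simp add: expand)
qed

definition elem :: "nat \<Rightarrow> nat \<Rightarrow> 'e \<Rightarrow>\<^sub>L 'e" where
  "elem i j = Blinfun (\<lambda>e. co j e *\<^sub>R b i)"

lemma elem_apply: "blinfun_apply (elem i j) e = co j e *\<^sub>R b i"
  unfolding elem_def
  by (subst bounded_linear_Blinfun_apply) (auto intro: bounded_linear_compose[OF bounded_linear_scaleR_left co_linear])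

definition entry :: "nat \<Rightarrow> nat \<Rightarrow> ('e \<Rightarrow>\<^sub>L 'e) \<Rightarrow> real" where
  "entry i j N = co i (blinfun_apply N (b j))"

lemma apply_expand: "blinfun_apply N e = (\<Sum>j<d. co j e *\<^sub>R blinfun_apply N (b j))"
proof -
  have "blinfun_apply N e = blinfun_apply N (\<Sum>j<d. co j e *\<^sub>R b j)" by (simp only: expand)
  then show ?thesis by (simp add: blinfun.sum_right blinfun.scaleR_right)
qed

lemma co_apply: "co i (blinfun_apply N e) = (\<Sum>j<d. entry i j N * co j e)"
  by (subst apply_expand) (simp add: co_sum co_scaleR entry_def mult.commute)

lemma elem_expand: "N = (\<Sum>i<d. \<Sum>j<d. entry i j N *\<^sub>R elem i j)"
proof (rule blinfun_eqI)
  fix e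
  have "blinfun_apply (\<Sum>i<d. \<Sum>j<d. entry i j N *\<^sub>R elem i j) e = (\<Sum>i<d. (\<Sum>j<d. entry i j N * co j e) *\<^sub>R b i)"
    by (simp add: blinfun.sum_left blinfun.scaleR_left elem_apply scaleR_sum_left)
  also have "\<dots> = blinfun_apply N e" by (simp add: co_apply[symmetric] expand)
  finally show "blinfun_apply N e = blinfun_apply (\<Sum>i<d. \<Sum>j<d. entry i j N *\<^sub>R elem i j) e" ..
qed

lemma entry_sum_elem:
  assumes "i < d" "j < d"
  shows "entry i j (\<Sum>i<d. \<Sum>j<d. a i j *\<^sub>R elem i j) = a i j"
proof -
  have delta: "(\<Sum>l<d. a m l * co l (b j)) = a m j" for m
  proof -
    have "(\<Sum>l<d. a m l * co l (b j)) = (\<Sum>l<d. if l = j then a m l else 0)"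
      using assms(2) by (intro sum.cong) (auto simp: dual)
    then show ?thesis using assms(2) by simp
  qed
  have "blinfun_apply (\<Sum>i<d. \<Sum>j<d. a i j *\<^sub>R elem i j) (b j) = (\<Sum>m<d. (\<Sum>l<d. a m l * co l (b j)) *\<^sub>R b m)"
    by (simp add: blinfun.sum_left blinfun.scaleR_left elem_apply scaleR_sum_left)
  then show ?thesis using assms(1) by (simp add: entry_def delta co_sum_basis)
qed

lemma entry_bounded_linear: "bounded_linear (entry i j)"
  unfolding entry_def[abs_def]
  by (rule bounded_linear_compose[OF co_linear blinfun.bounded_linear_left])

lemma entry_measurable[measurable]: "entry i j \<in> borel_measurable borel"
  by (intro borel_measurable_continuous_onI linear_continuous_on entry_bounded_linear)

lemma entry_diff: "entry i j (N - N') = entry i j N - entry i j N'"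
  and entry_minus: "entry i j (- N) = - entry i j N" and entry_0[simp]: "entry i j 0 = 0"
  by (simp_all add: entry_def blinfun.diff_left blinfun.minus_left co_diff co_minus)

lemma eq_iff_entry: "N = N' \<longleftrightarrow> (\<forall>i<d. \<forall>j<d. entry i j N = entry i j N')"
  using elem_expand[of N] elem_expand[of N'] by (metis (no_types, lifting) lessThan_iff sum.cong)

lemma entry_le: "i < d \<Longrightarrow> j < d \<Longrightarrow> \<bar>entry i j N\<bar> \<le> coC * bC * norm N"
proof -
  assume ij: "i < d" "j < d"
  have "\<bar>entry i j N\<bar> \<le> coC * norm (blinfun_apply N (b j))" unfolding entry_def by (rule coC(2)[OF ij(1)])
  also have "\<dots> \<le> coC * (norm N * bC)"
    using coC(1) by (intro mult_left_mono order_trans[OF norm_blinfun mult_left_mono[OF bC(2)[OF ij(2)]]]) auto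
  finally show ?thesis by (simp add: mult_ac)
qed

lemma norm_le_entries: "norm N \<le> bC * coC * (\<Sum>i<d. \<Sum>j<d. \<bar>entry i j N\<bar>)"
proof (rule norm_blinfun_bound)
  show "0 \<le> bC * coC * (\<Sum>i<d. \<Sum>j<d. \<bar>entry i j N\<bar>)"
    using bC(1) coC(1) by (intro mult_nonneg_nonneg sum_nonneg) auto
  fix e
  have "norm (blinfun_apply N e) \<le> bC * (\<Sum>i<d. \<bar>\<Sum>j<d. entry i j N * co j e\<bar>)"
    using norm_le_co[of "blinfun_apply N e"] by (simp add: co_apply)
  also have "\<dots> \<le> bC * (\<Sum>i<d. \<Sum>j<d. \<bar>entry i j N\<bar> * (coC * norm e))"
    using bC(1) coC(2)
    by (intro mult_left_mono sum_mono order_trans[OF sum_abs]) (auto simp: abs_mult intro!: mult_left_mono)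
  also have "\<dots> = bC * coC * (\<Sum>i<d. \<Sum>j<d. \<bar>entry i j N\<bar>) * norm e"
    by (simp add: sum_distrib_right sum_distrib_left mult_ac)
  finally show "norm (blinfun_apply N e) \<le> bC * coC * (\<Sum>i<d. \<Sum>j<d. \<bar>entry i j N\<bar>) * norm e" .
qed

text \<open>The operator space need not be second countable as a type, so measurability is transported
  along the continuous map that assembles an operator from its matrix entries.\<close>

lemma blinfun_measurable_of_entries:
  assumes m: "\<And>i j. i < d \<Longrightarrow> j < d \<Longrightarrow> (\<lambda>x. entry i j (F x)) \<in> borel_measurable M"
  shows "F \<in> borel_measurable M"
proof -
  define G where "G x = (\<lambda>k::nat \<times> nat. if fst k < d \<and> snd k < d then entry (fst k) (snd k) (F x) else 0)" for x
  define \<Phi> where "\<Phi> g = (\<Sum>i<d. \<Sum>j<d. g (i, j) *\<^sub>R elem i j)" for g :: "nat \<times> nat \<Rightarrow> real"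
  have "G \<in> borel_measurable M"
  proof (rule measurable_coordinatewise_then_product)
    fix k show "(\<lambda>x. G x k) \<in> borel_measurable M"
      using m[of "fst k" "snd k"] by (cases "fst k < d \<and> snd k < d") (auto simp: G_def)
  qed
  moreover have "continuous_on UNIV \<Phi>"
    unfolding \<Phi>_def
    by (intro continuous_on_sum continuous_on_scaleR continuous_on_const continuous_on_product_coordinates)
  then have "\<Phi> \<in> borel_measurable borel" by (rule borel_measurable_continuous_onI)
  ultimately have "(\<lambda>x. \<Phi> (G x)) \<in> borel_measurable M" by (rule measurable_compose)
  moreover have "\<Phi> (G x) = F x" for x
  proof -
    have "\<Phi> (G x) = (\<Sum>i<d. \<Sum>j<d. entry i j (F x) *\<^sub>R elem i j)"
      unfolding \<Phi>_def by (intro sum.cong) (auto simp: G_def)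
    also have "\<dots> = F x" by (rule elem_expand[symmetric])
    finally show ?thesis .
  qed
  ultimately show ?thesis by simp
qed

end

section \<open>Kernels are determined by their action on boxes\<close>

lemma box_Times_eq: "box (a1, a2) (b1, b2) = box a1 b1 \<times> box (a2 :: 'b::euclidean_space) (b2 :: 'b)"
  for a1 b1 :: "'a::euclidean_space"
  by (auto simp: box_def Basis_prod_def ball_Un)

text \<open>The positive and the negative part are densities of two measures that agree on boxes.\<close>

lemma AE_zero_of_box_integrals:
  fixes g :: "'a::euclidean_space \<Rightarrow> real"
  assumes g: "integrable lborel g" and zero: "\<And>a b. (\<integral>x. indicator (box a b) x * g x \<partial>lborel) = 0"
  shows "AE x in lborel. g x = 0"
proof -
  have [measurable]: "g \<in> borel_measurable borel" using borel_measurable_integrable[OF g] by simp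
  let ?P = "density lborel (\<lambda>x. ennreal (g x))" and ?N = "density lborel (\<lambda>x. ennreal (- g x))"
  have pn: "(\<integral>\<^sup>+x. ennreal (g x) * indicator (box a b) x \<partial>lborel) = (\<integral>\<^sup>+x. ennreal (- g x) * indicator (box a b) x \<partial>lborel)" for a b
  proof -
    let ?I = "indicator (box a b) :: 'a \<Rightarrow> real"
    have i: "integrable lborel (\<lambda>x. ?I x * max 0 (g x))" "integrable lborel (\<lambda>x. ?I x * max 0 (- g x))"
      by (auto intro!: integrable_real_indicator integrable_mult_indicator[where 'b=real, simplified] integrable_max g)
    have "(\<integral>\<^sup>+x. ennreal (g x) * indicator (box a b) x \<partial>lborel) = (\<integral>\<^sup>+x. ennreal (?I x * max 0 (g x)) \<partial>lborel)"
      by (intro nn_integral_cong) (auto simp: indicator_def max_def ennreal_neg)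
    also have "\<dots> = ennreal (\<integral>x. ?I x * max 0 (g x) \<partial>lborel)"
      by (intro nn_integral_eq_integral i AE_I2) auto
    also have "(\<integral>x. ?I x * max 0 (g x) \<partial>lborel) = (\<integral>x. ?I x * max 0 (- g x) \<partial>lborel)"
    proof -
      have "(\<integral>x. ?I x * max 0 (g x) \<partial>lborel) - (\<integral>x. ?I x * max 0 (- g x) \<partial>lborel) = (\<integral>x. ?I x * g x \<partial>lborel)"
        by (subst Bochner_Integration.integral_diff[symmetric, OF i])
           (auto intro!: Bochner_Integration.integral_cong simp: max_def algebra_simps)
      then show ?thesis using zero[of a b] by simp
    qed
    also have "ennreal \<dots> = (\<integral>\<^sup>+x. ennreal (?I x * max 0 (- g x)) \<partial>lborel)"
      by (intro nn_integral_eq_integral[symmetric] i AE_I2) auto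
    also have "\<dots> = (\<integral>\<^sup>+x. ennreal (- g x) * indicator (box a b) x \<partial>lborel)"
      by (intro nn_integral_cong) (auto simp: indicator_def max_def ennreal_neg)
    finally show ?thesis .
  qed
  have "?P = ?N"
  proof (rule measure_eqI_generator_eq[where E="range (\<lambda>(a, b). box a b)" and \<Omega>=UNIV and A="\<lambda>n::nat. box (- (real n *\<^sub>R One)) (real n *\<^sub>R One)"])
    show "Int_stable (range (\<lambda>(a, b). box a b :: 'a set))" by (auto simp: Int_stable_def box_Int_box)
    show "emeasure ?P X = emeasure ?N X" if "X \<in> range (\<lambda>(a, b). box a b)" for X
      using that pn by (auto simp: emeasure_density)
    show "sets ?P = sigma_sets UNIV (range (\<lambda>(a, b). box a b))" "sets ?N = sigma_sets UNIV (range (\<lambda>(a, b). box a b))"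
      by (simp_all add: borel_eq_box)
    show "(\<Union>i::nat. box (- (real i *\<^sub>R One)) (real i *\<^sub>R One) :: 'a set) = UNIV" by (rule UN_box_eq_UNIV)
    fix n :: nat
    let ?B = "box (- (real n *\<^sub>R One)) (real n *\<^sub>R One) :: 'a set"
    have "emeasure ?P ?B \<le> (\<integral>\<^sup>+x. ennreal (norm (g x)) \<partial>lborel)"
      by (subst emeasure_density) (auto intro!: nn_integral_mono simp: indicator_def intro: ennreal_leI)
    also have "\<dots> < \<infinity>" using g by (simp add: integrable_iff_bounded)
    finally show "emeasure ?P ?B \<noteq> \<infinity>" by simp
  qed auto
  then have "AE x in lborel. ennreal (g x) = ennreal (- g x)"
    by (intro sigma_finite_measure.density_unique[OF lborel.sigma_finite_measure_axioms]) auto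
  then show ?thesis
  proof eventually_elim
    case (elim x)
    then show ?case by (cases "g x \<ge> 0") (auto simp: ennreal_neg ennreal_eq_0_iff)
  qed
qed

text \<open>The boxes of a product space are products of boxes, so the kernel, restricted to a bounded set of first arguments to be
  integrable, integrates to 0 over every box of the product.\<close>

lemma kernel_zero_of_box_integrals:
  fixes D :: "'a::euclidean_space \<Rightarrow> 'a \<Rightarrow> real"
  assumes [measurable]: "case_prod D \<in> borel_measurable (borel \<Otimes>\<^sub>M borel)" "h \<in> borel_measurable borel"
    and D: "\<And>x y. ennreal \<bar>D x y\<bar> \<le> h (x - y)" and h: "(\<integral>\<^sup>+t. h t \<partial>lborel) < \<infinity>"
    and zero: "\<And>a b. AE x in lborel. (\<integral>y. indicator (box a b) y * D x y \<partial>lborel) = 0"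
  shows "AE x in lborel. AE y in lborel. D x y = 0"
proof -
  have meas[measurable]: "case_prod D \<in> borel_measurable (lborel \<Otimes>\<^sub>M lborel)"
    using assms(1) by (simp cong: measurable_cong_sets)
  let ?B = "\<lambda>n::nat. box (- (real n *\<^sub>R One)) (real n *\<^sub>R One) :: 'a set"
  have "AE z in lborel \<Otimes>\<^sub>M lborel. \<forall>n. indicator (?B n) (fst z) * D (fst z) (snd z) = 0"
    unfolding AE_all_countable
  proof
    fix n
    let ?D = "\<lambda>z. indicator (?B n) (fst z) * D (fst z) (snd z)"
    have "(\<integral>\<^sup>+z. ennreal \<bar>?D z\<bar> \<partial>(lborel \<Otimes>\<^sub>M lborel)) = (\<integral>\<^sup>+x. \<integral>\<^sup>+y. ennreal \<bar>indicator (?B n) x * D x y\<bar> \<partial>lborel \<partial>lborel)"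
      using lborel.nn_integral_fst[of "\<lambda>z. ennreal \<bar>?D z\<bar>" lborel] by simp
    also have "\<dots> \<le> (\<integral>\<^sup>+x. indicator (?B n) x * (\<integral>\<^sup>+t. h t \<partial>lborel) \<partial>lborel)"
    proof (intro nn_integral_mono)
      fix x
      have "(\<integral>\<^sup>+y. ennreal \<bar>indicator (?B n) x * D x y\<bar> \<partial>lborel) \<le> (\<integral>\<^sup>+y. indicator (?B n) x * h (x - y) \<partial>lborel)"
        using D by (intro nn_integral_mono) (auto simp: indicator_def)
      also have "\<dots> = indicator (?B n) x * (\<integral>\<^sup>+t. h t \<partial>lborel)"
        by (simp add: nn_integral_cmult nn_integral_lborel_diff_left)
      finally show "(\<integral>\<^sup>+y. ennreal \<bar>indicator (?B n) x * D x y\<bar> \<partial>lborel) \<le> indicator (?B n) x * (\<integral>\<^sup>+t. h t \<partial>lborel)" .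
    qed
    also have "\<dots> = emeasure lborel (?B n) * (\<integral>\<^sup>+t. h t \<partial>lborel)"
      by (subst nn_integral_multc) auto
    also have "\<dots> < \<infinity>" using h emeasure_lborel_box_finite[of "- (real n *\<^sub>R One)" "real n *\<^sub>R One :: 'a"]
      by (simp add: ennreal_mult_less_top)
    finally have int: "integrable (lborel \<Otimes>\<^sub>M lborel) ?D"
      by (intro integrableI_bounded) auto
    have "AE z in lborel. ?D z = 0"
    proof (rule AE_zero_of_box_integrals)
      show "integrable lborel ?D" using int by (simp add: lborel_prod)
      fix a b :: "'a \<times> 'a"
      obtain a1 a2 b1 b2 where ab: "a = (a1, a2)" "b = (b1, b2)" by (cases a, cases b) auto
      have "integrable (lborel \<Otimes>\<^sub>M lborel) (\<lambda>z. indicator (box a b) z *\<^sub>R ?D z)"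
        by (rule integrable_mult_indicator[OF _ int]) (simp add: ab box_Times_eq)
      then have int2: "integrable (lborel \<Otimes>\<^sub>M lborel) (\<lambda>z. indicator (box a b) z * ?D z)" by simp
      have "(\<integral>z. indicator (box a b) z * ?D z \<partial>lborel) = (\<integral>z. indicator (box a b) z * ?D z \<partial>(lborel \<Otimes>\<^sub>M lborel))"
        by (simp add: lborel_prod)
      also have "\<dots> = (\<integral>x. \<integral>y. indicator (box a b) (x, y) * ?D (x, y) \<partial>lborel \<partial>lborel)"
        using lborel_pair.integral_fst'[OF int2] by simp
      also have "\<dots> = (\<integral>x. (indicator (box a1 b1) x * indicator (?B n) x) * (\<integral>y. indicator (box a2 b2) y * D x y \<partial>lborel) \<partial>(lborel :: 'a measure))"
        by (intro Bochner_Integration.integral_cong refl)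
           (auto simp: ab box_Times_eq indicator_times simp flip: integral_mult_right_zero intro!: Bochner_Integration.integral_cong)
      also have "\<dots> = (\<integral>x. 0 \<partial>(lborel :: 'a measure))"
        using zero[of a2 b2] by (intro integral_cong_AE) (auto elim!: eventually_mono)
      finally show "(\<integral>z. indicator (box a b) z * ?D z \<partial>lborel) = 0" by simp
    qed
    then show "AE z in lborel \<Otimes>\<^sub>M lborel. ?D z = 0" by (subst lborel_prod)
  qed
  from lborel_pair.AE_pair[OF this] show ?thesis
  proof eventually_elim
    case (elim x)
    obtain n where "x \<in> ?B n" using UN_box_eq_UNIV[where 'a='a] by blast
    show ?case using elim
    proof eventually_elim
      case (elim y)
      from elim[rule_format, of n] \<open>x \<in> ?B n\<close> show ?case by simp
    qed
  qed
qed

section \<open>Lebesgue norms as Luxemburg norms\<close>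

lemma Inf_ennreal_ge: "N \<ge> 0 \<Longrightarrow> Inf {ennreal r | r. r > 0 \<and> N \<le> r} = ennreal N"
proof (rule antisym)
  assume N: "N \<ge> 0"
  show "Inf {ennreal r | r. r > 0 \<and> N \<le> r} \<le> ennreal N"
  proof (rule ennreal_le_epsilon)
    fix e :: real assume "0 < e"
    then have "ennreal (N + e) \<in> {ennreal r | r. r > 0 \<and> N \<le> r}" using N by (intro CollectI exI[of _ "N + e"]) auto
    then have "Inf {ennreal r | r. r > 0 \<and> N \<le> r} \<le> ennreal (N + e)" by (rule Inf_lower)
    then show "Inf {ennreal r | r. r > 0 \<and> N \<le> r} \<le> ennreal N + ennreal e" using N \<open>0 < e\<close> by simp
  qed
  show "ennreal N \<le> Inf {ennreal r | r. r > 0 \<and> N \<le> r}"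
    by (rule Inf_greatest) (auto intro: ennreal_leI)
qed

lemma luxemburg_finite_obtain:
  assumes "luxemburg M \<phi> f < \<infinity>"
  obtains r where "r > 0" "(\<integral>\<^sup>+x. \<phi> (ennreal (1 / r) * f x) \<partial>M) \<le> 1"
  using assms unfolding luxemburg_def Inf_less_iff by auto

lemma Lp_luxemburg:
  fixes u :: "'a::euclidean_space \<Rightarrow> 'e::real_normed_vector"
  assumes p: "1 \<le> p" and um: "u \<in> borel_measurable lebesgue"
  defines "\<Lambda> \<equiv> luxemburg lborel (lp_phi p) (\<lambda>x. ennreal (norm (u x)))"
  shows "u \<in> Lp p \<Longrightarrow> \<Lambda> = ennreal (Lp_norm p u)" "\<Lambda> < \<infinity> \<Longrightarrow> u \<in> Lp p"
proof -
  have nm[measurable]: "(\<lambda>x. norm (u x)) \<in> borel_measurable lebesgue"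
    by (rule measurable_compose[OF um borel_measurable_norm]) 
  let ?F = "\<lambda>r. \<integral>\<^sup>+x. lp_phi p (ennreal (1 / r) * ennreal (norm (u x))) \<partial>lborel"
  have "(u \<in> Lp p \<longrightarrow> \<Lambda> = ennreal (Lp_norm p u)) \<and> (\<Lambda> < \<infinity> \<longrightarrow> u \<in> Lp p)"
  proof (cases "p = \<infinity>")
    case True
    define E where "E = esssup lebesgue (\<lambda>x. ennreal (norm (u x)))"
    have F: "?F r \<le> 1 \<longleftrightarrow> E \<le> ennreal r" if r: "r > 0" for r
    proof -
      have le1: "ennreal (1 / r) * ennreal (norm (u x)) \<le> 1 \<longleftrightarrow> ennreal (norm (u x)) \<le> ennreal r" for x
        using r by (simp add: ennreal_mult[symmetric] ennreal_le_iff ennreal_le_1 divide_le_eq)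
      have E_iff: "E \<le> ennreal r \<longleftrightarrow> (AE x in lborel. ennreal (norm (u x)) \<le> ennreal r)"
      proof
        assume E: "E \<le> ennreal r"
        have "AE x in lebesgue. ennreal (norm (u x)) \<le> E" unfolding E_def by (rule esssup_AE)
        then have "AE x in lebesgue. ennreal (norm (u x)) \<le> ennreal r" by eventually_elim (rule order_trans[OF _ E])
        then show "AE x in lborel. ennreal (norm (u x)) \<le> ennreal r" by (simp add: AE_completion_iff)
      next
        assume "AE x in lborel. ennreal (norm (u x)) \<le> ennreal r"
        then show "E \<le> ennreal r" unfolding E_def by (intro esssup_I) (auto simp: AE_completion_iff)
      qed
      show ?thesis unfolding E_iff
      proof
        assume "?F r \<le> 1"
        then have "(\<integral>\<^sup>+x. lp_phi p (ennreal (1 / r) * ennreal (norm (u x))) \<partial>lebesgue) \<noteq> \<infinity>"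
          by (auto simp: nn_integral_completion top_unique)
        moreover have "(\<lambda>x. lp_phi p (ennreal (1 / r) * ennreal (norm (u x)))) \<in> borel_measurable lebesgue"
          by (rule measurable_compose[OF _ youngD(2)[OF young_lp_phi[OF p]]]) measurable
        ultimately have "AE x in lebesgue. lp_phi p (ennreal (1 / r) * ennreal (norm (u x))) \<noteq> \<infinity>"
          by (intro nn_integral_PInf_AE)
        then have "AE x in lebesgue. ennreal (norm (u x)) \<le> ennreal r"
          by eventually_elim (auto simp: lp_phi_def True le1 split: if_splits)
        then show "AE x in lborel. ennreal (norm (u x)) \<le> ennreal r" by (simp add: AE_completion_iff)
      next
        assume ae: "AE x in lborel. ennreal (norm (u x)) \<le> ennreal r"
        have "?F r \<le> (\<integral>\<^sup>+x. 0 \<partial>(lborel :: 'a measure))"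
          using ae by (intro nn_integral_mono_AE) (auto simp: lp_phi_def True le1 elim!: eventually_mono)
        then show "?F r \<le> 1" by simp
      qed
    qed
    show ?thesis
    proof (intro conjI impI)
      assume "u \<in> Lp p"
      then have "E < \<infinity>" by (simp add: Lp_def True E_def)
      then obtain e where e: "E = ennreal e" "e \<ge> 0" by (cases E) auto
      have "{ennreal r | r. r > 0 \<and> ?F r \<le> 1} = {ennreal r | r. r > 0 \<and> e \<le> r}"
        using F e by (auto simp: ennreal_le_iff)
      then show "\<Lambda> = ennreal (Lp_norm p u)"
        unfolding \<Lambda>_def luxemburg_def using Inf_ennreal_ge[OF e(2)] e by (simp add: Lp_norm_def True E_def[symmetric])
    next
      assume "\<Lambda> < \<infinity>"
      then obtain r where "r > 0" "?F r \<le> 1" unfolding \<Lambda>_def by (rule luxemburg_finite_obtain)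
      then have "E \<le> ennreal r" using F by blast
      then have "E < \<infinity>" by (rule le_less_trans) simp
      then show "u \<in> Lp p" using um by (simp add: Lp_def True E_def)
    qed
  next
    case False
    define q where "q = enn2real p"
    have q: "q \<ge> 1" unfolding q_def using p False
      by (metis enn2real_1 enn2real_mono less_top infinity_ennreal_def)
    define I where "I = (\<integral>\<^sup>+x. ennreal (norm (u x) powr q) \<partial>lebesgue)"
    have F: "?F r = ennreal (r powr (- q)) * I" if r: "r > 0" for r
    proof -
      have "?F r = (\<integral>\<^sup>+x. ennreal (r powr (- q)) * ennreal (norm (u x) powr q) \<partial>lebesgue)"
        unfolding nn_integral_completion
      proof (intro nn_integral_cong)
        fix x
        have "ennreal (1 / r) * ennreal (norm (u x)) = ennreal (norm (u x) / r)"
          using r by (subst ennreal_mult[symmetric]) auto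
        then have "lp_phi p (ennreal (1 / r) * ennreal (norm (u x))) = ennreal ((norm (u x) / r) powr q)"
          using r False by (simp add: lp_phi_def q_def)
        also have "(norm (u x) / r) powr q = r powr (- q) * norm (u x) powr q"
          using r by (simp add: powr_divide powr_minus_divide)
        finally show "lp_phi p (ennreal (1 / r) * ennreal (norm (u x))) = ennreal (r powr (- q)) * ennreal (norm (u x) powr q)"
          by (simp add: ennreal_mult)
      qed
      also have "\<dots> = ennreal (r powr (- q)) * I" unfolding I_def by (rule nn_integral_cmult) measurable
      finally show ?thesis .
    qed
    have Lp_iff: "u \<in> Lp p \<longleftrightarrow> I < \<infinity>"
    proof -
      have "u \<in> Lp p \<longleftrightarrow> integrable lebesgue (\<lambda>x. norm (u x) powr q)" using um False by (simp add: Lp_def q_def)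
      moreover have "(\<lambda>x. norm (u x) powr q) \<in> borel_measurable lebesgue" by measurable
      ultimately show ?thesis unfolding integrable_iff_bounded I_def by simp
    qed
    show ?thesis
    proof (intro conjI impI)
      assume uL: "u \<in> Lp p"
      then have int: "integrable lebesgue (\<lambda>x. norm (u x) powr q)" using False by (simp add: Lp_def q_def)
      define i where "i = (\<integral>x. norm (u x) powr q \<partial>lebesgue)"
      have i: "I = ennreal i" "i \<ge> 0" unfolding I_def i_def using int by (auto intro!: nn_integral_eq_integral)
      define N where "N = i powr (1 / q)"
      have Nq: "N powr q = i" unfolding N_def using q i(2) by (cases "i = 0") (auto simp: powr_powr)
      have "?F r \<le> 1 \<longleftrightarrow> N \<le> r" if r: "r > 0" for r
      proof -
        have "?F r \<le> 1 \<longleftrightarrow> r powr (- q) * i \<le> 1"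
          unfolding F[OF r] i(1) using i(2) by (simp add: ennreal_mult[symmetric] ennreal_le_1)
        also have "\<dots> \<longleftrightarrow> i \<le> r powr q" using r by (simp add: powr_minus field_simps)
        also have "\<dots> \<longleftrightarrow> N powr q \<le> r powr q" by (simp add: Nq)
        also have "\<dots> \<longleftrightarrow> N \<le> r"
        proof
          assume le: "N powr q \<le> r powr q"
          show "N \<le> r"
          proof (rule ccontr)
            assume "\<not> N \<le> r"
            then have "r powr q < N powr q" using r q by (intro powr_less_mono2) auto
            with le show False by simp
          qed
        next
          assume "N \<le> r"
          then show "N powr q \<le> r powr q" using q by (intro powr_mono2) (auto simp: N_def)
        qed
        finally show ?thesis .
      qed
      then have "{ennreal r | r. r > 0 \<and> ?F r \<le> 1} = {ennreal r | r. r > 0 \<and> N \<le> r}" by auto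
      then show "\<Lambda> = ennreal (Lp_norm p u)"
        unfolding \<Lambda>_def luxemburg_def using Inf_ennreal_ge[of N] False
        by (simp add: Lp_norm_def N_def i_def q_def)
    next
      assume "\<Lambda> < \<infinity>"
      then obtain r where r: "r > 0" "?F r \<le> 1" unfolding \<Lambda>_def by (rule luxemburg_finite_obtain)
      then have "ennreal (r powr (- q)) * I < \<infinity>" unfolding F[OF r(1)] by (auto intro: le_less_trans)
      then have "I < \<infinity>" using r(1) by (auto simp: ennreal_mult_less_top)
      then show "u \<in> Lp p" by (simp add: Lp_iff)
    qed
  qed
  then show "u \<in> Lp p \<Longrightarrow> \<Lambda> = ennreal (Lp_norm p u)" "\<Lambda> < \<infinity> \<Longrightarrow> u \<in> Lp p" by auto
qed

section \<open>Coordinate functions and matrix kernels\<close>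

lemma measurable_lebesgue_AE_eq:
  fixes f g :: "'a::euclidean_space \<Rightarrow> 'b::topological_space"
  assumes f: "f \<in> borel_measurable lebesgue" and eq: "AE x in lborel. f x = g x"
  shows "g \<in> borel_measurable lebesgue"
proof (rule measurableI)
  fix A :: "'b set" assume A: "A \<in> sets borel"
  have "f -` A \<inter> space lebesgue \<in> sets lebesgue" by (rule measurable_sets[OF f A])
  moreover have "AE x in lebesgue. x \<in> f -` A \<inter> space lebesgue \<longleftrightarrow> x \<in> g -` A \<inter> space lebesgue"
    unfolding AE_completion_iff using eq by eventually_elim simp
  ultimately show "g -` A \<inter> space lebesgue \<in> sets lebesgue"
    using completion.in_sets_AE by blast
qed auto

lemma borel_imp_lebesgue: "f \<in> borel_measurable borel \<Longrightarrow> f \<in> borel_measurable lebesgue"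
  by (simp add: measurable_completion)

lemma integral_LM:
  fixes f :: "'a::euclidean_space \<times> nat \<Rightarrow> real"
  assumes f: "integrable (LM d) f"
  shows "i < d \<Longrightarrow> integrable lborel (\<lambda>x. f (x, i))" "(\<integral>z. f z \<partial>LM d) = (\<Sum>i<d. \<integral>x. f (x, i) \<partial>lborel)"
proof -
  have fm: "f \<in> borel_measurable (LM d)" using f by (rule borel_measurable_integrable)
  then have [measurable]: "\<And>i. (\<lambda>x. f (x, i)) \<in> borel_measurable borel" by (simp add: LM_measurable_iff)
  have fin: "(\<integral>\<^sup>+x. (\<Sum>i<d. ennreal (norm (f (x, i)))) \<partial>lborel) < \<infinity>"
    using f fm nn_integral_LM[of "\<lambda>z. ennreal (norm (f z))" d] by (simp add: integrable_iff_bounded)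
  show int: "integrable lborel (\<lambda>x. f (x, i))" if "i < d" for i
  proof (rule integrableI_bounded)
    have "(\<integral>\<^sup>+x. ennreal (norm (f (x, i))) \<partial>lborel) \<le> (\<integral>\<^sup>+x. (\<Sum>i<d. ennreal (norm (f (x, i)))) \<partial>lborel)"
      using that by (intro nn_integral_mono member_le_sum) auto
    then show "(\<integral>\<^sup>+x. ennreal (norm (f (x, i))) \<partial>lborel) < \<infinity>" using fin by (rule le_less_trans)
  qed simp
  have "integrable (lborel \<Otimes>\<^sub>M idx d) f" using f by (simp add: LM_def)
  from LMp.integral_fst'[OF this]
  have "(\<integral>z. f z \<partial>LM d) = (\<integral>x. \<integral>i. f (x, i) \<partial>idx d \<partial>lborel)" by (simp add: LM_def)
  also have "\<dots> = (\<integral>x. (\<Sum>i<d. f (x, i)) \<partial>lborel)"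
  proof (intro Bochner_Integration.integral_cong refl)
    fix x
    have "idx d = density (count_space UNIV) (\<lambda>i. ennreal (indicator {..<d} i))"
      unfolding idx_def by (simp add: ennreal_indicator)
    then have "(\<integral>i. f (x, i) \<partial>idx d) = (\<integral>i. indicator {..<d} i *\<^sub>R f (x, i) \<partial>count_space UNIV)"
      by (simp add: integral_density)
    also have "\<dots> = (\<Sum>i | i \<in> UNIV \<and> indicator {..<d} i *\<^sub>R f (x, i) \<noteq> 0. indicator {..<d} i *\<^sub>R f (x, i))"
      by (rule lebesgue_integral_count_space_finite_support) (rule finite_subset[of _ "{..<d}"], auto simp: indicator_def split: if_splits)
    also have "\<dots> = (\<Sum>i<d. f (x, i))"
      by (rule sum.mono_neutral_cong_left) (auto simp: indicator_def split: if_splits)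
    finally show "(\<integral>i. f (x, i) \<partial>idx d) = (\<Sum>i<d. f (x, i))" .
  qed
  also have "\<dots> = (\<Sum>i<d. \<integral>x. f (x, i) \<partial>lborel)"
    by (rule Bochner_Integration.integral_sum) (use int in auto)
  finally show "(\<integral>z. f z \<partial>LM d) = (\<Sum>i<d. \<integral>x. f (x, i) \<partial>lborel)" .
qed

context real_coordinates
begin

text \<open>The coordinates of \<open>u\<close>, changed on a null set to become Borel measurable.\<close>

definition rep :: "('a::euclidean_space \<times> nat \<Rightarrow> real) \<Rightarrow> ('a \<Rightarrow> 'e) \<Rightarrow> bool" where
  "rep v u \<longleftrightarrow> v \<in> borel_measurable (LM d) \<and> (AE x in lborel. \<forall>i<d. v (x, i) = co i (u x))"

lemma rep_exists:
  fixes u :: "'a::euclidean_space \<Rightarrow> 'e"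
  assumes u: "u \<in> borel_measurable lebesgue"
  obtains v where "rep v u"
proof -
  have "\<exists>g. g \<in> borel_measurable lborel \<and> (AE x in lborel. co i (u x) = g x)" for i
    using completion_ex_borel_measurable_real[of "\<lambda>x. co i (u x)" lborel] measurable_compose[OF u co_measurable] by blast
  then obtain g where g: "\<And>i. g i \<in> borel_measurable lborel" "\<And>i. AE x in lborel. co i (u x) = g i x" by metis
  have "AE x in lborel. \<forall>i. co i (u x) = g i x" using g(2) by (simp add: AE_all_countable)
  then have "rep (\<lambda>(x, i). g i x) u"
    unfolding rep_def using g(1) by (auto simp: LM_measurable_iff elim!: eventually_mono)
  then show ?thesis by (rule that)
qed

lemma rep_sum:
  assumes "v \<in> borel_measurable (LM d)"
  shows "rep v (\<lambda>x. \<Sum>i<d. v (x, i) *\<^sub>R b i)" "(\<lambda>x. \<Sum>i<d. v (x, i) *\<^sub>R b i) \<in> borel_measurable borel"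
proof -
  have [measurable]: "\<And>i. (\<lambda>x. v (x, i)) \<in> borel_measurable borel" using assms by (simp add: LM_measurable_iff)
  show "(\<lambda>x. \<Sum>i<d. v (x, i) *\<^sub>R b i) \<in> borel_measurable borel" by measurable
  show "rep v (\<lambda>x. \<Sum>i<d. v (x, i) *\<^sub>R b i)" using assms by (simp add: rep_def co_sum_basis)
qed

lemma rep_AE_eq:
  assumes "rep v u"
  shows "AE x in lborel. u x = (\<Sum>i<d. v (x, i) *\<^sub>R b i)"
  using assms unfolding rep_def
  by (auto elim!: eventually_mono simp: expand)

lemma rep_measurable:
  assumes "rep v u"
  shows "u \<in> borel_measurable lebesgue"
proof (rule measurable_lebesgue_AE_eq)
  show "(\<lambda>x. \<Sum>i<d. v (x, i) *\<^sub>R b i) \<in> borel_measurable lebesgue"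
    using rep_sum(2) assms by (intro borel_imp_lebesgue) (auto simp: rep_def)
  show "AE x in lborel. (\<Sum>i<d. v (x, i) *\<^sub>R b i) = u x" using rep_AE_eq[OF assms] by eventually_elim simp
qed

lemma rep_unique: "rep v u \<Longrightarrow> rep w u \<Longrightarrow> AE z in LM d. v z = w z"
  unfolding rep_def AE_LM by (auto elim: eventually_elim2)

lemma rep_unique': "rep v u \<Longrightarrow> rep v u' \<Longrightarrow> AE x in lborel. u x = u' x"
  by (drule rep_AE_eq, drule rep_AE_eq) (auto elim: eventually_elim2)

lemma rep_cong: "rep v u \<Longrightarrow> w \<in> borel_measurable (LM d) \<Longrightarrow> AE z in LM d. v z = w z \<Longrightarrow> rep w u"
  unfolding rep_def AE_LM by (auto elim: eventually_elim2)

lemma rep_cong': "rep v u \<Longrightarrow> AE x in lborel. u x = u' x \<Longrightarrow> rep v u'"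
  unfolding rep_def by (auto elim: eventually_elim2)

lemma rep_add: "rep v u \<Longrightarrow> rep w u' \<Longrightarrow> rep (\<lambda>z. v z + w z) (\<lambda>x. u x + u' x)"
  unfolding rep_def by (auto elim: eventually_elim2 simp: co_add)

lemma luxemburg_rep_le:
  assumes y: "young \<phi>" and r: "rep v u"
  shows "luxemburg (LM d) \<phi> (\<lambda>z. ennreal \<bar>v z\<bar>)
     \<le> ennreal (coC * max 1 (real d)) * luxemburg lborel \<phi> (\<lambda>x. ennreal (norm (u x)))"
proof -
  define D where "D = max 1 (real d)"
  have D: "1 \<le> D" "real d \<le> D" by (simp_all add: D_def)
  show ?thesis unfolding D_def[symmetric]
  proof (rule le_mult_luxemburgI)
  show A: "0 < coC * D" using coC(1) D by simp
  note [measurable] = youngD(2)[OF y]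
  have [measurable]: "v \<in> borel_measurable (LM d)" using r by (simp add: rep_def)
  fix s assume s: "luxemburg lborel \<phi> (\<lambda>x. ennreal (norm (u x))) < ennreal s" "s > 0"
  let ?t = "coC * D * s"
  have "(\<integral>\<^sup>+z. \<phi> (ennreal (1 / ?t) * ennreal \<bar>v z\<bar>) \<partial>LM d)
    = (\<integral>\<^sup>+x. (\<Sum>i<d. \<phi> (ennreal (1 / ?t) * ennreal \<bar>v (x, i)\<bar>)) \<partial>lborel)"
    by (rule nn_integral_LM) measurable
  also have "\<dots> \<le> (\<integral>\<^sup>+x. \<phi> (ennreal (1 / s) * ennreal (norm (u x))) \<partial>lborel)"
  proof (rule nn_integral_mono_AE)
    have "AE x in lborel. \<forall>i<d. v (x, i) = co i (u x)" using r by (simp add: rep_def)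
    then show "AE x in lborel. (\<Sum>i<d. \<phi> (ennreal (1 / ?t) * ennreal \<bar>v (x, i)\<bar>)) \<le> \<phi> (ennreal (1 / s) * ennreal (norm (u x)))"
    proof eventually_elim
      case (elim x)
      let ?y = "ennreal (1 / s) * ennreal (norm (u x))"
      have "\<phi> (ennreal (1 / ?t) * ennreal \<bar>v (x, i)\<bar>) \<le> ennreal (1 / D) * \<phi> ?y" if "i < d" for i
      proof -
        have "1 / ?t * \<bar>v (x, i)\<bar> \<le> 1 / ?t * (coC * norm (u x))"
          using A s(2) coC(2)[OF that, of "u x"] elim that by (intro mult_left_mono) auto
        also have "\<dots> = 1 / D * (1 / s * norm (u x))" using coC(1) D(1) by simp
        finally have "ennreal (1 / ?t) * ennreal \<bar>v (x, i)\<bar> \<le> ennreal (1 / D) * ?y"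
          using A s(2) D(1) by (simp add: ennreal_mult[symmetric] ennreal_leI)
        then have "\<phi> (ennreal (1 / ?t) * ennreal \<bar>v (x, i)\<bar>) \<le> \<phi> (ennreal (1 / D) * ?y)"
          by (rule youngD(1)[OF y])
        also have "\<dots> \<le> ennreal (1 / D) * \<phi> ?y" by (rule young_mult_le[OF y]) (use D in \<open>simp add: ennreal_le_1\<close>)
        finally show ?thesis .
      qed
      then have "(\<Sum>i<d. \<phi> (ennreal (1 / ?t) * ennreal \<bar>v (x, i)\<bar>)) \<le> (\<Sum>i<d. ennreal (1 / D) * \<phi> ?y)"
        by (intro sum_mono) auto
      also have "\<dots> = (of_nat d * ennreal (1 / D)) * \<phi> ?y" by (simp add: mult.assoc)
      also have "of_nat d * ennreal (1 / D) \<le> 1"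
        using D by (simp add: ennreal_of_nat_eq_real_of_nat ennreal_mult[symmetric] ennreal_le_1)
      finally show ?case by (simp add: mult_right_mono)
    qed
  qed
  also have "\<dots> \<le> 1" by (rule luxemburg_less_imp[OF y s(1)])
  finally have "luxemburg (LM d) \<phi> (\<lambda>z. ennreal \<bar>v z\<bar>) \<le> ennreal ?t"
    using A s(2) by (intro luxemburg_le) auto
  then show "luxemburg (LM d) \<phi> (\<lambda>z. ennreal \<bar>v z\<bar>) \<le> ennreal (coC * D) * ennreal s"
    using A s(2) by (simp add: ennreal_mult)
qed
qed

lemma luxemburg_rep_ge:
  assumes y: "young \<phi>" and r: "rep v u"
  shows "luxemburg lborel \<phi> (\<lambda>x. ennreal (norm (u x)))
     \<le> ennreal (bC * max 1 (real d)) * luxemburg (LM d) \<phi> (\<lambda>z. ennreal \<bar>v z\<bar>)"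
proof -
  define D where "D = max 1 (real d)"
  have D: "1 \<le> D" "real d \<le> D" by (simp_all add: D_def)
  show ?thesis unfolding D_def[symmetric]
  proof (rule le_mult_luxemburgI)
  show A: "0 < bC * D" using bC(1) D by simp
  note [measurable] = youngD(2)[OF y]
  have [measurable]: "v \<in> borel_measurable (LM d)" using r by (simp add: rep_def)
  fix s assume s: "luxemburg (LM d) \<phi> (\<lambda>z. ennreal \<bar>v z\<bar>) < ennreal s" "s > 0"
  let ?t = "bC * D * s"
  have "(\<integral>\<^sup>+x. \<phi> (ennreal (1 / ?t) * ennreal (norm (u x))) \<partial>lborel)
    \<le> (\<integral>\<^sup>+x. (\<Sum>i<d. \<phi> (ennreal (1 / s) * ennreal \<bar>v (x, i)\<bar>)) \<partial>lborel)"
  proof (rule nn_integral_mono_AE)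
    have "AE x in lborel. \<forall>i<d. v (x, i) = co i (u x)" using r by (simp add: rep_def)
    then show "AE x in lborel. \<phi> (ennreal (1 / ?t) * ennreal (norm (u x))) \<le> (\<Sum>i<d. \<phi> (ennreal (1 / s) * ennreal \<bar>v (x, i)\<bar>))"
    proof eventually_elim
      case (elim x)
      let ?y = "\<lambda>i. ennreal (1 / s) * ennreal \<bar>v (x, i)\<bar>"
      let ?M = "count_space {..<d}"
      have "1 / ?t * norm (u x) \<le> 1 / ?t * (bC * (\<Sum>i<d. \<bar>co i (u x)\<bar>))"
        using A s(2) norm_le_co[of "u x"] by (intro mult_left_mono) auto
      also have "\<dots> = (\<Sum>i<d. 1 / D * (1 / s * \<bar>v (x, i)\<bar>))"
        using elim bC(1) D(1) by (simp add: sum_distrib_left[symmetric] sum_divide_distrib[symmetric])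
      finally have "ennreal (1 / ?t) * ennreal (norm (u x)) \<le> ennreal (\<Sum>i<d. 1 / D * (1 / s * \<bar>v (x, i)\<bar>))"
        using A s(2) D(1) by (simp add: ennreal_mult[symmetric] ennreal_leI)
      also have "\<dots> = (\<Sum>i<d. ennreal (1 / D * (1 / s * \<bar>v (x, i)\<bar>)))"
        by (rule sum_ennreal[symmetric]) (use s(2) D(1) in auto)
      also have "\<dots> = (\<Sum>i<d. ennreal (1 / D) * ?y i)"
        using s(2) D(1) by (intro sum.cong refl) (simp add: ennreal_mult[symmetric])
      also have "\<dots> = (\<integral>\<^sup>+i. ennreal (1 / D) * ?y i \<partial>?M)" by (simp add: nn_integral_count_space_finite)
      finally have "\<phi> (ennreal (1 / ?t) * ennreal (norm (u x))) \<le> \<phi> (\<integral>\<^sup>+i. ennreal (1 / D) * ?y i \<partial>?M)"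
        by (rule youngD(1)[OF y])
      also have "\<dots> \<le> (\<integral>\<^sup>+i. ennreal (1 / D) * \<phi> (?y i) \<partial>?M)"
        by (rule young_jensen_weighted[OF y])
           (use D in \<open>auto simp: nn_integral_count_space_finite ennreal_of_nat_eq_real_of_nat ennreal_mult[symmetric] ennreal_le_1\<close>)
      also have "\<dots> \<le> (\<integral>\<^sup>+i. 1 * \<phi> (?y i) \<partial>?M)"
        by (intro nn_integral_mono mult_right_mono) (use D in \<open>auto simp: ennreal_le_1\<close>)
      finally show ?case by (simp add: nn_integral_count_space_finite)
    qed
  qed
  also have "\<dots> = (\<integral>\<^sup>+z. \<phi> (ennreal (1 / s) * ennreal \<bar>v z\<bar>) \<partial>LM d)"
    by (rule nn_integral_LM[symmetric]) measurable
  also have "\<dots> \<le> 1" by (rule luxemburg_less_imp[OF y s(1)])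
  finally have "luxemburg lborel \<phi> (\<lambda>x. ennreal (norm (u x))) \<le> ennreal ?t"
    using A s(2) by (intro luxemburg_le) auto
  then show "luxemburg lborel \<phi> (\<lambda>x. ennreal (norm (u x))) \<le> ennreal (bC * D) * ennreal s"
    using A s(2) by (simp add: ennreal_mult)
qed
qed

text \<open>The matrix of an operator kernel in the arguments of the integral operator: the second argument of \<open>N\<close> is the
  difference.\<close>

definition krep :: "('a::euclidean_space \<times> nat \<Rightarrow> 'a \<times> nat \<Rightarrow> real) \<Rightarrow> ('a \<Rightarrow> 'a \<Rightarrow> 'e \<Rightarrow>\<^sub>L 'e) \<Rightarrow> bool" where
  "krep k N \<longleftrightarrow> (AE x in lborel. AE y in lborel. \<forall>i<d. \<forall>j<d. k (x, i) (y, j) = entry i j (N x (x - y)))"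

lemma rep_integral_op:
  fixes u :: "'a::euclidean_space \<Rightarrow> 'e"
  assumes km: "case_prod k \<in> borel_measurable (LM d \<Otimes>\<^sub>M LM d)" and k: "krep k N" and r: "rep v u"
    and int: "AE z in LM d. integrable (LM d) (\<lambda>y. k z y * v y)"
  shows "rep (kop (LM d) k v) (integral_op N u)"
  unfolding rep_def
proof
  interpret sigma_finite_measure "LM d :: ('a \<times> nat) measure" by (rule sigma_finite_LM)
  have vm[measurable]: "v \<in> borel_measurable (LM d)" using r by (simp add: rep_def)
  note [measurable] = km
  show "kop (LM d) k v \<in> borel_measurable (LM d)" by measurable
  have "AE x in lborel. \<forall>i<d. integrable (LM d) (\<lambda>y. k (x, i) y * v y)" using int by (simp add: AE_LM)
  then show "AE x in lborel. \<forall>i<d. kop (LM d) k v (x, i) = co i (integral_op N u x)"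
    using k unfolding krep_def
  proof eventually_elim
    case (elim x)
    have slice: "integrable lborel (\<lambda>y. k (x, i) (y, j) * v (y, j))" if "i < d" "j < d" for i j
      using integral_LM(1)[of d "\<lambda>y. k (x, i) y * v y"] elim(1) that by simp
    define G where "G y = (\<Sum>i<d. (\<Sum>j<d. k (x, i) (y, j) * v (y, j)) *\<^sub>R b i)" for y
    have Gint: "integrable lborel G"
      unfolding G_def by (intro Bochner_Integration.integrable_sum integrable_scaleR_left slice) auto
    have eq: "AE y in lborel. G y = blinfun_apply (N x (x - y)) (u y)"
    proof -
      have "AE y in lborel. \<forall>i<d. v (y, i) = co i (u y)" using r by (simp add: rep_def)
      then show ?thesis using elim(2)
      proof eventually_elim
        case (elim y)
        have "G y = (\<Sum>i<d. co i (blinfun_apply (N x (x - y)) (u y)) *\<^sub>R b i)"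
          unfolding G_def using elim by (intro sum.cong) (auto simp: co_apply intro!: sum.cong)
        then show ?case by (simp add: expand)
      qed
    qed
    have Gm: "G \<in> borel_measurable lborel" by (rule borel_measurable_integrable[OF Gint])
    then have Gl: "G \<in> borel_measurable lebesgue" by (rule measurable_completion)
    have "integral_op N u x = (\<integral>y. G y \<partial>lebesgue)"
      unfolding integral_op_def
      by (intro integral_cong_AE measurable_lebesgue_AE_eq[OF Gl eq] Gl) (use eq in \<open>auto simp: AE_completion_iff elim!: eventually_mono\<close>)
    also have "\<dots> = (\<integral>y. G y \<partial>lborel)" by (rule integral_completion[OF Gm])
    also have "\<dots> = (\<Sum>i<d. (\<Sum>j<d. \<integral>y. k (x, i) (y, j) * v (y, j) \<partial>lborel) *\<^sub>R b i)"
    proof -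
      have int: "integrable lborel (\<lambda>y. \<Sum>j<d. k (x, i) (y, j) * v (y, j))" if "i < d" for i
        by (rule Bochner_Integration.integrable_sum) (use slice that in auto)
      have "(\<integral>y. G y \<partial>lborel) = (\<Sum>i<d. \<integral>y. (\<Sum>j<d. k (x, i) (y, j) * v (y, j)) *\<^sub>R b i \<partial>lborel)"
        unfolding G_def by (rule Bochner_Integration.integral_sum) (use int in auto)
      also have "\<dots> = (\<Sum>i<d. (\<Sum>j<d. \<integral>y. k (x, i) (y, j) * v (y, j) \<partial>lborel) *\<^sub>R b i)"
      proof (rule sum.cong[OF refl])
        fix i assume "i \<in> {..<d}"
        then have i: "i < d" by simp
        have "(\<integral>y. (\<Sum>j<d. k (x, i) (y, j) * v (y, j)) *\<^sub>R b i \<partial>lborel) = (\<integral>y. (\<Sum>j<d. k (x, i) (y, j) * v (y, j)) \<partial>lborel) *\<^sub>R b i"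
          by (rule integral_scaleR_left) (rule int[OF i])
        also have "(\<integral>y. (\<Sum>j<d. k (x, i) (y, j) * v (y, j)) \<partial>lborel) = (\<Sum>j<d. \<integral>y. k (x, i) (y, j) * v (y, j) \<partial>lborel)"
          by (rule Bochner_Integration.integral_sum) (use slice[OF i] in auto)
        finally show "(\<integral>y. (\<Sum>j<d. k (x, i) (y, j) * v (y, j)) *\<^sub>R b i \<partial>lborel)
          = (\<Sum>j<d. \<integral>y. k (x, i) (y, j) * v (y, j) \<partial>lborel) *\<^sub>R b i" .
      qed
      finally show ?thesis .
    qed
    also have "\<dots> = (\<Sum>i<d. kop (LM d) k v (x, i) *\<^sub>R b i)"
      using elim(1) integral_LM(2)[of d "\<lambda>y. k (x, _) y * v y"] by (intro sum.cong refl) (simp add: kop_def integral_LM(2))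
    finally show ?case by (simp add: co_sum_basis)
  qed
qed

end

lemma AE_lborel_diff_left:
  fixes x :: "'a::euclidean_space"
  assumes "AE t in lborel. P t"
  shows "AE y in lborel. P (x - y)"
proof -
  obtain N where N: "{t \<in> space lborel. \<not> P t} \<subseteq> N" "emeasure lborel N = 0" "N \<in> sets lborel"
    using assms by (rule AE_E)
  have [measurable]: "N \<in> sets borel" using N(3) by simp
  have "(\<integral>\<^sup>+y. indicator N (x - y) \<partial>lborel) = (\<integral>\<^sup>+t. indicator N t \<partial>lborel)"
    by (rule nn_integral_lborel_diff_left) measurable
  also have "\<dots> = 0" using N(2) by simp
  finally have "AE y in lborel. (indicator N (x - y) :: ennreal) = 0"
    by (subst (asm) nn_integral_0_iff_AE) auto
  then show ?thesis
    by eventually_elim (use N(1) in \<open>auto simp: indicator_def split: if_splits\<close>)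
qed

lemma LM_pair_measurable:
  fixes K :: "nat \<Rightarrow> nat \<Rightarrow> 'a::euclidean_space \<Rightarrow> 'a \<Rightarrow> real"
  assumes "\<And>i j. case_prod (K i j) \<in> borel_measurable (borel \<Otimes>\<^sub>M borel)"
  shows "(\<lambda>(z, w). K (snd z) (snd w) (fst z) (fst w)) \<in> borel_measurable (LM d \<Otimes>\<^sub>M LM d)"
proof -
  have snd[measurable]: "snd \<in> measurable (LM d) (count_space UNIV)"
    by (simp cong: measurable_cong_sets add: measurable_cong_sets[OF sets_LM])
  have [measurable]: "case_prod (K i j) \<in> borel_measurable (borel \<Otimes>\<^sub>M borel)" for i j by fact
  have 1: "(\<lambda>z. K i (snd (snd z)) (fst (fst z)) (fst (snd z))) \<in> borel_measurable (LM d \<Otimes>\<^sub>M LM d)" for i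
    by (rule measurable_compose_countable[where f="\<lambda>j z. K i j (fst (fst z)) (fst (snd z))" and g="\<lambda>z. snd (snd z)"]) auto
  have "(\<lambda>z. K (snd (fst z)) (snd (snd z)) (fst (fst z)) (fst (snd z))) \<in> borel_measurable (LM d \<Otimes>\<^sub>M LM d)"
    by (rule measurable_compose_countable[where f="\<lambda>i z. K i (snd (snd z)) (fst (fst z)) (fst (snd z))" and g="\<lambda>z. snd (fst z)"])
       (auto intro: 1)
  then show ?thesis by (simp add: split_beta')
qed

lemma LM_kernel_slice_measurable:
  fixes k :: "'a::euclidean_space \<times> nat \<Rightarrow> 'a \<times> nat \<Rightarrow> real"
  assumes k: "case_prod k \<in> borel_measurable (LM d \<Otimes>\<^sub>M LM d)"
  shows "(\<lambda>(x, y). k (x, i) (y, j)) \<in> borel_measurable (borel \<Otimes>\<^sub>M borel)"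
proof -
  have p: "(\<lambda>x :: 'a. (x, i)) \<in> measurable borel (LM d)" for i
    by (simp cong: measurable_cong_sets add: measurable_cong_sets[OF refl sets_LM])
  have 1: "(\<lambda>z :: 'a \<times> 'a. (fst z, i)) \<in> measurable (borel \<Otimes>\<^sub>M borel) (LM d)"
    by (rule measurable_compose[OF measurable_fst p])
  have 2: "(\<lambda>z :: 'a \<times> 'a. (snd z, j)) \<in> measurable (borel \<Otimes>\<^sub>M borel) (LM d)"
    by (rule measurable_compose[OF measurable_snd p])
  have "(\<lambda>z :: 'a \<times> 'a. ((fst z, i), (snd z, j))) \<in> measurable (borel \<Otimes>\<^sub>M borel) (LM d \<Otimes>\<^sub>M LM d)"
    by (rule measurable_Pair[OF 1 2])
  from measurable_compose[OF this k] show ?thesis by (simp add: split_beta')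
qed

context real_coordinates
begin

text \<open>Borel versions of the entries agree with them only almost everywhere, so they are cut to 0 where they
  violate the domination, which then holds everywhere.\<close>

lemma kernel_rep_exists:
  fixes N :: "'a::euclidean_space \<Rightarrow> 'a \<Rightarrow> 'e \<Rightarrow>\<^sub>L 'e"
  assumes N: "(\<lambda>(x, y). N x y) \<in> borel_measurable lebesgue"
    and \<beta>: "integrable lebesgue \<beta>" "\<And>x y. norm (N x y) \<le> \<beta> y"
  obtains h k where "tdom d h k" "krep k N"
proof -
  obtain \<beta>' where \<beta>': "\<beta>' \<in> borel_measurable lborel" "AE x in lborel. \<beta> x = \<beta>' x"
    using completion_ex_borel_measurable_real[OF borel_measurable_integrable[OF \<beta>(1)]] by blast
  have [measurable]: "\<beta>' \<in> borel_measurable borel" using \<beta>'(1) by simp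
  have "\<exists>g. g \<in> borel_measurable lborel \<and> (AE z in lborel. entry i j (N (fst z) (snd z)) = g z)" for i j
    using completion_ex_borel_measurable_real[of "\<lambda>z. entry i j (N (fst z) (snd z))" lborel]
      measurable_compose[OF N entry_measurable] by (auto simp: split_beta')
  then obtain g where g: "\<And>i j. g i j \<in> borel_measurable lborel"
    "\<And>i j. AE z in lborel. entry i j (N (fst z) (snd z)) = g i j z" by metis
  have gm[measurable]: "g i j \<in> borel_measurable (borel \<Otimes>\<^sub>M borel)" for i j
    using g(1)[of i j] by (simp add: borel_prod)
  define c0 where "c0 = coC * bC"
  have c0: "c0 > 0" using coC(1) bC(1) by (simp add: c0_def)
  define h where "h t = ennreal (c0 * \<bar>\<beta>' t\<bar>)" for t
  have hm[measurable]: "h \<in> borel_measurable borel" unfolding h_def[abs_def] by measurable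
  define K where "K i j x y = (if ennreal \<bar>g i j (x, x - y)\<bar> \<le> h (x - y) \<and> i < d \<and> j < d then g i j (x, x - y) else 0)" for i j x y
  define k where "k = (\<lambda>z w. K (snd z) (snd w) (fst z) (fst w))"
  have "case_prod (K i j) \<in> borel_measurable (borel \<Otimes>\<^sub>M borel)" for i j
    unfolding K_def by measurable
  from LM_pair_measurable[OF this] have km: "case_prod k \<in> borel_measurable (LM d \<Otimes>\<^sub>M LM d)"
    by (simp add: k_def)
  have "integrable lborel (\<lambda>t. c0 * \<bar>\<beta>' t\<bar>)"
  proof -
    have "integrable lebesgue \<beta>'"
      using \<beta>(1) \<beta>' by (subst integrable_cong_AE[where g=\<beta>]) (auto simp: AE_completion_iff measurable_completion elim: eventually_mono)
    then show ?thesis using \<beta>'(1) by (simp add: integrable_completion)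
  qed
  then have fin: "(\<integral>\<^sup>+t. ennreal (norm (c0 * \<bar>\<beta>' t\<bar>)) \<partial>lborel) < \<infinity>"
    unfolding integrable_iff_bounded by (rule conjunct2)
  have nrm_eq: "norm (c0 * \<bar>\<beta>' t\<bar>) = c0 * \<bar>\<beta>' t\<bar>" for t using c0 by (simp add: abs_mult)
  have hfin: "(\<integral>\<^sup>+t. h t \<partial>lborel) < \<infinity>" using fin unfolding nrm_eq h_def .
  have kb: "ennreal \<bar>k x y\<bar> \<le> h (fst x - fst y)" for x y by (simp add: k_def K_def)
  have "tdom d h k"
    unfolding tdom_def using km hm hfin kb by blast
  moreover have "krep k N"
  proof -
    have "AE z in lborel. \<forall>i j. entry i j (N (fst z) (snd z)) = g i j z"
      by (intro AE_all_countable[THEN iffD2] allI g(2))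
    then have "AE z in lborel \<Otimes>\<^sub>M lborel. \<forall>i j. entry i j (N (fst z) (snd z)) = g i j z"
      by (subst lborel_prod)
    from lborel_pair.AE_pair[OF this]
    have "AE x in lborel. AE t in lborel. \<forall>i j. entry i j (N x t) = g i j (x, t)" by simp
    then show ?thesis unfolding krep_def
    proof eventually_elim
      case (elim x)
      have "AE t in lborel. \<forall>i<d. \<forall>j<d. entry i j (N x t) = g i j (x, t) \<and> ennreal \<bar>g i j (x, t)\<bar> \<le> h t"
        using elim \<beta>'(2)
      proof eventually_elim
        case (elim t)
        have "\<bar>g i j (x, t)\<bar> \<le> c0 * \<bar>\<beta>' t\<bar>" if "i < d" "j < d" for i j
        proof -
          have "\<bar>g i j (x, t)\<bar> \<le> c0 * norm (N x t)"
            using entry_le[OF that, of "N x t"] elim(1) by (simp add: c0_def)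
          also have "\<dots> \<le> c0 * \<bar>\<beta>' t\<bar>" using \<beta>(2)[of x t] elim(2) c0 by (intro mult_left_mono) auto
          finally show ?thesis .
        qed
        then show ?case using elim(1) by (simp add: h_def ennreal_leI)
      qed
      from AE_lborel_diff_left[OF this, of x] show ?case
        by eventually_elim (simp add: k_def K_def)
    qed
  qed
  ultimately show ?thesis by (rule that)
qed

section \<open>The inverse in coordinates\<close>

definition op_of :: "('a \<times> nat \<Rightarrow> 'a \<times> nat \<Rightarrow> real) \<Rightarrow> 'a \<Rightarrow> 'a \<Rightarrow> 'e \<Rightarrow>\<^sub>L 'e" where
  "op_of m z y = (\<Sum>i<d. \<Sum>j<d. m (z, i) (y, j) *\<^sub>R elem i j)"

lemma entry_op_of: "i < d \<Longrightarrow> j < d \<Longrightarrow> entry i j (op_of m z y) = m (z, i) (y, j)"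
  unfolding op_of_def by (rule entry_sum_elem)

lemma op_of_measurable:
  assumes "case_prod m \<in> borel_measurable (LM d \<Otimes>\<^sub>M LM d)"
  shows "(\<lambda>(z, y). op_of m z y) \<in> borel_measurable (borel \<Otimes>\<^sub>M borel)"
  by (rule blinfun_measurable_of_entries)
     (use LM_kernel_slice_measurable[OF assms] in \<open>simp add: split_beta' entry_op_of\<close>)

lemma apply_measurable:
  assumes "F \<in> borel_measurable M"
  shows "(\<lambda>x. blinfun_apply (F x) e) \<in> borel_measurable M"
  by (rule measurable_compose[OF assms])
     (intro borel_measurable_continuous_onI linear_continuous_on blinfun.bounded_linear_left)

definition op_of_bound :: real where "op_of_bound = bC * coC * (real d * real d) + 1"

lemma op_of_bound_pos: "op_of_bound > 0" using bC(1) coC(1) by (simp add: op_of_bound_def add_nonneg_pos)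

lemma norm_op_of_le:
  assumes "tdom d H m"
  shows "ennreal (norm (op_of m z y)) \<le> ennreal op_of_bound * H (z - y)"
proof (cases "H (z - y) = \<infinity>")
  case True
  then show ?thesis using op_of_bound_pos by (simp add: ennreal_mult_top)
next
  case False
  then obtain r where r: "H (z - y) = ennreal r" "r \<ge> 0" by (cases "H (z - y)") auto
  have le: "\<bar>m (z, i) (y, j)\<bar> \<le> r" for i j
    using tdomD(4)[OF assms, of "(z, i)" "(y, j)"] r by (simp add: ennreal_le_iff)
  have "norm (op_of m z y) \<le> bC * coC * (\<Sum>i<d. \<Sum>j<d. \<bar>entry i j (op_of m z y)\<bar>)" by (rule norm_le_entries)
  also have "\<dots> \<le> bC * coC * (\<Sum>i<d. \<Sum>j<d. r)"
    using bC(1) coC(1) le by (intro mult_left_mono sum_mono) (auto simp: entry_op_of)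
  also have "\<dots> = bC * coC * (real d * real d) * r" by simp
  also have "\<dots> \<le> op_of_bound * r" using r(2) by (intro mult_right_mono) (auto simp: op_of_bound_def)
  finally show ?thesis unfolding r using op_of_bound_pos r(2) by (simp add: ennreal_mult[symmetric] ennreal_leI)
qed

lemma rep_Lp_kop:
  fixes k m :: "'a::euclidean_space \<times> nat \<Rightarrow> 'a \<times> nat \<Rightarrow> real" and u :: "'a \<Rightarrow> 'e"
  assumes p: "1 \<le> p" and r: "rep f u" and u: "u \<in> Lp p" and k: "tdom d h k" and m: "tdom d H m"
  shows "AE z in LM d. integrable (LM d) (\<lambda>y. k z y * f y)"
    "AE z in LM d. kop (LM d) (kcomp (LM d) k m) f z = kop (LM d) k (kop (LM d) m f) z"
proof -
  note y = young_lp_phi[OF p]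
  interpret luxemburg_space "LM d :: ('a \<times> nat) measure" "lp_phi p"
    by (intro luxemburg_space.intro luxemburg_space_axioms.intro sigma_finite_LM y space_LM)
  have "nrm f \<le> ennreal (coC * max 1 (real d)) * ennreal (Lp_norm p u)"
    using luxemburg_rep_le[OF y r] Lp_luxemburg(1)[OF p rep_measurable[OF r] u] by (simp add: nrm_def)
  then have "nrm f < \<infinity>" by (rule le_less_trans) (simp add: ennreal_mult_less_top)
  then have f: "f \<in> Lg" using r by (simp add: Lg_def rep_def)
  obtain K where sk: "schur (LM d) K k" by (rule tdom_schur[OF k])
  obtain K' where sm: "schur (LM d) K' m" by (rule tdom_schur[OF m])
  show "AE z in LM d. integrable (LM d) (\<lambda>y. k z y * f y)" by (rule schur_AE_integrable[OF sk f])
  show "AE z in LM d. kop (LM d) (kcomp (LM d) k m) f z = kop (LM d) k (kop (LM d) m f) z"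
    by (rule kop_kcomp_AE[OF sk sm f])
qed

text \<open>In coordinates, the inverse \<open>R\<close> gives stability and solvability of the scalar equation. The two almost
  everywhere statements in the conclusion say that \<open>R\<close> is \<open>1 + M\<close>, and that \<open>M = - K - K M\<close>
  for the operators \<open>K\<close> and \<open>M\<close> with kernels \<open>k\<close> and \<open>m\<close>.\<close>

lemma scalar_inverse:
  fixes N :: "real ^ 'c \<Rightarrow> real ^ 'c \<Rightarrow> 'e \<Rightarrow>\<^sub>L 'e"
  defines "T \<equiv> id_plus (integral_op N)"
  assumes p: "1 \<le> p" and k: "tdom d h k" and kN: "krep k N"
    and R_Lp: "\<And>u. u \<in> Lp p \<Longrightarrow> R u \<in> Lp p"
    and R_bdd: "\<And>u. u \<in> Lp p \<Longrightarrow> Lp_norm p (R u) \<le> C * Lp_norm p u"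
    and RT: "\<And>u. u \<in> Lp p \<Longrightarrow> AE x in lebesgue. R (T u) x = u x"
    and TR: "\<And>u. u \<in> Lp p \<Longrightarrow> AE x in lebesgue. T (R u) x = u x"
  shows "\<exists>H m. tdom d H m \<and> (\<forall>f u. rep f u \<longrightarrow> u \<in> Lp p \<longrightarrow>
    rep (\<lambda>z. f z + kop (LM d) m f z) (R u) \<and>
    (AE z in LM d. kop (LM d) m f z + kop (LM d) k f z + kop (LM d) k (kop (LM d) m f) z = 0))"
proof -
  note y = young_lp_phi[OF p]
  interpret cell_space "LM d :: ((real ^ 'c) \<times> nat) measure" "lp_phi p" "\<lambda>z. cell (fst z)" len "max 1 (real d)" "3 ^ CARD('c)"
    by (rule cell_space_LM[OF y])
  have Lg_of_Lp: "v \<in> Lg" "nrm v \<le> ennreal (coC * max 1 (real d)) * ennreal (Lp_norm p u)"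
    if r: "rep v u" and u: "u \<in> Lp p" for v :: "(real ^ 'c) \<times> nat \<Rightarrow> real" and u
  proof -
    show le: "nrm v \<le> ennreal (coC * max 1 (real d)) * ennreal (Lp_norm p u)"
      using luxemburg_rep_le[OF y r] Lp_luxemburg(1)[OF p rep_measurable[OF r] u] by (simp add: nrm_def)
    have "nrm v < \<infinity>" by (rule le_less_trans[OF le]) (simp add: ennreal_mult_less_top)
    then show "v \<in> Lg" using r by (simp add: Lg_def rep_def)
  qed
  have Lp_of_fin: "u \<in> Lp p" if r: "rep v u" and v: "nrm v < \<infinity>" for v :: "(real ^ 'c) \<times> nat \<Rightarrow> real" and u
    by (rule Lp_luxemburg(2)[OF p rep_measurable[OF r]])
       (use luxemburg_rep_ge[OF y r] v in \<open>auto simp: nrm_def ennreal_mult_less_top intro: le_less_trans\<close>)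
  have Lp_norm_le: "ennreal (Lp_norm p u) \<le> ennreal (bC * max 1 (real d)) * nrm v"
    if r: "rep v u" and u: "u \<in> Lp p" for v :: "(real ^ 'c) \<times> nat \<Rightarrow> real" and u
    using luxemburg_rep_ge[OF y r] Lp_luxemburg(1)[OF p rep_measurable[OF r] u] by (simp add: nrm_def)
  obtain K where sk: "schur (LM d) K k" by (rule tdom_schur[OF k])
  note km = schurD(1)[OF sk]
  have T_rep: "rep (S k v) (T u)" if r: "rep v u" and u: "u \<in> Lp p" for v :: "(real ^ 'c) \<times> nat \<Rightarrow> real" and u
  proof -
    have v: "v \<in> Lg" by (rule Lg_of_Lp[OF r u])
    have "rep (\<lambda>z. v z + kop (LM d) k v z) (\<lambda>x. u x + integral_op N u x)"
      by (intro rep_add r rep_integral_op[OF km kN r] schur_AE_integrable[OF sk v])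
    then show ?thesis by (simp add: T_def id_plus_def S_def[abs_def])
  qed
  define C1 where "C1 = coC * max 1 (real d) * (max C 1) * (bC * max 1 (real d))"
  have C1: "C1 > 0" using coC(1) bC(1) by (simp add: C1_def)
  have st: "nrm v \<le> ennreal C1 * nrm (S k v)" if v: "v \<in> Lg" for v :: "(real ^ 'c) \<times> nat \<Rightarrow> real"
  proof -
    define u where "u x = (\<Sum>i<d. v (x, i) *\<^sub>R b i)" for x
    have r: "rep v u" unfolding u_def by (rule rep_sum(1)[OF LgD(1)[OF v]])
    have u: "u \<in> Lp p" by (rule Lp_of_fin[OF r LgD(2)[OF v]])
    have r2: "rep (S k v) (T u)" by (rule T_rep[OF r u])
    have Tu: "T u \<in> Lp p" by (rule Lp_of_fin[OF r2 LgD(2)[OF S_Lg[OF sk v]]])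
    have r3: "rep v (R (T u))"
      by (rule rep_cong'[OF r]) (use RT[OF u] in \<open>auto simp: AE_completion_iff elim!: eventually_mono\<close>)
    have "nrm v \<le> ennreal (coC * max 1 (real d)) * ennreal (Lp_norm p (R (T u)))"
      by (rule Lg_of_Lp(2)[OF r3 R_Lp[OF Tu]])
    also have "\<dots> \<le> ennreal (coC * max 1 (real d)) * (ennreal (max C 1) * ennreal (Lp_norm p (T u)))"
    proof (rule mult_left_mono)
      have nn: "Lp_norm p (T u) \<ge> 0" by (simp add: Lp_norm_def)
      have "Lp_norm p (R (T u)) \<le> max C 1 * Lp_norm p (T u)"
        using R_bdd[OF Tu] mult_right_mono[OF _ nn, of C "max C 1"] by simp
      then have "ennreal (Lp_norm p (R (T u))) \<le> ennreal (max C 1 * Lp_norm p (T u))" by (rule ennreal_leI)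
      then show "ennreal (Lp_norm p (R (T u))) \<le> ennreal (max C 1) * ennreal (Lp_norm p (T u))"
        using nn by (simp add: ennreal_mult)
    qed simp
    also have "\<dots> \<le> ennreal (coC * max 1 (real d)) * (ennreal (max C 1) * (ennreal (bC * max 1 (real d)) * nrm (S k v)))"
      by (intro mult_left_mono Lp_norm_le[OF r2 Tu]) auto
    also have "\<dots> = ennreal C1 * nrm (S k v)"
      unfolding C1_def using coC(1) bC(1) by (simp add: ennreal_mult mult.assoc)
    finally show ?thesis .
  qed
  have solv: "\<exists>v\<in>Lg. AE x in LM d. S k v x = f x" if f: "f \<in> Lg" for f :: "(real ^ 'c) \<times> nat \<Rightarrow> real"
  proof -
    define F where "F x = (\<Sum>i<d. f (x, i) *\<^sub>R b i)" for x
    have r: "rep f F" unfolding F_def by (rule rep_sum(1)[OF LgD(1)[OF f]])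
    have F: "F \<in> Lp p" by (rule Lp_of_fin[OF r LgD(2)[OF f]])
    have RF: "R F \<in> Lp p" by (rule R_Lp[OF F])
    then have "R F \<in> borel_measurable lebesgue" by (simp add: Lp_def)
    then obtain v where v: "rep v (R F)" by (rule rep_exists)
    have "rep (S k v) F"
      by (rule rep_cong'[OF T_rep[OF v RF]]) (use TR[OF F] in \<open>auto simp: AE_completion_iff elim!: eventually_mono\<close>)
    from rep_unique[OF this r] Lg_of_Lp(1)[OF v RF] show ?thesis by blast
  qed
  have "\<exists>H m. tdom d H m \<and> (\<forall>f\<in>Lg. AE x in LM d. S k (S m f) x = f x)"
    by (rule stable_kernel_inverse[OF y k C1 st solv]) blast+
  then obtain H m where m: "tdom d H m" and inv: "\<And>f. f \<in> Lg \<Longrightarrow> AE x in LM d. S k (S m f) x = f x"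
    by blast
  obtain Km where sm: "schur (LM d) Km m" by (rule tdom_schur[OF m])
  show ?thesis
  proof (intro exI conjI allI impI)
    show "tdom d H m" by (rule m)
    fix f and u :: "real ^ 'c \<Rightarrow> 'e"
    assume r: "rep f u" and u: "u \<in> Lp p"
    have f: "f \<in> Lg" by (rule Lg_of_Lp[OF r u])
    have mf: "kop (LM d) m f \<in> Lg" by (rule kop_Lg[OF sm f])
    show "AE z in LM d. kop (LM d) m f z + kop (LM d) k f z + kop (LM d) k (kop (LM d) m f) z = 0"
      using inv[OF f] kop_add_AE[OF sk f mf] by eventually_elim (simp add: S_def[abs_def])
    have Ru: "R u \<in> Lp p" by (rule R_Lp[OF u])
    then have "R u \<in> borel_measurable lebesgue" by (simp add: Lp_def)
    then obtain w where w: "rep w (R u)" by (rule rep_exists)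
    have wL: "w \<in> Lg" by (rule Lg_of_Lp[OF w Ru])
    have "rep (S k w) u"
      by (rule rep_cong'[OF T_rep[OF w Ru]]) (use TR[OF u] in \<open>auto simp: AE_completion_iff elim!: eventually_mono\<close>)
    from rep_unique[OF this r] have "AE z in LM d. S k w z = S k (S m f) z"
      using inv[OF f] by eventually_elim simp
    then have "AE z in LM d. w z = S m f z"
      by (rule S_eq_imp_eq[OF sk wL S_Lg[OF sm f], rotated]) (rule S_inj_of_stable[OF st])
    from rep_cong[OF w LgD(1)[OF S_Lg[OF sm f]] this]
    show "rep (\<lambda>z. f z + kop (LM d) m f z) (R u)" by (simp add: S_def[abs_def])
  qed
qed

end

section \<open>Linearity over the scalar field\<close>

context real_coordinates
begin

lemma box_indicator_Lp:
  fixes a c :: "'a::euclidean_space"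
  assumes p: "1 \<le> p"
  shows "(\<lambda>y. indicator (box a c) y *\<^sub>R (v :: 'e)) \<in> Lp p"
proof (rule Lp_luxemburg(2)[OF p])
  note y = young_lp_phi[OF p]
  have "(\<lambda>y. indicator (box a c) y *\<^sub>R v) \<in> borel_measurable borel" by measurable
  then show "(\<lambda>y. indicator (box a c) y *\<^sub>R v) \<in> borel_measurable lebesgue" by (rule borel_imp_lebesgue)
  define K where "K = max 1 (enn2real (emeasure lborel (box a c)))"
  have K: "emeasure lborel (box a c) \<le> ennreal K" "K \<ge> 1"
    using emeasure_lborel_box_finite[of a c] by (auto simp: K_def max_def ennreal_enn2real_if not_le)
  have "luxemburg lborel (lp_phi p) (indicator (box a c)) \<le> ennreal K"
    by (rule luxemburg_indicator[OF y _ K]) simp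
  then have fin: "luxemburg lborel (lp_phi p) (indicator (box a c)) < \<infinity>" by (rule le_less_trans) simp
  have "(\<lambda>y. ennreal (norm (indicator (box a c) y *\<^sub>R v))) = (\<lambda>y. ennreal (norm v) * indicator (box a c) y)"
    by (auto simp: fun_eq_iff indicator_def)
  then show "luxemburg lborel (lp_phi p) (\<lambda>y. ennreal (norm (indicator (box a c) y *\<^sub>R v))) < \<infinity>"
    using luxemburg_cmult[OF y, of "norm v" lborel "indicator (box a c)"] fin
    by (auto simp: ennreal_mult_less_top intro: le_less_trans)
qed

context
  fixes scl :: "'k::{real_normed_field,euclidean_space} \<Rightarrow> 'e \<Rightarrow> 'e"
  assumes ns: "normed_space_over scl"
begin

lemma scl_vector_space: "vector_space scl" using ns by (simp add: normed_space_over_def)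

lemma scl_of_real: "scl (of_real r) v = r *\<^sub>R v" using ns by (simp add: normed_space_over_def)

lemma scl_scaleR: "scl a (r *\<^sub>R v) = r *\<^sub>R scl a v"
proof -
  interpret vector_space scl by (rule scl_vector_space)
  show ?thesis by (simp add: scl_of_real[symmetric] scale_left_commute)
qed

lemma scl_scaleR_left: "scl (r *\<^sub>R a) v = r *\<^sub>R scl a v"
proof -
  interpret vector_space scl by (rule scl_vector_space)
  show ?thesis by (simp add: scl_of_real[symmetric] scaleR_conv_of_real)
qed

lemma scl_bounded_linear: "bounded_linear (scl a)"
proof -
  interpret vector_space scl by (rule scl_vector_space)
  show ?thesis
    by (rule bounded_linear_intro[where K="norm a"])
       (use ns in \<open>auto simp: scale_right_distrib scl_scaleR normed_space_over_def mult.commute\<close>)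
qed

lemma bounded_ops_iff:
  "A \<in> bounded_ops scl \<longleftrightarrow> (\<forall>a v. blinfun_apply A (scl a v) = scl a (blinfun_apply A v))"
proof -
  interpret V: vector_space scl by (rule scl_vector_space)
  show ?thesis
    unfolding bounded_ops_def Vector_Spaces.linear_def module_hom_def module_hom_axioms_def
    using V.module_axioms V.vector_space_axioms by (auto simp: blinfun.add_right)
qed

text \<open>Linearity needs to be tested on finitely many scalars and vectors, since the operator is linear over the real
  numbers.\<close>

lemma bounded_ops_iff_basis:
  "A \<in> bounded_ops scl \<longleftrightarrow> (\<forall>a\<in>Basis. \<forall>j<d. blinfun_apply A (scl a (b j)) = scl a (blinfun_apply A (b j)))"
proof
  assume "A \<in> bounded_ops scl"
  then show "\<forall>a\<in>Basis. \<forall>j<d. blinfun_apply A (scl a (b j)) = scl a (blinfun_apply A (b j))"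
    by (simp add: bounded_ops_iff)
next
  assume H: "\<forall>a\<in>Basis. \<forall>j<d. blinfun_apply A (scl a (b j)) = scl a (blinfun_apply A (b j))"
  interpret V: vector_space scl by (rule scl_vector_space)
  have 1: "blinfun_apply A (scl a v) = scl a (blinfun_apply A v)" if a: "a \<in> Basis" for a v
  proof -
    have "blinfun_apply A (scl a v) = blinfun_apply A (scl a (\<Sum>j<d. co j v *\<^sub>R b j))" by (simp only: expand)
    also have "\<dots> = (\<Sum>j<d. co j v *\<^sub>R blinfun_apply A (scl a (b j)))"
      by (simp add: V.scale_sum_right scl_scaleR blinfun.sum_right blinfun.scaleR_right)
    also have "\<dots> = (\<Sum>j<d. co j v *\<^sub>R scl a (blinfun_apply A (b j)))" using H a by (intro sum.cong) auto
    also have "\<dots> = scl a (blinfun_apply A (\<Sum>j<d. co j v *\<^sub>R b j))"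
      by (simp add: V.scale_sum_right scl_scaleR blinfun.sum_right blinfun.scaleR_right)
    finally show ?thesis by (simp only: expand)
  qed
  have "blinfun_apply A (scl a v) = scl a (blinfun_apply A v)" for a v
  proof -
    have "scl a w = (\<Sum>\<beta>\<in>Basis. (a \<bullet> \<beta>) *\<^sub>R scl \<beta> w)" for w
    proof -
      have "scl a w = scl (\<Sum>\<beta>\<in>Basis. (a \<bullet> \<beta>) *\<^sub>R \<beta>) w" by (simp only: euclidean_representation)
      then show ?thesis by (simp only: V.scale_sum_left scl_scaleR_left)
    qed
    then show ?thesis by (simp add: blinfun.sum_right blinfun.scaleR_right 1)
  qed
  then show "A \<in> bounded_ops scl" by (simp add: bounded_ops_iff)
qed

lemma bounded_ops_0: "0 \<in> bounded_ops scl" and bounded_ops_minus: "A \<in> bounded_ops scl \<Longrightarrow> - A \<in> bounded_ops scl"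
  and bounded_ops_diff: "A \<in> bounded_ops scl \<Longrightarrow> A' \<in> bounded_ops scl \<Longrightarrow> A - A' \<in> bounded_ops scl"
  using linear_0[OF bounded_linear.linear[OF scl_bounded_linear]] linear_neg[OF bounded_linear.linear[OF scl_bounded_linear]]
    linear_diff[OF bounded_linear.linear[OF scl_bounded_linear]]
  by (simp_all add: bounded_ops_iff blinfun.minus_left blinfun.diff_left)

lemma op_of_row_integrable:
  fixes m :: "'a::euclidean_space \<times> nat \<Rightarrow> 'a \<times> nat \<Rightarrow> real"
  assumes m: "tdom d H m"
  shows "integrable lborel (\<lambda>y. indicator (box a c) y *\<^sub>R blinfun_apply (op_of m x y) v)"
proof (rule integrableI_bounded)
  have "(\<lambda>y. op_of m x y) \<in> borel_measurable borel"
    using measurable_Pair2[OF op_of_measurable[OF tdomD(1)[OF m]], of x] by simp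
  from apply_measurable[OF this, of v]
  show "(\<lambda>y. indicator (box a c) y *\<^sub>R blinfun_apply (op_of m x y) v) \<in> borel_measurable lborel" by simp
  have "ennreal (norm (indicator (box a c) y *\<^sub>R blinfun_apply (op_of m x y) v)) \<le> ennreal (norm v) * (ennreal op_of_bound * H (x - y))" for y
  proof -
    have "norm (indicator (box a c) y *\<^sub>R blinfun_apply (op_of m x y) v) \<le> norm v * norm (op_of m x y)"
      using norm_blinfun[of "op_of m x y" v] by (auto simp: indicator_def mult.commute)
    then have "ennreal (norm (indicator (box a c) y *\<^sub>R blinfun_apply (op_of m x y) v)) \<le> ennreal (norm v) * ennreal (norm (op_of m x y))"
      by (simp add: ennreal_mult[symmetric] ennreal_leI)
    also have "\<dots> \<le> ennreal (norm v) * (ennreal op_of_bound * H (x - y))" by (intro mult_left_mono norm_op_of_le[OF m]) simp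
    finally show ?thesis .
  qed
  then have "(\<integral>\<^sup>+y. ennreal (norm (indicator (box a c) y *\<^sub>R blinfun_apply (op_of m x y) v)) \<partial>lborel)
    \<le> (\<integral>\<^sup>+y. ennreal (norm v) * (ennreal op_of_bound * H (x - y)) \<partial>lborel)"
    by (intro nn_integral_mono)
  also have "\<dots> = ennreal (norm v) * (ennreal op_of_bound * (\<integral>\<^sup>+t. H t \<partial>lborel))"
    using tdomD(2)[OF m] by (simp add: nn_integral_cmult nn_integral_lborel_diff_left)
  also have "\<dots> < \<infinity>" using tdomD(3)[OF m] by (simp add: ennreal_mult_less_top)
  finally show "(\<integral>\<^sup>+y. ennreal (norm (indicator (box a c) y *\<^sub>R blinfun_apply (op_of m x y) v)) \<partial>lborel) < \<infinity>" .
qed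

text \<open>Since \<open>R\<close> commutes with the scalars, so does the integral operator \<open>R - 1\<close>. The commutator of its
  kernel with a scalar therefore integrates to 0 over boxes, and vanishes almost everywhere.\<close>

lemma op_of_linear_over_scalars:
  fixes m :: "'a::euclidean_space \<times> nat \<Rightarrow> 'a \<times> nat \<Rightarrow> real"
  assumes p: "1 \<le> p" and m: "tdom d H m"
    and rep_R: "\<And>f u. rep f u \<Longrightarrow> u \<in> Lp p \<Longrightarrow> rep (\<lambda>z. f z + kop (LM d) m f z) (R u)"
    and int: "\<And>f (u :: 'a \<Rightarrow> 'e). rep f u \<Longrightarrow> u \<in> Lp p \<Longrightarrow> AE z in LM d. integrable (LM d) (\<lambda>y. m z y * f y)"
    and hom: "\<And>a u. u \<in> Lp p \<Longrightarrow> AE x in lebesgue. R (\<lambda>y. scl a (u y)) x = scl a (R u x)"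
  shows "AE x in lborel. AE y in lborel. op_of m x y \<in> bounded_ops scl"
proof -
  define Nm where "Nm x t = op_of m x (x - t)" for x t
  have km: "krep m Nm" unfolding krep_def Nm_def by (simp add: entry_op_of)
  have R_eq: "AE x in lborel. R u x = u x + integral_op Nm u x" if u: "u \<in> Lp p" for u
  proof -
    have "u \<in> borel_measurable lebesgue" using u by (simp add: Lp_def)
    then obtain f where f: "rep f u" by (rule rep_exists)
    have "rep (\<lambda>z. f z + kop (LM d) m f z) (\<lambda>x. u x + integral_op Nm u x)"
      by (intro rep_add f rep_integral_op[OF tdomD(1)[OF m] km f int[OF f u]])
    from rep_unique'[OF rep_R[OF f u] this] show ?thesis .
  qed
  let ?A = "\<lambda>x y. blinfun_apply (op_of m x y)"
  have op_box: "integral_op Nm (\<lambda>y. indicator (box q r) y *\<^sub>R v) x = (\<integral>y. indicator (box q r) y *\<^sub>R ?A x y v \<partial>lborel)" for q r v x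
  proof -
    have "integral_op Nm (\<lambda>y. indicator (box q r) y *\<^sub>R v) x = (\<integral>y. indicator (box q r) y *\<^sub>R ?A x y v \<partial>lebesgue)"
      by (simp add: integral_op_def Nm_def blinfun.scaleR_right)
    also have "\<dots> = (\<integral>y. indicator (box q r) y *\<^sub>R ?A x y v \<partial>lborel)"
      by (rule integral_completion) (rule borel_measurable_integrable[OF op_of_row_integrable[OF m]])
    finally show ?thesis .
  qed
  define D where "D a v i x y = co i (?A x y (scl a v) - scl a (?A x y v))" for a v i x y
  have Dm[measurable]: "case_prod (D a v i) \<in> borel_measurable (borel \<Otimes>\<^sub>M borel)" for a v i
  proof -
    note am = apply_measurable[OF op_of_measurable[OF tdomD(1)[OF m]]]
    have [measurable]: "scl a \<in> borel_measurable borel"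
      by (intro borel_measurable_continuous_onI linear_continuous_on scl_bounded_linear)
    note [measurable] = am[of "scl a v"] am[of v]
    have "(\<lambda>z. co i (blinfun_apply (case z of (z, y) \<Rightarrow> op_of m z y) (scl a v) - scl a (blinfun_apply (case z of (z, y) \<Rightarrow> op_of m z y) v)))
        \<in> borel_measurable (borel \<Otimes>\<^sub>M borel)" by measurable
    then show ?thesis by (simp add: D_def split_beta')
  qed
  have D0: "AE x in lborel. AE y in lborel. D a v i x y = 0" if i: "i < d" for a v i
  proof -
    define C where "C = coC * (op_of_bound * norm (scl a v) + norm a * (op_of_bound * norm v))"
    have C: "C \<ge> 0" unfolding C_def using coC(1) op_of_bound_pos by (intro mult_nonneg_nonneg add_nonneg_nonneg) auto
    have Dle: "ennreal \<bar>D a v i x y\<bar> \<le> ennreal C * H (x - y)" for x y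
    proof -
      have c1: "\<bar>D a v i x y\<bar> \<le> coC * (norm (op_of m x y) * norm (scl a v) + norm a * (norm (op_of m x y) * norm v))"
      proof -
        have "\<bar>D a v i x y\<bar> \<le> coC * norm (?A x y (scl a v) - scl a (?A x y v))"
          unfolding D_def by (rule coC(2)[OF i])
        also have "norm (?A x y (scl a v) - scl a (?A x y v)) \<le> norm (?A x y (scl a v)) + norm (scl a (?A x y v))"
          by (rule norm_triangle_ineq4)
        also have "norm (scl a (?A x y v)) = norm a * norm (?A x y v)" using ns by (simp add: normed_space_over_def)
        also have "norm (?A x y (scl a v)) + norm a * norm (?A x y v)
          \<le> norm (op_of m x y) * norm (scl a v) + norm a * (norm (op_of m x y) * norm v)"
          by (intro add_mono mult_left_mono norm_blinfun) simp
        finally show ?thesis using coC(1) by (simp add: mult_left_mono)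
      qed
      have c2: "coC * (norm (op_of m x y) * norm (scl a v) + norm a * (norm (op_of m x y) * norm v)) = (C / op_of_bound) * norm (op_of m x y)"
        using op_of_bound_pos by (simp add: C_def field_simps)
      have "ennreal \<bar>D a v i x y\<bar> \<le> ennreal (C / op_of_bound) * ennreal (norm (op_of m x y))"
        using c1 c2 C op_of_bound_pos by (simp add: ennreal_mult[symmetric] ennreal_leI)
      also have "\<dots> \<le> ennreal (C / op_of_bound) * (ennreal op_of_bound * H (x - y))"
        by (intro mult_left_mono norm_op_of_le[OF m]) simp
      also have "\<dots> = ennreal C * H (x - y)"
        using C op_of_bound_pos by (simp add: mult.assoc[symmetric] ennreal_mult[symmetric])
      finally show ?thesis .
    qed
    have [measurable]: "H \<in> borel_measurable borel" by (rule tdomD[OF m])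
    show ?thesis
    proof (rule kernel_zero_of_box_integrals[where h="\<lambda>t. ennreal C * H t"])
      show "(\<integral>\<^sup>+t. ennreal C * H t \<partial>lborel) < \<infinity>"
        using tdomD(3)[OF m] by (simp add: nn_integral_cmult ennreal_mult_less_top)
      show "AE x in lborel. (\<integral>y. indicator (box q r) y * D a v i x y \<partial>lborel) = 0" for q r
      proof -
        let ?u = "\<lambda>y. indicator (box q r) y *\<^sub>R v" and ?u' = "\<lambda>y. indicator (box q r) y *\<^sub>R scl a v"
        have uL: "?u \<in> Lp p" and u'L: "?u' \<in> Lp p" by (intro box_indicator_Lp p)+
        have "AE x in lborel. R ?u' x = scl a (R ?u x)"
          using hom[OF uL, of a] by (simp add: scl_scaleR AE_completion_iff)
        then show ?thesis using R_eq[OF uL] R_eq[OF u'L]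
        proof eventually_elim
          case (elim x)
          interpret bl: bounded_linear "scl a" by (rule scl_bounded_linear)
          have i1: "integrable lborel (\<lambda>y. indicator (box q r) y *\<^sub>R ?A x y (scl a v))"
            and i2: "integrable lborel (\<lambda>y. indicator (box q r) y *\<^sub>R ?A x y v)"
            by (intro op_of_row_integrable[OF m])+
          have "(\<integral>y. indicator (box q r) y *\<^sub>R ?A x y (scl a v) \<partial>lborel) = scl a (\<integral>y. indicator (box q r) y *\<^sub>R ?A x y v \<partial>lborel)"
            using elim by (simp add: op_box bl.add scl_scaleR)
          also have "\<dots> = (\<integral>y. scl a (indicator (box q r) y *\<^sub>R ?A x y v) \<partial>lborel)"
            by (rule integral_bounded_linear[OF scl_bounded_linear i2, symmetric])
          finally have "(\<integral>y. indicator (box q r) y *\<^sub>R ?A x y (scl a v) - scl a (indicator (box q r) y *\<^sub>R ?A x y v) \<partial>lborel) = 0"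
            using i1 integrable_bounded_linear[OF scl_bounded_linear i2] by simp
          then have "co i (\<integral>y. indicator (box q r) y *\<^sub>R ?A x y (scl a v) - scl a (indicator (box q r) y *\<^sub>R ?A x y v) \<partial>lborel) = 0"
            by simp
          then have "(\<integral>y. co i (indicator (box q r) y *\<^sub>R ?A x y (scl a v) - scl a (indicator (box q r) y *\<^sub>R ?A x y v)) \<partial>lborel) = 0"
            using i1 integrable_bounded_linear[OF scl_bounded_linear i2]
            by (subst integral_bounded_linear[OF co_linear]) auto
          then show ?case
            by (simp add: D_def scl_scaleR scaleR_diff_right[symmetric] co_scaleR)
        qed
      qed
    qed (use Dle in auto)
  qed
  have "AE x in lborel. \<forall>a\<in>Basis. \<forall>j\<in>{..<d}. \<forall>i\<in>{..<d}. AE y in lborel. D a (b j) i x y = 0"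
    using D0 by (intro AE_finite_allI) auto
  then show ?thesis
  proof eventually_elim
    case (elim x)
    then have "AE y in lborel. \<forall>a\<in>Basis. \<forall>j\<in>{..<d}. \<forall>i\<in>{..<d}. D a (b j) i x y = 0"
      by (intro AE_finite_allI) auto
    then show ?case
    proof eventually_elim
      case (elim y)
      have "?A x y (scl a (b j)) = scl a (?A x y (b j))" if "a \<in> Basis" "j < d" for a j
      proof -
        have "\<forall>i<d. co i (?A x y (scl a (b j)) - scl a (?A x y (b j))) = co i 0"
          using elim that by (simp add: D_def)
        then show ?thesis using eq_iff_co[of "?A x y (scl a (b j)) - scl a (?A x y (b j))" 0] by simp
      qed
      then show ?case by (simp add: bounded_ops_iff_basis)
    qed
  qed
qed

text \<open>The set where linearity fails is measurable, so the kernel can be replaced by 0 there.\<close>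

lemma linear_kernel_exists:
  fixes m :: "'a::euclidean_space \<times> nat \<Rightarrow> 'a \<times> nat \<Rightarrow> real"
  assumes m: "tdom d H m" and lin: "AE x in lborel. AE y in lborel. op_of m x y \<in> bounded_ops scl"
  obtains m' where "tdom d H m'" "\<And>x y. op_of m' x y \<in> bounded_ops scl"
    "AE z in LM d. AE w in LM d. m' z w = m z w"
proof -
  define P where "P x y \<longleftrightarrow> op_of m x y \<in> bounded_ops scl" for x y
  have Pm[measurable]: "Measurable.pred (borel \<Otimes>\<^sub>M borel) (\<lambda>z. P (fst z) (snd z))"
  proof -
    have am: "(\<lambda>z. blinfun_apply (op_of m (fst z) (snd z)) v) \<in> borel_measurable (borel \<Otimes>\<^sub>M borel)" for v
      using apply_measurable[OF op_of_measurable[OF tdomD(1)[OF m]], of v] by (simp add: split_beta')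
    have "Measurable.pred (borel \<Otimes>\<^sub>M borel) (\<lambda>z. \<forall>a\<in>Basis. \<forall>j\<in>{..<d}. blinfun_apply (op_of m (fst z) (snd z)) (scl a (b j)) = scl a (blinfun_apply (op_of m (fst z) (snd z)) (b j)))"
    proof (intro pred_intros_finite finite_Basis finite_lessThan)
      fix a :: 'k and j
      have [measurable]: "scl a \<in> borel_measurable borel"
        by (intro borel_measurable_continuous_onI linear_continuous_on scl_bounded_linear)
      note [measurable] = am[of "scl a (b j)"] am[of "b j"]
      show "Measurable.pred (borel \<Otimes>\<^sub>M borel) (\<lambda>z. blinfun_apply (op_of m (fst z) (snd z)) (scl a (b j)) = scl a (blinfun_apply (op_of m (fst z) (snd z)) (b j)))"
        by measurable
    qed
    then show ?thesis unfolding P_def bounded_ops_iff_basis Ball_def lessThan_iff .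
  qed
  define m' where "m' z w = (if P (fst z) (fst w) then m z w else 0)" for z w
  have op_of': "op_of m' x y = (if P x y then op_of m x y else 0)" for x y
    by (simp add: op_of_def m'_def)
  show ?thesis
  proof (rule that)
    have "(\<lambda>z :: ('a \<times> nat) \<times> ('a \<times> nat). (fst (fst z), fst (snd z))) \<in> measurable (LM d \<Otimes>\<^sub>M LM d) (borel \<Otimes>\<^sub>M borel)"
      by measurable
    from measurable_compose[OF this Pm]
    have [measurable]: "Measurable.pred (LM d \<Otimes>\<^sub>M LM d) (\<lambda>z. P (fst (fst z)) (fst (snd z)))" by simp
    note [measurable] = tdomD(1)[OF m]
    have "(\<lambda>z. if P (fst (fst z)) (fst (snd z)) then m (fst z) (snd z) else 0) \<in> borel_measurable (LM d \<Otimes>\<^sub>M LM d)"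
      by measurable
    then have "case_prod m' \<in> borel_measurable (LM d \<Otimes>\<^sub>M LM d)" by (simp add: m'_def split_beta')
    moreover have "ennreal \<bar>m' x y\<bar> \<le> H (fst x - fst y)" for x y
      using tdomD(4)[OF m, of x y] by (simp add: m'_def)
    ultimately show "tdom d H m'" using tdomD(2,3)[OF m] unfolding tdom_def by blast
    show "op_of m' x y \<in> bounded_ops scl" for x y
      by (simp add: op_of' P_def bounded_ops_0)
    show "AE z in LM d. AE w in LM d. m' z w = m z w"
      unfolding AE_LM using lin by (auto simp: m'_def P_def elim!: eventually_mono)
  qed
qed

end

end

section \<open>Composing a row with a kernel\<close>

text \<open>Measurability need not be assumed, since Lebesgue measure is complete and the integral of a nonmeasurable function is 0.\<close>

lemma integral_lebesgue_cong_AE: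
  fixes f g :: "'a::euclidean_space \<Rightarrow> 'b::{banach,second_countable_topology}"
  assumes eq: "AE x in lborel. f x = g x"
  shows "(\<integral>x. f x \<partial>lebesgue) = (\<integral>x. g x \<partial>lebesgue)"
proof (cases "f \<in> borel_measurable lebesgue")
  case True
  then show ?thesis
    using eq by (intro integral_cong_AE measurable_lebesgue_AE_eq[OF True eq]) (auto simp: AE_completion_iff)
next
  case False
  have "AE x in lborel. g x = f x" using eq by eventually_elim simp
  then have "g \<notin> borel_measurable lebesgue" using False measurable_lebesgue_AE_eq by blast
  then have "\<not> integrable lebesgue f" "\<not> integrable lebesgue g"
    using False by (auto dest: borel_measurable_integrable)
  then show ?thesis by (simp add: not_integrable_integral_eq)
qed

text \<open>The majorant of the composition of a single row \<open>F\<close> with a kernel dominated by \<open>H\<close>. Working with a single row makes the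
  dependence on the row explicit, which is what continuity of the rows is about.\<close>

definition row_mass :: "('a::euclidean_space \<Rightarrow> 'b::real_normed_vector) \<Rightarrow> ('a \<Rightarrow> ennreal) \<Rightarrow> 'a \<Rightarrow> ennreal" where
  "row_mass F H y = (\<integral>\<^sup>+z. ennreal (norm (F z)) * H (z - y) \<partial>lebesgue)"

lemma row_mass_integral:
  fixes F :: "'a::euclidean_space \<Rightarrow> 'b::real_normed_vector"
  assumes F: "F \<in> borel_measurable lebesgue" and H[measurable]: "H \<in> borel_measurable borel"
  shows "row_mass F H \<in> borel_measurable borel"
    "(\<integral>\<^sup>+y. row_mass F H y \<partial>lborel) = (\<integral>\<^sup>+z. ennreal (norm (F z)) \<partial>lebesgue) * (\<integral>\<^sup>+t. H t \<partial>lborel)"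
proof -
  have "(\<lambda>z. norm (F z)) \<in> borel_measurable lebesgue" by (rule measurable_compose[OF F borel_measurable_norm])
  then obtain f where f: "f \<in> borel_measurable lborel" "AE z in lborel. norm (F z) = f z"
    using completion_ex_borel_measurable_real by blast
  have [measurable]: "f \<in> borel_measurable borel" using f(1) by simp
  have eq: "row_mass F H = (\<lambda>y. \<integral>\<^sup>+z. ennreal (f z) * H (z - y) \<partial>lborel)"
    unfolding row_mass_def nn_integral_completion
    by (intro ext nn_integral_cong_AE) (use f(2) in eventually_elim, simp)
  show "row_mass F H \<in> borel_measurable borel" unfolding eq by measurable
  have "(\<integral>\<^sup>+y. row_mass F H y \<partial>lborel) = (\<integral>\<^sup>+z. \<integral>\<^sup>+y. ennreal (f z) * H (z - y) \<partial>lborel \<partial>lborel)"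
    unfolding eq by (rule lborel_pair.Fubini') measurable
  also have "\<dots> = (\<integral>\<^sup>+z. ennreal (f z) * (\<integral>\<^sup>+t. H t \<partial>lborel) \<partial>lborel)"
    by (simp add: nn_integral_cmult nn_integral_lborel_diff_left)
  also have "\<dots> = (\<integral>\<^sup>+z. ennreal (f z) \<partial>lborel) * (\<integral>\<^sup>+t. H t \<partial>lborel)" by (rule nn_integral_multc) measurable
  also have "(\<integral>\<^sup>+z. ennreal (f z) \<partial>lborel) = (\<integral>\<^sup>+z. ennreal (norm (F z)) \<partial>lebesgue)"
    unfolding nn_integral_completion by (intro nn_integral_cong_AE) (use f(2) in eventually_elim, simp)
  finally show "(\<integral>\<^sup>+y. row_mass F H y \<partial>lborel) = (\<integral>\<^sup>+z. ennreal (norm (F z)) \<partial>lebesgue) * (\<integral>\<^sup>+t. H t \<partial>lborel)" .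
qed

lemma row_mass_le_hconv:
  fixes F :: "'a::euclidean_space \<Rightarrow> 'b::real_normed_vector"
  assumes [measurable]: "g \<in> borel_measurable borel" "H \<in> borel_measurable borel"
    and le: "AE z in lborel. ennreal (norm (F z)) \<le> g (x - z)"
  shows "row_mass F H y \<le> hconv g H (x - y)"
proof -
  have "row_mass F H y \<le> (\<integral>\<^sup>+z. g (x - z) * H (z - y) \<partial>lborel)"
    unfolding row_mass_def nn_integral_completion
    using le by (intro nn_integral_mono_AE) (auto elim!: eventually_mono intro: mult_right_mono)
  also have "\<dots> = (\<integral>\<^sup>+z. g ((x - y) - (z - y)) * H (z - y) \<partial>lborel)" by (simp add: algebra_simps)
  also have "\<dots> = hconv g H (x - y)"
    unfolding hconv_def by (rule nn_integral_lborel_diff_right) measurable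
  finally show ?thesis .
qed

context real_coordinates
begin

lemma entry_compose: "entry i j (N o\<^sub>L N') = (\<Sum>l<d. entry i l N * entry l j N')"
  unfolding entry_def[of i j] entry_def[of _ j N'] by (simp only: blinfun_apply_blinfun_compose co_apply[of i N])

lemma op_of_slice_measurable:
  fixes m :: "'a::euclidean_space \<times> nat \<Rightarrow> 'a \<times> nat \<Rightarrow> real"
  assumes m: "tdom d H m"
  shows "(\<lambda>z. op_of m z y) \<in> borel_measurable borel"
  using measurable_Pair1[OF op_of_measurable[OF tdomD(1)[OF m]], of y] by simp

text \<open>The integral of \<open>F z o\<^sub>L op_of m z y\<close> over \<open>z\<close>, formed entry by entry because the space of
  operators is not assumed to be second countable.\<close>

definition rowcomp :: "('a::euclidean_space \<Rightarrow> 'e \<Rightarrow>\<^sub>L 'e) \<Rightarrow> ('a \<times> nat \<Rightarrow> 'a \<times> nat \<Rightarrow> real) \<Rightarrow> 'a \<Rightarrow> 'e \<Rightarrow>\<^sub>L 'e" where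
  "rowcomp F m y = (\<Sum>i<d. \<Sum>j<d. (\<integral>z. entry i j (F z o\<^sub>L op_of m z y) \<partial>lebesgue) *\<^sub>R elem i j)"

lemma entry_rowcomp:
  "i < d \<Longrightarrow> j < d \<Longrightarrow> entry i j (rowcomp F m y) = (\<integral>z. entry i j (F z o\<^sub>L op_of m z y) \<partial>lebesgue)"
  unfolding rowcomp_def by (rule entry_sum_elem)

lemma rowcomp_integrand_measurable:
  fixes m :: "'a::euclidean_space \<times> nat \<Rightarrow> 'a \<times> nat \<Rightarrow> real" and F :: "'a \<Rightarrow> 'e \<Rightarrow>\<^sub>L 'e"
  assumes F: "F \<in> borel_measurable lebesgue" and m: "tdom d H m"
  shows "(\<lambda>z. blinfun_apply (F z) (blinfun_apply (op_of m z y) e)) \<in> borel_measurable lebesgue"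
proof (rule measurable_of_co)
  fix i
  have [measurable]: "(\<lambda>z. entry i l (F z)) \<in> borel_measurable lebesgue" for l
    by (rule measurable_compose[OF F entry_measurable])
  have [measurable]: "(\<lambda>z. co l (blinfun_apply (op_of m z y) e)) \<in> borel_measurable lebesgue" for l
    by (rule borel_imp_lebesgue) (rule measurable_compose[OF apply_measurable[OF op_of_slice_measurable[OF m]] co_measurable])
  have "(\<lambda>z. \<Sum>l<d. entry i l (F z) * co l (blinfun_apply (op_of m z y) e)) \<in> borel_measurable lebesgue"
    by (intro borel_measurable_sum borel_measurable_times) measurable
  then show "(\<lambda>z. co i (blinfun_apply (F z) (blinfun_apply (op_of m z y) e))) \<in> borel_measurable lebesgue"
    by (simp only: co_apply[of i "F _"])
qed

lemma rowcomp_integrand_bound: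
  fixes m :: "'a::euclidean_space \<times> nat \<Rightarrow> 'a \<times> nat \<Rightarrow> real" and F :: "'a \<Rightarrow> 'e \<Rightarrow>\<^sub>L 'e"
  assumes F: "F \<in> borel_measurable lebesgue" and m: "tdom d H m"
  shows "(\<integral>\<^sup>+z. ennreal (norm (blinfun_apply (F z) (blinfun_apply (op_of m z y) e))) \<partial>lebesgue)
    \<le> ennreal (norm e) * (ennreal op_of_bound * row_mass F H y)"
proof -
  have [measurable]: "(\<lambda>z. ennreal (norm (F z)) * H (z - y)) \<in> borel_measurable lebesgue"
  proof (rule borel_measurable_times_ennreal)
    show "(\<lambda>z. ennreal (norm (F z))) \<in> borel_measurable lebesgue"
      using measurable_compose[OF F borel_measurable_norm] by simp
    have [measurable]: "H \<in> borel_measurable borel" by (rule tdomD[OF m])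
    show "(\<lambda>z. H (z - y)) \<in> borel_measurable lebesgue" by (rule borel_imp_lebesgue) measurable
  qed
  have "ennreal (norm (blinfun_apply (F z) (blinfun_apply (op_of m z y) e)))
    \<le> ennreal (norm e) * (ennreal op_of_bound * (ennreal (norm (F z)) * H (z - y)))" for z
  proof -
    have "norm (blinfun_apply (F z) (blinfun_apply (op_of m z y) e)) \<le> norm (F z) * (norm (op_of m z y) * norm e)"
      by (intro order_trans[OF norm_blinfun] mult_left_mono norm_blinfun) simp
    then have "ennreal (norm (blinfun_apply (F z) (blinfun_apply (op_of m z y) e)))
      \<le> ennreal (norm e) * (ennreal (norm (F z)) * ennreal (norm (op_of m z y)))"
      by (simp add: ennreal_mult[symmetric] ennreal_leI mult_ac)
    also have "\<dots> \<le> ennreal (norm e) * (ennreal (norm (F z)) * (ennreal op_of_bound * H (z - y)))"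
      by (intro mult_left_mono norm_op_of_le[OF m]) auto
    finally show ?thesis by (simp add: mult_ac)
  qed
  then have "(\<integral>\<^sup>+z. ennreal (norm (blinfun_apply (F z) (blinfun_apply (op_of m z y) e))) \<partial>lebesgue)
    \<le> (\<integral>\<^sup>+z. ennreal (norm e) * (ennreal op_of_bound * (ennreal (norm (F z)) * H (z - y))) \<partial>lebesgue)"
    by (intro nn_integral_mono)
  also have "\<dots> = ennreal (norm e) * (ennreal op_of_bound * row_mass F H y)"
    unfolding row_mass_def by (simp add: nn_integral_cmult)
  finally show ?thesis .
qed

lemma rowcomp_integrable:
  fixes m :: "'a::euclidean_space \<times> nat \<Rightarrow> 'a \<times> nat \<Rightarrow> real" and F :: "'a \<Rightarrow> 'e \<Rightarrow>\<^sub>L 'e"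
  assumes F: "F \<in> borel_measurable lebesgue" and m: "tdom d H m" and fin: "row_mass F H y < \<infinity>"
  shows "integrable lebesgue (\<lambda>z. blinfun_apply (F z) (blinfun_apply (op_of m z y) e))"
  by (rule integrableI_bounded[OF rowcomp_integrand_measurable[OF F m]])
     (rule le_less_trans[OF rowcomp_integrand_bound[OF F m]], use fin in \<open>simp add: ennreal_mult_less_top\<close>)

lemma rowcomp_apply:
  fixes m :: "'a::euclidean_space \<times> nat \<Rightarrow> 'a \<times> nat \<Rightarrow> real" and F :: "'a \<Rightarrow> 'e \<Rightarrow>\<^sub>L 'e"
  assumes F: "F \<in> borel_measurable lebesgue" and m: "tdom d H m" and fin: "row_mass F H y < \<infinity>"
  shows "blinfun_apply (rowcomp F m y) e = (\<integral>z. blinfun_apply (F z) (blinfun_apply (op_of m z y) e) \<partial>lebesgue)"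
proof -
  note int = rowcomp_integrable[OF F m fin]
  have basis: "blinfun_apply (rowcomp F m y) (b j) = (\<integral>z. blinfun_apply (F z) (blinfun_apply (op_of m z y) (b j)) \<partial>lebesgue)" if j: "j < d" for j
  proof -
    have "co i (blinfun_apply (rowcomp F m y) (b j)) = co i (\<integral>z. blinfun_apply (F z) (blinfun_apply (op_of m z y) (b j)) \<partial>lebesgue)" if i: "i < d" for i
      using entry_rowcomp[OF i j, of F m y] integral_bounded_linear[OF co_linear int, of i "b j"]
      by (simp add: entry_def)
    then show ?thesis by (simp add: eq_iff_co)
  qed
  have "blinfun_apply (rowcomp F m y) e = (\<Sum>j<d. co j e *\<^sub>R blinfun_apply (rowcomp F m y) (b j))" by (rule apply_expand)
  also have "\<dots> = (\<Sum>j<d. \<integral>z. co j e *\<^sub>R blinfun_apply (F z) (blinfun_apply (op_of m z y) (b j)) \<partial>lebesgue)"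
    by (intro sum.cong) (auto simp: basis)
  also have "\<dots> = (\<integral>z. (\<Sum>j<d. co j e *\<^sub>R blinfun_apply (F z) (blinfun_apply (op_of m z y) (b j))) \<partial>lebesgue)"
    by (rule Bochner_Integration.integral_sum[symmetric]) (intro integrable_scaleR_right int)
  also have "\<dots> = (\<integral>z. blinfun_apply (F z) (blinfun_apply (op_of m z y) e) \<partial>lebesgue)"
  proof (intro Bochner_Integration.integral_cong refl)
    fix z
    from apply_expand[of "F z o\<^sub>L op_of m z y" e]
    show "(\<Sum>j<d. co j e *\<^sub>R blinfun_apply (F z) (blinfun_apply (op_of m z y) (b j))) = blinfun_apply (F z) (blinfun_apply (op_of m z y) e)"
      by (simp only: blinfun_apply_blinfun_compose)
  qed
  finally show ?thesis .
qed

lemma rowcomp_norm_le: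
  fixes m :: "'a::euclidean_space \<times> nat \<Rightarrow> 'a \<times> nat \<Rightarrow> real" and F :: "'a \<Rightarrow> 'e \<Rightarrow>\<^sub>L 'e"
  assumes F: "F \<in> borel_measurable lebesgue" and m: "tdom d H m"
  shows "ennreal (norm (rowcomp F m y)) \<le> ennreal op_of_bound * row_mass F H y"
proof (cases "row_mass F H y < \<infinity>")
  case True
  then obtain r where r: "row_mass F H y = ennreal r" "r \<ge> 0" by (cases "row_mass F H y") auto
  have "norm (rowcomp F m y) \<le> op_of_bound * r"
  proof (rule norm_blinfun_bound)
    show "0 \<le> op_of_bound * r" using op_of_bound_pos r(2) by simp
    fix e
    have "ennreal (norm (blinfun_apply (rowcomp F m y) e))
      \<le> (\<integral>\<^sup>+z. ennreal (norm (blinfun_apply (F z) (blinfun_apply (op_of m z y) e))) \<partial>lebesgue)"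
      unfolding rowcomp_apply[OF F m True] by (rule integral_norm_bound_ennreal[OF rowcomp_integrable[OF F m True]])
    also have "\<dots> \<le> ennreal (norm e) * (ennreal op_of_bound * row_mass F H y)" by (rule rowcomp_integrand_bound[OF F m])
    also have "\<dots> = ennreal (op_of_bound * r * norm e)" using op_of_bound_pos r by (simp add: ennreal_mult mult_ac)
    finally show "norm (blinfun_apply (rowcomp F m y) e) \<le> op_of_bound * r * norm e"
      using op_of_bound_pos r(2) by (simp add: ennreal_le_iff)
  qed
  then show ?thesis using op_of_bound_pos r by (simp add: ennreal_mult[symmetric] ennreal_leI)
next
  case False
  then have "row_mass F H y = \<infinity>" by (simp add: not_less top_unique)
  then show ?thesis using op_of_bound_pos by (simp add: ennreal_mult_top)
qed

lemma rowcomp_measurable: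
  fixes m :: "'a::euclidean_space \<times> nat \<Rightarrow> 'a \<times> nat \<Rightarrow> real" and F :: "'a \<Rightarrow> 'e \<Rightarrow>\<^sub>L 'e"
  assumes F: "F \<in> borel_measurable lebesgue" and m: "tdom d H m"
  shows "rowcomp F m \<in> borel_measurable borel"
proof (rule blinfun_measurable_of_entries)
  fix i j assume ij: "i < d" "j < d"
  have "\<exists>g. g \<in> borel_measurable lborel \<and> (AE z in lborel. entry i l (F z) = g z)" for l
  proof -
    have "(\<lambda>z. entry i l (F z)) \<in> borel_measurable lebesgue" by (rule measurable_compose[OF F entry_measurable])
    from completion_ex_borel_measurable_real[OF this] show ?thesis by blast
  qed
  then obtain g where g: "\<And>l. g l \<in> borel_measurable lborel" "\<And>l. AE z in lborel. entry i l (F z) = g l z" by metis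
  have [measurable]: "g l \<in> borel_measurable borel" for l using g(1)[of l] by simp
  have jm: "(\<lambda>w. \<Sum>l<d. g l (snd w) * m (snd w, l) (fst w, j)) \<in> borel_measurable (borel \<Otimes>\<^sub>M borel)"
  proof (intro borel_measurable_sum borel_measurable_times)
    fix l
    show "(\<lambda>w. g l (snd w)) \<in> borel_measurable (borel \<Otimes>\<^sub>M borel)" by measurable
    show "(\<lambda>w. m (snd w, l) (fst w, j)) \<in> borel_measurable (borel \<Otimes>\<^sub>M borel)"
      using measurable_compose[OF measurable_Pair[OF measurable_snd measurable_fst] LM_kernel_slice_measurable[OF tdomD(1)[OF m]], of l j] by simp
  qed
  have "entry i j (rowcomp F m y) = (\<integral>z. (\<Sum>l<d. g l z * m (z, l) (y, j)) \<partial>lborel)" for y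
  proof -
    have "AE z in lborel. \<forall>l. entry i l (F z) = g l z" using g(2) by (simp add: AE_all_countable)
    then have "AE z in lborel. entry i j (F z o\<^sub>L op_of m z y) = (\<Sum>l<d. g l z * m (z, l) (y, j))"
    proof eventually_elim
      case (elim z)
      have "entry i l (F z) * entry l j (op_of m z y) = g l z * m (z, l) (y, j)" if "l < d" for l
        using elim by (simp only: entry_op_of[OF that ij(2)])
      then show ?case by (simp only: entry_compose) (intro sum.cong refl, simp)
    qed
    from integral_lebesgue_cong_AE[OF this]
    have "entry i j (rowcomp F m y) = (\<integral>z. (\<Sum>l<d. g l z * m (z, l) (y, j)) \<partial>lebesgue)"
      by (simp add: entry_rowcomp[OF ij])
    also have "\<dots> = (\<integral>z. (\<Sum>l<d. g l z * m (z, l) (y, j)) \<partial>lborel)"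
      by (rule integral_completion) (use measurable_Pair2[OF jm, of y] in simp)
    finally show ?thesis .
  qed
  then have "(\<lambda>y. entry i j (rowcomp F m y)) = (\<lambda>y. \<integral>z. (\<Sum>l<d. g l z * m (z, l) (y, j)) \<partial>lborel)"
    by (rule ext)
  moreover have "case_prod (\<lambda>y z. \<Sum>l<d. g l z * m (z, l) (y, j)) \<in> borel_measurable (borel \<Otimes>\<^sub>M lborel)"
    using jm by (simp add: split_beta' cong: measurable_cong_sets)
  then have "(\<lambda>y. \<integral>z. (\<Sum>l<d. g l z * m (z, l) (y, j)) \<partial>lborel) \<in> borel_measurable borel"
    by (rule sigma_finite_measure.borel_measurable_lebesgue_integral[OF lborel.sigma_finite_measure_axioms])
  ultimately show "(\<lambda>y. entry i j (rowcomp F m y)) \<in> borel_measurable borel" by (simp only:)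
qed

lemma rowcomp_diff:
  fixes m :: "'a::euclidean_space \<times> nat \<Rightarrow> 'a \<times> nat \<Rightarrow> real" and F :: "'a \<Rightarrow> 'e \<Rightarrow>\<^sub>L 'e"
  assumes F: "F \<in> borel_measurable lebesgue" "row_mass F H y < \<infinity>"
    and G: "G \<in> borel_measurable lebesgue" "row_mass G H y < \<infinity>" and m: "tdom d H m"
  shows "rowcomp F m y - rowcomp G m y = rowcomp (\<lambda>z. F z - G z) m y"
proof -
  have int: "integrable lebesgue (\<lambda>z. entry i j (F z o\<^sub>L op_of m z y))" "integrable lebesgue (\<lambda>z. entry i j (G z o\<^sub>L op_of m z y))" for i j
    using integrable_bounded_linear[OF co_linear rowcomp_integrable[OF F(1) m F(2)], of i "b j"]
      integrable_bounded_linear[OF co_linear rowcomp_integrable[OF G(1) m G(2)], of i "b j"] by (simp_all add: entry_def)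
  have "entry i j ((F z - G z) o\<^sub>L op_of m z y) = entry i j (F z o\<^sub>L op_of m z y) - entry i j (G z o\<^sub>L op_of m z y)" for i j z
    by (simp add: entry_def blinfun.diff_left co_diff)
  then show ?thesis
    using int by (simp add: eq_iff_entry entry_diff entry_rowcomp)
qed

lemma rowcomp_bounded_ops:
  fixes m :: "'a::euclidean_space \<times> nat \<Rightarrow> 'a \<times> nat \<Rightarrow> real"
    and scl :: "'k::{real_normed_field,euclidean_space} \<Rightarrow> 'e \<Rightarrow> 'e"
  assumes ns: "normed_space_over scl" and F: "F \<in> borel_measurable lebesgue" and m: "tdom d H m" and fin: "row_mass F H y < \<infinity>"
    and lin: "\<And>z. F z \<in> bounded_ops scl" "\<And>z. op_of m z y \<in> bounded_ops scl"
  shows "rowcomp F m y \<in> bounded_ops scl"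
  unfolding bounded_ops_iff[OF ns]
proof (intro allI)
  fix a v
  have "blinfun_apply (rowcomp F m y) (scl a v) = (\<integral>z. scl a (blinfun_apply (F z) (blinfun_apply (op_of m z y) v)) \<partial>lebesgue)"
    unfolding rowcomp_apply[OF F m fin] using lin by (simp add: bounded_ops_iff[OF ns])
  also have "\<dots> = scl a (blinfun_apply (rowcomp F m y) v)"
    unfolding rowcomp_apply[OF F m fin]
    by (rule integral_bounded_linear[OF scl_bounded_linear[OF ns] rowcomp_integrable[OF F m fin]])
  finally show "blinfun_apply (rowcomp F m y) (scl a v) = scl a (blinfun_apply (rowcomp F m y) v)" .
qed

text \<open>For almost every \<open>x\<close> the composition of the row \<open>F\<close> of the operator kernel is the matrix composition.
  The row version is defined for every \<open>x\<close>.\<close>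

lemma entry_rowcomp_kcomp:
  fixes m k :: "'a::euclidean_space \<times> nat \<Rightarrow> 'a \<times> nat \<Rightarrow> real"
  assumes F: "F \<in> borel_measurable lebesgue" and m: "tdom d H m" and k: "tdom d h k" and fin: "hconv h H (x - y) < \<infinity>"
    and eq: "AE z in lborel. \<forall>i<d. \<forall>j<d. k (x, i) (z, j) = entry i j (F z)" and ij: "i < d" "j < d"
  shows "entry i j (rowcomp F m y) = kcomp (LM d) k m (x, i) (y, j)"
proof -
  note [measurable] = tdomD(1,2)[OF k] tdomD(1,2)[OF m]
  interpret sigma_finite_measure "LM d :: ('a \<times> nat) measure" by (rule sigma_finite_LM)
  have int: "integrable (LM d) (\<lambda>z. k (x, i) z * m z (y, j))"
  proof (rule integrableI_bounded)
    show "(\<lambda>z. k (x, i) z * m z (y, j)) \<in> borel_measurable (LM d)" by measurable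
    have "(\<integral>\<^sup>+z. ennreal (norm (k (x, i) z * m z (y, j))) \<partial>LM d) \<le> (\<integral>\<^sup>+z. h (x - fst z) * H (fst z - y) \<partial>LM d)"
      by (intro nn_integral_mono)
         (use tdomD(4)[OF k, of "(x, i)"] tdomD(4)[OF m, of _ "(y, j)"] in \<open>auto simp: abs_mult ennreal_mult intro!: mult_mono\<close>)
    also have "\<dots> = of_nat d * hconv h H (x - y)" by (rule nn_integral_LM_hconv) measurable
    finally show "(\<integral>\<^sup>+z. ennreal (norm (k (x, i) z * m z (y, j))) \<partial>LM d) < \<infinity>"
      by (rule le_less_trans) (use fin in \<open>simp add: ennreal_mult_less_top of_nat_less_top\<close>)
  qed
  have "AE z in lborel. entry i j (F z o\<^sub>L op_of m z y) = (\<Sum>l<d. k (x, i) (z, l) * m (z, l) (y, j))"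
    using eq
  proof eventually_elim
    case (elim z)
    have "entry i l (F z) * entry l j (op_of m z y) = k (x, i) (z, l) * m (z, l) (y, j)" if "l < d" for l
      using elim[rule_format, OF ij(1) that] by (simp only: entry_op_of[OF that ij(2)])
    then show ?case by (simp only: entry_compose) (intro sum.cong refl, simp)
  qed
  from integral_lebesgue_cong_AE[OF this]
  have "entry i j (rowcomp F m y) = (\<integral>z. (\<Sum>l<d. k (x, i) (z, l) * m (z, l) (y, j)) \<partial>lebesgue)"
    by (simp add: entry_rowcomp[OF ij])
  also have "\<dots> = (\<integral>z. (\<Sum>l<d. k (x, i) (z, l) * m (z, l) (y, j)) \<partial>lborel)"
    by (rule integral_completion) (intro borel_measurable_sum, use integral_LM(1)[OF int] in auto)
  also have "\<dots> = (\<Sum>l<d. \<integral>z. k (x, i) (z, l) * m (z, l) (y, j) \<partial>lborel)"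
    by (rule Bochner_Integration.integral_sum) (use integral_LM(1)[OF int] in auto)
  also have "\<dots> = kcomp (LM d) k m (x, i) (y, j)"
    using integral_LM(2)[OF int] by (simp add: kcomp_def)
  finally show ?thesis .
qed

end

section \<open>A kernel with continuous rows\<close>

lemma Lp_one: "u \<in> Lp 1 \<longleftrightarrow> u \<in> borel_measurable lebesgue \<and> (\<integral>\<^sup>+x. ennreal (norm (u x)) \<partial>lebesgue) < \<infinity>"
proof (cases "u \<in> borel_measurable lebesgue")
  case True
  have "(\<lambda>x. norm (u x)) \<in> borel_measurable lebesgue" by (rule measurable_compose[OF True borel_measurable_norm])
  then show ?thesis using True by (simp add: Lp_def integrable_iff_bounded)
qed (simp add: Lp_def)

lemma Lp_norm_one: "u \<in> Lp 1 \<Longrightarrow> ennreal (Lp_norm 1 u) = (\<integral>\<^sup>+x. ennreal (norm (u x)) \<partial>lebesgue)"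
  using nn_integral_eq_integral[of lebesgue "\<lambda>x. norm (u x)"] by (simp add: Lp_def Lp_norm_def)

lemma AE_lborel_fst:
  assumes "AE x in (lborel :: 'a::euclidean_space measure). P x"
  shows "AE z in (lborel :: ('a \<times> 'a) measure). P (fst z)"
proof -
  obtain N where N: "{x \<in> space lborel. \<not> P x} \<subseteq> N" "emeasure lborel N = 0" "N \<in> sets (lborel :: 'a measure)"
    using assms by (rule AE_E)
  have "AE z in (lborel :: 'a measure) \<Otimes>\<^sub>M (lborel :: 'a measure). fst z \<notin> N"
  proof (rule lborel_pair.AE_pair_measure)
    have [measurable]: "N \<in> sets borel" using N(3) by simp
    show "{x \<in> space (lborel \<Otimes>\<^sub>M lborel). fst x \<notin> N} \<in> sets ((lborel :: 'a measure) \<Otimes>\<^sub>M (lborel :: 'a measure))" by measurable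
    have "AE x in lborel. x \<notin> N" using N by (intro AE_not_in) auto
    then show "AE x in lborel. AE y in (lborel :: 'a measure). fst (x, y) \<notin> N" by eventually_elim simp
  qed
  then have "AE z in (lborel :: ('a \<times> 'a) measure). fst z \<notin> N" by (subst (asm) lborel_prod)
  then show ?thesis by eventually_elim (use N(1) in auto)
qed

context real_coordinates
begin

lemma blinfun_measurable_diff:
  assumes "F \<in> borel_measurable M" "G \<in> borel_measurable M"
  shows "(\<lambda>x. F x - G x :: 'e \<Rightarrow>\<^sub>L 'e) \<in> borel_measurable M"
proof (rule blinfun_measurable_of_entries)
  fix i j
  have [measurable]: "(\<lambda>x. entry i j (F x)) \<in> borel_measurable M" "(\<lambda>x. entry i j (G x)) \<in> borel_measurable M"
    by (rule measurable_compose[OF _ entry_measurable], fact)+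
  show "(\<lambda>x. entry i j (F x - G x)) \<in> borel_measurable M" unfolding entry_diff by measurable
qed

lemma Lp_one_diff:
  fixes F G :: "'a::euclidean_space \<Rightarrow> 'e \<Rightarrow>\<^sub>L 'e"
  assumes F: "F \<in> Lp 1" and G: "G \<in> Lp 1"
  shows "(\<lambda>x. F x - G x) \<in> Lp 1"
  unfolding Lp_one
proof
  have m: "F \<in> borel_measurable lebesgue" "G \<in> borel_measurable lebesgue" using F G by (simp_all add: Lp_one)
  have [measurable]: "(\<lambda>x. norm (F x)) \<in> borel_measurable lebesgue" "(\<lambda>x. norm (G x)) \<in> borel_measurable lebesgue"
    by (intro measurable_compose[OF _ borel_measurable_norm] m)+
  show "(\<lambda>x. F x - G x) \<in> borel_measurable lebesgue" by (intro blinfun_measurable_diff m)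
  have "(\<integral>\<^sup>+x. ennreal (norm (F x - G x)) \<partial>lebesgue) \<le> (\<integral>\<^sup>+x. ennreal (norm (F x)) + ennreal (norm (G x)) \<partial>lebesgue)"
    by (intro nn_integral_mono) (simp add: norm_triangle_ineq4 ennreal_leI flip: ennreal_plus)
  also have "\<dots> = (\<integral>\<^sup>+x. ennreal (norm (F x)) \<partial>lebesgue) + (\<integral>\<^sup>+x. ennreal (norm (G x)) \<partial>lebesgue)"
    by (rule nn_integral_add) measurable
  also have "\<dots> < \<infinity>" using F G by (simp add: Lp_one)
  finally show "(\<integral>\<^sup>+x. ennreal (norm (F x - G x)) \<partial>lebesgue) < \<infinity>" .
qed

text \<open>The kernel of \<open>- K - K M\<close> is built row by row. Its row at \<open>x\<close> is a bounded
  linear function of the row of \<open>n\<close> at \<open>x\<close>, in the sense that the distance of two rows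
  in the mean is at most a constant times the distance of the rows of \<open>n\<close>. So continuity passes
  from \<open>n\<close> to the new kernel, whatever the kernel \<open>m\<close>.\<close>

lemma CN1_correction:
  fixes scl :: "'k::{real_normed_field,euclidean_space} \<Rightarrow> 'e \<Rightarrow> 'e" and n :: "'a::euclidean_space \<Rightarrow> 'a \<Rightarrow> 'e \<Rightarrow>\<^sub>L 'e"
    and \<beta> :: "'a \<Rightarrow> real"
  assumes ns: "normed_space_over scl"
    and ops: "\<And>x y. n x y \<in> bounded_ops scl"
    and meas: "(\<lambda>(x, y). n x y) \<in> borel_measurable lebesgue"
    and \<beta>: "integrable lebesgue \<beta>" "\<And>x y. norm (n x y) \<le> \<beta> y"
    and rows: "\<And>x. nbar n x \<in> Lp 1"
    and cont: "\<And>x0. ((\<lambda>x. Lp_norm 1 (\<lambda>y. nbar n x y - nbar n x0 y)) \<longlongrightarrow> 0) (at x0)"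
    and k: "tdom d h k" "krep k n"
    and m: "tdom d H m" "\<And>x y. op_of m x y \<in> bounded_ops scl"
  obtains M where "M \<in> CN1 scl" "krep (\<lambda>z w. - k z w - kcomp (LM d) k m z w) M"
proof -
  have [measurable]: "h \<in> borel_measurable borel" "H \<in> borel_measurable borel" by (rule tdomD[OF k(1)], rule tdomD[OF m(1)])
  obtain \<beta>' where \<beta>': "\<beta>' \<in> borel_measurable lborel" "AE x in lborel. \<beta> x = \<beta>' x"
    using completion_ex_borel_measurable_real[OF borel_measurable_integrable[OF \<beta>(1)]] by blast
  have [measurable]: "\<beta>' \<in> borel_measurable borel" using \<beta>'(1) by simp
  have \<beta>0: "0 \<le> \<beta> t" for t using \<beta>(2)[of t t] norm_ge_zero order_trans by blast
  \<comment> \<open>\<open>h\<close> is added so that one finiteness condition controls both the rows of \<open>n\<close> and the matrix kernel \<open>k\<close>\<close>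
  define g where "g t = ennreal \<bar>\<beta>' t\<bar> + h t" for t
  have [measurable]: "g \<in> borel_measurable borel" unfolding g_def[abs_def] by measurable
  have \<beta>fin: "(\<integral>\<^sup>+t. ennreal \<bar>\<beta>' t\<bar> \<partial>lborel) < \<infinity>"
  proof -
    have "(\<integral>\<^sup>+t. ennreal \<bar>\<beta>' t\<bar> \<partial>lborel) = (\<integral>\<^sup>+t. ennreal (norm (\<beta> t)) \<partial>lebesgue)"
      unfolding nn_integral_completion by (intro nn_integral_cong_AE) (use \<beta>'(2) in eventually_elim, simp)
    also have "\<dots> < \<infinity>" using \<beta>(1) by (simp add: integrable_iff_bounded)
    finally show ?thesis .
  qed
  define J where "J = hconv g H"
  have Jm[measurable]: "J \<in> borel_measurable borel" unfolding J_def by measurable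
  have gfin: "(\<integral>\<^sup>+t. g t \<partial>lborel) < \<infinity>"
    unfolding g_def using \<beta>fin tdomD(3)[OF k(1)] by (subst nn_integral_add) auto
  have Jint: "(\<integral>\<^sup>+t. J t \<partial>lborel) < \<infinity>"
    unfolding J_def using gfin tdomD(3)[OF m(1)] by (subst nn_integral_hconv) (auto simp: ennreal_mult_less_top)
  have JAE: "AE t in lborel. J t < \<infinity>"
    using nn_integral_noteq_infinite[of J lborel] Jint by (auto simp: less_top)
  have hJ: "hconv h H t < \<infinity>" if "J t < \<infinity>" for t
  proof -
    have "hconv h H t \<le> J t" unfolding J_def hconv_def g_def by (intro nn_integral_mono mult_right_mono) auto
    then show ?thesis using that by (rule le_less_trans)
  qed
  define K where "K = nbar n"
  have Kop: "K x z \<in> bounded_ops scl" for x z using ops by (simp add: K_def nbar_def)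
  have KL: "K x \<in> Lp 1" for x using rows by (simp add: K_def)
  have Km: "K x \<in> borel_measurable lebesgue" for x using KL[of x] by (simp add: Lp_one)
  have mass: "row_mass (K x) H y \<le> J (x - y)" for x y
    unfolding J_def
  proof (rule row_mass_le_hconv)
    show "AE z in lborel. ennreal (norm (K x z)) \<le> g (x - z)"
      using AE_lborel_diff_left[OF \<beta>'(2), of x]
    proof eventually_elim
      case (elim z)
      have "norm (K x z) \<le> \<bar>\<beta>' (x - z)\<bar>" using \<beta>(2)[of x "x - z"] elim by (simp add: K_def nbar_def)
      then have "ennreal (norm (K x z)) \<le> ennreal \<bar>\<beta>' (x - z)\<bar>" by (rule ennreal_leI)
      also have "\<dots> \<le> g (x - z)" by (simp add: g_def)
      finally show ?case .
    qed
  qed measurable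
  have massfin: "row_mass (K x) H y < \<infinity>" if "J (x - y) < \<infinity>" for x y
    using mass[of x y] that by (rule le_less_trans)
  \<comment> \<open>the majorant \<open>J\<close> is infinite only on a null set of differences, where the composition may diverge\<close>
  define M where "M x t = (if J t < \<infinity> then - n x t - rowcomp (K x) m (x - t) else 0)" for x t
  have Mrow: "nbar M x y = (if J (x - y) < \<infinity> then - K x y - rowcomp (K x) m y else 0)" for x y
    by (simp add: nbar_def M_def K_def)
  have Mops: "M x t \<in> bounded_ops scl" for x t
  proof (cases "J t < \<infinity>")
    case True
    then have "rowcomp (K x) m (x - t) \<in> bounded_ops scl"
      by (intro rowcomp_bounded_ops[OF ns Km m(1) massfin Kop m(2)]) simp
    then show ?thesis using True bounded_ops_diff[OF ns bounded_ops_minus[OF ns ops]] by (simp add: M_def)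
  qed (simp add: M_def bounded_ops_0[OF ns])
  have kAE: "AE x in lborel. \<forall>y. J (x - y) < \<infinity> \<longrightarrow> (\<forall>i<d. \<forall>j<d. entry i j (rowcomp (K x) m y) = kcomp (LM d) k m (x, i) (y, j))"
    using k(2) unfolding krep_def
  proof eventually_elim
    case (elim x)
    have "AE z in lborel. \<forall>i<d. \<forall>j<d. k (x, i) (z, j) = entry i j (K x z)" using elim by (simp only: K_def nbar_def)
    from entry_rowcomp_kcomp[OF Km m(1) k(1) hJ this] show ?case by blast
  qed
  have Mmeas: "(\<lambda>(x, y). M x y) \<in> borel_measurable lebesgue"
  proof (rule blinfun_measurable_of_entries)
    fix i j assume ij: "i < d" "j < d"
    define \<iota> :: "'a \<Rightarrow> real" where "\<iota> t = (if J t < \<infinity> then 1 else 0)" for t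
    have [measurable]: "\<iota> \<in> borel_measurable borel" unfolding \<iota>_def[abs_def] by measurable
    have \<iota>m: "(\<lambda>z :: 'a \<times> 'a. \<iota> (snd z)) \<in> borel_measurable lebesgue"
      by (rule borel_imp_lebesgue) (simp add: borel_prod[symmetric])
    have nm: "(\<lambda>z. entry i j (n (fst z) (snd z))) \<in> borel_measurable lebesgue"
      using measurable_compose[OF meas entry_measurable[of i j]] by (simp add: split_beta')
    have \<kappa>m: "(\<lambda>z :: 'a \<times> 'a. kcomp (LM d) k m (fst z, i) (fst z - snd z, j)) \<in> borel_measurable lebesgue"
    proof (rule borel_imp_lebesgue)
      have s: "(\<lambda>z :: 'a \<times> 'a. (fst z, fst z - snd z)) \<in> measurable (borel \<Otimes>\<^sub>M borel) (borel \<Otimes>\<^sub>M borel)" by measurable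
      show "(\<lambda>z :: 'a \<times> 'a. kcomp (LM d) k m (fst z, i) (fst z - snd z, j)) \<in> borel_measurable borel"
        using measurable_compose[OF s LM_kernel_slice_measurable[OF tdomD(1)[OF tdom_kcomp[OF k(1) m(1)]], of i j]]
        by (simp add: borel_prod)
    qed
    have "(\<lambda>z. \<iota> (snd z) * (- entry i j (n (fst z) (snd z)) - kcomp (LM d) k m (fst z, i) (fst z - snd z, j))) \<in> borel_measurable lebesgue"
      by (intro borel_measurable_times borel_measurable_diff borel_measurable_uminus \<iota>m nm \<kappa>m)
    then show "(\<lambda>z. entry i j (case z of (x, y) \<Rightarrow> M x y)) \<in> borel_measurable lebesgue"
    proof (rule measurable_lebesgue_AE_eq)
      show "AE z in lborel. \<iota> (snd z) * (- entry i j (n (fst z) (snd z)) - kcomp (LM d) k m (fst z, i) (fst z - snd z, j))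
        = entry i j (case z of (x, y) \<Rightarrow> M x y)"
        using AE_lborel_fst[OF kAE]
      proof eventually_elim
        case (elim z)
        show ?case
        proof (cases "J (snd z) < \<infinity>")
          case True
          then have "entry i j (rowcomp (K (fst z)) m (fst z - snd z)) = kcomp (LM d) k m (fst z, i) (fst z - snd z, j)"
            using elim[rule_format, of "fst z - snd z" i j] ij by simp
          then show ?thesis using True by (simp add: split_beta' M_def \<iota>_def entry_diff entry_minus)
        qed (simp add: split_beta' M_def \<iota>_def)
      qed
    qed
  qed
  define B where "B t = \<beta> t + enn2real (ennreal op_of_bound * J t)" for t
  have Bint: "integrable lebesgue B"
    unfolding B_def
  proof (intro Bochner_Integration.integrable_add \<beta>(1))
    have "integrable lborel (\<lambda>t. enn2real (ennreal op_of_bound * J t))"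
    proof (rule integrableI_bounded)
      have "(\<integral>\<^sup>+t. ennreal (norm (enn2real (ennreal op_of_bound * J t))) \<partial>lborel) \<le> (\<integral>\<^sup>+t. ennreal op_of_bound * J t \<partial>lborel)"
        by (intro nn_integral_mono) (simp add: ennreal_enn2real_if)
      also have "\<dots> < \<infinity>" using Jint by (simp add: nn_integral_cmult ennreal_mult_less_top)
      finally show "(\<integral>\<^sup>+t. ennreal (norm (enn2real (ennreal op_of_bound * J t))) \<partial>lborel) < \<infinity>" .
    qed measurable
    then show "integrable lebesgue (\<lambda>t. enn2real (ennreal op_of_bound * J t))"
      by (subst integrable_completion) (auto dest: borel_measurable_integrable)
  qed
  have Mle: "norm (M x t) \<le> B t" for x t
  proof (cases "J t < \<infinity>")
    case True
    have "ennreal (norm (rowcomp (K x) m (x - t))) \<le> ennreal op_of_bound * row_mass (K x) H (x - t)"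
      by (rule rowcomp_norm_le[OF Km m(1)])
    also have "\<dots> \<le> ennreal op_of_bound * J t" using mass[of x "x - t"] by (intro mult_left_mono) auto
    finally have "norm (rowcomp (K x) m (x - t)) \<le> enn2real (ennreal op_of_bound * J t)"
      using True enn2real_mono[of "ennreal (norm (rowcomp (K x) m (x - t)))" "ennreal op_of_bound * J t"]
      by (simp add: ennreal_mult_less_top)
    then have "norm (- n x t - rowcomp (K x) m (x - t)) \<le> B t"
      unfolding B_def using \<beta>(2)[of x t] norm_triangle_ineq4[of "- n x t" "rowcomp (K x) m (x - t)"] by simp
    then show ?thesis using True by (simp add: M_def)
  qed (simp add: M_def B_def \<beta>0)
  have MN1: "M \<in> N1 scl"
    unfolding N1_def using Mops Mmeas Bint Mle by auto
  have mass_int: "(\<integral>\<^sup>+y. ennreal op_of_bound * row_mass F H y \<partial>lborel) = ennreal op_of_bound * ((\<integral>\<^sup>+z. ennreal (norm (F z)) \<partial>lebesgue) * (\<integral>\<^sup>+t. H t \<partial>lborel))"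
    "(\<integral>\<^sup>+y. ennreal (norm (F y)) + ennreal op_of_bound * row_mass F H y \<partial>lebesgue)
      = (1 + ennreal op_of_bound * (\<integral>\<^sup>+t. H t \<partial>lborel)) * (\<integral>\<^sup>+z. ennreal (norm (F z)) \<partial>lebesgue)"
    if F: "F \<in> borel_measurable lebesgue" for F :: "'a \<Rightarrow> 'e \<Rightarrow>\<^sub>L 'e"
  proof -
    have Hm: "H \<in> borel_measurable borel" by measurable
    have [measurable]: "row_mass F H \<in> borel_measurable borel" by (rule row_mass_integral(1)[OF F Hm])
    show e: "(\<integral>\<^sup>+y. ennreal op_of_bound * row_mass F H y \<partial>lborel) = ennreal op_of_bound * ((\<integral>\<^sup>+z. ennreal (norm (F z)) \<partial>lebesgue) * (\<integral>\<^sup>+t. H t \<partial>lborel))"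
      by (simp add: nn_integral_cmult row_mass_integral(2)[OF F Hm])
    have 1: "(\<lambda>y. ennreal (norm (F y))) \<in> borel_measurable lebesgue"
      using measurable_compose[OF F borel_measurable_norm] by simp
    have 2: "(\<lambda>y. ennreal op_of_bound * row_mass F H y) \<in> borel_measurable lebesgue" by (rule borel_imp_lebesgue) measurable
    have "(\<integral>\<^sup>+y. ennreal (norm (F y)) + ennreal op_of_bound * row_mass F H y \<partial>lebesgue)
      = (\<integral>\<^sup>+y. ennreal (norm (F y)) \<partial>lebesgue) + (\<integral>\<^sup>+y. ennreal op_of_bound * row_mass F H y \<partial>lebesgue)"
      by (rule nn_integral_add[OF 1 2])
    also have "(\<integral>\<^sup>+y. ennreal op_of_bound * row_mass F H y \<partial>lebesgue) = (\<integral>\<^sup>+y. ennreal op_of_bound * row_mass F H y \<partial>lborel)"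
      by (rule nn_integral_completion)
    finally show "(\<integral>\<^sup>+y. ennreal (norm (F y)) + ennreal op_of_bound * row_mass F H y \<partial>lebesgue)
      = (1 + ennreal op_of_bound * (\<integral>\<^sup>+t. H t \<partial>lborel)) * (\<integral>\<^sup>+z. ennreal (norm (F z)) \<partial>lebesgue)"
      unfolding e by (simp add: distrib_left distrib_right mult_ac)
  qed
  define C where "C = 1 + op_of_bound * enn2real (\<integral>\<^sup>+t. H t \<partial>lborel)"
  have C: "C \<ge> 0" "1 + ennreal op_of_bound * (\<integral>\<^sup>+t. H t \<partial>lborel) = ennreal C"
  proof -
    obtain r where r: "(\<integral>\<^sup>+t. H t \<partial>lborel) = ennreal r" "r \<ge> 0"
      using tdomD(3)[OF m(1)] by (cases "\<integral>\<^sup>+t. H t \<partial>lborel") auto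
    show "C \<ge> 0" "1 + ennreal op_of_bound * (\<integral>\<^sup>+t. H t \<partial>lborel) = ennreal C"
      using r op_of_bound_pos by (auto simp: C_def ennreal_mult ennreal_plus)
  qed
  have Mrows: "nbar M x \<in> Lp 1" for x
    unfolding Lp_one
  proof
    have JxAE: "AE y in lborel. J (x - y) < \<infinity>" by (rule AE_lborel_diff_left[OF JAE])
    have "(\<lambda>y. 0 - K x y) \<in> borel_measurable lebesgue" by (intro blinfun_measurable_diff Km) simp
    then have "(\<lambda>y. (0 - K x y) - rowcomp (K x) m y) \<in> borel_measurable lebesgue"
      by (rule blinfun_measurable_diff) (rule borel_imp_lebesgue[OF rowcomp_measurable[OF Km m(1)]])
    then show "nbar M x \<in> borel_measurable lebesgue"
      by (rule measurable_lebesgue_AE_eq) (use JxAE in eventually_elim, simp add: Mrow)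
    have "(\<integral>\<^sup>+y. ennreal (norm (nbar M x y)) \<partial>lebesgue) \<le> (\<integral>\<^sup>+y. ennreal (norm (K x y)) + ennreal op_of_bound * row_mass (K x) H y \<partial>lebesgue)"
    proof (rule nn_integral_mono)
      fix y
      have "ennreal (norm (- K x y - rowcomp (K x) m y)) \<le> ennreal (norm (K x y)) + ennreal (norm (rowcomp (K x) m y))"
        using norm_triangle_ineq4[of "- K x y" "rowcomp (K x) m y"] by (simp add: ennreal_leI flip: ennreal_plus)
      also have "\<dots> \<le> ennreal (norm (K x y)) + ennreal op_of_bound * row_mass (K x) H y"
        by (intro add_left_mono rowcomp_norm_le[OF Km m(1)])
      finally show "ennreal (norm (nbar M x y)) \<le> ennreal (norm (K x y)) + ennreal op_of_bound * row_mass (K x) H y"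
        by (simp add: Mrow)
    qed
    also have "\<dots> < \<infinity>"
      unfolding mass_int(2)[OF Km] C(2) using KL[of x] by (simp add: Lp_one ennreal_mult_less_top)
    finally show "(\<integral>\<^sup>+y. ennreal (norm (nbar M x y)) \<partial>lebesgue) < \<infinity>" .
  qed
  have Mdiff: "Lp_norm 1 (\<lambda>y. nbar M x y - nbar M x0 y) \<le> C * Lp_norm 1 (\<lambda>y. K x y - K x0 y)" for x x0
  proof -
    let ?D = "\<lambda>y. K x y - K x0 y"
    have DL: "?D \<in> Lp 1" by (rule Lp_one_diff[OF KL KL])
    then have Dm: "?D \<in> borel_measurable lebesgue" by (simp add: Lp_one)
    have "ennreal (Lp_norm 1 (\<lambda>y. nbar M x y - nbar M x0 y)) = (\<integral>\<^sup>+y. ennreal (norm (nbar M x y - nbar M x0 y)) \<partial>lebesgue)"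
      by (rule Lp_norm_one[OF Lp_one_diff[OF Mrows Mrows]])
    also have "\<dots> \<le> (\<integral>\<^sup>+y. ennreal (norm (?D y)) + ennreal op_of_bound * row_mass ?D H y \<partial>lebesgue)"
      unfolding nn_integral_completion
    proof (rule nn_integral_mono_AE)
      show "AE y in lborel. ennreal (norm (nbar M x y - nbar M x0 y)) \<le> ennreal (norm (?D y)) + ennreal op_of_bound * row_mass ?D H y"
        using AE_lborel_diff_left[OF JAE, of x] AE_lborel_diff_left[OF JAE, of x0]
      proof eventually_elim
        case (elim y)
        have "nbar M x y - nbar M x0 y = - ?D y - (rowcomp (K x) m y - rowcomp (K x0) m y)" using elim by (simp add: Mrow)
        also have "\<dots> = - ?D y - rowcomp ?D m y"
          by (simp only: rowcomp_diff[OF Km massfin[OF elim(1)] Km massfin[OF elim(2)] m(1)])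
        finally have "norm (nbar M x y - nbar M x0 y) \<le> norm (?D y) + norm (rowcomp ?D m y)"
          using norm_triangle_ineq4[of "- ?D y" "rowcomp ?D m y"] by (simp only: norm_minus_cancel)
        then have "ennreal (norm (nbar M x y - nbar M x0 y)) \<le> ennreal (norm (?D y)) + ennreal (norm (rowcomp ?D m y))"
          by (simp add: ennreal_leI flip: ennreal_plus)
        also have "\<dots> \<le> ennreal (norm (?D y)) + ennreal op_of_bound * row_mass ?D H y"
          by (intro add_left_mono rowcomp_norm_le[OF Dm m(1)])
        finally show ?case .
      qed
    qed
    also have "\<dots> = ennreal C * ennreal (Lp_norm 1 ?D)"
      unfolding mass_int(2)[OF Dm] C(2) Lp_norm_one[OF DL] ..
    finally have le: "ennreal (Lp_norm 1 (\<lambda>y. nbar M x y - nbar M x0 y)) \<le> ennreal C * ennreal (Lp_norm 1 ?D)" .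
    have nn: "0 \<le> Lp_norm 1 ?D" by (simp add: Lp_norm_def)
    show ?thesis using le C(1) nn by (simp add: ennreal_mult[symmetric] ennreal_le_iff)
  qed
  have Mcont: "((\<lambda>x. Lp_norm 1 (\<lambda>y. nbar M x y - nbar M x0 y)) \<longlongrightarrow> 0) (at x0)" for x0
  proof (rule tendsto_sandwich[OF always_eventually always_eventually])
    show "\<forall>x. 0 \<le> Lp_norm 1 (\<lambda>y. nbar M x y - nbar M x0 y)" by (simp add: Lp_norm_def)
    show "\<forall>x. Lp_norm 1 (\<lambda>y. nbar M x y - nbar M x0 y) \<le> C * Lp_norm 1 (\<lambda>y. K x y - K x0 y)" using Mdiff by blast
    show "((\<lambda>x. C * Lp_norm 1 (\<lambda>y. K x y - K x0 y)) \<longlongrightarrow> 0) (at x0)"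
      unfolding K_def by (rule tendsto_mult_right_zero[OF cont])
  qed simp
  have "M \<in> CN1 scl"
    unfolding CN1_def using MN1 Bint Mle Mrows Mcont by blast
  moreover have "krep (\<lambda>z w. - k z w - kcomp (LM d) k m z w) M"
    unfolding krep_def using k(2)[unfolded krep_def] kAE
  proof eventually_elim
    case (elim x)
    show ?case using elim(1) AE_lborel_diff_left[OF JAE, of x]
    proof eventually_elim
      case (elim y)
      show ?case
      proof (intro allI impI)
        fix i j assume ij: "i < d" "j < d"
        have "entry i j (rowcomp (K x) m y) = kcomp (LM d) k m (x, i) (y, j)"
          using \<open>\<forall>y. J (x - y) < \<infinity> \<longrightarrow> _ y\<close> elim(2) ij by blast
        moreover have "entry i j (n x (x - y)) = k (x, i) (y, j)" using elim(1) ij by simp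
        ultimately show "- k (x, i) (y, j) - kcomp (LM d) k m (x, i) (y, j) = entry i j (M x (x - y))"
          using elim(2) by (simp add: M_def entry_diff entry_minus)
      qed
    qed
  qed
  ultimately show ?thesis by (rule that)
qed

end

section \<open>Inverses up to null sets\<close>

context real_coordinates
begin

lemma Lp_AE_eq:
  fixes u v :: "'a::euclidean_space \<Rightarrow> 'e"
  assumes p: "1 \<le> p" and u: "u \<in> Lp p" and eq: "AE x in lborel. u x = v x"
  shows "v \<in> Lp p" "Lp_norm p v = Lp_norm p u"
proof -
  note y = young_lp_phi[OF p]
  have um: "u \<in> borel_measurable lebesgue" using u by (simp add: Lp_def)
  have vm: "v \<in> borel_measurable lebesgue" by (rule measurable_lebesgue_AE_eq[OF um eq])
  have l: "luxemburg lborel (lp_phi p) (\<lambda>x. ennreal (norm (u x))) = luxemburg lborel (lp_phi p) (\<lambda>x. ennreal (norm (v x)))"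
    by (intro antisym luxemburg_mono_AE[OF y]) (use eq in eventually_elim, simp)+
  show v: "v \<in> Lp p"
    by (rule Lp_luxemburg(2)[OF p vm]) (simp add: l[symmetric] Lp_luxemburg(1)[OF p um u])
  have "ennreal (Lp_norm p v) = ennreal (Lp_norm p u)"
    using l by (simp add: Lp_luxemburg(1)[OF p um u] Lp_luxemburg(1)[OF p vm v])
  then show "Lp_norm p v = Lp_norm p u" by (simp add: Lp_norm_def)
qed

lemma Lp_add:
  fixes u v :: "'a::euclidean_space \<Rightarrow> 'e"
  assumes p: "1 \<le> p" and u: "u \<in> Lp p" and v: "v \<in> Lp p"
  shows "(\<lambda>x. u x + v x) \<in> Lp p"
proof -
  note y = young_lp_phi[OF p]
  have um: "u \<in> borel_measurable lebesgue" "v \<in> borel_measurable lebesgue" using u v by (simp_all add: Lp_def)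
  obtain f where f: "rep f u" by (rule rep_exists[OF um(1)])
  obtain g where g: "rep g v" by (rule rep_exists[OF um(2)])
  have [measurable]: "f \<in> borel_measurable (LM d)" "g \<in> borel_measurable (LM d)" using f g by (simp_all add: rep_def)
  let ?N = "\<lambda>f. luxemburg (LM d) (lp_phi p) (\<lambda>z. ennreal \<bar>f z\<bar>)"
  have fin: "?N f < \<infinity>" "?N g < \<infinity>"
    using luxemburg_rep_le[OF y f] luxemburg_rep_le[OF y g]
    by (auto simp: Lp_luxemburg(1)[OF p um(1) u] Lp_luxemburg(1)[OF p um(2) v] ennreal_mult_less_top intro: le_less_trans)
  have r: "rep (\<lambda>z. f z + g z) (\<lambda>x. u x + v x)" by (rule rep_add[OF f g])
  have "?N (\<lambda>z. f z + g z) \<le> luxemburg (LM d) (lp_phi p) (\<lambda>z. ennreal \<bar>f z\<bar> + ennreal \<bar>g z\<bar>)"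
    by (intro luxemburg_mono_AE[OF y] always_eventually allI) (simp flip: ennreal_plus)
  also have "\<dots> \<le> ?N f + ?N g" by (rule luxemburg_add[OF y]) measurable
  also have "\<dots> < \<infinity>" using fin by simp
  finally have "?N (\<lambda>z. f z + g z) < \<infinity>" .
  then show ?thesis
    by (intro Lp_luxemburg(2)[OF p rep_measurable[OF r]] le_less_trans[OF luxemburg_rep_ge[OF y r]])
       (simp add: ennreal_mult_less_top)
qed

lemma Lp_scl:
  fixes u :: "'a::euclidean_space \<Rightarrow> 'e" and scl :: "'k::{real_normed_field,euclidean_space} \<Rightarrow> 'e \<Rightarrow> 'e"
  assumes p: "1 \<le> p" and ns: "normed_space_over scl" and u: "u \<in> Lp p"
  shows "(\<lambda>x. scl a (u x)) \<in> Lp p"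
proof -
  note y = young_lp_phi[OF p]
  have um: "u \<in> borel_measurable lebesgue" using u by (simp add: Lp_def)
  have m: "(\<lambda>x. scl a (u x)) \<in> borel_measurable lebesgue"
    by (rule measurable_compose[OF um])
       (intro borel_measurable_continuous_onI linear_continuous_on scl_bounded_linear[OF ns])
  have "(\<lambda>x. ennreal (norm (scl a (u x)))) = (\<lambda>x. ennreal (norm a) * ennreal (norm (u x)))"
    using ns by (auto simp: normed_space_over_def ennreal_mult)
  then have "luxemburg lborel (lp_phi p) (\<lambda>x. ennreal (norm (scl a (u x)))) \<le> ennreal (norm a) * ennreal (Lp_norm p u)"
    using luxemburg_cmult[OF y, of "norm a" lborel "\<lambda>x. ennreal (norm (u x))"] by (simp add: Lp_luxemburg(1)[OF p um u])
  then show ?thesis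
    by (intro Lp_luxemburg(2)[OF p m]) (auto simp: ennreal_mult_less_top intro: le_less_trans)
qed

text \<open>All conditions on an inverse are statements up to null sets, so an inverse may be replaced by an operator that agrees with
  it almost everywhere on each function.\<close>

lemma Lp_inverse_AE_cong:
  fixes scl :: "'k::{real_normed_field,euclidean_space} \<Rightarrow> 'e \<Rightarrow> 'e"
    and T R R' :: "('a::euclidean_space \<Rightarrow> 'e) \<Rightarrow> 'a \<Rightarrow> 'e"
  assumes p: "1 \<le> p" and ns: "normed_space_over scl" and inv: "Lp_inverse scl p T R"
    and eq: "\<And>u. u \<in> Lp p \<Longrightarrow> AE x in lborel. R' u x = R u x"
    and T: "\<And>u v. AE x in lborel. u x = v x \<Longrightarrow> AE x in lborel. T u x = T v x"
  shows "Lp_inverse scl p T R'"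
proof -
  have T_bdd: "Lp_bounded_op scl p T" and R_bdd: "Lp_bounded_op scl p R"
    and RT: "\<And>u. u \<in> Lp p \<Longrightarrow> AE x in lborel. R (T u) x = u x"
    and TR: "\<And>u. u \<in> Lp p \<Longrightarrow> AE x in lborel. T (R u) x = u x"
    using inv by (simp_all add: Lp_inverse_def AE_completion_iff)
  have R_Lp: "\<And>u. u \<in> Lp p \<Longrightarrow> R u \<in> Lp p" and T_Lp: "\<And>u. u \<in> Lp p \<Longrightarrow> T u \<in> Lp p"
    using R_bdd T_bdd by (simp_all add: Lp_bounded_op_def)
  have R_add: "\<And>u v. u \<in> Lp p \<Longrightarrow> v \<in> Lp p \<Longrightarrow> AE x in lborel. R (\<lambda>y. u y + v y) x = R u x + R v x"
    and R_scl: "\<And>a u. u \<in> Lp p \<Longrightarrow> AE x in lborel. R (\<lambda>y. scl a (u y)) x = scl a (R u x)"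
    using R_bdd by (simp_all add: Lp_bounded_op_def AE_completion_iff)
  have "\<exists>C. \<forall>u\<in>Lp p. Lp_norm p (R u) \<le> C * Lp_norm p u"
    using R_bdd by (simp add: Lp_bounded_op_def)
  then obtain C where C: "\<And>u. u \<in> Lp p \<Longrightarrow> Lp_norm p (R u) \<le> C * Lp_norm p u" by blast
  have eq': "AE x in lborel. R u x = R' u x" if "u \<in> Lp p" for u using eq[OF that] by eventually_elim simp
  have "Lp_bounded_op scl p R'"
    unfolding Lp_bounded_op_def AE_completion_iff
  proof (intro conjI ballI allI exI[of _ C])
    fix u :: "'a \<Rightarrow> 'e" assume u: "u \<in> Lp p"
    show "R' u \<in> Lp p" by (rule Lp_AE_eq(1)[OF p R_Lp[OF u] eq'[OF u]])
    show "Lp_norm p (R' u) \<le> C * Lp_norm p u"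
      using C[OF u] Lp_AE_eq(2)[OF p R_Lp[OF u] eq'[OF u]] by simp
    show "AE x in lborel. R' (\<lambda>y. scl a (u y)) x = scl a (R' u x)" for a
      using eq[OF u] eq[OF Lp_scl[OF p ns u], of a] R_scl[OF u, of a] by eventually_elim simp
    fix v :: "'a \<Rightarrow> 'e" assume v: "v \<in> Lp p"
    show "AE x in lborel. R' (\<lambda>y. u y + v y) x = R' u x + R' v x"
      using eq[OF u] eq[OF v] eq[OF Lp_add[OF p u v]] R_add[OF u v] by eventually_elim simp
  qed
  moreover have "AE x in lborel. R' (T u) x = u x" if u: "u \<in> Lp p" for u
    using eq[OF T_Lp[OF u]] RT[OF u] by eventually_elim simp
  moreover have "AE x in lborel. T (R' u) x = u x" if u: "u \<in> Lp p" for u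
    using T[OF eq[OF u]] TR[OF u] by eventually_elim simp
  ultimately show ?thesis using T_bdd by (simp add: Lp_inverse_def AE_completion_iff)
qed

lemma krep_cong:
  fixes N N' :: "'a::euclidean_space \<Rightarrow> 'a \<Rightarrow> 'e \<Rightarrow>\<^sub>L 'e"
  assumes k: "krep k N" and eq: "AE (x, y) in lebesgue. N x y = N' x y"
  shows "krep k N'"
proof -
  have "AE z in (lborel :: ('a \<times> 'a) measure). N (fst z) (snd z) = N' (fst z) (snd z)"
    using eq by (simp add: AE_completion_iff split_beta')
  then have "AE z in lborel \<Otimes>\<^sub>M lborel. N (fst z) (snd z) = N' (fst z) (snd z)" by (subst lborel_prod)
  from lborel_pair.AE_pair[OF this] have "AE x in lborel. AE t in lborel. N x t = N' x t" by simp
  then show ?thesis using k unfolding krep_def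
  proof eventually_elim
    case (elim x)
    show ?case using AE_lborel_diff_left[OF elim(1), of x] elim(2) by eventually_elim simp
  qed
qed

text \<open>By \<open>M = - K - K M\<close> the corrected kernel defines the same operator.\<close>

lemma kernel_correction_kop:
  fixes k m m' :: "'a::euclidean_space \<times> nat \<Rightarrow> 'a \<times> nat \<Rightarrow> real" and u :: "'a \<Rightarrow> 'e"
  assumes p: "1 \<le> p" and r: "rep f u" and u: "u \<in> Lp p"
    and k: "tdom d h k" and m: "tdom d H m" and m': "tdom d H' m'"
    and eq: "AE z in LM d. AE w in LM d. m' z w = m z w"
    and inv: "AE z in LM d. kop (LM d) m f z + kop (LM d) k f z + kop (LM d) k (kop (LM d) m f) z = 0"
  shows "AE z in LM d. kop (LM d) (\<lambda>z w. - k z w - kcomp (LM d) k m' z w) f z = kop (LM d) m f z"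
proof -
  have f: "f \<in> borel_measurable (LM d)" using r by (simp add: rep_def)
  note int_k = rep_Lp_kop(1)[OF p r u k m'] and km = rep_Lp_kop(2)[OF p r u k m']
    and int_km = rep_Lp_kop(1)[OF p r u tdom_kcomp[OF k m'] m']
  interpret sigma_finite_measure "LM d :: ('a \<times> nat) measure" by (rule sigma_finite_LM)
  note [measurable] = tdomD(1)[OF k] tdomD(1)[OF m] tdomD(1)[OF m'] f
  have mf: "AE z in LM d. kop (LM d) m' f z = kop (LM d) m f z"
    using eq
  proof eventually_elim
    case (elim z)
    show ?case unfolding kop_def
      by (rule integral_cong_AE) (use elim in \<open>measurable, eventually_elim, simp\<close>)
  qed
  have mm: "kop (LM d) m' f \<in> borel_measurable (LM d)" and mm': "kop (LM d) m f \<in> borel_measurable (LM d)"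
    by measurable
  have kmf: "kop (LM d) k (kop (LM d) m' f) z = kop (LM d) k (kop (LM d) m f) z" for z
    by (rule kop_cong_AE[OF tdomD(1)[OF k] mm mm' mf]) simp
  show ?thesis using int_k int_km km inv
  proof eventually_elim
    case (elim z)
    have "kop (LM d) (\<lambda>z w. - k z w - kcomp (LM d) k m' z w) f z = - kop (LM d) k f z - kop (LM d) (kcomp (LM d) k m') f z"
      using elim(1,2) unfolding kop_def by (simp add: left_diff_distrib)
    then show ?case using elim(3,4) kmf[of z] by simp
  qed
qed

end

section \<open>Inversion in the class of kernels with continuous rows\<close>

theorem theorem5p3:
  fixes scl :: "'k::{real_normed_field,euclidean_space}
                  \<Rightarrow> 'e::{banach,second_countable_topology} \<Rightarrow> 'e"
    and n :: "real ^ 'c \<Rightarrow> real ^ 'c \<Rightarrow> 'e \<Rightarrow>\<^sub>L 'e"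
    and p :: ennreal
  assumes "normed_space_over scl"
    and "finite_dimensional_vector_space scl Basis_E"
    and "n \<in> CN1 scl"
    and "1 \<le> p"
    and "Lp_invertible scl p (id_plus (integral_op n))"
  shows "\<exists>m\<in>CN1 scl. Lp_inverse scl p (id_plus (integral_op n)) (id_plus (integral_op m))"
proof -
  note ns = assms(1) and p = assms(4)
  let ?T = "id_plus (integral_op n)"
  obtain d b co where "real_coordinates d b (co :: nat \<Rightarrow> 'e \<Rightarrow> real)"
    by (rule real_coordinates_exist[OF assms(1,2)])
  then interpret real_coordinates d b co .
  from assms(3) obtain n' \<beta> where n': "n' \<in> N1 scl" "AE (x, y) in lebesgue. n' x y = n x y"
    and \<beta>: "integrable lebesgue \<beta>" "\<And>x y. norm (n' x y) \<le> \<beta> y"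
    and rows: "\<And>x. nbar n' x \<in> Lp 1"
    and cont: "\<And>x0. ((\<lambda>x. Lp_norm 1 (\<lambda>y. nbar n' x y - nbar n' x0 y)) \<longlongrightarrow> 0) (at x0)"
    unfolding CN1_def by blast
  have ops: "\<And>x y. n' x y \<in> bounded_ops scl" and meas: "(\<lambda>(x, y). n' x y) \<in> borel_measurable lebesgue"
    using n'(1) by (simp_all add: N1_def)
  obtain h k where k: "tdom d h k" "krep k n'" by (rule kernel_rep_exists[OF meas \<beta>])
  have kn: "krep k n" by (rule krep_cong[OF k(2) n'(2)])
  obtain R where R: "Lp_inverse scl p ?T R" using assms(5) by (auto simp: Lp_invertible_def)
  have R_Lp: "\<And>u. u \<in> Lp p \<Longrightarrow> R u \<in> Lp p"
    and R_scl: "\<And>a u. u \<in> Lp p \<Longrightarrow> AE x in lebesgue. R (\<lambda>y. scl a (u y)) x = scl a (R u x)"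
    using R by (simp_all add: Lp_inverse_def Lp_bounded_op_def)
  have "\<exists>C. \<forall>u\<in>Lp p. Lp_norm p (R u) \<le> C * Lp_norm p u"
    using R by (simp add: Lp_inverse_def Lp_bounded_op_def)
  then obtain C where C: "\<And>u. u \<in> Lp p \<Longrightarrow> Lp_norm p (R u) \<le> C * Lp_norm p u" by blast
  have RT: "\<And>u. u \<in> Lp p \<Longrightarrow> AE x in lebesgue. R (?T u) x = u x"
    and TR: "\<And>u. u \<in> Lp p \<Longrightarrow> AE x in lebesgue. ?T (R u) x = u x"
    using R by (simp_all add: Lp_inverse_def)
  from scalar_inverse[OF p k(1) kn R_Lp C RT TR]
  obtain H m where m: "tdom d H m"
    and rep_R: "\<And>f u. rep f u \<Longrightarrow> u \<in> Lp p \<Longrightarrow> rep (\<lambda>z. f z + kop (LM d) m f z) (R u)"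
    and inv: "\<And>f u. rep f u \<Longrightarrow> u \<in> Lp p \<Longrightarrow> AE z in LM d. kop (LM d) m f z + kop (LM d) k f z + kop (LM d) k (kop (LM d) m f) z = 0"
    by blast
  have "AE x in lborel. AE y in lborel. op_of m x y \<in> bounded_ops scl"
    by (rule op_of_linear_over_scalars[OF ns p m rep_R rep_Lp_kop(1)[OF p _ _ m m] R_scl])
  then obtain m' where m': "tdom d H m'" "\<And>x y. op_of m' x y \<in> bounded_ops scl" "AE z in LM d. AE w in LM d. m' z w = m z w"
    by (rule linear_kernel_exists[OF ns m]) (rule that)
  define l where "l z w = - k z w - kcomp (LM d) k m' z w" for z w
  obtain M where M: "M \<in> CN1 scl" "krep l M"
    unfolding l_def[abs_def] by (rule CN1_correction[OF ns ops meas \<beta> rows cont k m'(1,2)])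
  obtain h' where l: "tdom d h' l"
    using tdom_add[OF tdom_uminus[OF k(1)] tdom_uminus[OF tdom_kcomp[OF k(1) m'(1)]]] by (simp add: l_def[abs_def])
  have "AE x in lborel. id_plus (integral_op M) u x = R u x" if u: "u \<in> Lp p" for u :: "real ^ 'c \<Rightarrow> 'e"
  proof -
    have "u \<in> borel_measurable lebesgue" using u by (simp add: Lp_def)
    then obtain f where f: "rep f u" by (rule rep_exists)
    have "AE z in LM d. kop (LM d) l f z = kop (LM d) m f z"
      unfolding l_def[abs_def]
      by (rule kernel_correction_kop[OF p f u k(1) m m'(1) m'(3) inv[OF f u]])
    moreover have "rep (\<lambda>z. f z + kop (LM d) l f z) (id_plus (integral_op M) u)"
      unfolding id_plus_def by (intro rep_add f rep_integral_op[OF tdomD(1)[OF l] M(2) f rep_Lp_kop(1)[OF p f u l l]])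
    moreover have "(\<lambda>z. f z + kop (LM d) m f z) \<in> borel_measurable (LM d)"
      using rep_R[OF f u] by (simp add: rep_def)
    ultimately have "rep (\<lambda>z. f z + kop (LM d) m f z) (id_plus (integral_op M) u)"
      by (elim rep_cong) (auto elim: eventually_mono)
    from rep_unique'[OF this rep_R[OF f u]] show ?thesis .
  qed
  moreover have "AE x in lborel. ?T u x = ?T v x" if uv: "AE x in lborel. u x = v x" for u v :: "real ^ 'c \<Rightarrow> 'e"
  proof -
    have "integral_op n u x = integral_op n v x" for x
      unfolding integral_op_def by (rule integral_lebesgue_cong_AE) (use uv in eventually_elim, simp)
    then show ?thesis using uv unfolding id_plus_def by (auto elim: eventually_mono)
  qed
  ultimately have "Lp_inverse scl p ?T (id_plus (integral_op M))" by (rule Lp_inverse_AE_cong[OF p ns R])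
  with M(1) show ?thesis by blast
qed

end
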